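(* Let $d\ge2$, $\nu\ge2$. Let $\Gamma$ be the $\mathbb Z^d$-periodic graph whose fundamental graph $\Gamma_f$ is obtained from the fundamental graph $\mathbb L^d_f$ of the $d$-dimensional lattice $\mathbb L^d$ by adding $\nu-1\ge1$ vertices $v_1,\ldots,v_{\nu-1}$ and $\nu-1$ unoriented edges $(v_1,v_\nu),\ldots,(v_{\nu-1},v_\nu)$ with zero indices, where $v_\nu$ is the unique vertex of $\mathbb L^d_f$. Then $\Gamma$ is a precise loop graph with the precise quasimomentum $\vartheta_\pi=(\pi,\ldots,\pi)\in\mathbb T^d$, and: (i) The spectrum of the Laplacian on $\Gamma$ has the form $\sigma(\Delta)=\sigma_{ac}(\Delta)\cup\sigma_{fb}(\Delta)$, $\sigma_{fb}(\Delta)=\{1\}$, where the flat band $1$ has multiplicity $\nu-2$, and $\sigma_{ac}(\Delta)$ has only two bands $\mathfrak S_1^0,\mathfrak S_2^0$ given by $$\sigma_{ac}(\Delta)=\mathfrak S_1^0\cup\mathfrak S_2^0,\quad \mathfrak S_1^0=\big[0,\,x-\sqrt{x^2-4d}\,\big],\quad \mathfrak S_2^0=\big[\nu,\,x+\sqrt{x^2-4d}\,\big],\quad x=\frac{\nu+4d}2 .$$ (ii) The spectrum of the Schrödinger operator $H=\Delta+Q$ on $\Gamma$ has the form $\sigma(H)=\bigcup_{n=1}^\nu[\lambda_n(0),\lambda_n(\vartheta_\pi)]$. (iii) Let $q_\nu=0$ and let all other values $q_1,\ldots,q_{\nu-1}$ of the potential at the vertices of $\Gamma_f$ be distinct. Then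 $\sigma(H)=\sigma_{ac}(H)$, i.e. $\sigma_{fb}(H)=\varnothing$. (iv) Let among the numbers $q_1,\ldots,q_{\nu-1}$ there exist a value $q_*$ of multiplicity $m$. Then the spectrum of $H$ on $\Gamma$ has the flat band $q_*+1$ of multiplicity $m-1$. (v) The Lebesgue measure of the spectrum of $H$ on $\Gamma$ satisfies $|\sigma(H)|=4d$. (In (i) and (iv), a flat band of multiplicity $0$ is understood to be absent.)
   Context: A $\mathbb Z^d$-periodic graph $\Gamma=(V,\mathcal E)$ ($d\ge2$) is a connected locally finite graph embedded in $\mathbb R^d$ (loops and multiple edges allowed, finitely many vertices in bounded sets), invariant under translations by a basis $a_1,\ldots,a_d$ of $\mathbb R^d$ (periods); in the coordinates of this basis with some origin, $\Gamma+m=\Gamma$ for $m\in\mathbb Z^d$. The degree of a vertex is the number of incident edges, a loop counted twice. Each unoriented edge gives two oriented edges $(u,v)$, $(v,u)$ (an unoriented loop gives two oriented loops). The fundamental graph is $\Gamma_f=\Gamma/\mathbb Z^d$, with vertices $\{v_1,\ldots,v_\nu\}=V\cap[0,1)^d$ and oriented edges $\mathcal A_f$. Writing $v=[v]+\tilde v$ with $[v]\in\mathbb Z^d$, $\tilde v\in[0,1)^d$, the index of an oriented edge $\mathbf e=(u,v)$ of $\Gamma$ (and of its class in $\mathcal A_f$) is $\tau(\mathbf e)=[v]-[u]$. Bridges are edges of $\mathcal A_f$ with nonzero index. $\Gamma$ is a loop graph if all bridges of (some) $\Gamma_f$ are loops; it is precise with precise quasimomentum $\vartheta_0\in\mathbb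 T^d$ if moreover $\cos\langle\tau(\mathbf e),\vartheta_0\rangle=-1$ for all bridges $\mathbf e$. The lattice $\mathbb L^d$ has vertex set $\mathbb Z^d$ and edges $(m,m+a_s)$, $m\in\mathbb Z^d$, $s=1,\ldots,d$, with $a_1,\ldots,a_d$ the standard basis; its fundamental graph $\mathbb L^d_f$ has one vertex and $d$ unoriented loops, with indices $\pm a_1,\ldots,\pm a_d$. (Thus $\Gamma$ is $\mathbb L^d$ with $\nu-1$ pendant vertices attached to every vertex.) $(\Delta f)(v)=\sum_{(v,u)_e\in\mathcal E}(f(v)-f(u))$ on $\ell^2(V)$; $H=\Delta+Q$ with $Q$ multiplication by a real $\mathbb Z^d$-periodic function, $q_j=Q(v_j)$. The Floquet matrices, $\vartheta\in\mathbb T^d=\mathbb R^d/(2\pi\mathbb Z)^d$, are $H(\vartheta)=\Delta(\vartheta)+\mathrm{diag}(q_1,\ldots,q_\nu)$, $\Delta_{jk}(\vartheta)=\varkappa_j\delta_{jk}-\sum_{\mathbf e=(v_j,v_k)\in\mathcal A_f}e^{i\langle\tau(\mathbf e),\vartheta\rangle}$, $\varkappa_j=\deg v_j$; the eigenvalues of $H(\vartheta)$ are $\lambda_1(\vartheta)\le\ldots\le\lambda_\nu(\vartheta)$. One has $\sigma(H)=\bigcup_n\lambda_n(\mathbb T^d)=\sigma_{ac}(H)\cup\sigma_{fb}(H)$, where $\sigma_{ac}(H)$ is the absolutely continuous spectrum (a finite union of non-degenerate intervals) and $\sigma_{fb}(H)$ is the set of flat bands, i.e. eigenvalues of $H$ of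 infinite multiplicity. A flat band $\mu$ has multiplicity $m$ if $\mu$ is an eigenvalue of $H(\vartheta)$ of multiplicity $m$ for every $\vartheta\in\mathbb T^d$, except maybe for a finite number of $\vartheta$. *)

theory Defs
  imports "HOL-Analysis.Analysis" "Jordan_Normal_Form.Char_Poly"
begin

no_notation Matrix.vec_index (infixl \<open>$\<close> 100)

section \<open>Periodic graphs\<close>

text \<open>
  Edges are drawn as parametrised curves, one curve for each orientation: an unoriented edge is
  the pair \<open>{g, reversepath g}\<close>. For a simple \<open>g\<close> the two are different, so that a loop gives two
  oriented loops with the same end points.
\<close>

record 'n pgraph =
  verts :: "(real ^ 'n) set"
  arcs :: "(real \<Rightarrow> real ^ 'n) set"

definition embedded_graph :: "'n::finite pgraph \<Rightarrow> bool" where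
  "embedded_graph G \<longleftrightarrow>
     verts G \<noteq> {} \<and>
     (\<forall>g\<in>arcs G. simple_path g \<and> pathstart g \<in> verts G \<and> pathfinish g \<in> verts G \<and>
                 reversepath g \<in> arcs G \<and> g ` {0<..<1} \<inter> verts G = {}) \<and>
     (\<forall>g\<in>arcs G. \<forall>h\<in>arcs G. h \<noteq> g \<longrightarrow> h \<noteq> reversepath g \<longrightarrow>
                 g ` {0<..<1} \<inter> h ` {0<..<1} = {})"

definition connected_graph :: "'n::finite pgraph \<Rightarrow> bool" where
  "connected_graph G \<longleftrightarrow>
     (\<forall>u\<in>verts G. \<forall>v\<in>verts G. (u, v) \<in> {(pathstart g, pathfinish g) | g. g \<in> arcs G}\<^sup>*)"

definition star :: "'n::finite pgraph \<Rightarrow> real ^ 'n \<Rightarrow> (real \<Rightarrow> real ^ 'n) set" where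
  "star G v = {g \<in> arcs G. pathstart g = v}"

text \<open>An unoriented loop counts twice, through its two orientations.\<close>

definition vdegree :: "'n::finite pgraph \<Rightarrow> real ^ 'n \<Rightarrow> nat" where
  "vdegree G v = card (star G v)"

definition translate :: "real ^ 'n \<Rightarrow> (real \<Rightarrow> real ^ 'n) \<Rightarrow> real \<Rightarrow> real ^ 'n" where
  "translate t g = (\<lambda>s. g s + t)"

definition periodic_graph :: "'n::finite pgraph \<Rightarrow> ('n \<Rightarrow> real ^ 'n) \<Rightarrow> bool" where
  "periodic_graph G a \<longleftrightarrow>
     embedded_graph G \<and> connected_graph G \<and>
     (\<forall>S. bounded S \<longrightarrow> finite (verts G \<inter> S)) \<and>
     (\<forall>v\<in>verts G. finite (star G v)) \<and>
     inj a \<and> independent (range a) \<and> span (range a) = UNIV \<and>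
     (\<forall>i. (\<lambda>v. v + a i) ` verts G = verts G \<and> translate (a i) ` arcs G = arcs G)"

definition lattice_vec :: "('n::finite \<Rightarrow> real ^ 'n) \<Rightarrow> int ^ 'n \<Rightarrow> real ^ 'n" where
  "lattice_vec a m = (\<Sum>i\<in>UNIV. of_int (m $ i) *\<^sub>R a i)"

text \<open>Coordinates with respect to the origin \<open>p\<close> and the basis \<open>a\<close>, and the parts
  \<open>[v]\<close> and \<open>v - [v]\<close> of a point; the latter is again a point of the space.\<close>

definition coords :: "('n::finite \<Rightarrow> real ^ 'n) \<Rightarrow> real ^ 'n \<Rightarrow> real ^ 'n \<Rightarrow> real ^ 'n" where
  "coords a p v = (\<chi> i. representation (range a) (v - p) (a i))"

definition int_part :: "('n::finite \<Rightarrow> real ^ 'n) \<Rightarrow> real ^ 'n \<Rightarrow> real ^ 'n \<Rightarrow> int ^ 'n" where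
  "int_part a p v = (\<chi> i. \<lfloor>coords a p v $ i\<rfloor>)"

definition frac_part :: "('n::finite \<Rightarrow> real ^ 'n) \<Rightarrow> real ^ 'n \<Rightarrow> real ^ 'n \<Rightarrow> real ^ 'n" where
  "frac_part a p v = v - lattice_vec a (int_part a p v)"

definition cell :: "('n::finite \<Rightarrow> real ^ 'n) \<Rightarrow> real ^ 'n \<Rightarrow> (real ^ 'n) set" where
  "cell a p = {v. \<forall>i. 0 \<le> coords a p v $ i \<and> coords a p v $ i < 1}"

definition edge_index ::
    "('n::finite \<Rightarrow> real ^ 'n) \<Rightarrow> real ^ 'n \<Rightarrow> (real \<Rightarrow> real ^ 'n) \<Rightarrow> int ^ 'n" where
  "edge_index a p g = int_part a p (pathfinish g) - int_part a p (pathstart g)"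

text \<open>Finite graphs with oriented edges, edge inversion and edge indices.\<close>

record ('v, 'e, 'n) igraph =
  iverts :: "'v set"
  iarcs :: "'e set"
  isrc :: "'e \<Rightarrow> 'v"
  itgt :: "'e \<Rightarrow> 'v"
  irev :: "'e \<Rightarrow> 'e"
  iidx :: "'e \<Rightarrow> int ^ 'n"

text \<open>
  The oriented edges are the orbits of the lattice translations. The sets whose only element is
  taken below are indeed singletons, since all edges of an orbit have the same index and
  translation equivalent end points.
\<close>

definition shift_rel ::
    "'n::finite pgraph \<Rightarrow> ('n \<Rightarrow> real ^ 'n) \<Rightarrow> ((real \<Rightarrow> real ^ 'n) \<times> (real \<Rightarrow> real ^ 'n)) set" where
  "shift_rel G a = {(g, h). g \<in> arcs G \<and> h \<in> arcs G \<and> (\<exists>m. h = translate (lattice_vec a m) g)}"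

definition fundamental_graph ::
    "'n::finite pgraph \<Rightarrow> ('n \<Rightarrow> real ^ 'n) \<Rightarrow> real ^ 'n \<Rightarrow>
     (real ^ 'n, (real \<Rightarrow> real ^ 'n) set, 'n) igraph" where
  "fundamental_graph G a p =
     \<lparr> iverts = verts G \<inter> cell a p,
       iarcs = arcs G // shift_rel G a,
       isrc = (\<lambda>E. the_elem ((\<lambda>g. frac_part a p (pathstart g)) ` E)),
       itgt = (\<lambda>E. the_elem ((\<lambda>g. frac_part a p (pathfinish g)) ` E)),
       irev = (\<lambda>E. reversepath ` E),
       iidx = (\<lambda>E. the_elem (edge_index a p ` E)) \<rparr>"

definition bridges :: "('v, 'e, 'n::finite) igraph \<Rightarrow> 'e set" where
  "bridges F = {e \<in> iarcs F. iidx F e \<noteq> 0}"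

definition phase :: "int ^ 'n \<Rightarrow> real ^ 'n::finite \<Rightarrow> real" where
  "phase t \<theta> = (\<Sum>i\<in>UNIV. of_int (t $ i) * \<theta> $ i)"

text \<open>These refer to the fundamental graph of the given periods and origin, because the
  coordinates of a quasimomentum depend on that choice.\<close>

definition loop_graph :: "'n::finite pgraph \<Rightarrow> ('n \<Rightarrow> real ^ 'n) \<Rightarrow> real ^ 'n \<Rightarrow> bool" where
  "loop_graph G a p \<longleftrightarrow> periodic_graph G a \<and>
     (let F = fundamental_graph G a p in \<forall>e\<in>bridges F. isrc F e = itgt F e)"

definition precise_loop_graph ::
    "'n::finite pgraph \<Rightarrow> ('n \<Rightarrow> real ^ 'n) \<Rightarrow> real ^ 'n \<Rightarrow> real ^ 'n \<Rightarrow> bool" where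
  "precise_loop_graph G a p \<theta> \<longleftrightarrow> loop_graph G a p \<and>
     (let F = fundamental_graph G a p in \<forall>e\<in>bridges F. cos (phase (iidx F e) \<theta>) = - 1)"

section \<open>The lattice with pendant vertices\<close>

definition std_vec :: "'n::finite \<Rightarrow> real ^ 'n" where
  "std_vec s = axis s 1"

definition integer_points :: "(real ^ 'n::finite) set" where
  "integer_points = {m. \<forall>i. m $ i \<in> \<int>}"

definition lattice_graph :: "'n::finite pgraph" where
  "lattice_graph =
     \<lparr> verts = integer_points,
       arcs = (\<Union>m\<in>integer_points. \<Union>s. {linepath m (m + std_vec s), linepath (m + std_vec s) m}) \<rparr>"

text \<open>
  Up to an isomorphism respecting indices, \<open>F\<close> is \<open>F0\<close> with additional vertices
  \<open>vs 1, \<dots>, vs (n - 1)\<close> and additional unoriented edges \<open>{e j, irev F (e j)}\<close> of zero index joining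
  \<open>vs j\<close> to the vertex \<open>vs n\<close> of \<open>F0\<close>.
\<close>

definition adds_pendants ::
    "('v, 'e, 'n::finite) igraph \<Rightarrow> ('w, 'f, 'n) igraph \<Rightarrow> nat \<Rightarrow> (nat \<Rightarrow> 'w) \<Rightarrow> bool" where
  "adds_pendants F0 F n vs \<longleftrightarrow> (\<exists>\<phi> \<psi> e.
     inj_on \<phi> (iverts F0) \<and> inj_on vs {1..<n} \<and>
     \<phi> ` iverts F0 \<inter> vs ` {1..<n} = {} \<and>
     iverts F = \<phi> ` iverts F0 \<union> vs ` {1..<n} \<and>
     vs n \<in> \<phi> ` iverts F0 \<and>
     inj_on \<psi> (iarcs F0) \<and>
     iarcs F = \<psi> ` iarcs F0 \<union> (\<Union>j\<in>{1..<n}. {e j, irev F (e j)}) \<and>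
     (\<forall>x\<in>iarcs F0. isrc F (\<psi> x) = \<phi> (isrc F0 x) \<and> itgt F (\<psi> x) = \<phi> (itgt F0 x) \<and>
                   irev F (\<psi> x) = \<psi> (irev F0 x) \<and> iidx F (\<psi> x) = iidx F0 x) \<and>
     (\<forall>j\<in>{1..<n}. isrc F (e j) = vs j \<and> itgt F (e j) = vs n \<and> iidx F (e j) = 0))"

section \<open>Operators on square summable functions\<close>

definition ell2 :: "'v set \<Rightarrow> ('v \<Rightarrow> complex) set" where
  "ell2 V = {f. (\<forall>v. v \<notin> V \<longrightarrow> f v = 0) \<and> (\<lambda>v. (cmod (f v))\<^sup>2) summable_on V}"

definition ell2_inner :: "'v set \<Rightarrow> ('v \<Rightarrow> complex) \<Rightarrow> ('v \<Rightarrow> complex) \<Rightarrow> complex" where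
  "ell2_inner V f g = (\<Sum>\<^sub>\<infinity>v\<in>V. cnj (f v) * g v)"

definition ell2_norm :: "'v set \<Rightarrow> ('v \<Rightarrow> complex) \<Rightarrow> real" where
  "ell2_norm V f = sqrt (\<Sum>\<^sub>\<infinity>v\<in>V. (cmod (f v))\<^sup>2)"

text \<open>The spectrum of the restriction of \<open>T\<close> to an invariant subspace \<open>M\<close>: the complement of the
  set of all \<open>z\<close> for which \<open>T - z\<close> maps \<open>M\<close> bijectively onto itself with bounded inverse.\<close>

definition spectrum_on ::
    "'v set \<Rightarrow> ('v \<Rightarrow> complex) set \<Rightarrow> (('v \<Rightarrow> complex) \<Rightarrow> 'v \<Rightarrow> complex) \<Rightarrow> complex set" where
  "spectrum_on V M T = {z. \<not> (bij_betw (\<lambda>f v. T f v - z * f v) M M \<and>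
     (\<exists>C. \<forall>f\<in>M. ell2_norm V f \<le> C * ell2_norm V (\<lambda>v. T f v - z * f v)))}"

definition op_spectrum :: "'v set \<Rightarrow> (('v \<Rightarrow> complex) \<Rightarrow> 'v \<Rightarrow> complex) \<Rightarrow> complex set" where
  "op_spectrum V T = spectrum_on V (ell2 V) T"

text \<open>
  For bounded self-adjoint \<open>T\<close>, the spectral measure of a vector \<open>f\<close> is the unique finite Borel
  measure of bounded support that integrates every polynomial \<open>q\<close> to \<open>\<langle>f, q(T) f\<rangle>\<close>.
\<close>

definition spectral_measure ::
    "'v set \<Rightarrow> (('v \<Rightarrow> complex) \<Rightarrow> 'v \<Rightarrow> complex) \<Rightarrow> ('v \<Rightarrow> complex) \<Rightarrow> real measure \<Rightarrow> bool" where
  "spectral_measure V T f \<mu> \<longleftrightarrow>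
     sets \<mu> = sets borel \<and> finite_measure \<mu> \<and> (\<exists>R. AE x in \<mu>. \<bar>x\<bar> \<le> R) \<and>
     (\<forall>k. ell2_inner V f ((T ^^ k) f) = complex_of_real (\<integral>x. x ^ k \<partial>\<mu>))"

definition ac_subspace ::
    "'v set \<Rightarrow> (('v \<Rightarrow> complex) \<Rightarrow> 'v \<Rightarrow> complex) \<Rightarrow> ('v \<Rightarrow> complex) set" where
  "ac_subspace V T =
     {f \<in> ell2 V. \<exists>\<mu>. spectral_measure V T f \<mu> \<and> absolutely_continuous lborel \<mu>}"

definition ac_spectrum :: "'v set \<Rightarrow> (('v \<Rightarrow> complex) \<Rightarrow> 'v \<Rightarrow> complex) \<Rightarrow> complex set" where
  "ac_spectrum V T = spectrum_on V (ac_subspace V T) T"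

definition eigenspace ::
    "'v set \<Rightarrow> (('v \<Rightarrow> complex) \<Rightarrow> 'v \<Rightarrow> complex) \<Rightarrow> complex \<Rightarrow> ('v \<Rightarrow> complex) set" where
  "eigenspace V T z = {f \<in> ell2 V. \<forall>v. T f v = z * f v}"

definition finite_dimensional :: "('v \<Rightarrow> complex) set \<Rightarrow> bool" where
  "finite_dimensional M \<longleftrightarrow> (\<exists>B. finite B \<and> (\<forall>f\<in>M. \<exists>c. f = (\<lambda>v. \<Sum>b\<in>B. c b * b v)))"

definition flat_bands :: "'v set \<Rightarrow> (('v \<Rightarrow> complex) \<Rightarrow> 'v \<Rightarrow> complex) \<Rightarrow> complex set" where
  "flat_bands V T = {z. \<not> finite_dimensional (eigenspace V T z)}"

section \<open>Laplace and Schroedinger operators and their Floquet matrices\<close>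

definition laplacian :: "'n::finite pgraph \<Rightarrow> (real ^ 'n \<Rightarrow> complex) \<Rightarrow> real ^ 'n \<Rightarrow> complex" where
  "laplacian G f v = (if v \<in> verts G then \<Sum>g\<in>star G v. f v - f (pathfinish g) else 0)"

definition schroedinger ::
    "'n::finite pgraph \<Rightarrow> (real ^ 'n \<Rightarrow> real) \<Rightarrow> (real ^ 'n \<Rightarrow> complex) \<Rightarrow> real ^ 'n \<Rightarrow> complex" where
  "schroedinger G Q f v = laplacian G f v + complex_of_real (Q v) * f v"

definition periodic_potential ::
    "'n::finite pgraph \<Rightarrow> ('n \<Rightarrow> real ^ 'n) \<Rightarrow> (real ^ 'n \<Rightarrow> real) \<Rightarrow> bool" where
  "periodic_potential G a Q \<longleftrightarrow> (\<forall>v\<in>verts G. \<forall>i. Q (v + a i) = Q v)"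

text \<open>
  \<open>vs\<close> enumerates the vertices of the fundamental graph as \<open>vs 1, vs 2, \<dots>\<close>, whereas rows and
  columns of matrices are numbered from 0.
\<close>

definition floquet ::
    "'n::finite pgraph \<Rightarrow> ('n \<Rightarrow> real ^ 'n) \<Rightarrow> real ^ 'n \<Rightarrow> (nat \<Rightarrow> real ^ 'n) \<Rightarrow>
     (real ^ 'n \<Rightarrow> real) \<Rightarrow> real ^ 'n \<Rightarrow> complex mat" where
  "floquet G a p vs Q \<theta> =
     (let F = fundamental_graph G a p; n = card (iverts F) in
      Matrix.mat n n (\<lambda>(j, k).
        (if j = k then of_nat (vdegree G (vs (Suc j))) + complex_of_real (Q (vs (Suc j))) else 0)
        - (\<Sum>e\<in>{e \<in> iarcs F. isrc F e = vs (Suc j) \<and> itgt F e = vs (Suc k)}.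
             cis (phase (iidx F e) \<theta>))))"

text \<open>The \<open>n\<close>-th eigenvalue, \<open>n = 1, 2, \<dots>\<close>, in increasing order and with multiplicities. Floquet
  matrices are Hermitian, so that all roots of the characteristic polynomial are real.\<close>

definition band_function ::
    "'n::finite pgraph \<Rightarrow> ('n \<Rightarrow> real ^ 'n) \<Rightarrow> real ^ 'n \<Rightarrow> (nat \<Rightarrow> real ^ 'n) \<Rightarrow>
     (real ^ 'n \<Rightarrow> real) \<Rightarrow> nat \<Rightarrow> real ^ 'n \<Rightarrow> real" where
  "band_function G a p vs Q n \<theta> =
     sorted_list_of_multiset (image_mset Re (proots (char_poly (floquet G a p vs Q \<theta>)))) ! (n - 1)"

text \<open>Representatives of the torus \<open>\<real>\<^sup>d / (2\<pi>\<int>)\<^sup>d\<close>.\<close>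

definition torus :: "(real ^ 'n::finite) set" where
  "torus = {\<theta>. \<forall>i. 0 \<le> \<theta> $ i \<and> \<theta> $ i < 2 * pi}"

definition spectral_band ::
    "'n::finite pgraph \<Rightarrow> ('n \<Rightarrow> real ^ 'n) \<Rightarrow> real ^ 'n \<Rightarrow> (nat \<Rightarrow> real ^ 'n) \<Rightarrow>
     (real ^ 'n \<Rightarrow> real) \<Rightarrow> nat \<Rightarrow> real set" where
  "spectral_band G a p vs Q n = band_function G a p vs Q n ` torus"

text \<open>A flat band of multiplicity 0 is an absent one.\<close>

definition has_flat_band ::
    "'n::finite pgraph \<Rightarrow> ('n \<Rightarrow> real ^ 'n) \<Rightarrow> real ^ 'n \<Rightarrow> (nat \<Rightarrow> real ^ 'n) \<Rightarrow>
     (real ^ 'n \<Rightarrow> real) \<Rightarrow> real \<Rightarrow> nat \<Rightarrow> bool" where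
  "has_flat_band G a p vs Q x m \<longleftrightarrow>
     (if m = 0 then complex_of_real x \<notin> flat_bands (verts G) (schroedinger G Q)
      else complex_of_real x \<in> flat_bands (verts G) (schroedinger G Q) \<and>
           finite {\<theta> \<in> torus. Polynomial.order (complex_of_real x) (char_poly (floquet G a p vs Q \<theta>)) \<noteq> m})"

end

theory Submission
  imports Defs "HOL-Probability.Probability"
begin

text \<open>
  Restricting a function on the vertices to the \<open>\<nu>\<close> translation orbits turns \<open>H\<close> into an operator on
  \<open>\<nu>\<close>-tuples of functions on the lattice: pendant component \<open>j\<close> obeys \<open>(H h)\<^sub>j = \<beta>\<^sub>j h\<^sub>j - h\<^sub>\<nu>\<close> with
  \<open>\<beta>\<^sub>j = 1 + q\<^sub>j\<close>, and the hub component \<open>(H h)\<^sub>\<nu> = (c + L) h\<^sub>\<nu> - \<Sum> h\<^sub>j\<close>, where \<open>c = q\<^sub>\<nu> + \<nu> - 1\<close> and \<open>L\<close>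
  is the lattice Laplacian, with spectrum \<open>[0, 4 d]\<close> and symbol \<open>t(\<theta>) = \<Sum> 2 (1 - cos \<theta>\<^sub>s)\<close>.
  Eliminating the pendant components, \<open>x \<notin> {\<beta>\<^sub>j}\<close> is spectral iff \<open>F x := x - c + \<Sum> 1 / (\<beta>\<^sub>j - x)\<close> lies
  in \<open>[0, 4 d]\<close>. \<open>F\<close> increases from \<open>-\<infinity>\<close> to \<open>\<infinity>\<close> between consecutive poles, so each gap contributes one
  band, swept monotonically as \<open>t\<close> runs from \<open>0\<close> (at \<open>\<theta> = 0\<close>) to \<open>4 d\<close> (at \<open>\<theta> = \<vartheta>\<^sub>\<pi>\<close>). The trace of the Floquet
  matrix grows by exactly \<open>t\<close>, hence the total length of the bands is \<open>4 d\<close>. If \<open>b\<close> is the value of \<open>m\<close> of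
  the \<open>\<beta>\<^sub>j\<close>, then tuples supported on these \<open>m\<close> components with sum 0 are eigenvectors, which gives the flat
  band \<open>b\<close> of multiplicity \<open>m - 1\<close>. On the orthogonal complement of all of these the Fourier transform
  diagonalises \<open>H\<close> with the nonconstant eigenvalue branches, whose level sets are null sets; so this
  complement is the absolutely continuous subspace.
\<close>

section \<open>The secular equation\<close>

text \<open>The absolutely continuous subspace is defined through the moments of spectral measures,
  so no functional calculus is at hand, and its two inclusions have different proofs. A vector with
  equal components at equal poles gets an explicit measure, pushed forward from the torus.
  Conversely, a vector with an absolutely continuous measure is orthogonal to every eigenvector, in
  particular to differences of two point masses at pendant vertices of one hub, and this forces the
  equality of components.

  Spectra are wanted both on the whole space and on this subspace. The spaces \<open>Mset K\<close>,
  with the symmetry imposed only at poles in \<open>K\<close>, cover both cases by one computation.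
  There the resolvent is built by elimination from that of the lattice Laplacian. At a pole the
  elimination breaks down, and the pendant equation determines the hub component instead; this is
  why a simple pole is not spectral.

  The branches \<open>ev n\<close> are defined as inverses of \<open>F\<close>, so that their order
  and monotonicity are known before any matrix appears. They are matched with the characteristic
  polynomial by comparing root multiplicities and degrees.\<close>

lemma order_linear_factor:
  "Polynomial.order x [:- a, 1:] = (if x = a then 1 else 0)" for x a :: "'a :: idom"
  using order_power_n_n[of a 1] by (auto intro!: order_0I)

text \<open>Splitting off one factor lowers the order of \<open>P\<close> at its root by exactly
  one, just as it lowers the number of indices with that value, so the hypothesis passes to the
  quotient.\<close>

lemma prod_linear_dvd:
  fixes P :: "'a :: field poly"
  assumes "finite S" "P \<noteq> 0" "\<And>x. card {n\<in>S. e n = x} \<le> Polynomial.order x P"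
  shows "(\<Prod>n\<in>S. [:- e n, 1:]) dvd P"
  using assms
proof (induction S arbitrary: P rule: finite_induct)
  case (insert k S)
  have "card {n\<in>insert k S. e n = e k} \<noteq> 0" using insert.hyps by (auto simp: card_eq_0_iff)
  then have "Polynomial.order (e k) P \<noteq> 0" using insert.prems(2)[of "e k"] by linarith
  then have "poly P (e k) = 0" using order_root by blast
  then obtain R where R: "P = [:- e k, 1:] * R" using poly_eq_0_iff_dvd by blast
  have R0: "R \<noteq> 0" using R insert.prems by auto
  have ord: "Polynomial.order x P = Polynomial.order x [:- e k, 1:] + Polynomial.order x R" for x
    using order_mult[of "[:- e k, 1:]" R x] insert.prems(1) R by simp
  have "card {n\<in>S. e n = x} \<le> Polynomial.order x R" for x
  proof (cases "e k = x")
    case True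
    have "{n\<in>insert k S. e n = x} = insert k {n\<in>S. e n = x}" using True by auto
    then have "card {n\<in>insert k S. e n = x} = Suc (card {n\<in>S. e n = x})" using insert.hyps by auto
    moreover have "Polynomial.order x P = Suc (Polynomial.order x R)"
      using ord[of x] True by (simp add: order_linear_factor)
    ultimately show ?thesis using insert.prems(2)[of x] by simp
  next
    case False
    have "{n\<in>insert k S. e n = x} = {n\<in>S. e n = x}" using False by auto
    moreover have "Polynomial.order x P = Polynomial.order x R"
      using ord[of x] False by (simp add: order_linear_factor)
    ultimately show ?thesis using insert.prems(2)[of x] by simp
  qed
  then have "(\<Prod>n\<in>S. [:- e n, 1:]) dvd R" using insert.IH R0 by blast
  then have "[:- e k, 1:] * (\<Prod>n\<in>S. [:- e n, 1:]) dvd P" unfolding R by (rule mult_dvd_mono[OF dvd_refl])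
  then show ?case by (simp only: prod.insert[OF insert.hyps])
qed simp

lemma monic_prod_linear:
  fixes e :: "'b \<Rightarrow> 'a :: idom"
  shows "finite S \<Longrightarrow> degree (\<Prod>n\<in>S. [:- e n, 1:]) = card S" "coeff (\<Prod>n\<in>S. [:- e n, 1:]) (card S) = 1"
proof -
  show d: "degree (\<Prod>n\<in>S. [:- e n, 1:]) = card S" if "finite S"
    by (subst degree_prod_sum_eq) auto
  have l: "lead_coeff (\<Prod>n\<in>S. [:- e n, 1:]) = 1"
    by (subst lead_coeff_prod) simp
  show "coeff (\<Prod>n\<in>S. [:- e n, 1:]) (card S) = 1"
    using l d by (cases "finite S") auto
qed

text \<open>Vieta's formula for the second coefficient; it turns an identity of characteristic
  polynomials into one of traces.\<close>

lemma coeff_prod_linear: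
  fixes e :: "'b \<Rightarrow> 'a :: idom"
  assumes "finite S" "S \<noteq> {}"
  shows "coeff (\<Prod>n\<in>S. [:- e n, 1:]) (card S - 1) = - (\<Sum>n\<in>S. e n)"
  using assms
proof (induction S rule: finite_ne_induct)
  case (insert k S)
  have "coeff (\<Prod>n\<in>S. [:- e n, 1:]) (card S) = 1" by (rule monic_prod_linear)
  moreover obtain m where "card S = Suc m" using insert.hyps by (metis card_0_eq not0_implies_Suc)
  ultimately show ?case using insert.hyps insert.IH by simp
qed simp

section \<open>Poles, gaps and eigenvalue branches\<close>

locale secular =
  fixes \<nu> :: nat and \<beta> :: "nat \<Rightarrow> real" and c :: real
  assumes nu2: "\<nu> \<ge> 2"
begin

text \<open>\<open>bs\<close> lists the poles in increasing order and with multiplicities, and \<open>gap n\<close> lies between the poles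
  number \<open>n - 1\<close> and \<open>n\<close>. If these coincide, the gap is empty and the \<open>n\<close>-th eigenvalue \<open>ev n t\<close> is the pole.\<close>

definition F :: "real \<Rightarrow> real" where "F x = x - c + (\<Sum>j\<in>{1..<\<nu>}. 1 / (\<beta> j - x))"
text \<open>Derivative of \<open>F\<close>, and also the squared norm of the eigenvector
  \<open>eigv x\<close>.\<close>

definition F' :: "real \<Rightarrow> real" where "F' x = 1 + (\<Sum>j\<in>{1..<\<nu>}. 1 / (\<beta> j - x)\<^sup>2)"
definition B :: "real set" where "B = \<beta> ` {1..<\<nu>}"
definition pole_mult :: "real \<Rightarrow> nat" where "pole_mult b = card {j \<in> {1..<\<nu>}. \<beta> j = b}"
definition bs :: "real list" where "bs = sort (map \<beta> [1..<\<nu>])"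
text \<open>Extended reals make the two unbounded outer gaps ordinary cases. The list
  \<open>bs\<close> counts from 0, so pole number k is \<open>bs ! (k - 1)\<close>.\<close>

definition lo :: "nat \<Rightarrow> ereal" where "lo n = (if n \<le> 1 then -\<infinity> else ereal (bs ! (n - 2)))"
definition hi :: "nat \<Rightarrow> ereal" where "hi n = (if n \<ge> \<nu> then \<infinity> else ereal (bs ! (n - 1)))"
definition gap :: "nat \<Rightarrow> real set" where "gap n = {x. lo n < ereal x \<and> ereal x < hi n}"
definition ev :: "nat \<Rightarrow> real \<Rightarrow> real" where
  "ev n t = (if lo n < hi n then THE x. x \<in> gap n \<and> F x = t else bs ! (n - 1))"

lemma length_bs: "length bs = \<nu> - 1"
  by (simp add: bs_def)

lemma sorted_bs: "sorted bs"
  by (simp add: bs_def)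

lemma bs_mono: "i \<le> j \<Longrightarrow> j < \<nu> - 1 \<Longrightarrow> bs ! i \<le> bs ! j"
  using sorted_bs by (simp add: sorted_nth_mono length_bs)

lemma set_bs: "set bs = B"
  by (auto simp: bs_def B_def)

lemma finite_B: "finite B"
  by (simp add: B_def)

lemma card_bs: "card {i. i < \<nu> - 1 \<and> bs ! i = b} = pole_mult b"
proof -
  have "card {i. i < length bs \<and> bs ! i = b} = count (mset bs) b"
    by (simp add: count_mset count_list_eq_length_filter length_filter_conv_card eq_commute)
  also have "\<dots> = count (image_mset \<beta> (mset_set {1..<\<nu>})) b"
    by (simp add: bs_def mset_upt)
  also have "\<dots> = pole_mult b"
    by (simp add: count_image_mset' sum.If_cases pole_mult_def)
       (auto intro!: arg_cong[where f = card])
  finally show ?thesis by (simp add: length_bs)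
qed

lemma pole_mult_pos: "b \<in> B \<Longrightarrow> pole_mult b \<ge> 1"
  unfolding pole_mult_def B_def by (auto simp: Suc_le_eq card_gt_0_iff)

lemma hi_lo: "1 \<le> n \<Longrightarrow> n < \<nu> \<Longrightarrow> lo (Suc n) = hi n"
  by (auto simp: lo_def hi_def)

lemma lo_le_hi: "n \<in> {1..\<nu>} \<Longrightarrow> lo n \<le> hi n"
  using sorted_bs by (auto simp: lo_def hi_def length_bs intro!: sorted_nth_mono)

lemma gap_B: "n \<in> {1..\<nu>} \<Longrightarrow> x \<in> gap n \<Longrightarrow> x \<notin> B"
proof
  assume n: "n \<in> {1..\<nu>}" and x: "x \<in> gap n" and "x \<in> B"
  then obtain i where i: "i < \<nu> - 1" "x = bs ! i"
    by (metis in_set_conv_nth set_bs length_bs)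
  have "i \<le> n - 2 \<or> i \<ge> n - 1" by auto
  then show False
  proof
    assume "i \<le> n - 2"
    show False
    proof (cases "n \<le> 1")
      case False
      then have "bs ! i \<le> bs ! (n - 2)" using \<open>i \<le> n - 2\<close> n i sorted_bs
        by (intro sorted_nth_mono) (auto simp: length_bs)
      then show False using x i False by (auto simp: gap_def lo_def)
    next
      case True
      then have n1: "n = 1" using n by auto
      have "bs ! 0 \<le> bs ! i" using i sorted_bs by (intro sorted_nth_mono) (auto simp: length_bs)
      then show False using x i n1 nu2 by (auto simp: gap_def hi_def)
    qed
  next
    assume "i \<ge> n - 1"
    then have "bs ! (n - 1) \<le> bs ! i" using i sorted_bs by (intro sorted_nth_mono) (auto simp: length_bs)
    moreover have "n < \<nu>" using \<open>i \<ge> n - 1\<close> i n by auto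
    ultimately show False using x i by (auto simp: gap_def hi_def)
  qed
qed

text \<open>Take the first gap whose upper end exceeds \<open>x\<close>. Its lower end is the upper
  end of the gap before it, which \<open>x\<close> has already reached, and equality would make
  \<open>x\<close> a pole.\<close>

lemma in_gap: assumes "x \<notin> B" obtains n where "n \<in> {1..\<nu>}" "x \<in> gap n"
proof -
  define P where "P n \<longleftrightarrow> n \<ge> 1 \<and> ereal x < hi n" for n
  have "P \<nu>" using nu2 by (auto simp: P_def hi_def)
  define n where "n = (LEAST n. P n)"
  have Pn: "P n" unfolding n_def by (rule LeastI[of P, OF \<open>P \<nu>\<close>])
  have le: "n \<le> \<nu>" unfolding n_def by (rule Least_le[of P, OF \<open>P \<nu>\<close>])
  have "lo n < ereal x"
  proof (cases "n = 1")
    case True then show ?thesis by (simp add: lo_def)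
  next
    case False
    then have n: "n \<ge> 2" using Pn by (auto simp: P_def)
    then have "\<not> P (n - 1)" unfolding n_def by (intro not_less_Least) (auto)
    then have "hi (n - 1) \<le> ereal x" using n by (auto simp: P_def)
    moreover have "hi (n - 1) = lo n" using hi_lo[of "n - 1"] n le by simp
    moreover have "lo n \<noteq> ereal x"
    proof
      assume "lo n = ereal x"
      then have "x = bs ! (n - 2)" using n by (simp add: lo_def)
      then have "x \<in> set bs" using n le by (auto simp: length_bs)
      then show False using assms by (simp add: set_bs)
    qed
    ultimately show ?thesis by (simp add: order_less_le)
  qed
  then show thesis using that[of n] Pn le by (auto simp: P_def gap_def)
qed

lemma gap_interval: "x \<in> gap n \<Longrightarrow> y \<in> gap n \<Longrightarrow> x \<le> z \<Longrightarrow> z \<le> y \<Longrightarrow> z \<in> gap n"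
  using less_le_trans[of "lo n" "ereal x" "ereal z"] le_less_trans[of "ereal z" "ereal y" "hi n"]
  by (auto simp: gap_def)

lemma gap_disjoint:
  assumes "n < m" "m \<le> \<nu>" "1 \<le> n" "x \<in> gap n" "y \<in> gap m" shows "x < y"
proof -
  have "hi n \<le> lo m"
    using assms sorted_bs by (auto simp: hi_def lo_def length_bs intro!: sorted_nth_mono)
  then have "ereal x < ereal y" using assms(4,5) unfolding gap_def
    by (metis (mono_tags, lifting) mem_Collect_eq less_trans less_le_trans)
  then show ?thesis by simp
qed

lemma recip_mono:
  fixes b x y :: real
  assumes "x \<le> y" "b \<notin> {x..y}" shows "1 / (b - x) \<le> 1 / (b - y)"
proof -
  have "b < x \<or> b > y" using assms by auto
  then show ?thesis
  proof
    assume "b > y" then show ?thesis using assms by (auto simp: field_simps)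
  next
    assume "b < x" then show ?thesis using assms by (auto simp: field_simps)
  qed
qed

text \<open>Every pole term increases on a pole-free interval, so \<open>F\<close> grows at least as
  fast as its linear part. This drives \<open>F\<close> to infinity in the outer gaps.\<close>

lemma F_mono: assumes "x \<le> y" "{x..y} \<inter> B = {}" shows "F y - F x \<ge> y - x"
proof -
  have "(\<Sum>j\<in>{1..<\<nu>}. 1 / (\<beta> j - x)) \<le> (\<Sum>j\<in>{1..<\<nu>}. 1 / (\<beta> j - y))"
  proof (intro sum_mono recip_mono assms)
    fix j assume "j \<in> {1..<\<nu>}"
    then have "\<beta> j \<in> B" by (auto simp: B_def)
    then show "\<beta> j \<notin> {x..y}" using assms by auto
  qed
  then show ?thesis by (simp add: F_def)
qed

text \<open>Keeps the term of one pole, whose blow-up drives \<open>F\<close> to infinity at a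
  finite end of a gap.\<close>

lemma F_mono_pole:
  assumes "x \<le> y" "{x..y} \<inter> B = {}" "u \<in> B" shows "F y - F x \<ge> 1 / (u - y) - 1 / (u - x)"
proof -
  obtain k where k: "k \<in> {1..<\<nu>}" "\<beta> k = u" using assms by (auto simp: B_def)
  have "(\<Sum>j\<in>{1..<\<nu>}-{k}. 1 / (\<beta> j - x)) \<le> (\<Sum>j\<in>{1..<\<nu>}-{k}. 1 / (\<beta> j - y))"
  proof (intro sum_mono recip_mono assms)
    fix j assume "j \<in> {1..<\<nu>} - {k}"
    then have "\<beta> j \<in> B" by (auto simp: B_def)
    then show "\<beta> j \<notin> {x..y}" using assms by auto
  qed
  moreover have "F z = z - c + 1 / (u - z) + (\<Sum>j\<in>{1..<\<nu>}-{k}. 1 / (\<beta> j - z))" for z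
    using sum.remove[of "{1..<\<nu>}" k "\<lambda>j. 1 / (\<beta> j - z)"] k by (simp add: F_def)
  ultimately show ?thesis using assms(1) by simp
qed

lemma F_strict: assumes "n \<in> {1..\<nu>}" "x \<in> gap n" "y \<in> gap n" "x < y" shows "F x < F y"
proof -
  have "{x..y} \<inter> B = {}" using gap_B[OF assms(1)] gap_interval[OF assms(2,3)] by auto
  from F_mono[OF _ this] assms(4) show ?thesis by simp
qed

lemma F_strict_iff: assumes "n \<in> {1..\<nu>}" "x \<in> gap n" "y \<in> gap n" shows "F x \<le> F y \<longleftrightarrow> x \<le> y"
  using F_strict[OF assms(1,2,3)] F_strict[OF assms(1,3,2)] by (metis linorder_not_less order_le_less)

lemma F_deriv: "x \<notin> B \<Longrightarrow> (F has_real_derivative F' x) (at x)"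
proof -
  assume x: "x \<notin> B"
  have ne: "\<beta> j - x \<noteq> 0" if "j \<in> {1..<\<nu>}" for j using x that by (auto simp: B_def)
  have "((\<lambda>x. x - c + (\<Sum>j\<in>{1..<\<nu>}. 1 / (\<beta> j - x))) has_real_derivative
     (1 - 0 + (\<Sum>j\<in>{1..<\<nu>}. 1 / (\<beta> j - x)\<^sup>2))) (at x)"
    using ne by (intro derivative_intros DERIV_sum)
      (auto intro!: derivative_eq_intros simp: power2_eq_square divide_simps)
  then show ?thesis by (simp add: F_def[abs_def] F'_def)
qed

lemma F'_ge: "F' x \<ge> 1" by (auto simp: F'_def intro: sum_nonneg)

lemma F_cont: "S \<inter> B = {} \<Longrightarrow> continuous_on S F"
  by (meson DERIV_isCont F_deriv continuous_at_imp_continuous_on disjoint_iff)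

lemma gap_nonempty: assumes "lo n < hi n" obtains x where "x \<in> gap n"
  using ereal_dense2[OF assms] by (auto simp: gap_def)

lemma F_upper: assumes n: "n \<in> {1..\<nu>}" and "lo n < hi n" shows "\<exists>x\<in>gap n. F x \<ge> t"
proof -
  obtain x where x: "x \<in> gap n" using gap_nonempty assms by blast
  show ?thesis
  proof (cases "n = \<nu>")
    case True
    \<comment> \<open>\<open>F\<close> grows at least as much as its argument, so this displacement
      makes up for the deficit.\<close>
    define y where "y = x + \<bar>t - F x\<bar>"
    have y: "y \<in> gap n" using x True unfolding gap_def hi_def y_def
      by (auto intro: less_le_trans)
    have "F y - F x \<ge> y - x" using gap_B[OF n] gap_interval[OF x y] by (intro F_mono) (auto simp: y_def)
    then show ?thesis using y by (intro bexI[of _ y]) (auto simp: y_def)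
  next
    case False
    define u where "u = bs ! (n - 1)"
    have u: "hi n = ereal u" "u \<in> B" using False n nth_mem[of "n-1" bs]
      by (auto simp: hi_def u_def set_bs length_bs)
    have xu: "x < u" using x u by (auto simp: gap_def)
    \<comment> \<open>Solves \<open>1 / (u - y) = 1 / (u - x) + \<bar>t - F x\<bar>\<close>: the
      term of the pole \<open>u\<close> alone makes up for the deficit.\<close>
    define y where "y = u - 1 / (1 / (u - x) + \<bar>t - F x\<bar>)"
    have pos: "1 / (u - x) + \<bar>t - F x\<bar> > 0" using xu by (simp add: add_pos_nonneg)
    have "1 / (1 / (u - x) + \<bar>t - F x\<bar>) \<le> 1 / (1 / (u - x))"
      using xu pos by (intro divide_left_mono mult_pos_pos) auto
    then have xy: "x \<le> y" by (simp add: y_def)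
    have yu: "y < u" using pos by (simp add: y_def)
    have y: "y \<in> gap n" using x u xy yu by (auto simp: gap_def intro: less_le_trans)
    have "F y - F x \<ge> 1 / (u - y) - 1 / (u - x)"
      using gap_B[OF n] gap_interval[OF x y] xy u by (intro F_mono_pole) auto
    also have "1 / (u - y) = 1 / (u - x) + \<bar>t - F x\<bar>" by (simp add: y_def)
    finally show ?thesis using y by (intro bexI[of _ y]) auto
  qed
qed

lemma F_lower: assumes n: "n \<in> {1..\<nu>}" and "lo n < hi n" shows "\<exists>x\<in>gap n. F x \<le> t"
proof -
  obtain x where x: "x \<in> gap n" using gap_nonempty assms by blast
  show ?thesis
  proof (cases "n = 1")
    case True
    define y where "y = x - \<bar>t - F x\<bar>"
    have y: "y \<in> gap n" using x True le_less_trans[of "ereal y" "ereal x" "hi n"] unfolding gap_def lo_def y_def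
      by auto
    have "F x - F y \<ge> x - y" using gap_B[OF n] gap_interval[OF y x] by (intro F_mono) (auto simp: y_def)
    then show ?thesis using y by (intro bexI[of _ y]) (auto simp: y_def)
  next
    case False
    define u where "u = bs ! (n - 2)"
    have u: "lo n = ereal u" "u \<in> B" using False n nth_mem[of "n-2" bs]
      by (auto simp: lo_def u_def set_bs length_bs)
    have xu: "u < x" using x u by (auto simp: gap_def)
    define y where "y = u + 1 / (1 / (x - u) + \<bar>t - F x\<bar>)"
    have pos: "1 / (x - u) + \<bar>t - F x\<bar> > 0" using xu by (simp add: add_pos_nonneg)
    have "1 / (1 / (x - u) + \<bar>t - F x\<bar>) \<le> 1 / (1 / (x - u))"
      using xu pos by (intro divide_left_mono mult_pos_pos) auto
    then have xy: "y \<le> x" by (simp add: y_def)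
    have yu: "u < y" using pos by (simp add: y_def)
    have y: "y \<in> gap n" using x u xy yu le_less_trans[of "ereal y" "ereal x" "hi n"] by (auto simp: gap_def)
    have "F x - F y \<ge> 1 / (u - x) - 1 / (u - y)"
      using gap_B[OF n] gap_interval[OF y x] xy u by (intro F_mono_pole) auto
    also have "1 / (u - y) = - (1 / (x - u) + \<bar>t - F x\<bar>)" by (simp add: y_def)
    also have "1 / (u - x) = - (1 / (x - u))" using xu by (simp add: field_simps)
    finally show ?thesis using y by (intro bexI[of _ y]) auto
  qed
qed

lemma ev_ex1: assumes n: "n \<in> {1..\<nu>}" and "lo n < hi n" shows "\<exists>!x. x \<in> gap n \<and> F x = t"
proof -
  obtain x where x: "x \<in> gap n" "F x \<le> t" using F_lower[OF assms] by blast
  obtain y where y: "y \<in> gap n" "F y \<ge> t" using F_upper[OF assms] by blast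
  have xy: "x \<le> y" using F_strict_iff[OF n x(1) y(1)] x y by simp
  have "{x..y} \<inter> B = {}" using gap_B[OF n] gap_interval[OF x(1) y(1)] by auto
  then have "\<exists>z. x \<le> z \<and> z \<le> y \<and> F z = t" using IVT'[of F x t y] F_cont[of "{x..y}"] x y xy by blast
  then obtain z where "z \<in> gap n" "F z = t" using gap_interval[OF x(1) y(1)] by blast
  moreover have "z = z'" if "z \<in> gap n" "F z = t" "z' \<in> gap n" "F z' = t" for z z'
    using F_strict_iff[OF n that(1,3)] F_strict_iff[OF n that(3,1)] that by auto
  ultimately show ?thesis by blast
qed

lemma ev_gap: assumes "n \<in> {1..\<nu>}" and "lo n < hi n"
  shows "ev n t \<in> gap n" "F (ev n t) = t"
  using theI'[OF ev_ex1[OF assms, of t]] assms by (auto simp: ev_def)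

lemma ev_eq: assumes "n \<in> {1..\<nu>}" and "x \<in> gap n" shows "ev n (F x) = x"
proof -
  have l: "lo n < hi n" using assms(2) by (auto simp: gap_def)
  show ?thesis using ev_ex1[OF assms(1) l, of "F x"] ev_gap[OF assms(1) l, of "F x"] assms(2) by blast
qed

text \<open>The outer gaps are unbounded, so an empty gap is an inner one and comes from two equal
  neighbours in \<open>bs\<close>.\<close>

lemma flat_cases: assumes "n \<in> {1..\<nu>}" "\<not> lo n < hi n"
  shows "n \<ge> 2" "n < \<nu>" "bs ! (n - 2) = bs ! (n - 1)" "ev n t = bs ! (n - 1)" "lo n = ereal (bs ! (n-1))"
    "hi n = ereal (bs ! (n-1))" "bs ! (n - 1) \<in> B"
proof -
  have e: "lo n = hi n" using lo_le_hi assms by force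
  show "n \<ge> 2" "n < \<nu>" using e assms nu2 by (auto simp: lo_def hi_def split: if_splits)
  then show "bs ! (n - 2) = bs ! (n - 1)" "ev n t = bs ! (n - 1)" "lo n = ereal (bs ! (n-1))"
    "hi n = ereal (bs ! (n-1))" "bs ! (n - 1) \<in> B" using e assms nth_mem[of "n-1" bs]
    by (auto simp: lo_def hi_def ev_def length_bs set_bs)
qed

lemma ev_bounds: assumes "n \<in> {1..\<nu>}" shows "lo n \<le> ereal (ev n t)" "ereal (ev n t) \<le> hi n"
proof -
  have "lo n \<le> ereal (ev n t) \<and> ereal (ev n t) \<le> hi n"
  proof (cases "lo n < hi n")
    case True
    then show ?thesis using ev_gap(1)[OF assms True, of t] by (auto simp: gap_def)
  next
    case False
    then show ?thesis using flat_cases[OF assms False] by simp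
  qed
  then show "lo n \<le> ereal (ev n t)" "ereal (ev n t) \<le> hi n" by auto
qed

lemma ev_mono: assumes "n \<in> {1..\<nu>}" shows "mono (ev n)"
proof (rule monoI)
  fix s t :: real assume "s \<le> t"
  show "ev n s \<le> ev n t"
  proof (cases "lo n < hi n")
    case True
    then show ?thesis using ev_gap[OF assms True] F_strict_iff[OF assms] \<open>s \<le> t\<close> by metis
  next
    case False
    then show ?thesis using flat_cases[OF assms False] by simp
  qed
qed

text \<open>A pole separates the two gaps, so the order of the branches persists at different
  parameters. This keeps the bands from overlapping and sorts the eigenvalues.\<close>

lemma ev_le_ev: assumes "1 \<le> n" "n < m" "m \<le> \<nu>" shows "ev n s \<le> ev m t"
proof -
  have "hi n \<le> lo m"
    using assms sorted_bs by (auto simp: hi_def lo_def length_bs intro!: sorted_nth_mono)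
  moreover have "ereal (ev n s) \<le> hi n" using ev_bounds(2)[of n s] assms by auto
  moreover have "lo m \<le> ereal (ev m t)" using ev_bounds(1)[of m t] assms by auto
  ultimately have "ereal (ev n s) \<le> ereal (ev m t)" by (meson order_trans)
  then show ?thesis by simp
qed

text \<open>A point between the two end values lies in the same gap, and \<open>F\<close> takes it
  to the required parameter.\<close>

lemma ev_image:
  assumes n: "n \<in> {1..\<nu>}" and t: "0 \<le> s"
  shows "ev n ` {0..s} = {ev n 0..ev n s}"
proof (cases "lo n < hi n")
  case True
  show ?thesis
  proof (intro equalityI subsetI)
    fix x assume "x \<in> ev n ` {0..s}"
    then show "x \<in> {ev n 0..ev n s}" using ev_mono[OF n] by (auto simp: mono_def)
  next
    fix x assume x: "x \<in> {ev n 0..ev n s}"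
    have xg: "x \<in> gap n" using gap_interval[OF ev_gap(1)[OF n True] ev_gap(1)[OF n True]] x by auto
    have "F x \<in> {0..s}" using F_strict_iff[OF n ev_gap(1)[OF n True] xg, of 0]
      F_strict_iff[OF n xg ev_gap(1)[OF n True], of s] ev_gap(2)[OF n True] x by auto
    then show "x \<in> ev n ` {0..s}" using ev_eq[OF n xg] by (metis imageI)
  qed
next
  case False
  then show ?thesis using flat_cases[OF n False] t by auto
qed

text \<open>Equal values are neighbours in a sorted list, so a repeated pole produces an empty
  gap.\<close>

lemma pole_mult_ge_2_iff: "pole_mult b \<ge> 2 \<longleftrightarrow> (\<exists>n\<in>{1..\<nu>}. \<not> lo n < hi n \<and> bs ! (n - 1) = b)"
proof
  let ?S = "{i. i < \<nu> - 1 \<and> bs ! i = b}"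
  assume "pole_mult b \<ge> 2"
  then have c: "card ?S \<ge> 2" using card_bs[of b] by simp
  then have ne: "?S \<noteq> {}" by (intro notI) (simp only: card.empty)
  have fin: "finite ?S" by simp
  define i where "i = Min ?S"
  have i: "i \<in> ?S" unfolding i_def using ne fin by (rule Min_in[rotated])
  have "\<exists>j\<in>?S. j \<noteq> i"
  proof (rule ccontr)
    assume "\<not> ?thesis"
    then have "?S \<subseteq> {i}" by auto
    then have "card ?S \<le> 1" using card_mono[of "{i}" ?S] by simp
    then show False using c by simp
  qed
  then obtain j where j: "j \<in> ?S" "j \<noteq> i" by blast
  have "i \<le> j" unfolding i_def using fin j(1) by (rule Min_le)
  then have ij: "Suc i \<le> j" using j by simp
  have "bs ! i \<le> bs ! Suc i" "bs ! Suc i \<le> bs ! j" using ij j i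
    by (intro bs_mono; simp)+
  then have "bs ! Suc i = b" using i j(1) unfolding mem_Collect_eq by linarith
  \<comment> \<open>Gap number \<open>i + 2\<close> is bounded by \<open>bs ! i\<close> and
    \<open>bs ! (i + 1)\<close>.\<close>
  then show "\<exists>n\<in>{1..\<nu>}. \<not> lo n < hi n \<and> bs ! (n - 1) = b"
    using i j ij by (intro bexI[of _ "i + 2"]) (auto simp: lo_def hi_def)
next
  assume "\<exists>n\<in>{1..\<nu>}. \<not> lo n < hi n \<and> bs ! (n - 1) = b"
  then obtain n where n: "n \<in> {1..\<nu>}" "\<not> lo n < hi n" "bs ! (n - 1) = b" by blast
  note f = flat_cases[OF n(1,2)]
  have "card {n - 2, n - 1} \<le> card {i. i < \<nu> - 1 \<and> bs ! i = b}"
    using n f(1-3) by (intro card_mono) auto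
  moreover have "card {n - 2, n - 1} = 2" using f by (auto simp: card_insert_if)
  ultimately show "pole_mult b \<ge> 2" using card_bs[of b] by simp
qed

lemma bands_union:
  assumes "0 \<le> s"
  shows "(\<Union>n\<in>{1..\<nu>}. {ev n 0..ev n s}) = {x. x \<notin> B \<and> F x \<in> {0..s}} \<union> {b. pole_mult b \<ge> 2}"
proof (intro equalityI subsetI)
  fix x assume "x \<in> (\<Union>n\<in>{1..\<nu>}. {ev n 0..ev n s})"
  then obtain n where n: "n \<in> {1..\<nu>}" "x \<in> ev n ` {0..s}" using ev_image assms by blast
  then obtain t where t: "t \<in> {0..s}" "x = ev n t" by blast
  show "x \<in> {x. x \<notin> B \<and> F x \<in> {0..s}} \<union> {b. pole_mult b \<ge> 2}"
  proof (cases "lo n < hi n")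
    case True
    then show ?thesis using ev_gap[OF n(1) True, of t] gap_B[OF n(1)] t by auto
  next
    case False
    then have "bs ! (n - 1) = x" using flat_cases(4)[OF n(1) False, of t] t by simp
    then have "pole_mult x \<ge> 2" unfolding pole_mult_ge_2_iff using n(1) False by blast
    then show ?thesis by simp
  qed
next
  fix x assume x: "x \<in> {x. x \<notin> B \<and> F x \<in> {0..s}} \<union> {b. pole_mult b \<ge> 2}"
  then consider "x \<notin> B" "F x \<in> {0..s}" | "pole_mult x \<ge> 2" by blast
  then show "x \<in> (\<Union>n\<in>{1..\<nu>}. {ev n 0..ev n s})"
  proof cases
    case 1
    then obtain n where n: "n \<in> {1..\<nu>}" "x \<in> gap n" using in_gap by blast
    then have "x \<in> ev n ` {0..s}" using ev_eq 1 by (metis imageI)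
    then show ?thesis using ev_image assms n by blast
  next
    case 2
    then obtain n where n: "n \<in> {1..\<nu>}" "\<not> lo n < hi n" "bs ! (n - 1) = x" using pole_mult_ge_2_iff by blast
    then have "x \<in> {ev n 0..ev n s}" using flat_cases(4)[OF n(1,2)] by simp
    then show ?thesis using n(1) by blast
  qed
qed

text \<open>The first copy of a pole in \<open>bs\<close> ends a nonempty gap, so only the later
  copies belong to empty gaps ending there. Away from the poles, the gaps are disjoint. Equality at
  the poles follows in \<open>card_ev\<close> once the degrees are compared.\<close>

lemma ev_count:
  "card {n\<in>{1..\<nu>}. ev n t = x} \<le> (if x \<in> B then pole_mult x - 1 else if F x = t then 1 else 0)"
proof (cases "x \<in> B")
  case True
  let ?S = "{i. i < \<nu> - 1 \<and> bs ! i = x}"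
  have card: "card ?S = pole_mult x" by (rule card_bs)
  have ne: "?S \<noteq> {}" using card pole_mult_pos[OF True] by (intro notI) (simp only: card.empty)
  have fin: "finite ?S" by simp
  define i where "i = Min ?S"
  have i: "i \<in> ?S" unfolding i_def using ne fin by (rule Min_in[rotated])
  have "{n\<in>{1..\<nu>}. ev n t = x} \<subseteq> Suc ` (?S - {i})"
  proof
    fix n assume "n \<in> {n\<in>{1..\<nu>}. ev n t = x}"
    then have n: "n \<in> {1..\<nu>}" "ev n t = x" by auto
    have fl: "\<not> lo n < hi n" using ev_gap(1)[OF n(1)] gap_B[OF n(1)] n(2) True by blast
    note f = flat_cases[OF n(1) fl]
    have "n - 2 \<in> ?S" using f(1-4) n(2) by auto
    then have "i \<le> n - 2" unfolding i_def using fin by (intro Min_le)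
    then have "n - 1 \<in> ?S - {i}" "n = Suc (n - 1)" using f(1-4) n(2) by auto
    then show "n \<in> Suc ` (?S - {i})" by blast
  qed
  then have "card {n\<in>{1..\<nu>}. ev n t = x} \<le> card (Suc ` (?S - {i}))" by (intro card_mono) auto
  also have "\<dots> = pole_mult x - 1" using i card by (simp add: card_image)
  finally show ?thesis using True by simp
next
  case False
  have nf: "lo n < hi n" if "n \<in> {1..\<nu>}" "ev n t = x" for n
    using flat_cases[OF that(1)] that False by metis
  show ?thesis
  proof (cases "{n\<in>{1..\<nu>}. ev n t = x} = {}")
    case True then show ?thesis unfolding True by simp
  next
    case ne: False
    then obtain n where n: "n \<in> {1..\<nu>}" "ev n t = x" by blast
    have "m = n" if m: "m \<in> {1..\<nu>}" "ev m t = x" for m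
    proof -
      have "x \<in> gap n" "x \<in> gap m"
        using ev_gap(1)[OF n(1) nf[OF n], of t] ev_gap(1)[OF m(1) nf[OF m], of t] n m by auto
      then have "\<not> m < n" "\<not> n < m"
        using gap_disjoint[of n m x x] gap_disjoint[of m n x x] n(1) m(1) by auto
      then show ?thesis by simp
    qed
    then have "{n\<in>{1..\<nu>}. ev n t = x} = {n}" using n by blast
    moreover have "F x = t" using ev_gap(2)[OF n(1) nf[OF n], of t] n by simp
    ultimately show ?thesis using False by simp
  qed
qed

section \<open>Factorisation of the characteristic polynomial\<close>

definition linprod :: "real \<Rightarrow> real poly" where
  "linprod t = (\<Prod>n\<in>{1..\<nu>}. [:- ev n t, 1:])"
definition pend :: "real poly" where "pend = (\<Prod>j\<in>{1..<\<nu>}. [:- \<beta> j, 1:])"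
text \<open>\<open>pend\<close> times \<open>F - t\<close> with the denominators cleared. It will
  turn out to be the characteristic polynomial of the Floquet matrix at symbol value
  \<open>t\<close>.\<close>

definition chi :: "real \<Rightarrow> real poly" where
  "chi t = [:- (c + t), 1:] * pend - (\<Sum>j\<in>{1..<\<nu>}. \<Prod>l\<in>{1..<\<nu>}-{j}. [:- \<beta> l, 1:])"

text \<open>By \<open>prod_linear_dvd\<close> it suffices to compare orders with the bounds of
  \<open>ev_count\<close>.\<close>

lemma ev_prod_dvd:
  assumes P: "\<And>b. b \<in> B \<Longrightarrow> [:- b, 1:] ^ (pole_mult b - 1) dvd P"
    and r: "\<And>x. x \<notin> B \<Longrightarrow> F x = t \<Longrightarrow> poly P x = 0"
  shows "linprod t dvd P"
proof (cases "P = 0")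
  case False
  show ?thesis unfolding linprod_def
  proof (rule prod_linear_dvd[OF _ False])
    fix x
    show "card {n \<in> {1..\<nu>}. ev n t = x} \<le> Polynomial.order x P"
    proof (cases "x \<in> B")
      case True
      then have "pole_mult x - 1 \<le> Polynomial.order x P" using P[OF True] False order_divides by blast
      then show ?thesis using ev_count[of t x] True by simp
    next
      case x: False
      show ?thesis
      proof (cases "F x = t")
        case True
        then have "Polynomial.order x P \<noteq> 0" using r[OF x True] False order_root by blast
        then show ?thesis using ev_count[of t x] x True by simp
      next
        case False
        then have "card {n \<in> {1..\<nu>}. ev n t = x} = 0" using ev_count[of t x] x by simp
        then show ?thesis by (simp only: zero_le)
      qed
    qed
  qed simp
qed simp

lemma pow_dvd_prod:
  assumes "finite S" "card {l\<in>S. \<beta> l = b} \<ge> k"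
  shows "[:- b, 1:] ^ k dvd (\<Prod>l\<in>S. [:- \<beta> l, 1:])"
proof -
  have "[:- b, 1:] ^ card {l\<in>S. \<beta> l = b} = (\<Prod>l\<in>{l\<in>S. \<beta> l = b}. [:- \<beta> l, 1:])"
    by (subst prod.cong[OF refl, of _ _ "\<lambda>_. [:- b, 1:]"]) auto
  also have "\<dots> dvd (\<Prod>l\<in>S. [:- \<beta> l, 1:])"
    using assms by (intro prod_dvd_prod_subset) auto
  finally show ?thesis using le_imp_power_dvd[OF assms(2)] dvd_trans by blast
qed

text \<open>Leaving out one index removes at most one of the \<open>pole_mult b\<close> factors with
  root \<open>b\<close>, hence the exponent.\<close>

lemma pow_dvd_chi: "[:- b, 1:] ^ (pole_mult b - 1) dvd chi t"
proof -
  have 1: "[:- b, 1:] ^ (pole_mult b - 1) dvd pend"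
    unfolding pend_def by (intro pow_dvd_prod) (auto simp: pole_mult_def)
  have 2: "[:- b, 1:] ^ (pole_mult b - 1) dvd (\<Prod>l\<in>{1..<\<nu>}-{j}. [:- \<beta> l, 1:])" if "j \<in> {1..<\<nu>}" for j
  proof (intro pow_dvd_prod)
    have "{l \<in> {1..<\<nu>}. \<beta> l = b} - {j} \<subseteq> {l \<in> {1..<\<nu>} - {j}. \<beta> l = b}" by auto
    then have "card ({l \<in> {1..<\<nu>}. \<beta> l = b} - {j}) \<le> card {l \<in> {1..<\<nu>} - {j}. \<beta> l = b}"
      by (intro card_mono) auto
    moreover have "pole_mult b - 1 \<le> card ({l \<in> {1..<\<nu>}. \<beta> l = b} - {j})"
      using diff_card_le_card_Diff[of "{j}" "{l \<in> {1..<\<nu>}. \<beta> l = b}"] by (simp add: pole_mult_def)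
    ultimately show "pole_mult b - 1 \<le> card {l \<in> {1..<\<nu>} - {j}. \<beta> l = b}" by simp
  qed simp
  show ?thesis unfolding chi_def using 1 2 by (intro dvd_diff dvd_mult dvd_sum) auto
qed

lemma poly_chi: assumes "x \<notin> B" shows "poly (chi t) x = poly pend x * (F x - t)"
proof -
  have ne: "x - \<beta> j \<noteq> 0" if "j \<in> {1..<\<nu>}" for j using assms that by (auto simp: B_def)
  have p: "poly pend x = (x - \<beta> j) * (\<Prod>l\<in>{1..<\<nu>}-{j}. x - \<beta> l)" if "j \<in> {1..<\<nu>}" for j
    using prod.remove[OF _ that, of "\<lambda>l. x - \<beta> l"] by (simp add: pend_def poly_prod)
  have "(\<Sum>j\<in>{1..<\<nu>}. \<Prod>l\<in>{1..<\<nu>}-{j}. x - \<beta> l) = (\<Sum>j\<in>{1..<\<nu>}. - (poly pend x * (1 / (\<beta> j - x))))"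
  proof (rule sum.cong)
    fix j assume j: "j \<in> {1..<\<nu>}"
    show "(\<Prod>l\<in>{1..<\<nu>}-{j}. x - \<beta> l) = - (poly pend x * (1 / (\<beta> j - x)))"
      unfolding p[OF j] using ne[OF j] by (simp add: field_simps)
  qed simp
  also have "\<dots> = - poly pend x * (\<Sum>j\<in>{1..<\<nu>}. 1 / (\<beta> j - x))"
    by (simp add: sum_distrib_left sum_negf)
  finally show ?thesis
    by (simp add: chi_def poly_sum poly_prod F_def algebra_simps)
qed

lemma degree_pend: "degree pend = \<nu> - 1" "lead_coeff pend = 1"
  using monic_prod_linear[where S="{1..<\<nu>}" and e=\<beta>] by (simp_all add: pend_def)

lemma degree_linprod: "degree (linprod t) = \<nu>" "lead_coeff (linprod t) = 1"
  using monic_prod_linear[where S="{1..\<nu>}" and e="\<lambda>n. ev n t"] by (simp_all add: linprod_def)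

lemma degree_chi: "degree (chi t) = \<nu>" "lead_coeff (chi t) = 1"
proof -
  let ?A = "[:- (c + t), 1:] * pend"
  let ?R = "\<Sum>j\<in>{1..<\<nu>}. \<Prod>l\<in>{1..<\<nu>}-{j}. [:- \<beta> l, 1:]"
  have pn: "pend \<noteq> 0" using degree_pend(2) by auto
  have dA: "degree ?A = \<nu>" using nu2 pn degree_pend(1) by (subst degree_mult_eq) auto
  have lA: "lead_coeff ?A = 1" unfolding lead_coeff_mult degree_pend(2) by simp
  have "degree ?R \<le> \<nu> - 2"
  proof (rule degree_sum_le)
    fix j assume j: "j \<in> {1..<\<nu>}"
    have "degree (\<Prod>l\<in>{1..<\<nu>}-{j}. [:- \<beta> l, 1:]) = card ({1..<\<nu>}-{j})"
      by (subst degree_prod_sum_eq) auto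
    then show "degree (\<Prod>l\<in>{1..<\<nu>}-{j}. [:- \<beta> l, 1:]) \<le> \<nu> - 2" using j by simp
  qed simp
  then have dR: "degree ?R < degree ?A" using dA nu2 by simp
  show dc: "degree (chi t) = \<nu>" unfolding chi_def diff_conv_add_uminus
    using dR dA by (subst degree_add_eq_left) auto
  show "lead_coeff (chi t) = 1" unfolding dc using lA coeff_eq_0[of ?R \<nu>] dR dA
    by (simp add: chi_def)
qed

text \<open>Divisibility in one direction is enough, as both polynomials are monic of degree
  \<open>\<nu>\<close>.\<close>

lemma chi_eq: "chi t = linprod t"
proof -
  have "linprod t dvd chi t"
    by (rule ev_prod_dvd[OF pow_dvd_chi]) (simp add: poly_chi)
  then obtain K where K: "chi t = linprod t * K" by blast
  have nz: "linprod t \<noteq> 0" "K \<noteq> 0" using degree_chi(2)[of t] K by auto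
  then have "degree K = 0" using K degree_mult_eq[OF nz] degree_chi(1)[of t] degree_linprod(1)[of t] by simp
  then obtain k where "K = [:k:]" using degree_eq_zeroE by blast
  moreover have "lead_coeff K = 1" using degree_chi(2)[of t] degree_linprod(2)[of t] K lead_coeff_mult[of "linprod t" K] by simp
  ultimately show ?thesis using K by simp
qed

text \<open>The upper bound is \<open>ev_count\<close>. The lower one reads the order of the root
  \<open>b\<close> off the factorisation of \<open>chi t\<close>.\<close>

lemma card_ev: assumes "b \<in> B" shows "card {n\<in>{1..\<nu>}. ev n t = b} = pole_mult b - 1"
proof (rule antisym)
  show "card {n\<in>{1..\<nu>}. ev n t = b} \<le> pole_mult b - 1" using ev_count[of t b] assms by simp
  have nz: "linprod t \<noteq> 0" using degree_linprod(2)[of t] by auto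
  have "pole_mult b - 1 \<le> Polynomial.order b (linprod t)"
    using pow_dvd_chi[of b t] nz unfolding chi_eq order_divides by blast
  also have "\<dots> = count (proots (linprod t)) b" using nz by simp
  also have "\<dots> = count (\<Sum>n\<in>{1..\<nu>}. {#ev n t#}) b"
    using nz by (simp add: linprod_def proots_prod)
  also have "\<dots> = card {n\<in>{1..\<nu>}. ev n t = b}"
    by (simp add: count_sum sum.If_cases) (auto intro!: arg_cong[where f = card])
  finally show "pole_mult b - 1 \<le> card {n\<in>{1..\<nu>}. ev n t = b}" .
qed

text \<open>The parameter enters \<open>chi t\<close> only through \<open>- t * pend\<close>, and
  \<open>pend\<close> is monic of degree \<open>\<nu> - 1\<close>; compare the coefficients of that
  degree.\<close>

lemma trace: "(\<Sum>n\<in>{1..\<nu>}. ev n t) - (\<Sum>n\<in>{1..\<nu>}. ev n 0) = t"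
proof -
  have "[:- (c + t), 1:] * pend = ([:- (c + 0), 1:] - [:t:]) * pend" by simp
  also have "\<dots> = [:- (c + 0), 1:] * pend - Polynomial.smult t pend"
    by (simp only: left_diff_distrib) simp
  finally have "chi t = chi 0 - Polynomial.smult t pend"
    by (simp only: chi_def diff_diff_eq2 diff_right_commute)
  then have "coeff (linprod t) (\<nu> - 1) = coeff (linprod 0) (\<nu> - 1) - t * coeff pend (\<nu> - 1)"
    by (simp add: chi_eq)
  then show ?thesis using coeff_prod_linear[of "{1..\<nu>}" "\<lambda>n. ev n t"] degree_pend
     coeff_prod_linear[of "{1..\<nu>}" "\<lambda>n. ev n 0"] nu2 by (simp add: linprod_def)
qed

text \<open>\<open>ev_le_ev\<close> excludes overlaps only up to end points, so the closed bands are
  replaced by open intervals, which changes the union by a finite set. Degenerate bands become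
  empty, and the lengths add up by \<open>trace\<close>.\<close>

lemma emeasure_bands:
  assumes "0 \<le> t"
  shows "emeasure lborel (\<Union>n\<in>{1..\<nu>}. {ev n 0..ev n t}) = ennreal t"
proof -
  have le: "ev n 0 \<le> ev n t" if "n \<in> {1..\<nu>}" for n using ev_mono[OF that] assms by (auto simp: mono_def)
  have dis: "disjoint_family_on (\<lambda>n. {ev n 0<..<ev n t}) {1..\<nu>}"
    unfolding disjoint_family_on_def
  proof (intro ballI impI)
    fix m n assume mn: "m \<in> {1..\<nu>}" "n \<in> {1..\<nu>}" "m \<noteq> n"
    show "{ev m 0<..<ev m t} \<inter> {ev n 0<..<ev n t} = {}"
      using ev_le_ev[of m n t 0] ev_le_ev[of n m t 0] mn
      by (cases "m < n") auto
  qed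
  have "emeasure lborel (\<Union>n\<in>{1..\<nu>}. {ev n 0..ev n t}) = emeasure lborel (\<Union>n\<in>{1..\<nu>}. {ev n 0<..<ev n t})"
  proof (rule emeasure_eq_AE)
    have "AE x in lborel. x \<notin> (\<Union>n\<in>{1..\<nu>}. {ev n 0, ev n t})"
      by (rule AE_not_in, rule finite_imp_null_set_lborel) auto
    then show "AE x in lborel. x \<in> (\<Union>n\<in>{1..\<nu>}. {ev n 0..ev n t}) \<longleftrightarrow> x \<in> (\<Union>n\<in>{1..\<nu>}. {ev n 0<..<ev n t})"
      by eventually_elim (auto simp: less_le)
  qed auto
  also have "\<dots> = (\<Sum>n\<in>{1..\<nu>}. emeasure lborel {ev n 0<..<ev n t})"
    by (rule sum_emeasure[symmetric]) (use dis in auto)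
  also have "\<dots> = (\<Sum>n\<in>{1..\<nu>}. ennreal (ev n t - ev n 0))"
    using le by (intro sum.cong) auto
  also have "\<dots> = ennreal (\<Sum>n\<in>{1..\<nu>}. ev n t - ev n 0)"
    using le by (intro sum_ennreal) auto
  also have "\<dots> = ennreal t" using trace[of t] by (simp add: sum_subtractf)
  finally show ?thesis .
qed

section \<open>Eigenvectors and the spectral resolution of a single fibre\<close>

definition roots :: "real \<Rightarrow> real set" where "roots t = {x. x \<notin> B \<and> F x = t}"
definition bands :: "nat set" where "bands = {n\<in>{1..\<nu>}. lo n < hi n}"

lemma bij_roots: "bij_betw (\<lambda>n. ev n t) bands (roots t)"
proof (rule bij_betw_imageI)
  show "inj_on (\<lambda>n. ev n t) bands"
  proof (rule inj_onI)
    fix m n assume m: "m \<in> bands" and n: "n \<in> bands" and e: "ev m t = ev n t"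
    have "ev m t \<in> gap n" "ev m t \<in> gap m" "1 \<le> n" "n \<le> \<nu>" "1 \<le> m" "m \<le> \<nu>"
      using ev_gap(1)[of n t] ev_gap(1)[of m t] m n e by (auto simp: bands_def)
    then show "m = n"
      using gap_disjoint[of m n "ev m t" "ev m t"] gap_disjoint[of n m "ev m t" "ev m t"]
      by (cases m n rule: linorder_cases) auto
  qed
  show "(\<lambda>n. ev n t) ` bands = roots t"
  proof (intro equalityI subsetI)
    fix x assume "x \<in> (\<lambda>n. ev n t) ` bands"
    then show "x \<in> roots t" using ev_gap gap_B by (auto simp: bands_def roots_def)
  next
    fix x assume x: "x \<in> roots t"
    then obtain n where n: "n \<in> {1..\<nu>}" "x \<in> gap n" using in_gap by (auto simp: roots_def)
    then have "lo n < hi n" by (auto simp: gap_def)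
    then show "x \<in> (\<lambda>n. ev n t) ` bands" using ev_eq[OF n] n x by (force simp: roots_def bands_def)
  qed
qed

lemma finite_bands: "finite bands" by (simp add: bands_def)

lemma finite_roots: "finite (roots t)"
  using bij_betw_finite[OF bij_roots] finite_bands by blast

text \<open>The multiplicities of the poles add up to \<open>\<nu> - 1\<close>, while the constant
  branches take away \<open>pole_mult b - 1\<close> of the \<open>\<nu>\<close> branches at each
  pole. At least \<open>card B + 1\<close> branches remain, one more than the degree of the
  polynomial in \<open>Lf_zero\<close>.\<close>

lemma card_roots: "card B < card (roots t)"
proof -
  have B1: "pole_mult b = Suc (pole_mult b - 1)" if "b \<in> B" for b using pole_mult_pos[OF that] by simp
  have "\<nu> - 1 = (\<Sum>b\<in>B. pole_mult b)"
    using sum.group[of "{1..<\<nu>}" B \<beta> "\<lambda>_. 1::nat"] by (simp add: B_def pole_mult_def)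
  also have "\<dots> = (\<Sum>b\<in>B. Suc (pole_mult b - 1))" by (rule sum.cong[OF refl B1])
  also have "\<dots> = card B + (\<Sum>b\<in>B. pole_mult b - 1)" by (simp only: sum_Suc add.commute)
  finally have 1: "\<nu> - 1 = card B + (\<Sum>b\<in>B. pole_mult b - 1)" .
  have split: "{1..\<nu>} = bands \<union> (\<Union>b\<in>B. {n\<in>{1..\<nu>}. ev n t = b})"
  proof (intro equalityI subsetI)
    fix n assume n: "n \<in> {1..\<nu>}"
    show "n \<in> bands \<union> (\<Union>b\<in>B. {n\<in>{1..\<nu>}. ev n t = b})"
      using flat_cases(4,7)[OF n] n unfolding bands_def by fastforce
  qed (auto simp: bands_def)
  have "\<nu> = card {1..\<nu>}" by simp
  also have "\<dots> = card (bands \<union> (\<Union>b\<in>B. {n\<in>{1..\<nu>}. ev n t = b}))" by (rule arg_cong[OF split])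
  also have "\<dots> \<le> card bands + card (\<Union>b\<in>B. {n\<in>{1..\<nu>}. ev n t = b})" by (rule card_Un_le)
  also have "card (\<Union>b\<in>B. {n\<in>{1..\<nu>}. ev n t = b}) \<le> (\<Sum>b\<in>B. card {n\<in>{1..\<nu>}. ev n t = b})"
    by (rule card_UN_le[OF finite_B])
  also have "\<dots> = (\<Sum>b\<in>B. pole_mult b - 1)" by (intro sum.cong card_ev) auto
  finally have "\<nu> \<le> card bands + (\<Sum>b\<in>B. pole_mult b - 1)" by simp
  moreover have "card bands = card (roots t)" using bij_betw_same_card[OF bij_roots] .
  ultimately show ?thesis using 1 nu2 by linarith
qed

definition idx :: "nat set" where "idx = {1..\<nu>}"
text \<open>The orthogonal complement of the vectors of sum zero supported on pendant indices with a
  common pole.\<close>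

definition sym_vec :: "(nat \<Rightarrow> 'b) \<Rightarrow> bool" where
  "sym_vec x \<longleftrightarrow> (\<forall>i\<in>{1..<\<nu>}. \<forall>j\<in>{1..<\<nu>}. \<beta> i = \<beta> j \<longrightarrow> x i = x j)"
text \<open>Pairing with the real vector \<open>eigv s\<close>.\<close>

definition Lf :: "real \<Rightarrow> (nat \<Rightarrow> complex) \<Rightarrow> complex" where
  "Lf s x = x \<nu> + (\<Sum>j\<in>{1..<\<nu>}. x j / of_real (\<beta> j - s))"
definition Hm :: "real \<Rightarrow> (nat \<Rightarrow> complex) \<Rightarrow> nat \<Rightarrow> complex" where
  "Hm t x k = (if k = \<nu> then of_real (c + t) * x \<nu> - (\<Sum>j\<in>{1..<\<nu>}. x j)
     else if k \<in> {1..<\<nu>} then of_real (\<beta> k) * x k - x \<nu> else 0)"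
definition eigv :: "real \<Rightarrow> nat \<Rightarrow> complex" where
  "eigv s k = (if k = \<nu> then 1 else of_real (1 / (\<beta> k - s)))"

lemma sum_idx: "(\<Sum>k\<in>idx. f k) = f \<nu> + (\<Sum>j\<in>{1..<\<nu>}. f j)" for f :: "nat \<Rightarrow> 'b :: comm_monoid_add"
proof -
  have "idx = insert \<nu> {1..<\<nu>}" using nu2 by (auto simp: idx_def)
  then show ?thesis by simp
qed

lemma ne_B: "s \<notin> B \<Longrightarrow> j \<in> {1..<\<nu>} \<Longrightarrow> \<beta> j \<noteq> s" "s \<notin> B \<Longrightarrow> j \<in> {1..<\<nu>} \<Longrightarrow> \<beta> j - s \<noteq> 0"
  by (auto simp: B_def)

text \<open>\<open>Lf s\<close> is a left eigenvector. Writing \<open>\<beta> j\<close> as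
  \<open>(\<beta> j - s) + s\<close> produces the sum that cancels the one in the hub component, and
  \<open>F s = t\<close> turns the coefficient of \<open>x \<nu>\<close> into
  \<open>s\<close>.\<close>

lemma Lf_Hm: assumes "s \<in> roots t" shows "Lf s (Hm t x) = of_real s * Lf s x"
proof -
  have s: "s \<notin> B" "F s = t" using assms by (auto simp: roots_def)
  have "(\<Sum>j\<in>{1..<\<nu>}. Hm t x j / of_real (\<beta> j - s))
    = (\<Sum>j\<in>{1..<\<nu>}. x j + of_real s * (x j / of_real (\<beta> j - s)) - x \<nu> * of_real (1 / (\<beta> j - s)))"
  proof (rule sum.cong)
    fix j assume j: "j \<in> {1..<\<nu>}"
    define D where "D = complex_of_real (\<beta> j - s)"
    have "D \<noteq> 0" "complex_of_real (\<beta> j) = D + of_real s" using ne_B(2)[OF s(1) j] by (simp_all add: D_def)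
    then show "Hm t x j / of_real (\<beta> j - s) = x j + of_real s * (x j / of_real (\<beta> j - s)) - x \<nu> * of_real (1 / (\<beta> j - s))"
      using j by (simp add: Hm_def D_def[symmetric] field_simps del: of_real_diff)
        (simp add: D_def)?
  qed simp
  also have "\<dots> = (\<Sum>j\<in>{1..<\<nu>}. x j) + of_real s * (\<Sum>j\<in>{1..<\<nu>}. x j / of_real (\<beta> j - s))
     - x \<nu> * of_real (\<Sum>j\<in>{1..<\<nu>}. 1 / (\<beta> j - s))"
    by (simp add: sum.distrib sum_subtractf sum_distrib_left)
  also have "(\<Sum>j\<in>{1..<\<nu>}. 1 / (\<beta> j - s)) = t - s + c" using s(2) by (simp add: F_def)
  finally show ?thesis by (simp add: Lf_def Hm_def algebra_simps)
qed

text \<open>The pairing of two eigenvectors is the divided difference of \<open>F\<close>, which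
  vanishes between two solutions of \<open>F = t\<close> and becomes the derivative when they
  coincide.\<close>

lemma Lf_eigv: assumes "s \<in> roots t" "r \<in> roots t"
  shows "Lf r (eigv s) = (if r = s then of_real (F' s) else 0)"
proof -
  have s: "s \<notin> B" "F s = t" and r: "r \<notin> B" "F r = t" using assms by (auto simp: roots_def)
  have L: "Lf r (eigv s) = of_real (1 + (\<Sum>j\<in>{1..<\<nu>}. 1 / ((\<beta> j - s) * (\<beta> j - r))))"
    by (simp add: Lf_def eigv_def)
  show ?thesis
  proof (cases "r = s")
    case True
    then show ?thesis unfolding L by (simp add: F'_def power2_eq_square)
  next
    case False
    have "(\<Sum>j\<in>{1..<\<nu>}. 1 / (\<beta> j - r)) - (\<Sum>j\<in>{1..<\<nu>}. 1 / (\<beta> j - s)) =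
        (\<Sum>j\<in>{1..<\<nu>}. (r - s) * (1 / ((\<beta> j - s) * (\<beta> j - r))))"
      unfolding sum_subtractf[symmetric]
    proof (rule sum.cong)
      fix j assume j: "j \<in> {1..<\<nu>}"
      show "1 / (\<beta> j - r) - 1 / (\<beta> j - s) = (r - s) * (1 / ((\<beta> j - s) * (\<beta> j - r)))"
        using ne_B(2)[OF s(1) j] ne_B(2)[OF r(1) j] by (simp add: divide_simps)
    qed simp
    then have "F r - F s = (r - s) * (1 + (\<Sum>j\<in>{1..<\<nu>}. 1 / ((\<beta> j - s) * (\<beta> j - r))))"
      by (simp add: F_def algebra_simps sum_distrib_left)
    then have "1 + (\<Sum>j\<in>{1..<\<nu>}. 1 / ((\<beta> j - s) * (\<beta> j - r))) = 0" using s r False by simp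
    then show ?thesis unfolding L using False by (simp only: of_real_0 if_False)
  qed
qed

text \<open>Clearing denominators in \<open>Lf s y\<close> gives a polynomial in \<open>s\<close> of degree at most \<open>card B\<close>.\<close>

lemma Lf_zero:
  assumes y: "sym_vec y" and z: "\<And>s. s \<in> roots t \<Longrightarrow> Lf s y = 0" and k: "k \<in> idx"
  shows "y k = 0"
proof -
  \<comment> \<open>By symmetry \<open>y\<close> is a function \<open>g\<close> of the pole. Each
    pole then enters once, with weight \<open>pole_mult b\<close>, which keeps the degree of
    \<open>p\<close> below the number of roots.\<close>
  define g where "g b = y (SOME j. j \<in> {1..<\<nu>} \<and> \<beta> j = b)" for b
  have g: "y j = g (\<beta> j)" if "j \<in> {1..<\<nu>}" for j
  proof -
    have "(SOME i. i \<in> {1..<\<nu>} \<and> \<beta> i = \<beta> j) \<in> {1..<\<nu>} \<and> \<beta> (SOME i. i \<in> {1..<\<nu>} \<and> \<beta> i = \<beta> j) = \<beta> j"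
      by (rule someI[of _ j]) (use that in simp)
    then show ?thesis using y that unfolding g_def sym_vec_def by metis
  qed
  define P where "P A = (\<Prod>b\<in>A. [:- complex_of_real b, 1:])" for A
  define p where "p = Polynomial.smult (y \<nu>) (P B) - (\<Sum>b\<in>B. Polynomial.smult (of_nat (pole_mult b) * g b) (P (B - {b})))"
  have dP: "degree (P A) = card A" if "finite A" for A
    unfolding P_def using monic_prod_linear(1)[OF that, of complex_of_real] by simp
  have poly_P: "poly (P A) x = (\<Prod>b\<in>A. x - of_real b)" for A x
    by (simp add: P_def poly_prod)
  have poly_p: "poly p (of_real s) = poly (P B) (of_real s) * Lf s y" if "s \<notin> B" for s
  proof -
    have "(\<Sum>j\<in>{1..<\<nu>}. y j / of_real (\<beta> j - s)) = (\<Sum>b\<in>B. \<Sum>j\<in>{j\<in>{1..<\<nu>}. \<beta> j = b}. y j / of_real (\<beta> j - s))"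
      by (rule sum.group[symmetric]) (auto simp: B_def)
    also have "\<dots> = (\<Sum>b\<in>B. of_nat (pole_mult b) * g b / of_real (b - s))"
      by (intro sum.cong refl) (simp add: g pole_mult_def)
    finally have L: "Lf s y = y \<nu> + (\<Sum>b\<in>B. of_nat (pole_mult b) * g b / of_real (b - s))" by (simp add: Lf_def)
    have "poly (P B) (of_real s) * (of_nat (pole_mult b) * g b / of_real (b - s))
       = - (of_nat (pole_mult b) * g b * poly (P (B - {b})) (of_real s))" if b: "b \<in> B" for b
    proof -
      have "poly (P B) (of_real s) = (of_real s - of_real b) * poly (P (B - {b})) (of_real s)"
        unfolding poly_P using prod.remove[OF finite_B b] by simp
      then have "poly (P B) (of_real s) = - (complex_of_real (b - s) * poly (P (B - {b})) (of_real s))"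
        by (simp add: algebra_simps)
      moreover have "complex_of_real (b - s) \<noteq> 0" using b \<open>s \<notin> B\<close> by auto
      ultimately show ?thesis by (simp del: of_real_diff)
    qed
    then show ?thesis
      by (simp add: p_def L poly_sum distrib_left sum_distrib_left sum_negf mult.commute)
  qed
  have "degree p \<le> card B" unfolding p_def
  proof (intro degree_diff_le degree_sum_le)
    show "degree (Polynomial.smult (y \<nu>) (P B)) \<le> card B" using dP[OF finite_B] degree_smult_le by metis
    fix b assume "b \<in> B"
    have "degree (P (B - {b})) \<le> card B" using dP[of "B - {b}"] finite_B by (simp add: card_Diff1_le)
    then show "degree (Polynomial.smult (of_nat (pole_mult b) * g b) (P (B - {b}))) \<le> card B"
      using degree_smult_le le_trans by blast
  qed (rule finite_B)
  have "p = 0"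
  proof (rule ccontr)
    assume p: "p \<noteq> 0"
    have "of_real ` roots t \<subseteq> {x. poly p x = 0}"
      using poly_p z by (auto simp: roots_def)
    then have "card (complex_of_real ` roots t) \<le> card {x. poly p x = 0}"
      using poly_roots_finite[OF p] by (intro card_mono)
    also have "\<dots> \<le> degree p" using card_poly_roots_bound[OF p] .
    also have "card (complex_of_real ` roots t) = card (roots t)"
      by (intro card_image inj_onI) simp
    finally show False using card_roots[of t] \<open>degree p \<le> card B\<close> by simp
  qed
  \<comment> \<open>At the pole \<open>b\<close>, all summands of \<open>p\<close> but one contain a
    vanishing factor, which isolates \<open>g b\<close>.\<close>
  have gb: "g b = 0" if b: "b \<in> B" for b
  proof -
    have z0: "poly (P (B - {b'})) (of_real b) = 0" if "b' \<in> B - {b}" for b'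
      unfolding poly_P using that b finite_B by (auto simp: prod_zero_iff)
    have zB: "poly (P B) (of_real b) = 0" unfolding poly_P using b finite_B by (auto simp: prod_zero_iff)
    have "0 = poly p (of_real b)" using \<open>p = 0\<close> by simp
    also have "\<dots> = - (of_nat (pole_mult b) * g b * poly (P (B - {b})) (of_real b))"
      unfolding p_def using z0 zB sum.remove[OF finite_B b, of "\<lambda>b'. of_nat (pole_mult b') * g b' * poly (P (B - {b'})) (of_real b)"]
      by (simp add: poly_sum)
    finally have "of_nat (pole_mult b) * g b * poly (P (B - {b})) (of_real b) = 0" by simp
    moreover have "poly (P (B - {b})) (of_real b) \<noteq> 0"
      unfolding poly_P using finite_B by (auto simp: prod_zero_iff)
    moreover have "pole_mult b \<noteq> 0" using pole_mult_pos[OF b] by simp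
    ultimately show ?thesis by simp
  qed
  have "P B \<noteq> 0" unfolding P_def using finite_B by (auto simp: prod_zero_iff)
  moreover have "p = Polynomial.smult (y \<nu>) (P B)" unfolding p_def using gb by simp
  ultimately have "y \<nu> = 0" using \<open>p = 0\<close> by simp
  moreover have "y j = 0" if "j \<in> {1..<\<nu>}" for j using g[OF that] gb that by (auto simp: B_def)
  ultimately show ?thesis using k by (cases "k = \<nu>") (auto simp: idx_def)
qed

lemma Lf_diff_sum:
  "Lf r (\<lambda>k. x k - (\<Sum>s\<in>S. a s * e s k)) = Lf r x - (\<Sum>s\<in>S. a s * Lf r (e s))"
proof -
  have "(\<Sum>j\<in>{1..<\<nu>}. (\<Sum>s\<in>S. a s * e s j) / of_real (\<beta> j - r)) =
     (\<Sum>s\<in>S. a s * (\<Sum>j\<in>{1..<\<nu>}. e s j / of_real (\<beta> j - r)))"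
    by (simp add: sum_divide_distrib sum_distrib_left) (rule sum.swap)
  then show ?thesis
    by (simp add: Lf_def diff_divide_distrib sum_subtractf distrib_left sum.distrib)
qed

text \<open>Completeness: by orthogonality the difference of both sides is annihilated by every
  \<open>Lf r\<close>, and it is symmetric, so \<open>Lf_zero\<close> applies.\<close>

lemma eigv_expansion:
  assumes x: "sym_vec x" and k: "k \<in> idx"
  shows "x k = (\<Sum>s\<in>roots t. Lf s x / of_real (F' s) * eigv s k)"
proof -
  let ?y = "\<lambda>k. x k - (\<Sum>s\<in>roots t. Lf s x / of_real (F' s) * eigv s k)"
  have "?y k = 0"
  proof (rule Lf_zero[OF _ _ k])
    show "sym_vec ?y" unfolding sym_vec_def
    proof (intro ballI impI)
      fix i j assume ij: "i \<in> {1..<\<nu>}" "j \<in> {1..<\<nu>}" "\<beta> i = \<beta> j"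
      have "x i = x j" using x ij unfolding sym_vec_def by blast
      moreover have "eigv s i = eigv s j" for s using ij by (auto simp: eigv_def)
      ultimately show "?y i = ?y j" by simp
    qed
    fix r assume r: "r \<in> roots t"
    have "F' r \<noteq> 0" using F'_ge[of r] by auto
    have "(\<Sum>s\<in>roots t. Lf s x / of_real (F' s) * Lf r (eigv s)) = (\<Sum>s\<in>roots t. if s = r then Lf s x else 0)"
      using r \<open>F' r \<noteq> 0\<close> by (intro sum.cong refl) (auto simp: Lf_eigv[of _ t])
    then show "Lf r ?y = 0"
      unfolding Lf_diff_sum using r finite_roots by simp
  qed
  then show ?thesis by simp
qed

lemma parseval:
  assumes x: "sym_vec x"
  shows "(\<Sum>k\<in>idx. cnj (x k) * z k) = (\<Sum>s\<in>roots t. cnj (Lf s x) * Lf s z / of_real (F' s))"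
proof -
  have "(\<Sum>k\<in>idx. cnj (x k) * z k) = (\<Sum>k\<in>idx. \<Sum>s\<in>roots t. cnj (Lf s x) / of_real (F' s) * (eigv s k * z k))"
  proof (rule sum.cong)
    fix k assume k: "k \<in> idx"
    have "cnj (x k) = (\<Sum>s\<in>roots t. cnj (Lf s x) / of_real (F' s) * eigv s k)"
    proof -
      have "cnj (eigv s k) = eigv s k" for s by (simp add: eigv_def)
      then show ?thesis by (subst eigv_expansion[OF x k, of t]) simp
    qed
    then show "cnj (x k) * z k = (\<Sum>s\<in>roots t. cnj (Lf s x) / of_real (F' s) * (eigv s k * z k))"
      by (simp add: sum_distrib_right mult.assoc)
  qed simp
  also have "\<dots> = (\<Sum>s\<in>roots t. cnj (Lf s x) / of_real (F' s) * (\<Sum>k\<in>idx. eigv s k * z k))"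
    by (subst sum.swap) (simp add: sum_distrib_left)
  finally show ?thesis by (simp add: sum_idx eigv_def Lf_def)
qed

text \<open>In one fibre, the spectral measure of \<open>x\<close> has an atom at every nonconstant
  branch. Summing over branch numbers instead of roots gives terms that are functions of
  \<open>t\<close> and can be integrated over the torus.\<close>

lemma Hm_moments:
  assumes x: "sym_vec x"
  shows "(\<Sum>k\<in>idx. cnj (x k) * (Hm t ^^ r) x k) =
    of_real (\<Sum>n\<in>bands. ev n t ^ r * ((cmod (Lf (ev n t) x))\<^sup>2 / F' (ev n t)))"
proof -
  have L: "Lf s ((Hm t ^^ r) x) = of_real (s ^ r) * Lf s x" if "s \<in> roots t" for s
    by (induction r) (simp_all add: Lf_Hm[OF that])
  have "(\<Sum>k\<in>idx. cnj (x k) * (Hm t ^^ r) x k) = (\<Sum>s\<in>roots t. of_real (s ^ r * ((cmod (Lf s x))\<^sup>2 / F' s)))"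
    unfolding parseval[OF x, of _ t]
  proof (intro sum.cong refl)
    fix s assume s: "s \<in> roots t"
    have "cnj (Lf s x) * Lf s x = of_real ((cmod (Lf s x))\<^sup>2)"
      by (simp only: complex_norm_square mult.commute)
    then show "cnj (Lf s x) * Lf s ((Hm t ^^ r) x) / of_real (F' s) = of_real (s ^ r * ((cmod (Lf s x))\<^sup>2 / F' s))"
      by (simp add: L[OF s] mult.left_commute)
  qed
  also have "\<dots> = (\<Sum>n\<in>bands. of_real (ev n t ^ r * ((cmod (Lf (ev n t) x))\<^sup>2 / F' (ev n t))))"
    by (rule sum.reindex_bij_betw[OF bij_roots, symmetric])
  finally show ?thesis by simp
qed

end

section \<open>Square summable functions on the lattice\<close>

definition sqs :: "('a \<Rightarrow> complex) \<Rightarrow> bool" where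
  "sqs f \<longleftrightarrow> (\<lambda>x. (cmod (f x))\<^sup>2) summable_on UNIV"

lemma sqs_0: "sqs (\<lambda>_. 0)" by (simp add: sqs_def)

lemma sqs_add: assumes "sqs f" "sqs g" shows "sqs (\<lambda>x. f x + g x)"
  unfolding sqs_def
proof (rule summable_on_comparison_test)
  show "(\<lambda>x. 2 * (cmod (f x))\<^sup>2 + 2 * (cmod (g x))\<^sup>2) summable_on UNIV"
    using assms unfolding sqs_def by (intro summable_on_add summable_on_cmult_right)
  show "(cmod (f x + g x))\<^sup>2 \<le> 2 * (cmod (f x))\<^sup>2 + 2 * (cmod (g x))\<^sup>2" for x
  proof -
    have "(cmod (f x + g x))\<^sup>2 \<le> (cmod (f x) + cmod (g x))\<^sup>2" by (intro power_mono norm_triangle_ineq) simp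
    also have "\<dots> \<le> 2 * (cmod (f x))\<^sup>2 + 2 * (cmod (g x))\<^sup>2"
      using zero_le_power2[of "cmod (f x) - cmod (g x)"] by (simp add: power2_eq_square algebra_simps)
    finally show ?thesis .
  qed
qed simp

lemma sqs_cmult: "sqs f \<Longrightarrow> sqs (\<lambda>x. c * f x)"
  unfolding sqs_def by (simp add: norm_mult power_mult_distrib summable_on_cmult_right)

lemma sqs_comp: "bij h \<Longrightarrow> sqs f \<Longrightarrow> sqs (\<lambda>x. f (h x))"
  unfolding sqs_def using summable_on_reindex_bij_betw[of h UNIV UNIV "\<lambda>x. (cmod (f x))\<^sup>2"] by simp

lemma sqs_bound: "sqs f \<Longrightarrow> (\<And>x. cmod (g x) \<le> cmod (f x)) \<Longrightarrow> sqs g"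
  unfolding sqs_def by (rule summable_on_comparison_test) (auto intro: power_mono)

text \<open>As a type, the space can be an instance of \<open>real_inner\<close> and
  \<open>banach\<close>, which gives the Cauchy-Schwarz inequality and the contraction
  principle.\<close>

typedef 'a l2 = "{f :: 'a \<Rightarrow> complex. sqs f}" morphisms ap Abs_l2
  using sqs_0 by blast

setup_lifting type_definition_l2

lemma sqs_ap: "sqs (ap f)" using ap by auto

lemma ap_Abs: "sqs f \<Longrightarrow> ap (Abs_l2 f) = f" by (simp add: Abs_l2_inverse)

text \<open>The type classes provide real scalars only, hence a separate operation for complex
  ones.\<close>

lift_definition scl :: "complex \<Rightarrow> 'a l2 \<Rightarrow> 'a l2" is "\<lambda>c f x. c * f x" by (rule sqs_cmult)

lemma cin_summable: assumes "sqs f" "sqs g" shows "(\<lambda>x. cnj (f x) * g x) summable_on A"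
proof -
  have "(\<lambda>x. norm (cnj (f x) * g x)) summable_on UNIV"
  proof (rule summable_on_comparison_test)
    show "(\<lambda>x. (cmod (f x))\<^sup>2 + (cmod (g x))\<^sup>2) summable_on UNIV"
      using assms unfolding sqs_def by (intro summable_on_add)
    show "norm (cnj (f x) * g x) \<le> (cmod (f x))\<^sup>2 + (cmod (g x))\<^sup>2" for x
      using sum_squares_bound[of "cmod (f x)" "cmod (g x)"] mult_nonneg_nonneg[of "cmod (f x)" "cmod (g x)"]
      by (simp add: norm_mult del: mult_nonneg_nonneg zero_le_mult_iff)
  qed simp
  then have "(\<lambda>x. cnj (f x) * g x) summable_on UNIV" by (rule abs_summable_summable)
  then show ?thesis by (rule summable_on_subset) simp
qed

text \<open>The complex inner product, conjugate linear in the first argument. The class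
  \<open>real_inner\<close> sees its real part.\<close>

definition cin :: "'a l2 \<Rightarrow> 'a l2 \<Rightarrow> complex" where
  "cin f g = (\<Sum>\<^sub>\<infinity>x. cnj (ap f x) * ap g x)"

instantiation l2 :: (type) real_vector
begin

lift_definition zero_l2 :: "'a l2" is "\<lambda>_. 0" by (rule sqs_0)
lift_definition plus_l2 :: "'a l2 \<Rightarrow> 'a l2 \<Rightarrow> 'a l2" is "\<lambda>f g x. f x + g x" by (rule sqs_add)
lift_definition uminus_l2 :: "'a l2 \<Rightarrow> 'a l2" is "\<lambda>f x. - f x" using sqs_cmult[of _ "-1"] by simp
lift_definition minus_l2 :: "'a l2 \<Rightarrow> 'a l2 \<Rightarrow> 'a l2" is "\<lambda>f g x. f x - g x"
  using sqs_add sqs_cmult[of _ "-1"] by fastforce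
lift_definition scaleR_l2 :: "real \<Rightarrow> 'a l2 \<Rightarrow> 'a l2" is "\<lambda>r f x. of_real r * f x" by (rule sqs_cmult)
instance
proof
  fix f g h :: "'a l2" and a b :: real
  show "f + g + h = f + (g + h)" "f + g = g + f" "0 + f = f" "- f + f = 0" "f - g = f + - g"
    by (transfer; simp add: algebra_simps)+
  show "a *\<^sub>R (f + g) = a *\<^sub>R f + a *\<^sub>R g" "(a + b) *\<^sub>R f = a *\<^sub>R f + b *\<^sub>R f"
    "a *\<^sub>R b *\<^sub>R f = (a * b) *\<^sub>R f" "1 *\<^sub>R f = f"
    by (transfer; simp add: algebra_simps)+
qed

end

lemma ap_simps: "ap (f + g) x = ap f x + ap g x" "ap (f - g) x = ap f x - ap g x"
  "ap (- f) x = - ap f x" "ap 0 x = 0" "ap (scaleR r f) x = of_real r * ap f x" "ap (scl c f) x = c * ap f x"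
  by (transfer; simp)+

lemma cin_add: "cin (f + g) h = cin f h + cin g h"
  by (simp add: cin_def ap_simps ring_distribs infsum_add cin_summable sqs_ap)

lemma cin_cnj: "cnj (cin f g) = cin g f"
  by (simp add: cin_def infsum_cnj[symmetric] mult.commute del: infsum_cnj)

lemma cin_scl: "cin (scl c f) g = cnj c * cin f g"
  by (simp add: cin_def ap_simps mult.assoc infsum_cmult_right cin_summable[OF sqs_ap sqs_ap])

lemma cin_self: "cin f f = of_real (\<Sum>\<^sub>\<infinity>x. (cmod (ap f x))\<^sup>2)"
proof -
  have "cnj (ap f x) * ap f x = of_real ((cmod (ap f x))\<^sup>2)" for x
    by (simp only: complex_norm_square mult.commute)
  then show ?thesis using sqs_ap[of f] unfolding cin_def sqs_def
    by (simp only:) (metis has_sum_of_real infsumI summable_iff_has_sum_infsum)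
qed

instantiation l2 :: (type) real_inner
begin

definition inner_l2 :: "'a l2 \<Rightarrow> 'a l2 \<Rightarrow> real" where "inner_l2 f g = Re (cin f g)"
definition norm_l2 :: "'a l2 \<Rightarrow> real" where "norm_l2 f = sqrt (inner f f)"
definition sgn_l2 :: "'a l2 \<Rightarrow> 'a l2" where "sgn_l2 f = scaleR (inverse (norm f)) f"
definition dist_l2 :: "'a l2 \<Rightarrow> 'a l2 \<Rightarrow> real" where "dist_l2 f g = norm (f - g)"
definition uniformity_l2 :: "('a l2 \<times> 'a l2) filter" where
  "uniformity_l2 = (INF e\<in>{0<..}. principal {(x, y). dist x y < e})"
definition open_l2 :: "'a l2 set \<Rightarrow> bool" where
  "open_l2 U \<longleftrightarrow> (\<forall>x\<in>U. eventually (\<lambda>(x', y). x' = x \<longrightarrow> y \<in> U) uniformity)"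

instance
proof
  fix f g h :: "'a l2" and r :: real
  show "dist f g = norm (f - g)" by (rule dist_l2_def)
  show "sgn f = f /\<^sub>R norm f" by (simp add: sgn_l2_def)
  show "(uniformity :: ('a l2 \<times> 'a l2) filter) = (INF e\<in>{0<..}. principal {(x, y). dist x y < e})"
    by (rule uniformity_l2_def)
  show "open U \<longleftrightarrow> (\<forall>x\<in>U. eventually (\<lambda>(x', y). x' = x \<longrightarrow> y \<in> U) uniformity)" for U :: "'a l2 set"
    by (rule open_l2_def)
  show "inner f g = inner g f" using arg_cong[OF cin_cnj[of f g], of Re] by (simp add: inner_l2_def)
  show "inner (f + g) h = inner f h + inner g h" by (simp add: inner_l2_def cin_add)
  have "r *\<^sub>R f = scl (of_real r) f" by transfer simp
  then show "inner (r *\<^sub>R f) g = r * inner f g" by (simp add: inner_l2_def cin_scl)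
  show "0 \<le> inner f f" by (simp add: inner_l2_def cin_self infsum_nonneg)
  show "inner f f = 0 \<longleftrightarrow> f = 0"
  proof
    assume "inner f f = 0"
    then have "(\<Sum>\<^sub>\<infinity>x. (cmod (ap f x))\<^sup>2) = 0" by (simp add: inner_l2_def cin_self)
    then have "(cmod (ap f x))\<^sup>2 = 0" for x
      using nonneg_infsum_le_0D[of "\<lambda>x. (cmod (ap f x))\<^sup>2" UNIV x] sqs_ap[of f] by (simp add: sqs_def)
    then show "f = 0" by (simp add: ap_inject[symmetric] zero_l2.rep_eq fun_eq_iff)
  next
    assume "f = 0"
    then show "inner f f = 0" by (simp add: inner_l2_def cin_self ap_simps)
  qed
  show "norm f = sqrt (inner f f)" by (rule norm_l2_def)
qed

end

lemma norm_sq: "(norm f)\<^sup>2 = (\<Sum>\<^sub>\<infinity>x. (cmod (ap f x))\<^sup>2)" for f :: "'a l2"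
  by (simp add: power2_norm_eq_inner inner_l2_def cin_self)

lemma l2_eqI: "(\<And>x. ap f x = ap g x) \<Longrightarrow> f = g"
  by (simp add: ap_inject[symmetric] fun_eq_iff)

lemma ap_sum: "ap (\<Sum>i\<in>I. f i) x = (\<Sum>i\<in>I. ap (f i) x)"
  by (induction I rule: infinite_finite_induct) (auto simp: ap_simps)

lemma sum_le_norm: assumes "finite S" shows "(\<Sum>x\<in>S. (cmod (ap f x))\<^sup>2) \<le> (norm f)\<^sup>2"
  unfolding norm_sq using sqs_ap[of f] unfolding sqs_def
  by (intro finite_sum_le_infsum assms) auto

lemma norm_le: assumes "\<And>S. finite S \<Longrightarrow> (\<Sum>x\<in>S. (cmod (ap f x))\<^sup>2) \<le> K\<^sup>2" "K \<ge> 0" shows "norm f \<le> K"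
proof -
  have "(norm f)\<^sup>2 \<le> K\<^sup>2" unfolding norm_sq using sqs_ap[of f] assms(1) unfolding sqs_def
    by (intro infsum_le_finite_sums) auto
  then show ?thesis using assms(2) power2_le_imp_le by blast
qed

lemma ap_le_norm: "cmod (ap f x) \<le> norm f"
  using sum_le_norm[of "{x}" f] by (simp add: power2_le_iff_abs_le)

text \<open>Pointwise limits exist because evaluation is bounded. The Cauchy estimate for finite
  partial sums survives the limit and yields both square summability and convergence in
  norm.\<close>

instance l2 :: (type) banach
proof
  fix X :: "nat \<Rightarrow> 'a l2" assume X: "Cauchy X"
  have "Cauchy (\<lambda>n. ap (X n) x)" for x
  proof (rule metric_CauchyI)
    fix e :: real assume "e > 0"
    then obtain M where M: "\<forall>m\<ge>M. \<forall>n\<ge>M. dist (X m) (X n) < e" using X metric_CauchyD by blast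
    have "dist (ap (X m) x) (ap (X n) x) < e" if "m \<ge> M" "n \<ge> M" for m n
      using M that ap_le_norm[of "X m - X n" x] by (fastforce simp: dist_norm ap_simps)
    then show "\<exists>M. \<forall>m\<ge>M. \<forall>n\<ge>M. dist (ap (X m) x) (ap (X n) x) < e" by blast
  qed
  then have "\<exists>l. (\<lambda>n. ap (X n) x) \<longlonglongrightarrow> l" for x using Cauchy_convergent convergent_def by blast
  then obtain g where g: "\<And>x. (\<lambda>n. ap (X n) x) \<longlonglongrightarrow> g x" by metis
  have fin: "(\<Sum>x\<in>S. (cmod (g x - ap (X n) x))\<^sup>2) \<le> e\<^sup>2"
    if "finite S" "e > 0" "\<forall>m\<ge>M. \<forall>n\<ge>M. dist (X m) (X n) < e" "n \<ge> M" for S e M n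
  proof (rule tendsto_upperbound)
    show "(\<lambda>m. \<Sum>x\<in>S. (cmod (ap (X m) x - ap (X n) x))\<^sup>2) \<longlonglongrightarrow> (\<Sum>x\<in>S. (cmod (g x - ap (X n) x))\<^sup>2)"
      by (intro tendsto_intros g)
    show "\<forall>\<^sub>F m in sequentially. (\<Sum>x\<in>S. (cmod (ap (X m) x - ap (X n) x))\<^sup>2) \<le> e\<^sup>2"
      using eventually_ge_at_top[of M]
    proof eventually_elim
      case (elim m)
      have "(\<Sum>x\<in>S. (cmod (ap (X m - X n) x))\<^sup>2) \<le> (norm (X m - X n))\<^sup>2" by (rule sum_le_norm) fact
      also have "\<dots> \<le> e\<^sup>2" using that(3,4) elim by (intro power_mono) (auto simp: dist_norm less_imp_le)
      finally show ?case by (simp add: ap_simps)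
    qed
  qed simp
  obtain M where M: "\<forall>m\<ge>M. \<forall>n\<ge>M. dist (X m) (X n) < 1" using X metric_CauchyD[OF X, of 1] by auto
  have "sqs (\<lambda>x. g x - ap (X M) x)" unfolding sqs_def
  proof (rule nonneg_bdd_above_summable_on)
    show "bdd_above (sum (\<lambda>x. (cmod (g x - ap (X M) x))\<^sup>2) ` {F. F \<subseteq> UNIV \<and> finite F})"
      by (rule bdd_aboveI[of _ "1\<^sup>2"]) (use fin[OF _ _ M] in auto)
  qed simp
  then have "sqs (\<lambda>x. (g x - ap (X M) x) + ap (X M) x)" by (rule sqs_add[OF _ sqs_ap])
  then have sg: "sqs g" by simp
  have "X \<longlonglongrightarrow> Abs_l2 g"
  proof (rule metric_LIMSEQ_I)
    fix e :: real assume e: "e > 0"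
    then obtain M where M: "\<forall>m\<ge>M. \<forall>n\<ge>M. dist (X m) (X n) < e / 2" using X metric_CauchyD[OF X, of "e/2"] by auto
    have "dist (X n) (Abs_l2 g) < e" if "n \<ge> M" for n
    proof -
      have "norm (Abs_l2 g - X n) \<le> e / 2"
        using fin[OF _ _ M that] e by (intro norm_le) (auto simp: ap_simps ap_Abs[OF sg])
      then show ?thesis using e by (simp add: dist_norm norm_minus_commute)
    qed
    then show "\<exists>M. \<forall>n\<ge>M. dist (X n) (Abs_l2 g) < e" by blast
  qed
  then show "convergent X" by (auto simp: convergent_def)
qed

lemma norm_mono_l2: assumes "\<And>x. cmod (ap f x) \<le> cmod (ap g x)" shows "norm f \<le> norm g"
proof (rule norm_le)
  fix S :: "'a set" assume "finite S"
  then show "(\<Sum>x\<in>S. (cmod (ap f x))\<^sup>2) \<le> (norm g)\<^sup>2"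
    by (intro order_trans[OF sum_mono sum_le_norm] power_mono assms) auto
qed simp

lemma norm_scl: "norm (scl c f) = cmod c * norm f"
proof -
  have "(norm (scl c f))\<^sup>2 = (cmod c * norm f)\<^sup>2"
    unfolding power_mult_distrib norm_sq using sqs_ap[of f]
    by (simp add: ap_simps norm_mult power_mult_distrib infsum_cmult_right sqs_def)
  then show ?thesis by (simp add: power2_eq_iff_nonneg)
qed

lemma cin_add_right: "cin h (f + g) = cin h f + cin h g"
  using arg_cong[OF cin_add[of f g h], of cnj] by (simp add: cin_cnj)

lemma cin_diff: "cin (f - g) h = cin f h - cin g h"
  using cin_add[of "f - g" g h] by simp

lemma cin_diff_right: "cin h (f - g) = cin h f - cin h g"
  using cin_add_right[of h "f - g" g] by simp

lemma cin_scl_right: "cin g (scl c f) = c * cin g f"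
  using arg_cong[OF cin_scl[of c f g], of cnj] by (simp add: cin_cnj)

lemma cin_sum: "cin (\<Sum>i\<in>I. f i) h = (\<Sum>i\<in>I. cin (f i) h)"
  by (induction I rule: infinite_finite_induct) (auto simp: cin_add, simp_all add: cin_def ap_simps)

lemma cin_sum_right: "cin h (\<Sum>i\<in>I. f i) = (\<Sum>i\<in>I. cin h (f i))"
  by (induction I rule: infinite_finite_induct) (auto simp: cin_add_right, simp_all add: cin_def ap_simps)

lemma cin_eq_norm: "cin f f = of_real ((norm f)\<^sup>2)"
  by (simp only: cin_self norm_sq)

lemma cin_bound: "cmod (cin f g) \<le> norm f * norm g"
proof (cases "cin f g = 0")
  case False
  \<comment> \<open>A phase that makes the inner product equal to its modulus, so that the real
    Cauchy-Schwarz inequality applies.\<close>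
  define u where "u = cnj (cin f g) / of_real (cmod (cin f g))"
  have u1: "cmod u = 1" using False by (simp add: u_def norm_divide)
  have "cin f (scl u g) = of_real (cmod (cin f g))"
    using False by (simp add: cin_scl_right u_def complex_norm_square[symmetric] power2_eq_square mult.commute)
  then have "cmod (cin f g) = inner f (scl u g)" by (simp add: inner_l2_def)
  also have "\<dots> \<le> norm f * norm (scl u g)" by (rule norm_cauchy_schwarz)
  finally show ?thesis using u1 by (simp add: norm_scl)
qed simp

section \<open>Shifts, adjacency operator and Laplacian of the lattice\<close>

lift_definition shift :: "int ^ 'n \<Rightarrow> (int ^ 'n) l2 \<Rightarrow> (int ^ 'n) l2" is "\<lambda>s f x. f (x + s)"
  by (rule sqs_comp) (auto intro: bij_plus_right)

definition ax :: "'n::finite \<Rightarrow> int ^ 'n" where "ax i = axis i 1"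
definition adj :: "(int ^ 'n::finite) l2 \<Rightarrow> (int ^ 'n) l2" where
  "adj f = (\<Sum>i\<in>UNIV. shift (ax i) f + shift (- ax i) f)"
definition lap :: "(int ^ 'n::finite) l2 \<Rightarrow> (int ^ 'n) l2" where
  "lap f = scl (of_nat (2 * CARD('n))) f - adj f"

lemma ap_shift: "ap (shift s f) x = ap f (x + s)"
  by transfer simp

lemma ap_lap: "ap (lap f) m = of_nat (2 * CARD('n)) * ap f m - (\<Sum>i\<in>UNIV. ap f (m + ax i) + ap f (m - ax i))"
  for f :: "(int ^ 'n::finite) l2"
  by (simp add: lap_def adj_def ap_simps ap_sum ap_shift)

lemma norm_shift: "norm (shift s f) = norm f"
proof -
  have "bij (\<lambda>x::int^'a. x + s)" by (auto intro: bij_plus_right)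
  then have "(norm (shift s f))\<^sup>2 = (norm f)\<^sup>2"
    unfolding norm_sq ap_shift using infsum_reindex_bij_betw[of "\<lambda>x. x + s" UNIV UNIV "\<lambda>x. (cmod (ap f x))\<^sup>2"] by simp
  then show ?thesis by (simp add: power2_eq_iff_nonneg)
qed

lemma cin_shift: "cin (shift s f) g = cin f (shift (- s) g)"
proof -
  have "bij (\<lambda>x::int^'a. x + s)" by (auto intro: bij_plus_right)
  then show ?thesis
    unfolding cin_def ap_shift
    using infsum_reindex_bij_betw[of "\<lambda>x. x + s" UNIV UNIV "\<lambda>x. cnj (ap f x) * ap g (x - s)"] by simp
qed

lemma norm_adj: "norm (adj f) \<le> 2 * real CARD('n) * norm f" for f :: "(int ^ 'n::finite) l2"
proof -
  have "norm (adj f) \<le> (\<Sum>i\<in>(UNIV::'n set). norm f + norm f)" unfolding adj_def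
    by (intro order_trans[OF norm_sum] sum_mono) (metis norm_shift norm_triangle_ineq)
  then show ?thesis by simp
qed

lemma cin_adj: "cin (adj f) g = cin f (adj g)"
  unfolding adj_def cin_sum cin_sum_right by (simp add: cin_add cin_add_right cin_shift add.commute)

lemma cin_lap: "cin (lap f) g = cin f (lap g)"
  unfolding lap_def by (simp add: cin_diff cin_diff_right cin_adj cin_scl cin_scl_right)

lemma shift_lin: "shift s (f - g) = shift s f - shift s g" "shift s (f + g) = shift s f + shift s g"
   "shift s (scl c f) = scl c (shift s f)"
  by (rule l2_eqI; simp add: ap_simps ap_shift)+

lemma scl_lin: "scl c (f - g) = scl c f - scl c g" "scl c (f + g) = scl c f + scl c g"
  "scl c (scl b f) = scl (c * b) f" "scl c (\<Sum>i\<in>I. h i) = (\<Sum>i\<in>I. scl c (h i))"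
  "scl (a - b) f = scl a f - scl b f" "scl (a + b) f = scl a f + scl b f" "scl 1 f = f" "scl c 0 = 0"
  by (rule l2_eqI; simp add: ap_simps ap_sum algebra_simps sum_distrib_left)+

lemma adj_lin: "adj (f - g) = adj f - adj g" "adj (f + g) = adj f + adj g" "adj (scl c f) = scl c (adj f)"
  unfolding adj_def by (simp_all add: shift_lin scl_lin sum.distrib sum_subtractf)

lemma lap_lin: "lap (f - g) = lap f - lap g" "lap (f + g) = lap f + lap g" "lap (scl c f) = scl c (lap f)"
  unfolding lap_def by (simp_all add: adj_lin scl_lin mult.commute)

lemma norm_lap: "norm (lap f) \<le> 4 * real CARD('n) * norm f" for f :: "(int ^ 'n::finite) l2"
  using norm_triangle_ineq4[of "scl (of_nat (2 * CARD('n))) f" "adj f"] norm_adj[of f]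
  by (simp add: lap_def norm_scl norm_mult)

text \<open>As \<open>adj\<close> is symmetric, \<open>adj f\<close> and an imaginary multiple of
  \<open>f\<close> are orthogonal for the real inner product.\<close>

lemma adj_imag: "(norm (adj f + scl (\<i> * of_real y) f))\<^sup>2 = (norm (adj f))\<^sup>2 + y\<^sup>2 * (norm f)\<^sup>2"
proof -
  have "cin (adj f) f = cnj (cin (adj f) f)" by (simp add: cin_cnj cin_adj)
  then have im: "Im (cin (adj f) f) = 0" by (metis Reals_cnj_iff complex_is_Real_iff)
  have "inner (adj f) (scl (\<i> * of_real y) f) = 0" by (simp add: inner_l2_def cin_scl_right im)
  then have "(norm (adj f + scl (\<i> * of_real y) f))\<^sup>2 = (norm (adj f))\<^sup>2 + (norm (scl (\<i> * of_real y) f))\<^sup>2"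
    by (simp add: power2_norm_eq_inner inner_add_left inner_add_right inner_commute)
  then show ?thesis by (simp add: norm_scl norm_mult power_mult_distrib)
qed

text \<open>The disc of centre \<open>-\<i> y\<close> that contains the spectrum of the adjacency operator but not
  \<open>-u\<close> makes the resolvent equation a contraction.\<close>

lemma adj_resolvent:
  fixes g :: "(int ^ 'n::finite) l2"
  assumes u: "Im u \<noteq> 0 \<or> \<bar>Re u\<bar> > 2 * real CARD('n)"
  shows "\<exists>C\<ge>0. \<forall>g :: (int ^ 'n::finite) l2. (\<exists>f. adj f + scl u f = g) \<and>
    (\<forall>f. adj f + scl u f = g \<longrightarrow> norm f \<le> C * norm g)"
proof -
  define D where "D = 2 * real CARD('n)"
  \<comment> \<open>For nonreal \<open>u\<close>, the choice makes the cross term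
    \<open>- 2 * Im u * y\<close> in the square of \<open>cmod w\<close> equal to
    \<open>D\<^sup>2 + 1\<close>, so that this square exceeds \<open>D\<^sup>2 + y\<^sup>2\<close>,
    the squared bound for \<open>adj + \<i> * y\<close>. For real \<open>u\<close>, the assumption
    gives this already with \<open>y = 0\<close>.\<close>
  define y where "y = (if Im u = 0 then 0 else - (D\<^sup>2 + 1) / (2 * Im u))"
  define w where "w = u - \<i> * of_real y"
  have D0: "D \<ge> 0" by (simp add: D_def)
  have w2: "(cmod w)\<^sup>2 = (Re u)\<^sup>2 + (Im u - y)\<^sup>2" by (simp add: w_def cmod_power2)
  have lt: "D\<^sup>2 + y\<^sup>2 < (cmod w)\<^sup>2"
  proof (cases "Im u = 0")
    case True
    then have "D < \<bar>Re u\<bar>" using u by (simp add: D_def)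
    then have "D\<^sup>2 < (Re u)\<^sup>2" using D0 abs_le_square_iff[of "Re u" D] by (simp add: linorder_not_le[symmetric])
    then show ?thesis using True by (simp add: w2 y_def)
  next
    case False
    then have "- 2 * (Im u * y) = D\<^sup>2 + 1" by (simp add: y_def field_simps)
    then have "(Im u - y)\<^sup>2 = (Im u)\<^sup>2 + y\<^sup>2 + D\<^sup>2 + 1" by (simp add: power2_eq_square algebra_simps)
    then show ?thesis unfolding w2 by (simp add: add_nonneg_pos add_pos_nonneg)
  qed
  define q where "q = sqrt (D\<^sup>2 + y\<^sup>2) / cmod w"
  have w0: "cmod w > 0" using lt by (smt (verit) norm_ge_zero zero_le_power2 zero_power2)
  have q1: "q < 1" unfolding q_def using lt w0 real_less_lsqrt by (simp add: divide_less_eq real_sqrt_less_iff real_less_lsqrt)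
  have q0: "q \<ge> 0" by (simp add: q_def)
  have wne: "w \<noteq> 0" using w0 by auto
  define Z where "Z f = adj f + scl (\<i> * of_real y) f" for f :: "(int ^ 'n) l2"
  have Zn: "norm (Z f) \<le> q * cmod w * norm f" for f
  proof -
    have "(norm (Z f))\<^sup>2 \<le> D\<^sup>2 * (norm f)\<^sup>2 + y\<^sup>2 * (norm f)\<^sup>2" unfolding Z_def adj_imag
      using power_mono[OF norm_adj[of f] norm_ge_zero, of 2] by (simp add: D_def power_mult_distrib)
    also have "\<dots> = (q * cmod w * norm f)\<^sup>2" using w0 by (simp add: q_def power_mult_distrib distrib_right)
    finally show ?thesis using q0 by (auto intro: power2_le_imp_le)
  qed
  have Zd: "Z (f - h) = Z f - Z h" for f h by (simp add: Z_def adj_lin scl_lin)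
  have eqv: "adj f + scl u f = g \<longleftrightarrow> scl (1 / w) (g - Z f) = f" for f g :: "(int ^ 'n) l2"
  proof -
    have "adj f + scl u f = Z f + scl w f" unfolding Z_def w_def by (simp add: scl_lin)
    moreover have "scl (1/w) (scl w f) = f" "scl w (scl (1/w) (g - Z f)) = g - Z f" using wne by (simp_all add: scl_lin)
    ultimately show ?thesis by (metis add_diff_cancel_left' diff_add_cancel add.commute)
  qed
  define C where "C = 1 / (cmod w * (1 - q))"
  have C0: "C \<ge> 0" using w0 q1 by (simp add: C_def)
  have "(\<exists>f. adj f + scl u f = g) \<and> (\<forall>f. adj f + scl u f = g \<longrightarrow> norm f \<le> C * norm g)" for g :: "(int ^ 'n) l2"
  proof -
    have "\<exists>!f. scl (1 / w) (g - Z f) = f"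
    proof (rule banach_fix_type[OF q0 q1], intro allI)
      fix f h :: "(int ^ 'n) l2"
      have "scl (1/w) (g - Z f) - scl (1/w) (g - Z h) = scl (1/w) (Z (h - f))"
        by (simp add: scl_lin[symmetric] Zd)
      then show "dist (scl (1/w) (g - Z f)) (scl (1/w) (g - Z h)) \<le> q * dist f h"
        using Zn[of "h - f"] w0 by (simp add: dist_norm norm_scl norm_divide norm_minus_commute field_simps)
    qed
    then have ex: "\<exists>!f. adj f + scl u f = g" by (simp add: eqv)
    moreover have "norm f \<le> C * norm g" if "adj f + scl u f = g" for f
    proof -
      have "f = scl (1/w) (g - Z f)" using that eqv by metis
      then have "norm f = norm (g - Z f) / cmod w" by (metis norm_scl norm_divide norm_one mult.commute times_divide_eq_right mult_1_right)
      also have "\<dots> \<le> (norm g + q * cmod w * norm f) / cmod w"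
        using norm_triangle_ineq4[of g "Z f"] Zn[of f] w0 by (intro divide_right_mono) auto
      finally have "norm f * (1 - q) \<le> norm g / cmod w" using w0 by (simp add: field_simps)
      then show ?thesis unfolding C_def using q1 w0 by (simp add: field_simps)
    qed
    ultimately show ?thesis by blast
  qed
  then show ?thesis using C0 by blast
qed

text \<open>Since \<open>lap\<close> is \<open>2 d - adj\<close>, this is
  \<open>adj_resolvent\<close> with \<open>u = z - 2 d\<close> and the sign of \<open>g\<close>
  reversed.\<close>

lemma lap_resolvent:
  assumes z: "z \<notin> complex_of_real ` {0..4 * real CARD('n)}"
  shows "\<exists>C\<ge>0. \<forall>g :: (int ^ 'n::finite) l2. (\<exists>f. lap f - scl z f = g) \<and>
    (\<forall>f. lap f - scl z f = g \<longrightarrow> norm f \<le> C * norm g)"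
proof -
  define u where "u = z - of_nat (2 * CARD('n))"
  have "Im u \<noteq> 0 \<or> \<bar>Re u\<bar> > 2 * real CARD('n)"
  proof (rule ccontr)
    assume "\<not> ?thesis"
    then have "z = of_real (Re z)" "Re z \<in> {0..4 * real CARD('n)}"
      by (auto simp: u_def complex_eq_iff abs_le_iff)
    then show False using z by blast
  qed
  from adj_resolvent[OF this] obtain C where C: "C \<ge> 0"
    "\<And>g :: (int ^ 'n) l2. (\<exists>f. adj f + scl u f = g) \<and> (\<forall>f. adj f + scl u f = g \<longrightarrow> norm f \<le> C * norm g)" by blast
  have "lap f - scl z f = g \<longleftrightarrow> adj f + scl u f = - g" for f g :: "(int ^ 'n) l2"
  proof -
    have "adj f + scl u f = - (lap f - scl z f)" by (simp add: u_def lap_def scl_lin)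
    then show ?thesis by (metis minus_equation_iff)
  qed
  then show ?thesis using C(1) C(2)[of "- g" for g] by (intro exI[of _ C]) simp
qed

lemma summable_geo_int:
  fixes r :: real assumes "0 < r" "r < 1"
  shows "(\<lambda>k::int. r ^ nat \<bar>k\<bar>) summable_on UNIV"
proof -
  have g: "(\<lambda>n::nat. r ^ n) summable_on UNIV"
    using assms by (intro norm_summable_imp_summable_on) (simp add: summable_geometric)
  have 1: "(\<lambda>k::int. r ^ nat \<bar>k\<bar>) summable_on range int"
    by (subst summable_on_reindex) (use g in \<open>auto simp: o_def\<close>)
  have 2: "(\<lambda>k::int. r ^ nat \<bar>k\<bar>) summable_on range (\<lambda>n. - int n)"
    by (subst summable_on_reindex) (use g in \<open>auto simp: o_def inj_def\<close>)
  have "UNIV = range int \<union> range (\<lambda>n. - int n)"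
    by (metis (no_types, lifting) UNIV_eq_I Un_iff int_cases2 rangeI)
  then show ?thesis using summable_on_union[OF 1 2] by simp
qed

text \<open>A finite set of lattice points lies in a cube with finite side \<open>K\<close>, over
  which the sum of products factorises into one-dimensional sums.\<close>

lemma summable_prod_int:
  fixes h :: "int \<Rightarrow> real"
  assumes "h summable_on UNIV" "\<And>k. h k \<ge> 0"
  shows "(\<lambda>n :: int ^ 'n::finite. \<Prod>i\<in>UNIV. h (n $ i)) summable_on UNIV"
proof (rule nonneg_bdd_above_summable_on)
  show "0 \<le> (\<Prod>i\<in>UNIV. h (n $ i))" for n :: "int ^ 'n" by (intro prod_nonneg) (simp add: assms)
  show "bdd_above (sum (\<lambda>n :: int ^ 'n. \<Prod>i\<in>UNIV. h (n $ i)) ` {F. F \<subseteq> UNIV \<and> finite F})"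
  proof (rule bdd_aboveI)
    fix x assume "x \<in> sum (\<lambda>n :: int ^ 'n. \<Prod>i\<in>UNIV. h (n $ i)) ` {F. F \<subseteq> UNIV \<and> finite F}"
    then obtain S :: "(int ^ 'n) set" where S: "finite S" "x = (\<Sum>n\<in>S. \<Prod>i\<in>UNIV. h (n $ i))" by blast
    define K where "K = (\<Union>n\<in>S. range (\<lambda>i. n $ i))"
    have fK: "finite K" unfolding K_def using S by auto
    have "x = (\<Sum>g\<in>(\<lambda>n i. n $ i) ` S. \<Prod>i\<in>UNIV. h (g i))"
      unfolding S(2) by (subst sum.reindex) (auto simp: inj_on_def Finite_Cartesian_Product.vec_eq_iff fun_eq_iff)
    also have "\<dots> \<le> (\<Sum>g\<in>Pi\<^sub>E (UNIV :: 'n set) (\<lambda>_. K). \<Prod>i\<in>UNIV. h (g i))"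
    proof (rule Groups_Big.sum_mono2)
      show "finite ((UNIV :: 'n set) \<rightarrow>\<^sub>E K)" by (rule finite_PiE) (use fK in auto)
      show "(\<lambda>n i. n $ i) ` S \<subseteq> UNIV \<rightarrow>\<^sub>E K" by (auto simp: K_def)
    qed (simp add: prod_nonneg assms)
    also have "\<dots> = (\<Prod>i\<in>(UNIV::'n set). \<Sum>k\<in>K. h k)"
      by (rule prod_sum_PiE[symmetric]) (use fK in auto)
    also have "\<dots> \<le> (\<Prod>i\<in>(UNIV::'n set). infsum h UNIV)"
      using assms fK by (intro prod_mono conjI sum_nonneg finite_sum_le_infsum) auto
    finally show "x \<le> (\<Prod>i\<in>(UNIV::'n set). infsum h UNIV)" .
  qed
qed

lemma ax_nth: "ax i $ j = (if j = i then 1 else 0)"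
  by (simp add: ax_def axis_def)

text \<open>With ratio \<open>r = 1 / (1 + \<delta>)\<close>, the relative change is
  \<open>1 - r \<le> \<delta>\<close> for a step away from the origin and
  \<open>1 / r - 1 = \<delta>\<close> for a step towards it.\<close>

lemma geo_step:
  fixes \<delta> :: real and k :: int
  assumes "\<delta> > 0" "\<bar>e\<bar> = 1"
  shows "\<bar>(1 / (1 + \<delta>)) ^ nat \<bar>k + e\<bar> - (1 / (1 + \<delta>)) ^ nat \<bar>k\<bar>\<bar> \<le> \<delta> * (1 / (1 + \<delta>)) ^ nat \<bar>k\<bar>"
proof -
  define r where "r = 1 / (1 + \<delta>)"
  have r: "0 < r" "r < 1" "r * (1 + \<delta>) = 1" using assms by (auto simp: r_def)
  have "r * \<delta> \<le> \<delta>" using mult_right_mono[of r 1 \<delta>] r assms by simp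
  then have r': "1 - r \<le> \<delta>" using r(3) by (simp add: algebra_simps)
  have "nat \<bar>k + e\<bar> = Suc (nat \<bar>k\<bar>) \<or> nat \<bar>k\<bar> = Suc (nat \<bar>k + e\<bar>)" using assms(2) by linarith
  then have "\<bar>r ^ nat \<bar>k + e\<bar> - r ^ nat \<bar>k\<bar>\<bar> \<le> \<delta> * r ^ nat \<bar>k\<bar>"
  proof
    assume "nat \<bar>k + e\<bar> = Suc (nat \<bar>k\<bar>)"
    then have "\<bar>r ^ nat \<bar>k + e\<bar> - r ^ nat \<bar>k\<bar>\<bar> = (1 - r) * r ^ nat \<bar>k\<bar>"
      using r by (simp add: abs_if algebra_simps mult_less_cancel_right1)
    then show ?thesis using r r' by (simp add: mult_right_mono)
  next
    assume e: "nat \<bar>k\<bar> = Suc (nat \<bar>k + e\<bar>)"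
    define R where "R = r ^ nat \<bar>k + e\<bar>"
    have 1: "r ^ nat \<bar>k\<bar> = r * R" using e by (simp add: R_def)
    have R0: "R > 0" using r by (simp add: R_def)
    have 2: "\<bar>R - r * R\<bar> = (1 - r) * R" using r R0 by (simp add: abs_if algebra_simps)
    have "\<delta> * r = 1 - r" using r(3) by (simp add: algebra_simps)
    then have "\<bar>R - r * R\<bar> \<le> \<delta> * (r * R)" unfolding 2 by (simp only: mult.assoc[symmetric] order_refl)
    then show ?thesis unfolding 1 R_def .
  qed
  then show ?thesis by (simp add: r_def)
qed

text \<open>Exponentially damped plane waves are approximate eigenfunctions.\<close>

lemma lap_approx:
  assumes t: "0 \<le> t" "t \<le> 4 * real CARD('n)" and e: "e > 0"
  shows "\<exists>f :: (int ^ 'n::finite) l2. f \<noteq> 0 \<and> norm (lap f - scl (of_real t) f) \<le> e * norm f"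
proof -
  define d where "d = real CARD('n)"
  have d0: "d > 0" by (simp add: d_def)
  \<comment> \<open>On the diagonal of the torus the symbol is
    \<open>2 d - 2 d cos \<theta>\<close>, which already takes every value between 0 and
    \<open>4 d\<close>.\<close>
  define \<theta> where "\<theta> = arccos (1 - t / (2 * d))"
  have "-1 \<le> 1 - t / (2 * d)" "1 - t / (2 * d) \<le> 1" using t d0 by (auto simp: d_def field_simps)
  then have cos: "t = 2 * d - 2 * d * cos \<theta>" using d0 by (simp add: \<theta>_def cos_arccos field_simps)
  \<comment> \<open>Each of the \<open>2 d\<close> neighbours of a point contributes a relative
    error of at most \<open>\<delta>\<close>.\<close>
  define \<delta> where "\<delta> = e / (2 * d)"
  have \<delta>: "\<delta> > 0" using e d0 by (simp add: \<delta>_def)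
  define r where "r = 1 / (1 + \<delta>)"
  have r: "0 < r" "r < 1" using \<delta> by (auto simp: r_def)
  define w where "w n = (\<Prod>i\<in>UNIV. r ^ nat \<bar>n $ i\<bar>)" for n :: "int ^ 'n"
  define g where "g n = of_real (w n) * cis (\<theta> * of_int (\<Sum>i\<in>UNIV. n $ i))" for n
  have wpos: "w n > 0" for n using r by (auto simp: w_def intro: prod_pos)
  have ng: "cmod (g n) = w n" for n using wpos[of n] by (simp add: g_def norm_mult)
  have "(\<lambda>n :: int ^ 'n. \<Prod>i\<in>UNIV. (r\<^sup>2) ^ nat \<bar>n $ i\<bar>) summable_on UNIV"
    using r by (intro summable_prod_int summable_geo_int) (auto simp: power_less_one_iff)
  moreover have "(\<Prod>i\<in>UNIV. (r\<^sup>2) ^ nat \<bar>n $ i\<bar>) = (cmod (g n))\<^sup>2" for n :: "int ^ 'n"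
    by (simp add: ng w_def prod_power_distrib power_mult[symmetric] mult.commute)
  ultimately have sq: "sqs g" by (simp add: sqs_def)
  define f where "f = Abs_l2 g"
  have apf: "ap f = g" using sq by (simp add: f_def ap_Abs)
  \<comment> \<open>The phase of the plane wave is transported exactly, so only the change of the
    damping factor remains.\<close>
  have step: "cmod (g (n + k) - cis (\<theta> * of_int s) * g n) \<le> \<delta> * w n"
    if k: "k $ i = s" "\<And>j. j \<noteq> i \<Longrightarrow> k $ j = 0" and s: "\<bar>s\<bar> = 1" for n k i s
  proof -
    define W where "W = (\<Prod>j\<in>UNIV - {i}. r ^ nat \<bar>n $ j\<bar>)"
    have W0: "W > 0" using r by (auto simp: W_def intro: prod_pos)
    have w1: "w n = r ^ nat \<bar>n $ i\<bar> * W" by (simp add: w_def W_def prod.remove[of UNIV i])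
    have "(\<Prod>j\<in>UNIV - {i}. r ^ nat \<bar>(n + k) $ j\<bar>) = W" unfolding W_def by (intro prod.cong) (auto simp: k)
    then have w2: "w (n + k) = r ^ nat \<bar>n $ i + s\<bar> * W"
      by (simp add: w_def prod.remove[of UNIV i] k(1))
    have "(\<Sum>j\<in>UNIV. k $ j) = s" using k by (subst sum.remove[of UNIV i]) auto
    then have "(\<Sum>j\<in>UNIV. (n + k) $ j) = s + (\<Sum>j\<in>UNIV. n $ j)" by (simp add: sum.distrib)
    then have "g (n + k) = of_real (w (n + k)) * (cis (\<theta> * of_int s) * cis (\<theta> * of_int (\<Sum>i\<in>UNIV. n $ i)))"
      by (simp only: g_def cis_mult) (simp add: distrib_left)
    then have "g (n + k) - cis (\<theta> * of_int s) * g n =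
        of_real (w (n + k) - w n) * (cis (\<theta> * of_int s) * cis (\<theta> * of_int (\<Sum>i\<in>UNIV. n $ i)))"
      by (simp add: g_def algebra_simps)
    then have "cmod (g (n + k) - cis (\<theta> * of_int s) * g n) = \<bar>w (n + k) - w n\<bar>"
      by (simp add: norm_mult del: of_real_diff)
    also have "\<dots> = \<bar>r ^ nat \<bar>n $ i + s\<bar> - r ^ nat \<bar>n $ i\<bar>\<bar> * W"
      using W0 by (simp add: w1 w2 left_diff_distrib[symmetric] abs_mult)
    also have "\<dots> \<le> (\<delta> * r ^ nat \<bar>n $ i\<bar>) * W"
      unfolding r_def using \<delta> s W0 by (intro mult_right_mono geo_step) auto
    finally show ?thesis by (simp add: w1)
  qed
  have pt: "cmod (ap (lap f - scl (of_real t) f) n) \<le> cmod (ap (scl (of_real e) f) n)" for n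
  proof -
    have c2: "cis \<theta> + cis (- \<theta>) = of_real (2 * cos \<theta>)" by (simp add: complex_eq_iff)
    have "ap (lap f - scl (of_real t) f) n =
       - (\<Sum>i\<in>UNIV. (g (n + ax i) - cis (\<theta> * of_int 1) * g n) + (g (n - ax i) - cis (\<theta> * of_int (-1)) * g n))"
    proof -
      have "(\<Sum>i\<in>(UNIV::'n set). (cis \<theta> * g n + cis (- \<theta>) * g n)) = of_real (2 * d * cos \<theta>) * g n"
        by (simp only: distrib_right[symmetric] c2) (simp add: d_def)
      then show ?thesis
        by (simp add: ap_simps ap_lap apf sum.distrib sum_subtractf cos d_def algebra_simps)
    qed
    also have "cmod \<dots> \<le> (\<Sum>i\<in>(UNIV::'n set). \<delta> * w n + \<delta> * w n)"
      unfolding norm_minus_cancel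
    proof (rule sum_norm_le, rule order_trans[OF norm_triangle_ineq add_mono])
      fix i :: 'n
      show "cmod (g (n + ax i) - cis (\<theta> * of_int 1) * g n) \<le> \<delta> * w n"
        by (rule step[of _ i]) (auto simp: ax_nth)
      show "cmod (g (n - ax i) - cis (\<theta> * of_int (-1)) * g n) \<le> \<delta> * w n"
        using step[of "- ax i" i "-1" n] by (auto simp: ax_nth)
    qed
    also have "\<dots> = e * w n" using d0 by (simp add: \<delta>_def d_def[symmetric] field_simps)
    also have "\<dots> = cmod (ap (scl (of_real e) f) n)" using e by (simp add: ap_simps apf norm_mult ng)
    finally show ?thesis .
  qed
  have "norm (lap f - scl (of_real t) f) \<le> norm (scl (of_real e) f)"
    by (rule norm_mono_l2[OF pt])
  then have "norm (lap f - scl (of_real t) f) \<le> e * norm f" using e by (simp add: norm_scl)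
  moreover have "f \<noteq> 0"
  proof
    assume "f = 0"
    then have "g 0 = 0" using apf ap_simps(4)[of 0] by metis
    then show False using wpos[of 0] ng[of 0] by simp
  qed
  ultimately show ?thesis by blast
qed

lift_definition cut :: "'a set \<Rightarrow> 'a l2 \<Rightarrow> 'a l2" is "\<lambda>S f x. if x \<in> S then f x else 0"
  by (erule sqs_bound) auto

lemma ap_cut: "ap (cut S f) x = (if x \<in> S then ap f x else 0)"
  by transfer simp

lemma cut_approx: assumes "e > 0" shows "\<exists>S. finite S \<and> norm (f - cut S f) \<le> e"
proof -
  have "((\<lambda>x. (cmod (ap f x))\<^sup>2) has_sum (norm f)\<^sup>2) UNIV"
    unfolding norm_sq using sqs_ap[of f] by (simp add: sqs_def)
  then have "(sum (\<lambda>x. (cmod (ap f x))\<^sup>2) \<longlongrightarrow> (norm f)\<^sup>2) (finite_subsets_at_top UNIV)"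
    by (simp add: has_sum_def)
  then have "\<forall>\<^sub>F S in finite_subsets_at_top UNIV. sum (\<lambda>x. (cmod (ap f x))\<^sup>2) S > (norm f)\<^sup>2 - e\<^sup>2"
    using assms by (intro order_tendstoD) auto
  then obtain S where S: "finite S" "sum (\<lambda>x. (cmod (ap f x))\<^sup>2) S > (norm f)\<^sup>2 - e\<^sup>2"
    unfolding eventually_finite_subsets_at_top by blast
  have "norm (f - cut S f) \<le> e"
  proof (rule norm_le)
    fix A :: "'a set" assume A: "finite A"
    have "(\<Sum>x\<in>A. (cmod (ap (f - cut S f) x))\<^sup>2) = (\<Sum>x\<in>A - S. (cmod (ap f x))\<^sup>2)"
      by (rule sum.mono_neutral_cong_right) (auto simp: A ap_simps ap_cut)
    also have "\<dots> = (\<Sum>x\<in>(A - S) \<union> S. (cmod (ap f x))\<^sup>2) - (\<Sum>x\<in>S. (cmod (ap f x))\<^sup>2)"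
      using A S by (subst sum.union_disjoint) auto
    also have "\<dots> \<le> e\<^sup>2" using sum_le_norm[of "(A - S) \<union> S" f] A S by simp
    finally show "(\<Sum>x\<in>A. (cmod (ap (f - cut S f) x))\<^sup>2) \<le> e\<^sup>2" .
  qed (use assms in simp)
  then show ?thesis using S by blast
qed

section \<open>The Fourier transform\<close>

definition unif :: "real measure" where
  "unif = density lborel (\<lambda>x. ennreal (indicator {0..2*pi} x / (2 * pi)))"
text \<open>Product measures live on functions, so quasimomenta are functions here and vectors in
  the Floquet matrices.\<close>

definition tor :: "('n::finite \<Rightarrow> real) measure" where
  "tor = Pi\<^sub>M UNIV (\<lambda>_. unif)"

lemma sets_unif [measurable_cong, simp]: "sets unif = sets borel" "space unif = UNIV"
  by (simp_all add: unif_def)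

lemma measurable_unif [simp]: "measurable unif M = measurable borel M"
  by (rule measurable_cong_sets) simp_all

lemma prob_space_unif: "prob_space unif"
proof (rule prob_spaceI)
  have "emeasure unif (space unif) = (\<integral>\<^sup>+x. ennreal (1 / (2 * pi)) * indicator {0..2*pi} x \<partial>lborel)"
    unfolding unif_def by (subst emeasure_density) (auto intro!: nn_integral_cong split: split_indicator)
  also have "\<dots> = ennreal (1 / (2 * pi)) * ennreal (2 * pi)"
    by (subst nn_integral_cmult_indicator) auto
  finally show "emeasure unif (space unif) = 1" by (simp add: ennreal_mult[symmetric])
qed

interpretation unif: prob_space unif by (rule prob_space_unif)
interpretation pu: product_sigma_finite "\<lambda>_ :: 'n::finite. unif"
  by standard

lemma prob_space_tor: "prob_space (tor :: ('n::finite \<Rightarrow> real) measure)"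
  unfolding tor_def by (intro prob_space_PiM prob_space_unif)

interpretation tor: prob_space "tor :: ('n::finite \<Rightarrow> real) measure" by (rule prob_space_tor)

lemma AE_unif: "(AE x in lborel. x \<in> {0..2*pi} \<longrightarrow> Q x) \<Longrightarrow> AE x in unif. Q x"
  unfolding unif_def by (subst AE_density) (auto split: split_indicator)

lemma integral_cis_unif: "(\<integral>x. cis (of_int k * x) \<partial>unif) = (if k = 0 then 1 else 0)"
proof (cases "k = 0")
  case True
  then show ?thesis using unif.prob_space by simp
next
  case False
  define G where "G x = cis (of_int k * x) / (\<i> * of_int k)" for x :: real
  have "(G has_vector_derivative cis (of_int k * x)) (at x within {0..2*pi})" for x
  proof -
    have "((\<lambda>z. exp (\<i> * of_int k * z) / (\<i> * of_int k)) has_field_derivative exp (\<i> * of_int k * of_real x)) (at (of_real x))"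
      using False by (auto intro!: derivative_eq_intros)
    from has_vector_derivative_real_field[OF this] show ?thesis
      by (simp add: G_def[abs_def] cis_conv_exp mult.assoc)
  qed
  then have "has_bochner_integral lborel (\<lambda>x. indicator {0..2*pi} x *\<^sub>R cis (of_int k * x)) (G (2*pi) - G 0)"
    by (intro has_bochner_integral_FTC_Icc) (auto intro!: continuous_intros)
  moreover have "G (2*pi) - G 0 = 0"
  proof -
    have "cis (of_int k * (2 * pi)) = cis (2 * pi * of_int k)" by (simp add: mult.commute)
    then show ?thesis by (simp add: G_def cis_multiple_2pi)
  qed
  ultimately have z: "(\<integral>x. indicator {0..2*pi} x *\<^sub>R cis (of_int k * x) \<partial>lborel) = 0"
    by (simp only: has_bochner_integral_integral_eq)
  have "(\<integral>x. cis (of_int k * x) \<partial>unif) = (\<integral>x. (1 / (2*pi)) *\<^sub>R (indicator {0..2*pi} x *\<^sub>R cis (of_int k * x)) \<partial>lborel)"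
  proof -
    have [measurable]: "(\<lambda>x. cis (of_int k * x)) \<in> borel_measurable borel"
      by (intro borel_measurable_continuous_onI continuous_intros)
    have "(\<integral>x. cis (of_int k * x) \<partial>unif) = (\<integral>x. (indicator {0..2*pi} x / (2*pi)) *\<^sub>R cis (of_int k * x) \<partial>lborel)"
      unfolding unif_def by (rule integral_density) auto
    then show ?thesis by simp
  qed
  also have "\<dots> = 0" by (simp only: integral_scaleR_right z scaleR_zero_right)
  finally show ?thesis using False by simp
qed

text \<open>The character of frequency \<open>n\<close>, as a product over the coordinates, so that
  its integral against the product measure factorises.\<close>

definition ex :: "int ^ 'n::finite \<Rightarrow> ('n \<Rightarrow> real) \<Rightarrow> complex" where
  "ex n \<omega> = (\<Prod>i\<in>UNIV. cis (of_int (n $ i) * \<omega> i))"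

lemma measurable_coord [measurable]: "(\<lambda>\<omega>. \<omega> i) \<in> borel_measurable (tor :: ('n::finite \<Rightarrow> real) measure)"
proof -
  have "(\<lambda>\<omega>. \<omega> i) \<in> measurable (tor :: ('n \<Rightarrow> real) measure) unif"
    unfolding tor_def by (rule measurable_component_singleton) simp
  then show ?thesis by (simp cong: measurable_cong_sets)
qed

lemma measurable_cis [measurable]: "cis \<in> borel_measurable borel"
  by (intro borel_measurable_continuous_onI continuous_intros)

lemma measurable_ex [measurable]: "ex n \<in> borel_measurable tor"
  unfolding ex_def by measurable

lemma cmod_ex [simp]: "cmod (ex n \<omega>) = 1"
  by (simp add: ex_def prod_norm[symmetric])

lemma ex_add: "ex (m + n) \<omega> = ex m \<omega> * ex n \<omega>"
  by (simp add: ex_def prod.distrib[symmetric] cis_mult algebra_simps)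

lemma cnj_ex: "cnj (ex n \<omega>) = ex (- n) \<omega>"
  by (simp add: ex_def cis_cnj)

lemma integral_ex: "(\<integral>\<omega>. ex n \<omega> \<partial>tor) = (if n = 0 then 1 else 0)"
proof -
  have "(\<integral>\<omega>. ex n \<omega> \<partial>tor) = (\<Prod>i\<in>UNIV. \<integral>x. cis (of_int (n $ i) * x) \<partial>unif)"
    unfolding ex_def tor_def
    by (rule pu.product_integral_prod) (auto intro!: unif.integrable_const_bound[of _ 1])
  also have "\<dots> = (if n = 0 then 1 else 0)"
    by (auto simp: integral_cis_unif Finite_Cartesian_Product.vec_eq_iff)
  finally show ?thesis .
qed

definition symb :: "('n::finite \<Rightarrow> real) \<Rightarrow> real" where
  "symb \<omega> = 2 * real CARD('n) - 2 * (\<Sum>i\<in>UNIV. cos (\<omega> i))"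

lemma symb_bounds: "0 \<le> symb \<omega>" "symb \<omega> \<le> 4 * real CARD('n)" for \<omega> :: "'n::finite \<Rightarrow> real"
proof -
  have "(\<Sum>i\<in>(UNIV::'n set). cos (\<omega> i)) \<le> (\<Sum>i\<in>(UNIV::'n set). 1)" by (intro sum_mono) simp
  moreover have "(\<Sum>i\<in>(UNIV::'n set). cos (\<omega> i)) \<ge> (\<Sum>i\<in>(UNIV::'n set). - 1)" by (intro sum_mono) simp
  ultimately show "0 \<le> symb \<omega>" "symb \<omega> \<le> 4 * real CARD('n)" by (auto simp: symb_def)
qed

lemma measurable_symb [measurable]: "symb \<in> borel_measurable (tor :: ('n::finite \<Rightarrow> real) measure)"
  unfolding symb_def by measurable

lemma symb_ex: "complex_of_real (symb \<omega>) = of_nat (2 * CARD('n)) - (\<Sum>i\<in>UNIV. ex (ax i) \<omega> + ex (- ax i) \<omega>)"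
  for \<omega> :: "'n::finite \<Rightarrow> real"
proof -
  have "ex (ax i) \<omega> = cis (\<omega> i)" for i
    unfolding ex_def by (subst prod.remove[of UNIV i]) (auto simp: ax_nth)
  moreover have "ex (- ax i) \<omega> = cis (- \<omega> i)" for i
    unfolding ex_def by (subst prod.remove[of UNIV i]) (auto simp: ax_nth)
  moreover have "cis x + cis (- x) = of_real (2 * cos x)" for x by (simp add: complex_eq_iff)
  ultimately have "ex (ax i) \<omega> + ex (- ax i) \<omega> = of_real (2 * cos (\<omega> i))" for i by (simp del: of_real_mult)
  then show ?thesis by (simp add: symb_def sum_distrib_left)
qed

text \<open>The squared L2 norm as a nonnegative integral, meaningful before integrability is
  known.\<close>

definition N :: "(('n::finite \<Rightarrow> real) \<Rightarrow> complex) \<Rightarrow> ennreal" where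
  "N F = (\<integral>\<^sup>+\<omega>. ennreal ((cmod (F \<omega>))\<^sup>2) \<partial>tor)"

section \<open>Fourier transforms of finitely supported functions and their limits\<close>

definition supp :: "'a l2 \<Rightarrow> 'a set" where "supp f = {x. ap f x \<noteq> 0}"
definition trig_poly :: "(int ^ 'n::finite) l2 \<Rightarrow> ('n \<Rightarrow> real) \<Rightarrow> complex" where
  "trig_poly f \<omega> = (\<Sum>n\<in>supp f. ap f n * ex n \<omega>)"

lemma trig_poly_superset: "finite S \<Longrightarrow> supp f \<subseteq> S \<Longrightarrow> trig_poly f \<omega> = (\<Sum>n\<in>S. ap f n * ex n \<omega>)"
  unfolding trig_poly_def by (rule sum.mono_neutral_left) (auto simp: supp_def)

lemma measurable_trig_poly [measurable]: "trig_poly f \<in> borel_measurable tor"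
  unfolding trig_poly_def by measurable

text \<open>Plancherel's identity: after expanding the square, orthogonality of the characters
  leaves the diagonal terms.\<close>

lemma N_trig_poly: assumes f: "finite (supp f)" shows "N (trig_poly f) = ennreal ((norm f)\<^sup>2)"
proof -
  have sq: "complex_of_real ((cmod (trig_poly f \<omega>))\<^sup>2) = (\<Sum>m\<in>supp f. \<Sum>n\<in>supp f. (ap f m * cnj (ap f n)) * ex (m - n) \<omega>)" for \<omega>
  proof -
    have "ap f m * ex m \<omega> * (cnj (ap f n) * cnj (ex n \<omega>)) = (ap f m * cnj (ap f n)) * ex (m - n) \<omega>" for m n
      using ex_add[of m "- n" \<omega>] by (simp add: cnj_ex mult_ac)
    then show ?thesis by (simp only: complex_norm_square trig_poly_def cnj_sum complex_cnj_mult sum_product)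
  qed
  have int: "integrable tor (\<lambda>\<omega>. (cmod (trig_poly f \<omega>))\<^sup>2)"
  proof (rule tor.integrable_const_bound)
    show "AE \<omega> in tor. norm ((cmod (trig_poly f \<omega>))\<^sup>2) \<le> (\<Sum>n\<in>supp f. cmod (ap f n))\<^sup>2"
    proof (rule AE_I2)
      fix \<omega>
      have "cmod (trig_poly f \<omega>) \<le> (\<Sum>n\<in>supp f. cmod (ap f n))"
        unfolding trig_poly_def by (rule sum_norm_le) (simp add: norm_mult)
      then show "norm ((cmod (trig_poly f \<omega>))\<^sup>2) \<le> (\<Sum>n\<in>supp f. cmod (ap f n))\<^sup>2" by (simp add: power_mono)
    qed
  qed simp
  have ie: "integrable tor (\<lambda>\<omega>. c * ex n \<omega>)" for c and n :: "int ^ 'a"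
    by (rule tor.integrable_const_bound[of _ "cmod c"]) (auto simp: norm_mult)
  have "complex_of_real (\<integral>\<omega>. (cmod (trig_poly f \<omega>))\<^sup>2 \<partial>tor) = (\<integral>\<omega>. complex_of_real ((cmod (trig_poly f \<omega>))\<^sup>2) \<partial>tor)"
    by (rule integral_complex_of_real[symmetric])
  also have "\<dots> = (\<Sum>m\<in>supp f. \<Sum>n\<in>supp f. (ap f m * cnj (ap f n)) * (\<integral>\<omega>. ex (m - n) \<omega> \<partial>tor))"
    unfolding sq by (simp add: Bochner_Integration.integral_sum Bochner_Integration.integrable_sum ie)
  also have "\<dots> = (\<Sum>m\<in>supp f. ap f m * cnj (ap f m))"
    using f by (simp add: integral_ex if_distrib cong: if_cong)
  also have "\<dots> = of_real (\<Sum>m\<in>supp f. (cmod (ap f m))\<^sup>2)"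
    by (simp only: complex_norm_square of_real_sum)
  finally have "(\<integral>\<omega>. (cmod (trig_poly f \<omega>))\<^sup>2 \<partial>tor) = (\<Sum>m\<in>supp f. (cmod (ap f m))\<^sup>2)"
    by (simp only: of_real_eq_iff)
  also have "\<dots> = (norm f)\<^sup>2"
    unfolding norm_sq infsum_finite[OF f, symmetric]
    by (rule infsum_cong_neutral) (auto simp: supp_def)
  finally have "(\<integral>\<omega>. (cmod (trig_poly f \<omega>))\<^sup>2 \<partial>tor) = (norm f)\<^sup>2" .
  then show ?thesis unfolding N_def using int by (subst nn_integral_eq_integral) auto
qed

lemma supp_lin: "supp (f + g) \<subseteq> supp f \<union> supp g" "supp (f - g) \<subseteq> supp f \<union> supp g" "supp (scl c f) \<subseteq> supp f"
  by (auto simp: supp_def ap_simps)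

lemma trig_poly_lin: assumes "finite (supp f)" "finite (supp g)"
  shows "trig_poly (f + g) \<omega> = trig_poly f \<omega> + trig_poly g \<omega>" "trig_poly (f - g) \<omega> = trig_poly f \<omega> - trig_poly g \<omega>" "trig_poly (scl c f) \<omega> = c * trig_poly f \<omega>"
proof -
  let ?S = "supp f \<union> supp g"
  have S: "finite ?S" using assms by simp
  have t: "trig_poly f \<omega> = (\<Sum>n\<in>?S. ap f n * ex n \<omega>)" "trig_poly g \<omega> = (\<Sum>n\<in>?S. ap g n * ex n \<omega>)"
    by (rule trig_poly_superset[OF S]; blast)+
  show "trig_poly (f + g) \<omega> = trig_poly f \<omega> + trig_poly g \<omega>" unfolding t
    by (subst trig_poly_superset[OF S supp_lin(1)]) (simp add: ap_simps distrib_right sum.distrib)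
  show "trig_poly (f - g) \<omega> = trig_poly f \<omega> - trig_poly g \<omega>" unfolding t
    by (subst trig_poly_superset[OF S supp_lin(2)]) (simp add: ap_simps left_diff_distrib sum_subtractf)
  show "trig_poly (scl c f) \<omega> = c * trig_poly f \<omega>"
    by (subst trig_poly_superset[OF assms(1) supp_lin(3)]) (simp add: trig_poly_def ap_simps sum_distrib_left mult.assoc)
qed

lemma supp_shift: "supp (shift s f) = (\<lambda>n. n - s) ` supp f"
  unfolding supp_def ap_shift by (force simp: image_iff)

lemma trig_poly_shift: "trig_poly (shift s f) \<omega> = ex (- s) \<omega> * trig_poly f \<omega>"
  unfolding trig_poly_def supp_shift sum_distrib_left
  by (subst sum.reindex) (auto simp: ap_shift inj_on_def ex_add[of _ "- s", simplified] mult_ac intro!: sum.cong)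

lemma trig_poly_sum: assumes "\<And>i. i \<in> I \<Longrightarrow> finite (supp (f i))"
  shows "finite (supp (\<Sum>i\<in>I. f i)) \<and> trig_poly (\<Sum>i\<in>I. f i) \<omega> = (\<Sum>i\<in>I. trig_poly (f i) \<omega>)"
  using assms
proof (induction I rule: infinite_finite_induct)
  case (insert i I)
  have "finite (supp (f i))" "finite (supp (\<Sum>i\<in>I. f i))" using insert by auto
  then have "finite (supp (f i + (\<Sum>i\<in>I. f i)))" "trig_poly (f i + (\<Sum>i\<in>I. f i)) \<omega> = trig_poly (f i) \<omega> + trig_poly (\<Sum>i\<in>I. f i) \<omega>"
    using supp_lin(1)[of "f i"] by (auto simp: trig_poly_lin intro: finite_subset)
  then show ?case using insert by simp
qed (simp_all add: supp_def trig_poly_def ap_simps)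

lemma trig_poly_lap: assumes f: "finite (supp f)"
  shows "finite (supp (lap f))" "trig_poly (lap f) \<omega> = of_real (symb \<omega>) * trig_poly f \<omega>"
proof -
  have s: "finite (supp (shift s f))" for s using f by (simp add: supp_shift)
  have s2: "finite (supp (shift (ax i) f + shift (- ax i) f))" for i
    by (rule finite_subset[OF supp_lin(1)]) (use s in blast)
  have a: "finite (supp (adj f))" "trig_poly (adj f) \<omega> = (\<Sum>i\<in>UNIV. (ex (ax i) \<omega> + ex (- ax i) \<omega>)) * trig_poly f \<omega>"
    unfolding adj_def using trig_poly_sum[of UNIV "\<lambda>i. shift (ax i) f + shift (- ax i) f" \<omega>] s2
    by (simp_all add: trig_poly_lin s trig_poly_shift sum_distrib_right distrib_right add.commute)
  have c: "finite (supp (scl z f))" for z by (rule finite_subset[OF supp_lin(3) f])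
  show "finite (supp (lap f))" unfolding lap_def
    by (rule finite_subset[OF supp_lin(2)]) (use a(1) c in blast)
  show "trig_poly (lap f) \<omega> = of_real (symb \<omega>) * trig_poly f \<omega>"
    unfolding lap_def symb_ex using a c f by (simp add: trig_poly_lin left_diff_distrib)
qed

text \<open>Young's inequality
  \<open>2 * a * b \<le> \<delta> * a\<^sup>2 + b\<^sup>2 / \<delta>\<close>. It replaces the
  triangle inequality; a small \<open>\<delta>\<close> brings the factor of the main term close to
  1.\<close>

lemma N_add: assumes [measurable]: "F \<in> borel_measurable tor" "G \<in> borel_measurable tor"
  and d: "\<delta> > 0"
  shows "N (\<lambda>\<omega>. F \<omega> + G \<omega>) \<le> ennreal (1 + \<delta>) * N F + ennreal (1 + 1/\<delta>) * N G"
proof -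
  have "(cmod (F \<omega> + G \<omega>))\<^sup>2 \<le> (1 + \<delta>) * (cmod (F \<omega>))\<^sup>2 + (1 + 1/\<delta>) * (cmod (G \<omega>))\<^sup>2" for \<omega>
  proof -
    let ?a = "cmod (F \<omega>)" and ?b = "cmod (G \<omega>)"
    have "0 \<le> (\<delta> * ?a - ?b)\<^sup>2 / \<delta>" using d by simp
    also have "\<dots> = \<delta> * ?a\<^sup>2 + ?b\<^sup>2 / \<delta> - 2 * ?a * ?b" using d by (simp add: power2_eq_square field_simps)
    finally have "(?a + ?b)\<^sup>2 \<le> (1 + \<delta>) * ?a\<^sup>2 + (1 + 1/\<delta>) * ?b\<^sup>2"
      by (simp add: power2_eq_square algebra_simps)
    moreover have "(cmod (F \<omega> + G \<omega>))\<^sup>2 \<le> (?a + ?b)\<^sup>2" by (intro power_mono norm_triangle_ineq norm_ge_zero)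
    ultimately show ?thesis by linarith
  qed
  then have "N (\<lambda>\<omega>. F \<omega> + G \<omega>) \<le> (\<integral>\<^sup>+\<omega>. ennreal (1 + \<delta>) * ennreal ((cmod (F \<omega>))\<^sup>2) + ennreal (1 + 1/\<delta>) * ennreal ((cmod (G \<omega>))\<^sup>2) \<partial>tor)"
    unfolding N_def using d by (intro nn_integral_mono) (simp add: ennreal_mult'[symmetric] ennreal_plus[symmetric] del: ennreal_plus)
  also have "\<dots> = ennreal (1 + \<delta>) * N F + ennreal (1 + 1/\<delta>) * N G"
    unfolding N_def by (simp add: nn_integral_add nn_integral_cmult)
  finally show ?thesis .
qed

lemma N_mult_le: assumes [measurable]: "F \<in> borel_measurable tor"
  and "\<And>\<omega>. cmod (G \<omega>) \<le> K * cmod (F \<omega>)" "K \<ge> 0"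
  shows "N G \<le> ennreal (K\<^sup>2) * N F"
proof -
  have "(cmod (G \<omega>))\<^sup>2 \<le> K\<^sup>2 * (cmod (F \<omega>))\<^sup>2" for \<omega>
    using power_mono[OF assms(2)[of \<omega>], of 2] by (simp add: power_mult_distrib)
  then have "N G \<le> (\<integral>\<^sup>+\<omega>. ennreal (K\<^sup>2) * ennreal ((cmod (F \<omega>))\<^sup>2) \<partial>tor)"
    unfolding N_def by (intro nn_integral_mono) (simp add: ennreal_mult[symmetric])
  then show ?thesis by (simp add: N_def nn_integral_cmult)
qed

text \<open>A relation, because a transform is determined only almost everywhere. The L2 closure of
  \<open>trig_poly\<close> is described by one common approximating sequence, along which bounded
  linear operations carry over.\<close>

definition FT :: "(int ^ 'n::finite) l2 \<Rightarrow> (('n \<Rightarrow> real) \<Rightarrow> complex) \<Rightarrow> bool" where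
  "FT f F \<longleftrightarrow> F \<in> borel_measurable tor \<and> (\<exists>fs. (\<forall>k::nat. finite (supp (fs k))) \<and> fs \<longlonglongrightarrow> f \<and>
     (\<lambda>k. N (\<lambda>\<omega>. F \<omega> - trig_poly (fs k) \<omega>)) \<longlonglongrightarrow> 0)"

lemma FT_measurable: "FT f F \<Longrightarrow> F \<in> borel_measurable tor" by (simp add: FT_def)

lemma tendsto_0_le_ennreal:
  fixes u v :: "nat \<Rightarrow> ennreal"
  assumes "v \<longlonglongrightarrow> 0" "\<And>k. u k \<le> v k" shows "u \<longlonglongrightarrow> 0"
  by (rule tendsto_sandwich[OF _ _ tendsto_const assms(1)]) (use assms(2) in auto)

lemma FT_add: assumes "FT f F" "FT g G" shows "FT (f + g) (\<lambda>\<omega>. F \<omega> + G \<omega>)"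
proof -
  have [measurable]: "F \<in> borel_measurable tor" "G \<in> borel_measurable tor" using assms by (auto simp: FT_def)
  obtain fs where fs: "\<And>k. finite (supp (fs k))" "fs \<longlonglongrightarrow> f" "(\<lambda>k. N (\<lambda>\<omega>. F \<omega> - trig_poly (fs k) \<omega>)) \<longlonglongrightarrow> 0"
    using assms(1) by (auto simp: FT_def)
  obtain gs where gs: "\<And>k. finite (supp (gs k))" "gs \<longlonglongrightarrow> g" "(\<lambda>k. N (\<lambda>\<omega>. G \<omega> - trig_poly (gs k) \<omega>)) \<longlonglongrightarrow> 0"
    using assms(2) by (auto simp: FT_def)
  have "(\<lambda>k. N (\<lambda>\<omega>. F \<omega> + G \<omega> - trig_poly (fs k + gs k) \<omega>)) \<longlonglongrightarrow> 0"
  proof (rule tendsto_0_le_ennreal)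
    have "(\<lambda>k. ennreal (1+1) * N (\<lambda>\<omega>. F \<omega> - trig_poly (fs k) \<omega>) + ennreal (1 + 1 / 1) * N (\<lambda>\<omega>. G \<omega> - trig_poly (gs k) \<omega>)) \<longlonglongrightarrow> ennreal (1+1) * 0 + ennreal (1 + 1 / 1) * 0"
      by (intro tendsto_add ennreal_tendsto_cmult fs gs) auto
    then show "(\<lambda>k. ennreal (1+1) * N (\<lambda>\<omega>. F \<omega> - trig_poly (fs k) \<omega>) + ennreal (1 + 1 / 1) * N (\<lambda>\<omega>. G \<omega> - trig_poly (gs k) \<omega>)) \<longlonglongrightarrow> 0" by simp
    show "N (\<lambda>\<omega>. F \<omega> + G \<omega> - trig_poly (fs k + gs k) \<omega>) \<le> ennreal (1+1) * N (\<lambda>\<omega>. F \<omega> - trig_poly (fs k) \<omega>) + ennreal (1 + 1 / 1) * N (\<lambda>\<omega>. G \<omega> - trig_poly (gs k) \<omega>)" for k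
    proof -
      have "(\<lambda>\<omega>. F \<omega> + G \<omega> - trig_poly (fs k + gs k) \<omega>) = (\<lambda>\<omega>. (F \<omega> - trig_poly (fs k) \<omega>) + (G \<omega> - trig_poly (gs k) \<omega>))"
        using fs gs by (simp add: trig_poly_lin algebra_simps)
      then show ?thesis using N_add[of "\<lambda>\<omega>. F \<omega> - trig_poly (fs k) \<omega>" "\<lambda>\<omega>. G \<omega> - trig_poly (gs k) \<omega>" 1] by simp
    qed
  qed
  moreover have "finite (supp (fs k + gs k))" for k 
    by (rule finite_subset[OF supp_lin(1)]) (use fs(1) gs(1) in blast)
  moreover have "(\<lambda>k. fs k + gs k) \<longlonglongrightarrow> f + g" using fs gs by (intro tendsto_add)
  ultimately show ?thesis unfolding FT_def by (intro conjI exI[of _ "\<lambda>k. fs k + gs k"]) auto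
qed

text \<open>If a bounded operator acts on trigonometric polynomials as a bounded multiplier, both
  sides pass to the limit along the same approximating sequence. The instances are
  \<open>scl\<close> and \<open>lap\<close>.\<close>

lemma FT_apply:
  assumes FT: "FT f F" and L: "\<And>f g. L (f - g) = L f - L g" "\<And>f. norm (L f) \<le> K * norm f"
    and l: "\<And>\<omega>. cmod (l \<omega>) \<le> K" "l \<in> borel_measurable tor" "K \<ge> 0"
    and trig_poly: "\<And>f \<omega>. finite (supp f) \<Longrightarrow> finite (supp (L f)) \<and> trig_poly (L f) \<omega> = l \<omega> * trig_poly f \<omega>"
  shows "FT (L f) (\<lambda>\<omega>. l \<omega> * F \<omega>)"
proof -
  have [measurable]: "F \<in> borel_measurable tor" "l \<in> borel_measurable tor" using assms by (auto simp: FT_def)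
  obtain fs where fs: "\<And>k. finite (supp (fs k))" "fs \<longlonglongrightarrow> f" "(\<lambda>k. N (\<lambda>\<omega>. F \<omega> - trig_poly (fs k) \<omega>)) \<longlonglongrightarrow> 0"
    using FT by (auto simp: FT_def)
  have "(\<lambda>k. N (\<lambda>\<omega>. l \<omega> * F \<omega> - trig_poly (L (fs k)) \<omega>)) \<longlonglongrightarrow> 0"
  proof (rule tendsto_0_le_ennreal)
    show "(\<lambda>k. ennreal (K\<^sup>2) * N (\<lambda>\<omega>. F \<omega> - trig_poly (fs k) \<omega>)) \<longlonglongrightarrow> 0"
      using ennreal_tendsto_cmult[OF _ fs(3), of "ennreal (K\<^sup>2)"] by simp
    show "N (\<lambda>\<omega>. l \<omega> * F \<omega> - trig_poly (L (fs k)) \<omega>) \<le> ennreal (K\<^sup>2) * N (\<lambda>\<omega>. F \<omega> - trig_poly (fs k) \<omega>)" for k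
      using l trig_poly fs(1)[of k] by (intro N_mult_le) (auto simp: right_diff_distrib[symmetric] norm_mult mult_right_mono)
  qed
  moreover have "(\<lambda>k. L (fs k)) \<longlonglongrightarrow> L f"
  proof (rule Lim_null_comparison[of _ _, THEN LIM_zero_cancel])
    show "\<forall>\<^sub>F k in sequentially. norm (L (fs k) - L f) \<le> K * norm (fs k - f)"
      using L(2) by (simp add: L(1)[symmetric])
    show "(\<lambda>k. K * norm (fs k - f)) \<longlonglongrightarrow> 0"
      using tendsto_mult_right_zero[OF tendsto_norm_zero[OF LIM_zero[OF fs(2)]]] by simp
  qed
  ultimately show ?thesis unfolding FT_def using trig_poly fs(1) by (intro conjI exI[of _ "\<lambda>k. L (fs k)"]) auto
qed

lemma FT_scl: "FT f F \<Longrightarrow> FT (scl c f) (\<lambda>\<omega>. c * F \<omega>)"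
  by (rule FT_apply[of f F "scl c" "cmod c" "\<lambda>_. c"])
    (auto simp: scl_lin norm_scl trig_poly_lin intro: finite_subset[OF supp_lin(3)])

lemma FT_lap: "FT f F \<Longrightarrow> FT (lap f) (\<lambda>\<omega>. of_real (symb \<omega>) * F \<omega>)" for f :: "(int ^ 'n::finite) l2"
  by (rule FT_apply[of f F lap "4 * real CARD('n)"])
    (use symb_bounds[where 'n='n] in \<open>auto simp: lap_lin norm_lap trig_poly_lap\<close>)

text \<open>\<open>N_add\<close> is used in both directions between \<open>F\<close> and its
  approximants. In the limit the error term disappears, and then the factor
  \<open>1 + \<delta>\<close> tends to 1.\<close>

lemma FT_norm: assumes "FT f F" shows "N F = ennreal ((norm f)\<^sup>2)"
proof -
  have [measurable]: "F \<in> borel_measurable tor" using assms by (auto simp: FT_def)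
  obtain fs where fs: "\<And>k. finite (supp (fs k))" "fs \<longlonglongrightarrow> f" "(\<lambda>k. N (\<lambda>\<omega>. F \<omega> - trig_poly (fs k) \<omega>)) \<longlonglongrightarrow> 0"
    using assms by (auto simp: FT_def)
  have lim: "(\<lambda>k. ennreal ((norm (fs k))\<^sup>2)) \<longlonglongrightarrow> ennreal ((norm f)\<^sup>2)"
    using fs(2) by (intro tendsto_ennrealI tendsto_intros)
  have 1: "N F \<le> ennreal (1 + \<delta>) * ennreal ((norm f)\<^sup>2)" if d: "\<delta> > 0" for \<delta>
  proof (rule tendsto_lowerbound)
    have "(\<lambda>k. ennreal (1 + \<delta>) * ennreal ((norm (fs k))\<^sup>2) + ennreal (1 + 1/\<delta>) * N (\<lambda>\<omega>. F \<omega> - trig_poly (fs k) \<omega>)) \<longlonglongrightarrow> ennreal (1 + \<delta>) * ennreal ((norm f)\<^sup>2) + ennreal (1 + 1/\<delta>) * 0"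
      by (intro tendsto_add ennreal_tendsto_cmult lim fs) auto
    then show "(\<lambda>k. ennreal (1 + \<delta>) * ennreal ((norm (fs k))\<^sup>2) + ennreal (1 + 1/\<delta>) * N (\<lambda>\<omega>. F \<omega> - trig_poly (fs k) \<omega>)) \<longlonglongrightarrow> ennreal (1 + \<delta>) * ennreal ((norm f)\<^sup>2)"
      by simp
    show "\<forall>\<^sub>F k in sequentially. N F \<le> ennreal (1 + \<delta>) * ennreal ((norm (fs k))\<^sup>2) + ennreal (1 + 1/\<delta>) * N (\<lambda>\<omega>. F \<omega> - trig_poly (fs k) \<omega>)"
      using N_add[of "trig_poly (fs k)" "\<lambda>\<omega>. F \<omega> - trig_poly (fs k) \<omega>" \<delta> for k] d by (simp add: N_trig_poly fs)
  qed simp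
  have 2: "ennreal ((norm f)\<^sup>2) \<le> ennreal (1 + \<delta>) * N F" if d: "\<delta> > 0" for \<delta>
  proof (rule tendsto_le[OF _ _ lim])
    have "(\<lambda>k. ennreal (1 + \<delta>) * N F + ennreal (1 + 1/\<delta>) * N (\<lambda>\<omega>. F \<omega> - trig_poly (fs k) \<omega>)) \<longlonglongrightarrow> ennreal (1 + \<delta>) * N F + ennreal (1 + 1/\<delta>) * 0"
      by (intro tendsto_add tendsto_const ennreal_tendsto_cmult fs) auto
    then show "(\<lambda>k. ennreal (1 + \<delta>) * N F + ennreal (1 + 1/\<delta>) * N (\<lambda>\<omega>. F \<omega> - trig_poly (fs k) \<omega>)) \<longlonglongrightarrow> ennreal (1 + \<delta>) * N F"
      by simp
    have "N (\<lambda>\<omega>. trig_poly (fs k) \<omega> - F \<omega>) = N (\<lambda>\<omega>. F \<omega> - trig_poly (fs k) \<omega>)" for k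
      by (simp add: N_def norm_minus_commute)
    then show "\<forall>\<^sub>F k in sequentially. ennreal ((norm (fs k))\<^sup>2) \<le> ennreal (1 + \<delta>) * N F + ennreal (1 + 1/\<delta>) * N (\<lambda>\<omega>. F \<omega> - trig_poly (fs k) \<omega>)"
      using N_add[of F "\<lambda>\<omega>. trig_poly (fs k) \<omega> - F \<omega>" \<delta> for k] d by (simp add: N_trig_poly[symmetric] fs)
  qed simp
  have "N F \<le> ennreal (2 * (norm f)\<^sup>2)" using 1[of 1] by (simp add: ennreal_mult)
  then have "N F < \<infinity>" by (rule le_less_trans) simp
  then obtain r where r: "N F = ennreal r" "r \<ge> 0" by (cases "N F") auto
  have e: "(\<lambda>k. (1 + inverse (real (Suc k))) * s) \<longlonglongrightarrow> (1 + 0) * s" for s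
    by (intro tendsto_intros LIMSEQ_inverse_real_of_nat)
  have "r \<le> (1 + inverse (real (Suc k))) * (norm f)\<^sup>2" for k
  proof -
    have "ennreal r \<le> ennreal ((1 + inverse (real (Suc k))) * (norm f)\<^sup>2)"
      using 1[of "inverse (real (Suc k))"] unfolding r(1) by (subst ennreal_mult) (auto simp del: of_nat_Suc ennreal_plus)
    then show ?thesis by (simp del: of_nat_Suc)
  qed
  then have "r \<le> (norm f)\<^sup>2" using LIMSEQ_le_const[OF e[of "(norm f)\<^sup>2"]] by auto
  moreover have "(norm f)\<^sup>2 \<le> (1 + inverse (real (Suc k))) * r" for k
  proof -
    have "ennreal ((norm f)\<^sup>2) \<le> ennreal ((1 + inverse (real (Suc k))) * r)"
      using 2[of "inverse (real (Suc k))"] r(2) unfolding r(1) by (subst ennreal_mult) (auto simp del: of_nat_Suc ennreal_plus)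
    then show ?thesis using r(2) by (simp del: of_nat_Suc)
  qed
  then have "(norm f)\<^sup>2 \<le> r" using LIMSEQ_le_const[OF e[of r]] by auto
  ultimately show ?thesis using r by simp
qed

lemma FT_integral: assumes "FT f F"
  shows "integrable tor (\<lambda>\<omega>. (cmod (F \<omega>))\<^sup>2)" "(\<integral>\<omega>. (cmod (F \<omega>))\<^sup>2 \<partial>tor) = (norm f)\<^sup>2"
proof -
  have [measurable]: "F \<in> borel_measurable tor" using assms by (auto simp: FT_def)
  have n: "(\<integral>\<^sup>+\<omega>. ennreal ((cmod (F \<omega>))\<^sup>2) \<partial>tor) = ennreal ((norm f)\<^sup>2)" using FT_norm[OF assms] by (simp add: N_def)
  show "integrable tor (\<lambda>\<omega>. (cmod (F \<omega>))\<^sup>2)"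
    by (rule integrableI_nn_integral_finite[OF _ _ n]) auto
  show "(\<integral>\<omega>. (cmod (F \<omega>))\<^sup>2 \<partial>tor) = (norm f)\<^sup>2"
    using n by (simp add: integral_eq_nn_integral)
qed

text \<open>Polarisation of \<open>FT_integral\<close>. Real parts suffice, as the moments of a
  symmetric operator are real.\<close>

lemma FT_inner: assumes "FT f F" "FT g G"
  shows "integrable tor (\<lambda>\<omega>. Re (cnj (F \<omega>) * G \<omega>))" "(\<integral>\<omega>. Re (cnj (F \<omega>) * G \<omega>) \<partial>tor) = Re (cin f g)"
proof -
  have pol: "Re (cnj a * b) = ((cmod (a + b))\<^sup>2 - (cmod a)\<^sup>2 - (cmod b)\<^sup>2) / 2" for a b :: complex
    by (simp add: cmod_power2) (simp add: power2_eq_square algebra_simps)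
  note i = FT_integral[OF FT_add[OF assms]] FT_integral[OF assms(1)] FT_integral[OF assms(2)]
  show "integrable tor (\<lambda>\<omega>. Re (cnj (F \<omega>) * G \<omega>))" unfolding pol using i by auto
  have "(\<integral>\<omega>. Re (cnj (F \<omega>) * G \<omega>) \<partial>tor) = ((norm (f + g))\<^sup>2 - (norm f)\<^sup>2 - (norm g)\<^sup>2) / 2"
    unfolding pol using i by simp
  also have "\<dots> = inner f g"
    by (simp add: power2_norm_eq_inner inner_add_left inner_add_right inner_commute)
  finally show "(\<integral>\<omega>. Re (cnj (F \<omega>) * G \<omega>) \<partial>tor) = Re (cin f g)" by (simp add: inner_l2_def)
qed

text \<open>Riesz-Fischer argument: with errors \<open>h k\<close> that decrease geometrically, the
  increments \<open>G k\<close> have summable integrals, so the trigonometric polynomials converge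
  almost everywhere, and Fatou's lemma gives convergence in L2.\<close>

lemma FT_ex: "\<exists>F. FT f F" for f :: "(int ^ 'n::finite) l2"
proof -
  define h where "h k = (1/2::real) ^ k" for k
  have h: "h k > 0" "h (Suc k) = h k / 2" for k by (simp_all add: h_def)
  have "\<exists>S. finite S \<and> norm (f - cut S f) \<le> h k" for k by (rule cut_approx[OF h(1)])
  then obtain S where S: "\<And>k. finite (S k)" "\<And>k. norm (f - cut (S k) f) \<le> h k" by metis
  define fs where "fs k = cut (S k) f" for k
  have fin: "finite (supp (fs k))" for k
    by (rule finite_subset[OF _ S(1)[of k]]) (auto simp: supp_def fs_def ap_cut)
  have fs_lim: "fs \<longlonglongrightarrow> f"
  proof (rule Lim_null_comparison[of _ _, THEN LIM_zero_cancel])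
    show "\<forall>\<^sub>F k in sequentially. norm (fs k - f) \<le> h k" using S(2) by (simp add: fs_def norm_minus_commute)
    show "h \<longlonglongrightarrow> 0" unfolding h_def by (rule LIMSEQ_realpow_zero) auto
  qed
  have dist: "norm (fs l - fs k) \<le> 2 * h k" if "k \<le> l" for k l
  proof -
    have "norm (fs l - fs k) \<le> norm (fs l - f) + norm (f - fs k)"
      using norm_triangle_ineq[of "fs l - f" "f - fs k"] by simp
    also have "\<dots> \<le> h l + h k" using S(2) by (intro add_mono) (simp_all add: fs_def norm_minus_commute)
    also have "h l \<le> h k" unfolding h_def using that by (intro power_decreasing) auto
    finally show ?thesis by simp
  qed
  have Nd: "N (\<lambda>\<omega>. trig_poly (fs l) \<omega> - trig_poly (fs k) \<omega>) \<le> ennreal ((2 * h k)\<^sup>2)" if "k \<le> l" for k l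
  proof -
    have f': "finite (supp (fs l - fs k))" by (rule finite_subset[OF supp_lin(2)]) (use fin in blast)
    have "(\<lambda>\<omega>. trig_poly (fs l) \<omega> - trig_poly (fs k) \<omega>) = trig_poly (fs l - fs k)" using fin by (simp add: trig_poly_lin fun_eq_iff)
    moreover have "(norm (fs l - fs k))\<^sup>2 \<le> (2 * h k)\<^sup>2" by (intro power_mono dist that norm_ge_zero)
    ultimately show ?thesis using N_trig_poly[OF f'] by (simp only: ennreal_leI)
  qed
  define G where "G k \<omega> = trig_poly (fs (Suc k)) \<omega> - trig_poly (fs k) \<omega>" for k \<omega>
  have [measurable]: "G k \<in> borel_measurable tor" for k unfolding G_def by measurable
  \<comment> \<open>From \<open>cmod G \<le> h + (cmod G)\<^sup>2 / h\<close> and the bound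
    \<open>(2 * h)\<^sup>2\<close> for the integral of the square, the total is
    \<open>h + 4 * h\<close>.\<close>
  have G1: "(\<integral>\<^sup>+\<omega>. ennreal (cmod (G k \<omega>)) \<partial>tor) \<le> ennreal (5 * h k)" for k
  proof -
    have b: "cmod (G k \<omega>) \<le> h k + (1 / h k) * (cmod (G k \<omega>))\<^sup>2" for \<omega>
    proof -
      have "0 \<le> (h k - cmod (G k \<omega>))\<^sup>2" by simp
      then have "2 * h k * cmod (G k \<omega>) \<le> (h k)\<^sup>2 + (cmod (G k \<omega>))\<^sup>2" by (simp add: power2_eq_square algebra_simps)
      moreover have "0 \<le> h k * cmod (G k \<omega>)" using h[of k] by simp
      ultimately have "h k * cmod (G k \<omega>) \<le> (h k)\<^sup>2 + (cmod (G k \<omega>))\<^sup>2" by linarith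
      then show ?thesis using h(1)[of k] by (simp add: field_simps power2_eq_square)
    qed
    have "(\<integral>\<^sup>+\<omega>. ennreal (cmod (G k \<omega>)) \<partial>tor) \<le> (\<integral>\<^sup>+\<omega>. ennreal (h k) + ennreal (1 / h k) * ennreal ((cmod (G k \<omega>))\<^sup>2) \<partial>tor)"
    proof (rule nn_integral_mono)
      fix \<omega>
      have "ennreal (cmod (G k \<omega>)) \<le> ennreal (h k + (1 / h k) * (cmod (G k \<omega>))\<^sup>2)" using b by (rule ennreal_leI)
      also have "\<dots> = ennreal (h k) + ennreal (1 / h k) * ennreal ((cmod (G k \<omega>))\<^sup>2)"
        using h(1)[of k] ennreal_mult[of "1 / h k" "(cmod (G k \<omega>))\<^sup>2"] by (simp add: ennreal_plus)
      finally show "ennreal (cmod (G k \<omega>)) \<le> ennreal (h k) + ennreal (1 / h k) * ennreal ((cmod (G k \<omega>))\<^sup>2)" .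
    qed
    also have "\<dots> = ennreal (h k) + ennreal (1 / h k) * N (G k)"
      by (simp add: nn_integral_add nn_integral_cmult N_def tor.emeasure_space_1)
    also have "\<dots> \<le> ennreal (h k) + ennreal (1 / h k) * ennreal ((2 * h k)\<^sup>2)"
      using Nd[of k "Suc k"] unfolding G_def by (intro add_mono mult_left_mono) auto
    also have "\<dots> = ennreal (5 * h k)"
      using h(1)[of k] by (simp add: ennreal_mult[symmetric] ennreal_plus[symmetric] power2_eq_square del: ennreal_plus)
    finally show ?thesis .
  qed
  have "(\<integral>\<^sup>+\<omega>. (\<Sum>k. ennreal (cmod (G k \<omega>))) \<partial>tor) = (\<Sum>k. \<integral>\<^sup>+\<omega>. ennreal (cmod (G k \<omega>)) \<partial>tor)"
    by (rule nn_integral_suminf) simp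
  also have "\<dots> \<le> (\<Sum>k. ennreal (5 * h k))" by (intro suminf_le G1) auto
  also have "\<dots> = ennreal (\<Sum>k. 5 * h k)"
    using h(1) by (intro suminf_ennreal2) (auto intro!: summable_mult simp: h_def less_imp_le summable_geometric)
  finally have "(\<integral>\<^sup>+\<omega>. (\<Sum>k. ennreal (cmod (G k \<omega>))) \<partial>tor) \<noteq> \<infinity>" by (auto simp: top_unique)
  then have "AE \<omega> in tor. (\<Sum>k. ennreal (cmod (G k \<omega>))) \<noteq> \<infinity>" by (intro nn_integral_PInf_AE) simp
  then have conv: "AE \<omega> in tor. (\<lambda>k. trig_poly (fs k) \<omega>) \<longlonglongrightarrow> lim (\<lambda>k. trig_poly (fs k) \<omega>)"
  proof eventually_elim
    case (elim \<omega>)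
    then have "summable (\<lambda>k. norm (G k \<omega>))" by (intro summable_suminf_not_top) auto
    then have "summable (\<lambda>k. G k \<omega>)" by (rule summable_norm_cancel)
    then have "convergent (\<lambda>n. \<Sum>k<n. G k \<omega>)" by (simp add: summable_iff_convergent)
    moreover have "(\<Sum>k<n. G k \<omega>) = trig_poly (fs n) \<omega> - trig_poly (fs 0) \<omega>" for n
      unfolding G_def by (rule sum_lessThan_telescope)
    ultimately have "convergent (\<lambda>n. trig_poly (fs n) \<omega> - trig_poly (fs 0) \<omega>)" by simp
    then have "convergent (\<lambda>n. trig_poly (fs n) \<omega>)" by (simp add: convergent_diff_const_right_iff)
    then show ?case by (simp add: convergent_LIMSEQ_iff)
  qed
  define F where "F \<omega> = lim (\<lambda>k. trig_poly (fs k) \<omega>)" for \<omega>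
  have [measurable]: "F \<in> borel_measurable tor" unfolding F_def by measurable
  have NF: "N (\<lambda>\<omega>. F \<omega> - trig_poly (fs k) \<omega>) \<le> ennreal ((2 * h k)\<^sup>2)" for k
  proof -
    have "N (\<lambda>\<omega>. F \<omega> - trig_poly (fs k) \<omega>) = (\<integral>\<^sup>+\<omega>. liminf (\<lambda>l. ennreal ((cmod (trig_poly (fs l) \<omega> - trig_poly (fs k) \<omega>))\<^sup>2)) \<partial>tor)"
      unfolding N_def
    proof (rule nn_integral_cong_AE)
      show "AE \<omega> in tor. ennreal ((cmod (F \<omega> - trig_poly (fs k) \<omega>))\<^sup>2) = liminf (\<lambda>l. ennreal ((cmod (trig_poly (fs l) \<omega> - trig_poly (fs k) \<omega>))\<^sup>2))"
        using conv
      proof eventually_elim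
        case (elim \<omega>)
        then have "(\<lambda>l. ennreal ((cmod (trig_poly (fs l) \<omega> - trig_poly (fs k) \<omega>))\<^sup>2)) \<longlonglongrightarrow> ennreal ((cmod (F \<omega> - trig_poly (fs k) \<omega>))\<^sup>2)"
          unfolding F_def by (intro tendsto_ennrealI tendsto_intros)
        then show ?case by (intro lim_imp_Liminf[symmetric]) auto
      qed
    qed
    also have "\<dots> \<le> liminf (\<lambda>l. N (\<lambda>\<omega>. trig_poly (fs l) \<omega> - trig_poly (fs k) \<omega>))"
      unfolding N_def by (rule nn_integral_liminf) simp
    also have "\<dots> \<le> liminf (\<lambda>l. ennreal ((2 * h k)\<^sup>2))"
      using Nd by (intro Liminf_mono) (auto intro: eventually_sequentiallyI[of k])
    also have "\<dots> = ennreal ((2 * h k)\<^sup>2)" by (rule Liminf_const) simp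
    finally show ?thesis .
  qed
  have "(\<lambda>k. N (\<lambda>\<omega>. F \<omega> - trig_poly (fs k) \<omega>)) \<longlonglongrightarrow> 0"
  proof (rule tendsto_0_le_ennreal[OF _ NF])
    have "h \<longlonglongrightarrow> 0" unfolding h_def by (rule LIMSEQ_realpow_zero) auto
    then have "(\<lambda>k. ennreal ((2 * h k)\<^sup>2)) \<longlonglongrightarrow> ennreal ((2 * 0)\<^sup>2)"
      by (intro tendsto_ennrealI tendsto_intros)
    then show "(\<lambda>k. ennreal ((2 * h k)\<^sup>2)) \<longlonglongrightarrow> 0" by simp
  qed
  then show ?thesis unfolding FT_def using fin fs_lim by (intro exI[of _ F]) auto
qed

text \<open>Off the critical points 0, pi and 2 pi, the preimage consists of images under the two
  inverse branches given by \<open>arccos\<close>, and differentiable maps send null sets to null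
  sets.\<close>

lemma negligible_cos_preimage:
  assumes "negligible A" shows "negligible {y \<in> {0..2*pi}. C - 2 * cos y \<in> A}"
proof -
  define S where "S = {n \<in> A. -1 < (C - n) / 2 \<and> (C - n) / 2 < 1}"
  have S: "negligible S" using assms by (rule negligible_subset) (auto simp: S_def)
  define g where "g n = arccos ((C - n) / 2)" for n
  have g: "g differentiable_on S"
  proof (rule differentiable_at_imp_differentiable_on)
    fix n assume "n \<in> S"
    then have n: "-1 < (C - n) / 2" "(C - n) / 2 < 1" by (auto simp: S_def)
    have "((\<lambda>n. (C - n) / 2) has_real_derivative (- 1 / 2)) (at n)" by (auto intro!: derivative_eq_intros)
    from DERIV_chain2[OF DERIV_arccos[OF n] this] have "(g has_real_derivative inverse (- sqrt (1 - ((C - n) / 2)\<^sup>2)) * (- 1 / 2)) (at n)"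
      unfolding g_def[abs_def] .
    then show "g differentiable at n" using differentiable_def has_field_derivative_def by blast
  qed
  have g': "(\<lambda>n. 2 * pi - g n) differentiable_on S" using g by (intro derivative_intros)
  have n1: "negligible (g ` S)" by (rule negligible_differentiable_image_negligible[OF _ S g]) simp
  have n2: "negligible ((\<lambda>n. 2 * pi - g n) ` S)" by (rule negligible_differentiable_image_negligible[OF _ S g']) simp
  have n3: "negligible {0, pi, 2 * pi}" by (intro negligible_finite) simp
  have "{y \<in> {0..2*pi}. C - 2 * cos y \<in> A} \<subseteq> g ` S \<union> (\<lambda>n. 2 * pi - g n) ` S \<union> {0, pi, 2*pi}"
  proof
    fix y assume "y \<in> {y \<in> {0..2*pi}. C - 2 * cos y \<in> A}"
    then have y: "0 \<le> y" "y \<le> 2 * pi" "C - 2 * cos y \<in> A" by auto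
    have main: "C - 2 * cos z \<in> S \<and> g (C - 2 * cos z) = z" if "0 < z" "z < pi" "C - 2 * cos z \<in> A" for z
    proof -
      have "cos z < 1" "cos z > -1"
        using cos_monotone_0_pi[of 0 z] cos_monotone_0_pi[of z pi] that by auto
      then show ?thesis using that by (auto simp: S_def g_def arccos_cos)
    qed
    consider "y \<in> {0, pi, 2 * pi}" | "0 < y" "y < pi" | "pi < y" "y < 2 * pi" using y by force
    then show "y \<in> g ` S \<union> (\<lambda>n. 2 * pi - g n) ` S \<union> {0, pi, 2*pi}"
    proof cases
      case 2
      then show ?thesis using main[of y] y by (metis UnI1 imageI)
    next
      case 3
      have "cos (2 * pi - y) = cos y" by (simp add: cos_diff)
      then have "C - 2 * cos y \<in> S" "g (C - 2 * cos y) = 2 * pi - y" using main[of "2 * pi - y"] 3 y by auto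
      then have "y = 2 * pi - g (C - 2 * cos y)" by simp
      then show ?thesis using \<open>C - 2 * cos y \<in> S\<close> by blast
    qed auto
  qed
  then show ?thesis by (rule negligible_subset[rotated]) (intro negligible_Un n1 n2 n3)
qed

text \<open>By Fubini's theorem in a single coordinate: with the others fixed, the symbol has the
  form \<open>C - 2 * cos y\<close>.\<close>

lemma symb_AE_not_in:
  assumes A: "A \<in> null_sets lborel"
  shows "AE \<omega> in (tor :: ('n::finite \<Rightarrow> real) measure). symb \<omega> \<notin> A"
proof -
  have [measurable]: "A \<in> sets borel" using A by auto
  have negl: "negligible A" using A by (simp add: negligible_iff_null_sets null_sets_completionI)
  obtain i :: 'n where True by simp
  define I where "I = (UNIV :: 'n set) - {i}"
  have I: "finite I" "i \<notin> I" "UNIV = insert i I" by (auto simp: I_def)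
  have "(\<integral>\<^sup>+\<omega>. indicator A (symb \<omega>) \<partial>(tor :: ('n \<Rightarrow> real) measure)) =
     (\<integral>\<^sup>+x. (\<integral>\<^sup>+y. indicator A (symb (x(i := y))) \<partial>unif) \<partial>(Pi\<^sub>M I (\<lambda>_. unif)))"
  proof -
    have "(\<lambda>\<omega>. indicator A (symb \<omega>)) \<in> borel_measurable (tor :: ('n \<Rightarrow> real) measure)" by measurable
    then show ?thesis unfolding tor_def I(3) by (intro pu.product_nn_integral_insert I)
  qed
  also have "\<dots> = (\<integral>\<^sup>+x. 0 \<partial>(Pi\<^sub>M I (\<lambda>_. unif)))"
  proof (rule nn_integral_cong)
    fix x :: "'n \<Rightarrow> real"
    define C where "C = 2 * real CARD('n) - 2 * (\<Sum>j\<in>I. cos (x j))"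
    have s: "symb (x(i := y)) = C - 2 * cos y" for y
    proof -
      have "(\<Sum>j\<in>I. cos ((x(i := y)) j)) = (\<Sum>j\<in>I. cos (x j))" using I by (intro sum.cong) auto
      moreover have "(\<Sum>j\<in>UNIV. cos ((x(i := y)) j)) = cos y + (\<Sum>j\<in>I. cos ((x(i := y)) j))"
        unfolding I_def by (subst sum.remove[of UNIV i]) auto
      ultimately show ?thesis unfolding symb_def C_def by simp
    qed
    have "{y \<in> {0..2*pi}. C - 2 * cos y \<in> A} \<in> null_sets lebesgue"
      using negligible_cos_preimage[OF negl] by (simp add: negligible_iff_null_sets)
    moreover have "{y \<in> {0..2*pi}. C - 2 * cos y \<in> A} \<in> sets borel" by measurable
    ultimately have "{y \<in> {0..2*pi}. C - 2 * cos y \<in> A} \<in> null_sets lborel"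
      by (auto simp: null_sets_def)
    then have "AE y in lborel. y \<notin> {y \<in> {0..2*pi}. C - 2 * cos y \<in> A}" by (rule AE_not_in)
    then have "AE y in lborel. y \<in> {0..2*pi} \<longrightarrow> C - 2 * cos y \<notin> A" by eventually_elim auto
    then have "AE y in unif. C - 2 * cos y \<notin> A" by (rule AE_unif)
    then have "AE y in unif. indicator A (symb (x(i := y))) = (0::ennreal)" by eventually_elim (simp add: s)
    then show "(\<integral>\<^sup>+y. indicator A (symb (x(i := y))) \<partial>unif) = 0"
      by (rule nn_integral_zero')
  qed
  finally have "(\<integral>\<^sup>+\<omega>. indicator A (symb \<omega>) \<partial>(tor :: ('n \<Rightarrow> real) measure)) = 0" by simp
  then have "AE \<omega> in (tor :: ('n \<Rightarrow> real) measure). indicator A (symb \<omega>) = (0::ennreal)"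
    by (subst (asm) nn_integral_0_iff_AE) auto
  then show ?thesis by eventually_elim (auto split: split_indicator_asm)
qed

section \<open>Spectra of the component model\<close>

lemma scl_0: "scl 0 f = 0"
  by (rule l2_eqI) (simp add: ap_simps)

lemma ell2_iff: "f \<in> ell2 V \<longleftrightarrow> (\<forall>v. v \<notin> V \<longrightarrow> f v = 0) \<and> sqs f"
proof -
  have "(\<lambda>v. (cmod (f v))\<^sup>2) summable_on V \<longleftrightarrow> (\<lambda>v. (cmod (f v))\<^sup>2) summable_on UNIV" if "\<forall>v. v \<notin> V \<longrightarrow> f v = 0"
    by (rule summable_on_cong_neutral) (use that in auto)
  then show ?thesis unfolding ell2_def sqs_def by blast
qed

lemma ell2_inner_eq:
  assumes "f \<in> ell2 V" "g \<in> ell2 V" shows "ell2_inner V f g = cin (Abs_l2 f) (Abs_l2 g)"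
proof -
  have "sqs f" "sqs g" using assms by (auto simp: ell2_iff)
  then show ?thesis unfolding ell2_inner_def cin_def
    using assms by (intro infsum_cong_neutral) (auto simp: ap_Abs ell2_iff)
qed

lemma ell2_norm_eq:
  assumes "f \<in> ell2 V" shows "ell2_norm V f = norm (Abs_l2 f)"
proof -
  have "sqs f" using assms by (auto simp: ell2_iff)
  have "(\<Sum>\<^sub>\<infinity>v\<in>V. (cmod (f v))\<^sup>2) = (norm (Abs_l2 f))\<^sup>2"
    unfolding norm_sq using assms \<open>sqs f\<close> by (intro infsum_cong_neutral) (auto simp: ap_Abs ell2_iff)
  then show ?thesis by (simp add: ell2_norm_def)
qed

lemma ell2_lin: "f \<in> ell2 V \<Longrightarrow> g \<in> ell2 V \<Longrightarrow> (\<lambda>v. a * f v + b * g v) \<in> ell2 V"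
  unfolding ell2_iff by (auto intro: sqs_add sqs_cmult)

lemma Abs_l2_lin: "f \<in> ell2 V \<Longrightarrow> g \<in> ell2 V \<Longrightarrow>
   Abs_l2 (\<lambda>v. a * f v + b * g v) = scl a (Abs_l2 f) + scl b (Abs_l2 g)"
  using ell2_lin[of f V g a b] by (intro l2_eqI) (simp add: ap_simps ap_Abs ell2_iff)

lemma ell2_inner_lin: assumes "f \<in> ell2 V" "g \<in> ell2 V" "h \<in> ell2 V"
  shows "ell2_inner V h (\<lambda>v. a * f v + b * g v) = a * ell2_inner V h f + b * ell2_inner V h g"
    "ell2_inner V (\<lambda>v. a * f v + b * g v) h = cnj a * ell2_inner V f h + cnj b * ell2_inner V g h"
  using assms ell2_lin[OF assms(1,2), of a b]
  by (simp_all add: ell2_inner_eq Abs_l2_lin cin_add cin_add_right cin_scl cin_scl_right)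

lemma ell2_inner_cnj: assumes "f \<in> ell2 V" "g \<in> ell2 V"
  shows "cnj (ell2_inner V f g) = ell2_inner V g f"
  using assms by (simp add: ell2_inner_eq cin_cnj)

text \<open>
  Let \<open>H e = b e\<close> and let \<open>q(x) = 1 - ((x - b) / R)\<^sup>2\<close> with \<open>R\<close> so large that \<open>0 < q \<le> 1\<close> on the
  support of the spectral measure of \<open>f\<close>. Then \<open>\<langle>e, f\<rangle> = \<langle>e, q(H)^M f\<rangle>\<close>, which tends to 0, because
  \<open>\<parallel>q(H)^M f\<parallel>\<^sup>2\<close> is the integral of \<open>q^(2M)\<close> and the spectral measure has no atom at \<open>b\<close>.
\<close>

lemma ac_orthogonal_eigenvector:
  fixes H :: "('v \<Rightarrow> complex) \<Rightarrow> 'v \<Rightarrow> complex"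
  assumes inv: "\<And>f. f \<in> ell2 V \<Longrightarrow> H f \<in> ell2 V"
    and lin: "\<And>f g a b. f \<in> ell2 V \<Longrightarrow> g \<in> ell2 V \<Longrightarrow> H (\<lambda>v. a * f v + b * g v) = (\<lambda>v. a * H f v + b * H g v)"
    and sym: "\<And>f g. f \<in> ell2 V \<Longrightarrow> g \<in> ell2 V \<Longrightarrow> ell2_inner V (H f) g = ell2_inner V f (H g)"
    and f: "f \<in> ac_subspace V H" and e: "e \<in> ell2 V" "\<And>v. H e v = of_real b * e v"
  shows "ell2_inner V e f = 0"
proof -
  have fV: "f \<in> ell2 V" using f by (simp add: ac_subspace_def)
  obtain \<mu> where mu: "spectral_measure V H f \<mu>" "absolutely_continuous lborel \<mu>"
    using f by (auto simp: ac_subspace_def)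
  have s[measurable_cong]: "sets \<mu> = sets borel" and fin: "finite_measure \<mu>"
    and mom: "\<And>k. ell2_inner V f ((H ^^ k) f) = complex_of_real (\<integral>x. x ^ k \<partial>\<mu>)"
    using mu(1) by (auto simp: spectral_measure_def)
  interpret finite_measure \<mu> by fact
  obtain R0 where R0: "AE x in \<mu>. \<bar>x\<bar> \<le> R0" using mu(1) by (auto simp: spectral_measure_def)
  define R where "R = \<bar>R0\<bar> + \<bar>b\<bar> + 1"
  define q where "q = [:1 - b\<^sup>2 / R\<^sup>2, 2 * b / R\<^sup>2, - 1 / R\<^sup>2:]"
  have R1: "R > 0" by (simp add: R_def)
  have pq: "poly q x = 1 - ((x - b) / R)\<^sup>2" for x
    using R1 by (simp add: q_def power_divide power2_diff) (simp add: field_simps power2_eq_square)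
  \<comment> \<open>\<open>G\<close> is \<open>H - b\<close> and, below, \<open>A\<close> is
    \<open>q(H)\<close>; both are written as linear combinations of the form treated by
    \<open>ell2_lin\<close>.\<close>
  define G where "G g = (\<lambda>v. 1 * H g v + of_real (- b) * g v)" for g
  define A where "A g = (\<lambda>v. 1 * g v + of_real (- 1 / R\<^sup>2) * G (G g) v)" for g
  have Gi: "G g \<in> ell2 V" if "g \<in> ell2 V" for g unfolding G_def by (intro ell2_lin inv that)
  have Ai: "A g \<in> ell2 V" if "g \<in> ell2 V" for g unfolding A_def by (intro ell2_lin Gi that)
  have Gs: "ell2_inner V (G g) h = ell2_inner V g (G h)" if "g \<in> ell2 V" "h \<in> ell2 V" for g h
    unfolding G_def using that by (simp only: ell2_inner_lin inv sym) simp
  have As: "ell2_inner V (A g) h = ell2_inner V g (A h)" if "g \<in> ell2 V" "h \<in> ell2 V" for g h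
    unfolding A_def using that by (simp only: ell2_inner_lin Gi Gs) simp
  have Ak: "(A ^^ M) g \<in> ell2 V" if "g \<in> ell2 V" for g M
    by (induction M) (auto simp: that Ai)
  have Hk: "(H ^^ M) g \<in> ell2 V" if "g \<in> ell2 V" for g M
    by (induction M) (auto simp: that inv)
  have Hk_lin: "(H ^^ k) (\<lambda>v. a * g v + c * h v) = (\<lambda>v. a * (H ^^ k) g v + c * (H ^^ k) h v)"
    if "g \<in> ell2 V" "h \<in> ell2 V" for g h a c k
    by (induction k) (simp_all add: lin Hk that)
  have Aks: "ell2_inner V ((A ^^ M) g) h = ell2_inner V g ((A ^^ M) h)" if "g \<in> ell2 V" "h \<in> ell2 V" for g h M
    using that
  proof (induction M arbitrary: h)
    case (Suc M)
    have "ell2_inner V ((A ^^ Suc M) g) h = ell2_inner V ((A ^^ M) g) (A h)"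
      using Suc.prems by (simp add: As Ak)
    also have "\<dots> = ell2_inner V g ((A ^^ M) (A h))" using Suc by (simp add: Ai)
    finally show ?case by (simp add: funpow_swap1)
  qed simp
  have int: "integrable \<mu> (\<lambda>x. x ^ k * poly p x)" for k p
  proof -
    have c: "continuous_on UNIV (\<lambda>x::real. x ^ k * poly p x)" by (intro continuous_intros)
    have "bounded ((\<lambda>x::real. x ^ k * poly p x) ` {-\<bar>R0\<bar>..\<bar>R0\<bar>})"
      by (intro compact_imp_bounded compact_continuous_image continuous_on_subset[OF c]) auto
    then obtain K where K: "\<And>x. x \<in> {-\<bar>R0\<bar>..\<bar>R0\<bar>} \<Longrightarrow> norm (x ^ k * poly p x) \<le> K"
      unfolding bounded_iff by blast
    have [measurable]: "(\<lambda>x. x ^ k * poly p x) \<in> borel_measurable \<mu>"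
      using borel_measurable_continuous_onI[OF c] by (simp add: measurable_cong_sets[OF s refl])
    show ?thesis
      by (rule integrable_const_bound[of _ K]) (use R0 in \<open>eventually_elim, intro K, auto\<close>, measurable)
  qed
  \<comment> \<open>States that \<open>\<phi>\<close> behaves like \<open>p(H) f\<close> when tested
    by moments against \<open>f\<close>. The relation is closed under \<open>H\<close> and real
    linear combinations, so powers of \<open>A\<close> correspond to powers of
    \<open>q\<close>.\<close>
  define Mom where "Mom \<phi> p \<longleftrightarrow> \<phi> \<in> ell2 V \<and> (\<forall>k. ell2_inner V f ((H ^^ k) \<phi>) = of_real (\<integral>x. x ^ k * poly p x \<partial>\<mu>))" for \<phi> p
  have Mom_H: "Mom (H \<phi>) ([:0, 1:] * p)" if "Mom \<phi> p" for \<phi> p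
    unfolding Mom_def
  proof (intro conjI allI)
    show "H \<phi> \<in> ell2 V" using that inv by (simp add: Mom_def)
    fix k
    have "(H ^^ k) (H \<phi>) = (H ^^ Suc k) \<phi>" by (simp add: funpow_swap1)
    then show "ell2_inner V f ((H ^^ k) (H \<phi>)) = of_real (\<integral>x. x ^ k * poly ([:0, 1:] * p) x \<partial>\<mu>)"
      using that unfolding Mom_def by (simp add: mult_ac del: funpow.simps) 
  qed
  have Mom_lin: "Mom (\<lambda>v. of_real a * \<phi> v + of_real c * \<psi> v) (Polynomial.smult a p + Polynomial.smult c r)"
    if "Mom \<phi> p" "Mom \<psi> r" for \<phi> \<psi> a c p r
    unfolding Mom_def
  proof (intro conjI allI)
    have e: "\<phi> \<in> ell2 V" "\<psi> \<in> ell2 V" using that by (auto simp: Mom_def)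
    then show "(\<lambda>v. of_real a * \<phi> v + of_real c * \<psi> v) \<in> ell2 V" by (rule ell2_lin)
    fix k
    have "(\<integral>x. x ^ k * poly (Polynomial.smult a p + Polynomial.smult c r) x \<partial>\<mu>)
        = (\<integral>x. a * (x ^ k * poly p x) + c * (x ^ k * poly r x) \<partial>\<mu>)"
      by (simp add: algebra_simps)
    also have "\<dots> = a * (\<integral>x. x ^ k * poly p x \<partial>\<mu>) + c * (\<integral>x. x ^ k * poly r x \<partial>\<mu>)"
      using int[of k p] int[of k r] by simp
    finally show "ell2_inner V f ((H ^^ k) (\<lambda>v. of_real a * \<phi> v + of_real c * \<psi> v)) =
      of_real (\<integral>x. x ^ k * poly (Polynomial.smult a p + Polynomial.smult c r) x \<partial>\<mu>)"
      unfolding Hk_lin[OF e] using that e by (simp add: ell2_inner_lin fV Hk Mom_def)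
  qed
  have Mom_A: "Mom (A \<phi>) (q * p)" if m: "Mom \<phi> p" for \<phi> p
  proof -
    have g: "Mom (G \<psi>) ([:- b, 1:] * r)" if "Mom \<psi> r" for \<psi> r
    proof -
      have "Polynomial.smult 1 ([:0, 1:] * r) + Polynomial.smult (- b) r = [:- b, 1:] * r" by simp
      then show ?thesis using Mom_lin[OF Mom_H[OF that] that, of 1 "- b"] unfolding G_def by simp
    qed
    have "Polynomial.smult 1 p + Polynomial.smult (- 1 / R\<^sup>2) ([:- b, 1:] * ([:- b, 1:] * p)) =
      ([:1:] + Polynomial.smult (- 1 / R\<^sup>2) ([:- b, 1:] * [:- b, 1:])) * p"
      by (simp only: distrib_right mult_smult_left mult.assoc) simp
    also have "[:1:] + Polynomial.smult (- 1 / R\<^sup>2) ([:- b, 1:] * [:- b, 1:]) = q"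
      by (simp add: q_def power2_eq_square)
    finally show ?thesis using Mom_lin[OF m g[OF g[OF m]], of 1 "- 1 / R\<^sup>2"] unfolding A_def by simp
  qed
  have Mom_Ak: "Mom ((A ^^ M) f) (q ^ M)" for M
  proof (induction M)
    case 0
    then show ?case using mom fV by (simp add: Mom_def)
  next
    case (Suc M)
    then show ?case using Mom_A[OF Suc] by simp
  qed
  have nrm: "(norm (Abs_l2 ((A ^^ M) f)))\<^sup>2 = (\<integral>x. (poly q x) ^ (M + M) \<partial>\<mu>)" for M
  proof -
    have "complex_of_real ((norm (Abs_l2 ((A ^^ M) f)))\<^sup>2) = ell2_inner V ((A ^^ M) f) ((A ^^ M) f)"
      by (simp only: ell2_inner_eq Ak fV cin_eq_norm)
    also have "\<dots> = ell2_inner V f ((A ^^ (M + M)) f)" by (simp add: Aks fV Ak funpow_add)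
    also have "\<dots> = complex_of_real (\<integral>x. (poly q x) ^ (M + M) \<partial>\<mu>)"
      using Mom_Ak[of "M + M"] unfolding Mom_def by (auto dest!: spec[of _ 0] simp: poly_power)
    finally show ?thesis by (simp only: of_real_eq_iff)
  qed
  have Ge: "G e = (\<lambda>v. 0)" by (simp add: G_def e(2))
  have z: "ell2_inner V (\<lambda>v. 0) h = 0" for h by (simp add: ell2_inner_def)
  have eA: "ell2_inner V e (A h) = ell2_inner V e h" if "h \<in> ell2 V" for h
  proof -
    have "ell2_inner V e (G (G h)) = 0" using Gs[OF e(1) Gi[OF that]] Ge z by simp
    then show ?thesis unfolding A_def using that e(1) by (simp only: ell2_inner_lin Gi) simp
  qed
  have eAk: "ell2_inner V e ((A ^^ M) f) = ell2_inner V e f" for M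
    by (induction M) (simp_all add: eA Ak fV)
  have le: "cmod (ell2_inner V e f) \<le> norm (Abs_l2 e) * norm (Abs_l2 ((A ^^ M) f))" for M
    using cin_bound[of "Abs_l2 e" "Abs_l2 ((A ^^ M) f)"] eAk[of M]
    by (simp add: ell2_inner_eq e(1) Ak fV)
  have q01: "0 < poly q x \<and> poly q x \<le> 1 \<and> (x \<noteq> b \<longrightarrow> poly q x < 1)" if "\<bar>x\<bar> \<le> R0" for x
  proof -
    have "\<bar>(x - b) / R\<bar> < 1" using that R1 by (simp add: R_def divide_less_eq)
    then have "((x - b) / R)\<^sup>2 < 1" by (simp add: abs_square_less_1)
    then show ?thesis using R1 by (simp add: pq)
  qed
  have "(\<lambda>M. \<integral>x. (poly q x) ^ (M + M) \<partial>\<mu>) \<longlonglongrightarrow> (\<integral>x. indicator {b} x \<partial>\<mu>)"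
  proof (rule integral_dominated_convergence[where w = "\<lambda>_. 1"])
    have "(\<lambda>x. poly q x ^ (M + M)) \<in> borel_measurable borel" for M
      by (intro borel_measurable_continuous_onI continuous_intros)
    then show "(\<lambda>x. poly q x ^ (M + M)) \<in> borel_measurable \<mu>" for M
      by (simp add: measurable_cong_sets[OF s refl])
    show "AE x in \<mu>. (\<lambda>M. (poly q x) ^ (M + M)) \<longlonglongrightarrow> indicator {b} x"
      using R0
    proof eventually_elim
      case (elim x)
      show ?case
      proof (cases "x = b")
        case True
        then show ?thesis by (simp add: pq)
      next
        case False
        have "(\<lambda>M. ((poly q x)\<^sup>2) ^ M) \<longlonglongrightarrow> 0"
          using q01[OF elim] False by (intro LIMSEQ_realpow_zero) (auto simp: power_less_one_iff)
        then show ?thesis using False by (simp add: power_add power2_eq_square power_mult_distrib)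
      qed
    qed
    show "AE x in \<mu>. norm ((poly q x) ^ (M + M)) \<le> 1" for M
      using R0
    proof eventually_elim
      case (elim x)
      then show ?case using q01[OF elim] by (auto simp: power_le_one)
    qed
  qed (auto simp: measurable_cong_sets[OF s refl])
  also have "(\<integral>x. indicator {b} x \<partial>\<mu>) = (0 :: real)"
  proof -
    have "{b} \<in> null_sets lborel" by (rule finite_imp_null_set_lborel) simp
    then have "{b} \<in> null_sets \<mu>" using mu(2) by (auto simp: absolutely_continuous_def)
    moreover from this have "measure \<mu> {b} = 0" by (rule measure_eq_0_null_sets)
    moreover have "{b} \<inter> space \<mu> = {b}" using sets_eq_imp_space_eq[OF s] by simp
    ultimately show ?thesis by simp
  qed
  finally have "(\<lambda>M. (norm (Abs_l2 ((A ^^ M) f)))\<^sup>2) \<longlonglongrightarrow> 0" by (simp add: nrm)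
  from tendsto_real_sqrt[OF this] have "(\<lambda>M. norm (Abs_l2 ((A ^^ M) f))) \<longlonglongrightarrow> 0" by simp
  then have "(\<lambda>M. norm (Abs_l2 e) * norm (Abs_l2 ((A ^^ M) f))) \<longlonglongrightarrow> 0" by (rule tendsto_mult_right_zero)
  then have "cmod (ell2_inner V e f) \<le> 0" using le by (intro LIMSEQ_le_const) auto
  then show ?thesis by simp
qed

text \<open>Separates the spectral theory from the geometry: of the graph only the orbit coordinates
  \<open>pt\<close> and the action of the operator in them remain.\<close>

locale pendant_model = secular \<nu> \<beta> c
  for \<nu> :: nat and \<beta> :: "nat \<Rightarrow> real" and c :: real +
  fixes V :: "'v set" and pt :: "nat \<Rightarrow> int ^ 'n::finite \<Rightarrow> 'v" and H :: "('v \<Rightarrow> complex) \<Rightarrow> 'v \<Rightarrow> complex"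
  assumes bij: "bij_betw (\<lambda>(j, m). pt j m) ({1..\<nu>} \<times> UNIV) V"
    and H_out: "\<And>f v. v \<notin> V \<Longrightarrow> f v = 0 \<Longrightarrow> H f v = 0"
    and H_pend: "\<And>f j m. j \<in> {1..<\<nu>} \<Longrightarrow> H f (pt j m) = of_real (\<beta> j) * f (pt j m) - f (pt \<nu> m)"
    and H_hub: "\<And>f m. H f (pt \<nu> m) = of_real c * f (pt \<nu> m) + (of_nat (2 * CARD('n)) * f (pt \<nu> m)
        - (\<Sum>i\<in>UNIV. f (pt \<nu> (m + ax i)) + f (pt \<nu> (m - ax i)))) - (\<Sum>j\<in>{1..<\<nu>}. f (pt j m))"
begin

definition comp :: "('v \<Rightarrow> complex) \<Rightarrow> nat \<Rightarrow> (int ^ 'n) l2" where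
  "comp f j = Abs_l2 (\<lambda>m. f (pt j m))"
text \<open>Assembles a square summable function on \<open>V\<close> from its components; inverse to
  \<open>comp\<close> on \<open>idx\<close>.\<close>

definition mk :: "(nat \<Rightarrow> (int ^ 'n) l2) \<Rightarrow> 'v \<Rightarrow> complex" where
  "mk h v = (if v \<in> V then (case inv_into ({1..\<nu>} \<times> UNIV) (\<lambda>(j, m). pt j m) v of (j, m) \<Rightarrow> ap (h j) m) else 0)"
definition Hl :: "(nat \<Rightarrow> (int ^ 'n) l2) \<Rightarrow> nat \<Rightarrow> (int ^ 'n) l2" where
  "Hl h k = (if k = \<nu> then scl (of_real c) (h \<nu>) + lap (h \<nu>) - (\<Sum>j\<in>{1..<\<nu>}. h j)
     else scl (of_real (\<beta> k)) (h k) - h \<nu>)"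

lemma pt_V: "j \<in> idx \<Longrightarrow> pt j m \<in> V"
  using bij by (auto simp: bij_betw_def idx_def)

lemma V_pt: assumes "v \<in> V" obtains j m where "j \<in> idx" "v = pt j m"
  using bij assms by (auto simp: bij_betw_def idx_def)

lemma pt_eq: "j \<in> idx \<Longrightarrow> k \<in> idx \<Longrightarrow> pt j m = pt k n \<longleftrightarrow> j = k \<and> m = n"
  using inj_on_eq_iff[OF bij_betw_imp_inj_on[OF bij], of "(j, m)" "(k, n)"] by (simp add: idx_def)

lemma nu_idx: "\<nu> \<in> idx" and J_idx: "j \<in> {1..<\<nu>} \<Longrightarrow> j \<in> idx"
  using nu2 by (auto simp: idx_def)

lemma idx_cases: assumes "k \<in> idx" obtains "k = \<nu>" | "k \<in> {1..<\<nu>}" "k \<noteq> \<nu>"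
  using assms by (force simp: idx_def)

lemma finite_idx: "finite idx" by (simp add: idx_def)

lemma infsum_V:
  fixes u :: "'v \<Rightarrow> complex"
  assumes "(\<lambda>v. norm (u v)) summable_on V" shows "infsum u V = (\<Sum>j\<in>idx. infsum (\<lambda>m. u (pt j m)) UNIV)"
proof -
  have r: "(\<lambda>(j, m). u (pt j m)) summable_on idx \<times> UNIV"
    using summable_on_reindex_bij_betw[OF bij, of u] Infinite_Sum.abs_summable_summable[OF assms] unfolding idx_def
    by (simp add: case_prod_unfold)
  have "infsum u V = infsum (\<lambda>(j, m). u (pt j m)) (idx \<times> UNIV)"
    using infsum_reindex_bij_betw[OF bij, of u] by (simp add: case_prod_unfold idx_def)
  also have "\<dots> = infsum (\<lambda>j. infsum (\<lambda>m. u (pt j m)) UNIV) idx"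
    using infsum_Sigma'_banach[OF r] by simp
  finally show ?thesis using finite_idx by simp
qed

lemma sqs_comp_pt: assumes "f \<in> ell2 V" "j \<in> idx" shows "sqs (\<lambda>m. f (pt j m))"
proof -
  have i: "inj (pt j)" using pt_eq assms(2) by (auto simp: inj_def)
  have "(\<lambda>v. (cmod (f v))\<^sup>2) summable_on range (pt j)"
    using assms(1) unfolding ell2_iff sqs_def by (auto intro: summable_on_subset)
  then show ?thesis unfolding sqs_def by (subst (asm) summable_on_reindex[OF i]) (simp add: o_def)
qed

lemma ap_comp: "f \<in> ell2 V \<Longrightarrow> j \<in> idx \<Longrightarrow> ap (comp f j) m = f (pt j m)"
  by (simp add: comp_def ap_Abs sqs_comp_pt)

lemma ell2_inner_comp: assumes "f \<in> ell2 V" "g \<in> ell2 V"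
  shows "ell2_inner V f g = (\<Sum>j\<in>idx. cin (comp f j) (comp g j))"
proof -
  have "(\<lambda>v. cnj (f v) * g v) summable_on V"
    using assms by (intro cin_summable) (auto simp: ell2_iff)
  then have "(\<lambda>v. norm (cnj (f v) * g v)) summable_on V"
    by (simp add: summable_on_iff_abs_summable_on_complex)
  from infsum_V[OF this] show ?thesis
    unfolding ell2_inner_def cin_def by (simp add: ap_comp assms)
qed

lemma ell2_norm_comp: assumes "f \<in> ell2 V"
  shows "ell2_norm V f = sqrt (\<Sum>j\<in>idx. (norm (comp f j))\<^sup>2)"
proof -
  have "complex_of_real ((ell2_norm V f)\<^sup>2) = ell2_inner V f f"
    by (simp only: ell2_norm_eq ell2_inner_eq assms cin_eq_norm)
  also have "\<dots> = complex_of_real (\<Sum>j\<in>idx. (norm (comp f j))\<^sup>2)"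
    by (simp only: ell2_inner_comp assms cin_eq_norm of_real_sum)
  finally have "(ell2_norm V f)\<^sup>2 = (\<Sum>j\<in>idx. (norm (comp f j))\<^sup>2)" by (simp only: of_real_eq_iff)
  moreover have "ell2_norm V f \<ge> 0" using assms by (simp add: ell2_norm_eq)
  ultimately show ?thesis by (metis real_sqrt_unique)
qed

lemma norm_comp_le: assumes "f \<in> ell2 V" "j \<in> idx" shows "norm (comp f j) \<le> ell2_norm V f"
proof -
  have "(norm (comp f j))\<^sup>2 \<le> (\<Sum>j\<in>idx. (norm (comp f j))\<^sup>2)"
    using assms(2) finite_idx by (intro member_le_sum) auto
  then show ?thesis unfolding ell2_norm_comp[OF assms(1)] by (simp add: real_le_rsqrt)
qed

lemma ell2_norm_le: assumes "f \<in> ell2 V" shows "ell2_norm V f \<le> (\<Sum>j\<in>idx. norm (comp f j))"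
  unfolding ell2_norm_comp[OF assms] using L2_set_le_sum[of idx "\<lambda>j. norm (comp f j)"]
  by (simp add: L2_set_def)

lemma mk_pt: "j \<in> idx \<Longrightarrow> mk h (pt j m) = ap (h j) m"
proof -
  assume j: "j \<in> idx"
  have "inv_into ({1..\<nu>} \<times> UNIV) (\<lambda>(j, m). pt j m) ((\<lambda>(j, m). pt j m) (j, m)) = (j, m)"
    by (rule inv_into_f_f) (use bij j in \<open>auto simp: bij_betw_def idx_def\<close>)
  then show ?thesis using pt_V[OF j] by (simp add: mk_def)
qed

lemma mk_ell2: "mk h \<in> ell2 V"
proof -
  have "(\<lambda>x. norm ((cmod (case x of (j, m) \<Rightarrow> ap (h j) m))\<^sup>2)) summable_on idx \<times> UNIV"
    unfolding Infinite_Sum.abs_summable_on_Sigma_iff using finite_idx sqs_ap by (auto simp: sqs_def)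
  then have "(\<lambda>x. (cmod (mk h ((\<lambda>(j, m). pt j m) x)))\<^sup>2) summable_on idx \<times> UNIV"
    by (subst summable_on_cong[where g = "\<lambda>x. norm ((cmod (case x of (j, m) \<Rightarrow> ap (h j) m))\<^sup>2)"]) (auto simp: mk_pt)
  then have "(\<lambda>v. (cmod (mk h v))\<^sup>2) summable_on V"
    using summable_on_reindex_bij_betw[OF bij, of "\<lambda>v. (cmod (mk h v))\<^sup>2"] by (simp add: idx_def)
  then show ?thesis by (simp add: ell2_def mk_def)
qed

lemma comp_mk: "j \<in> idx \<Longrightarrow> comp (mk h) j = h j"
  by (rule l2_eqI) (simp add: ap_comp mk_ell2 mk_pt)

lemma ell2_eqI: assumes "f \<in> ell2 V" "g \<in> ell2 V" "\<And>j. j \<in> idx \<Longrightarrow> comp f j = comp g j" shows "f = g"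
proof
  fix v
  show "f v = g v"
  proof (cases "v \<in> V")
    case True
    then obtain j m where "j \<in> idx" "v = pt j m" using V_pt by blast
    then show ?thesis using assms ap_comp by metis
  next
    case False
    then show ?thesis using assms by (simp add: ell2_iff)
  qed
qed

lemma H_mk: assumes "f \<in> ell2 V" shows "H f = mk (Hl (comp f))"
proof
  fix v
  show "H f v = mk (Hl (comp f)) v"
  proof (cases "v \<in> V")
    case True
    then obtain j m where jm: "j \<in> idx" "v = pt j m" using V_pt by blast
    from jm(1) show ?thesis
    proof (cases rule: idx_cases)
      case 1
      then show ?thesis unfolding jm(2) mk_pt[OF jm(1)]
        by (simp add: Hl_def H_hub ap_simps ap_lap ap_sum ap_comp assms nu_idx J_idx)
    next
      case 2
      then show ?thesis unfolding jm(2) mk_pt[OF jm(1)]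
        by (simp add: Hl_def H_pend ap_simps ap_comp assms nu_idx J_idx)
    qed
  next
    case False
    then show ?thesis using assms H_out[OF False] by (simp add: ell2_iff mk_def)
  qed
qed

lemma H_ell2: "f \<in> ell2 V \<Longrightarrow> H f \<in> ell2 V"
  by (simp add: H_mk mk_ell2)

lemma comp_H: "f \<in> ell2 V \<Longrightarrow> j \<in> idx \<Longrightarrow> comp (H f) j = Hl (comp f) j"
  by (simp add: H_mk comp_mk)

lemma comp_lin: "f \<in> ell2 V \<Longrightarrow> g \<in> ell2 V \<Longrightarrow> j \<in> idx \<Longrightarrow>
    comp (\<lambda>v. a * f v + b * g v) j = scl a (comp f j) + scl b (comp g j)"
  by (rule l2_eqI) (simp add: ap_comp ell2_lin ap_simps)

lemma Hl_lin: "Hl (\<lambda>j. scl a (h j) + scl b (k j)) j = scl a (Hl h j) + scl b (Hl k j)"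
  by (simp add: Hl_def scl_lin lap_lin sum.distrib mult.commute algebra_simps)

lemma Hl_cong: "(\<And>j. j \<in> idx \<Longrightarrow> h j = k j) \<Longrightarrow> j \<in> idx \<Longrightarrow> Hl h j = Hl k j"
  using J_idx nu_idx by (simp add: Hl_def)

lemma H_lin: assumes "f \<in> ell2 V" "g \<in> ell2 V"
  shows "H (\<lambda>v. a * f v + b * g v) = (\<lambda>v. a * H f v + b * H g v)"
proof (rule ell2_eqI)
  fix j assume j: "j \<in> idx"
  have "comp (H (\<lambda>v. a * f v + b * g v)) j = Hl (\<lambda>j. scl a (comp f j) + scl b (comp g j)) j"
    using assms j by (simp add: comp_H ell2_lin) (rule Hl_cong, simp_all add: comp_lin)
  then show "comp (H (\<lambda>v. a * f v + b * g v)) j = comp (\<lambda>v. a * H f v + b * H g v) j"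
    using assms j by (simp add: Hl_lin comp_lin H_ell2 comp_H)
qed (intro H_ell2 ell2_lin assms)+

lemma H_sym: assumes "f \<in> ell2 V" "g \<in> ell2 V" shows "ell2_inner V (H f) g = ell2_inner V f (H g)"
proof -
  have "ell2_inner V (H f) g = (\<Sum>j\<in>idx. cin (Hl (comp f) j) (comp g j))"
    using assms by (simp add: ell2_inner_comp H_ell2 comp_H)
  also have "\<dots> = (\<Sum>j\<in>idx. cin (comp f j) (Hl (comp g) j))"
    unfolding sum_idx by (simp add: Hl_def cin_add cin_diff cin_add_right cin_diff_right cin_scl cin_scl_right
        cin_lap cin_sum cin_sum_right sum_subtractf)
  also have "\<dots> = ell2_inner V f (H g)"
    using assms by (simp add: ell2_inner_comp H_ell2 comp_H)
  finally show ?thesis .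
qed

text \<open>\<open>Mset UNIV\<close> turns out to be the absolutely continuous subspace.\<close>

definition Mset :: "real set \<Rightarrow> ('v \<Rightarrow> complex) set" where
  "Mset K = {f \<in> ell2 V. \<forall>i\<in>{1..<\<nu>}. \<forall>j\<in>{1..<\<nu>}. \<beta> i = \<beta> j \<and> \<beta> i \<in> K \<longrightarrow> comp f i = comp f j}"
definition symk :: "real set \<Rightarrow> (nat \<Rightarrow> (int ^ 'n) l2) \<Rightarrow> bool" where
  "symk K h \<longleftrightarrow> (\<forall>i\<in>{1..<\<nu>}. \<forall>j\<in>{1..<\<nu>}. \<beta> i = \<beta> j \<and> \<beta> i \<in> K \<longrightarrow> h i = h j)"
definition Rz :: "complex \<Rightarrow> (nat \<Rightarrow> (int ^ 'n) l2) \<Rightarrow> nat \<Rightarrow> (int ^ 'n) l2" where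
  "Rz z h k = Hl h k - scl z (h k)"

lemma Mset_empty: "Mset {} = ell2 V" by (auto simp: Mset_def)

lemma Mset_symk: "f \<in> Mset K \<longleftrightarrow> f \<in> ell2 V \<and> symk K (comp f)"
  by (auto simp: Mset_def symk_def)

lemma symk_cong: "(\<And>j. j \<in> idx \<Longrightarrow> h j = k j) \<Longrightarrow> symk K h \<longleftrightarrow> symk K k"
  unfolding symk_def by (intro ball_cong refl) (simp add: J_idx)

lemma mk_Mset: "symk K h \<Longrightarrow> mk h \<in> Mset K"
  unfolding Mset_symk using symk_cong[of "comp (mk h)" h K] by (simp add: mk_ell2 comp_mk)

lemma symk_Rz: "symk K h \<Longrightarrow> symk K (Rz z h)"
  unfolding symk_def
proof (intro ballI impI)
  fix i j assume h: "\<forall>i\<in>{1..<\<nu>}. \<forall>j\<in>{1..<\<nu>}. \<beta> i = \<beta> j \<and> \<beta> i \<in> K \<longrightarrow> h i = h j"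
    and ij: "i \<in> {1..<\<nu>}" "j \<in> {1..<\<nu>}" "\<beta> i = \<beta> j \<and> \<beta> i \<in> K"
  have "h i = h j" using h ij by blast
  then show "Rz z h i = Rz z h j" using ij by (simp add: Rz_def Hl_def)
qed

lemma resolvent_ell2: "f \<in> ell2 V \<Longrightarrow> (\<lambda>v. H f v - z * f v) \<in> ell2 V"
  using ell2_lin[of "H f" V f 1 "- z"] H_ell2 by simp

lemma comp_resolvent: "f \<in> ell2 V \<Longrightarrow> j \<in> idx \<Longrightarrow> comp (\<lambda>v. H f v - z * f v) j = Rz z (comp f) j"
  using comp_lin[of "H f" f j 1 "- z"] H_ell2[of f]
  by (simp add: Rz_def comp_H scl_lin) (rule l2_eqI, simp add: ap_simps)

lemma resolvent_Mset: "f \<in> Mset K \<Longrightarrow> (\<lambda>v. H f v - z * f v) \<in> Mset K"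
  unfolding Mset_symk using symk_cong[of "comp (\<lambda>v. H f v - z * f v)" "Rz z (comp f)" K]
  by (auto simp: resolvent_ell2 comp_resolvent symk_Rz)

text \<open>Component norms and the norm on \<open>V\<close> agree up to factors
  \<open>card idx\<close>. Hence an estimate by components yields injectivity and a bounded inverse,
  while a solution that respects the symmetry yields surjectivity within the subspace.\<close>

lemma not_spectrumI:
  assumes bd: "\<And>h k. symk K h \<Longrightarrow> k \<in> idx \<Longrightarrow> norm (h k) \<le> C * (\<Sum>j\<in>idx. norm (Rz z h j))"
    and surj: "\<And>g. symk K g \<Longrightarrow> \<exists>h. symk K h \<and> (\<forall>j\<in>idx. Rz z h j = g j)" and C: "C \<ge> 0"
  shows "z \<notin> spectrum_on V (Mset K) H"
proof -
  let ?T = "\<lambda>f v. H f v - z * f v"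
  define m where "m = real (card idx)"
  have b: "ell2_norm V f \<le> m * (C * (m * ell2_norm V (?T f)))" if f: "f \<in> Mset K" for f
  proof -
    have fe: "f \<in> ell2 V" "symk K (comp f)" using f by (auto simp: Mset_symk)
    have "(\<Sum>j\<in>idx. norm (Rz z (comp f) j)) \<le> (\<Sum>j\<in>idx. ell2_norm V (?T f))"
      using norm_comp_le[OF resolvent_ell2[OF fe(1)]] comp_resolvent[OF fe(1)] by (intro sum_mono) metis
    then have "C * (\<Sum>j\<in>idx. norm (Rz z (comp f) j)) \<le> C * (m * ell2_norm V (?T f))"
      using C by (intro mult_left_mono) (auto simp: m_def)
    then have "(\<Sum>j\<in>idx. norm (comp f j)) \<le> (\<Sum>j\<in>idx. C * (m * ell2_norm V (?T f)))"
      using bd[OF fe(2)] by (intro sum_mono) (meson order_trans)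
    then show ?thesis using ell2_norm_le[OF fe(1)] by (simp add: m_def)
  qed
  have "inj_on ?T (Mset K)"
  proof (rule inj_onI)
    fix f g assume fg: "f \<in> Mset K" "g \<in> Mset K" "?T f = ?T g"
    have e: "f \<in> ell2 V" "g \<in> ell2 V" "symk K (comp f)" "symk K (comp g)" using fg by (auto simp: Mset_symk)
    define h where "h j = scl 1 (comp f j) + scl (-1) (comp g j)" for j
    have "symk K h" using e(3,4) unfolding symk_def h_def by metis
    moreover have "Rz z h j = 0" if "j \<in> idx" for j
    proof -
      have "Rz z h j = scl 1 (Rz z (comp f) j) + scl (-1) (Rz z (comp g) j)"
        unfolding Rz_def h_def Hl_lin by (simp add: scl_lin mult.commute algebra_simps)
      also have "Rz z (comp f) j = Rz z (comp g) j"
        using comp_resolvent[OF e(1) that, of z] comp_resolvent[OF e(2) that, of z] fg(3) by simp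
      finally show ?thesis by (simp add: scl_lin(6)[symmetric]) (rule l2_eqI, simp add: ap_simps)
    qed
    ultimately have "h j = 0" if "j \<in> idx" for j using bd[of h j] that by simp
    then have "comp f j = comp g j" if "j \<in> idx" for j
      using that unfolding h_def by (metis ap_simps(1,4,6) l2_eqI add_eq_0_iff mult_1 mult_minus1 neg_equal_iff_equal)
    then show "f = g" using ell2_eqI[OF e(1,2)] by blast
  qed
  moreover have "?T ` Mset K = Mset K"
  proof (intro equalityI subsetI)
    fix g assume "g \<in> ?T ` Mset K"
    then show "g \<in> Mset K" using resolvent_Mset by blast
  next
    fix g assume g: "g \<in> Mset K"
    then have ge: "g \<in> ell2 V" "symk K (comp g)" by (auto simp: Mset_symk)
    obtain h where h: "symk K h" "\<And>j. j \<in> idx \<Longrightarrow> Rz z h j = comp g j" using surj[OF ge(2)] by blast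
    have "?T (mk h) = g"
    proof (rule ell2_eqI[OF resolvent_ell2[OF mk_ell2] ge(1)])
      fix j assume j: "j \<in> idx"
      have "Rz z (comp (mk h)) j = Rz z h j" unfolding Rz_def using Hl_cong[of "comp (mk h)" h j] j by (simp add: comp_mk)
      then show "comp (?T (mk h)) j = comp g j" using comp_resolvent[OF mk_ell2 j] h(2)[OF j] by simp
    qed
    then show "g \<in> ?T ` Mset K" using mk_Mset[OF h(1)] by blast
  qed
  ultimately show ?thesis unfolding spectrum_on_def bij_betw_def using b
    by (auto intro!: exI[of _ "m * (C * m)"] simp: mult.assoc)
qed

section \<open>Spectra on the symmetric subspaces\<close>

definition Fz :: "complex \<Rightarrow> complex" where
  "Fz z = z - of_real c + (\<Sum>j\<in>{1..<\<nu>}. 1 / (of_real (\<beta> j) - z))"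
definition symb_max :: real where "symb_max = 4 * real CARD('n)"

lemma Rz_J: "j \<in> {1..<\<nu>} \<Longrightarrow> Rz z h j = scl (of_real (\<beta> j) - z) (h j) - h \<nu>"
  by (simp add: Rz_def Hl_def scl_lin)

lemma Rz_nu: "Rz z h \<nu> = scl (of_real c - z) (h \<nu>) + lap (h \<nu>) - (\<Sum>j\<in>{1..<\<nu>}. h j)"
  by (simp add: Rz_def Hl_def scl_lin)

lemma norm_Rz_le: "k \<in> idx \<Longrightarrow> norm (Rz z h k) \<le> (\<Sum>j\<in>idx. norm (Rz z h j))"
  using finite_idx by (intro member_le_sum) auto

lemma idx_all: "(\<forall>k\<in>idx. P k) \<longleftrightarrow> P \<nu> \<and> (\<forall>j\<in>{1..<\<nu>}. P j)"
proof -
  have "idx = insert \<nu> {1..<\<nu>}" using nu2 by (auto simp: idx_def)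
  then show ?thesis by simp
qed

text \<open>Off the poles, each pendant equation gives its component in terms of the hub component.
  What remains is an equation for \<open>lap - Fz z\<close> at the hub, which
  \<open>lap_resolvent\<close> solves with a bound.\<close>

lemma not_spectrum_regular:
  assumes zB: "z \<notin> of_real ` B" and Fz: "Fz z \<notin> of_real ` {0..symb_max}"
  shows "z \<notin> spectrum_on V (Mset K) H"
proof -
  define e where "e j = 1 / (of_real (\<beta> j) - z)" for j
  have e: "(of_real (\<beta> j) - z) * e j = 1" if "j \<in> {1..<\<nu>}" for j
    using zB that by (auto simp: e_def B_def)
  have e2: "scl (of_real (\<beta> j) - z) (scl (e j) u) = u" "scl (e j) (scl (of_real (\<beta> j) - z) u) = u"
    if "j \<in> {1..<\<nu>}" for j and u :: "(int ^ 'n) l2"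
  proof -
    have "e j * (of_real (\<beta> j) - z) = 1" using e[OF that] by (simp only: mult.commute)
    then show "scl (of_real (\<beta> j) - z) (scl (e j) u) = u" "scl (e j) (scl (of_real (\<beta> j) - z) u) = u"
      by (simp_all only: scl_lin(3,7) e[OF that])
  qed
  have FE: "Fz z = z - of_real c + (\<Sum>j\<in>{1..<\<nu>}. e j)" by (simp add: Fz_def e_def)
  have se: "scl (\<Sum>j\<in>{1..<\<nu>}. e j) u = (\<Sum>j\<in>{1..<\<nu>}. scl (e j) u)" for u :: "(int ^ 'n) l2"
    by (rule l2_eqI) (simp add: ap_simps ap_sum sum_distrib_right)
  obtain C0 where C0: "C0 \<ge> 0" "\<And>g :: (int ^ 'n) l2. \<exists>f. lap f - scl (Fz z) f = g"
    "\<And>f :: (int ^ 'n) l2. norm f \<le> C0 * norm (lap f - scl (Fz z) f)"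
    using lap_resolvent[of "Fz z"] Fz unfolding symb_max_def by blast
  define E where "E = 1 + (\<Sum>j\<in>{1..<\<nu>}. cmod (e j))"
  have E1: "E \<ge> 1" by (simp add: E_def sum_nonneg)
  have eE: "cmod (e j) \<le> E" if "j \<in> {1..<\<nu>}" for j
    using member_le_sum[OF that, of "\<lambda>j. cmod (e j)"] by (simp add: E_def)
  show ?thesis
  proof (rule not_spectrumI[where C = "E * (1 + C0 * E)"])
    show "E * (1 + C0 * E) \<ge> 0" using E1 C0 by simp
  next
    fix h k assume k: "k \<in> idx"
    define S where "S = (\<Sum>j\<in>idx. norm (Rz z h j))"
    have S0: "S \<ge> 0" by (simp add: S_def sum_nonneg)
    have RS: "norm (Rz z h k) \<le> S" if "k \<in> idx" for k unfolding S_def by (rule norm_Rz_le[OF that])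
    have hj: "h j = scl (e j) (Rz z h j + h \<nu>)" if "j \<in> {1..<\<nu>}" for j
      unfolding Rz_J[OF that] using e2[OF that] by simp
    have "(\<Sum>j\<in>{1..<\<nu>}. h j) = (\<Sum>j\<in>{1..<\<nu>}. scl (e j) (Rz z h j)) + scl (\<Sum>j\<in>{1..<\<nu>}. e j) (h \<nu>)"
      unfolding se sum.distrib[symmetric] by (intro sum.cong refl) (subst hj, auto simp: scl_lin)
    then have eq: "lap (h \<nu>) - scl (Fz z) (h \<nu>) = Rz z h \<nu> + (\<Sum>j\<in>{1..<\<nu>}. scl (e j) (Rz z h j))"
      unfolding FE Rz_nu by (simp add: scl_lin)
    have "norm (lap (h \<nu>) - scl (Fz z) (h \<nu>)) \<le> norm (Rz z h \<nu>) + (\<Sum>j\<in>{1..<\<nu>}. norm (scl (e j) (Rz z h j)))"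
      unfolding eq by (rule order_trans[OF norm_triangle_ineq add_left_mono[OF norm_sum]])
    also have "\<dots> \<le> S + (\<Sum>j\<in>{1..<\<nu>}. cmod (e j) * S)"
      using RS nu_idx J_idx by (intro add_mono sum_mono) (auto simp: norm_scl mult_left_mono)
    also have "\<dots> = E * S" by (simp add: E_def distrib_right sum_distrib_right)
    finally have "C0 * norm (lap (h \<nu>) - scl (Fz z) (h \<nu>)) \<le> C0 * (E * S)" using C0(1) by (rule mult_left_mono)
    then have hn: "norm (h \<nu>) \<le> C0 * E * S" using C0(3)[of "h \<nu>"] by simp
    from k show "norm (h k) \<le> E * (1 + C0 * E) * S"
    proof (cases rule: idx_cases)
      case 1
      have "C0 * E * S \<le> E * (1 + C0 * E) * S"
      proof (rule mult_right_mono[OF _ S0])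
        have "C0 * E \<le> E * (C0 * E)" using mult_right_mono[OF E1, of "C0 * E"] C0 E1 by simp
        then show "C0 * E \<le> E * (1 + C0 * E)" using E1 by (simp add: distrib_left)
      qed
      then show ?thesis using hn 1 by simp
    next
      case 2
      have "norm (h k) = cmod (e k) * norm (Rz z h k + h \<nu>)" using hj[OF 2(1)] by (metis norm_scl)
      also have "\<dots> \<le> E * (S + C0 * E * S)"
        using eE[OF 2(1)] RS[OF k] hn E1 norm_triangle_ineq[of "Rz z h k" "h \<nu>"] by (intro mult_mono) auto
      finally show ?thesis by (simp add: algebra_simps)
    qed
  next
    fix g assume g: "symk K g"
    obtain u where u: "lap u - scl (Fz z) u = g \<nu> + (\<Sum>j\<in>{1..<\<nu>}. scl (e j) (g j))" using C0(2) by blast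
    define h where "h k = (if k = \<nu> then u else scl (e k) (g k + u))" for k
    have hnu: "h \<nu> = u" by (simp add: h_def)
    have hj: "h j = scl (e j) (g j + u)" if "j \<in> {1..<\<nu>}" for j using that by (simp add: h_def)
    have "symk K h" unfolding symk_def
    proof (intro ballI impI)
      fix i j assume ij: "i \<in> {1..<\<nu>}" "j \<in> {1..<\<nu>}" "\<beta> i = \<beta> j \<and> \<beta> i \<in> K"
      then have "g i = g j" using g unfolding symk_def by blast
      then show "h i = h j" using ij by (simp add: h_def e_def)
    qed
    moreover have "\<forall>j\<in>idx. Rz z h j = g j" unfolding idx_all
    proof (intro conjI ballI)
      show "Rz z h j = g j" if "j \<in> {1..<\<nu>}" for j
        unfolding Rz_J[OF that] hj[OF that] hnu using e2[OF that] by simp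
      have "(\<Sum>j\<in>{1..<\<nu>}. h j) = (\<Sum>j\<in>{1..<\<nu>}. scl (e j) (g j)) + scl (\<Sum>j\<in>{1..<\<nu>}. e j) u"
        unfolding se sum.distrib[symmetric] by (intro sum.cong refl) (simp add: hj scl_lin)
      moreover have "lap u = g \<nu> + (\<Sum>j\<in>{1..<\<nu>}. scl (e j) (g j)) + scl (Fz z) u" using u by (metis diff_add_cancel)
      ultimately show "Rz z h \<nu> = g \<nu>" unfolding Rz_nu hnu FE by (simp add: scl_lin)
    qed
    ultimately show "\<exists>h. symk K h \<and> (\<forall>j\<in>idx. Rz z h j = g j)" by blast
  qed
qed

text \<open>At the pole, the roles change. A pendant equation with \<open>\<beta> j = b\<close>
  reads \<open>- h \<nu> = g j\<close> and determines the hub component, whereupon the hub equation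
  determines the component at the pole. For this, all components at the pole must agree: there is
  only one, or the subspace imposes it.\<close>

lemma not_spectrum_pole:
  assumes b: "b \<in> B" and m: "pole_mult b = 1 \<or> b \<in> K"
  shows "of_real b \<notin> spectrum_on V (Mset K) H"
proof -
  define Jb where "Jb = {j \<in> {1..<\<nu>}. \<beta> j = b}"
  define J' where "J' = {1..<\<nu>} - Jb"
  have JJ: "{1..<\<nu>} = Jb \<union> J'" "Jb \<inter> J' = {}" "finite Jb" "finite J'" by (auto simp: Jb_def J'_def)
  have J'J: "j \<in> {1..<\<nu>}" if "j \<in> J'" for j using that by (auto simp: J'_def)
  obtain j0 where j0: "j0 \<in> Jb" using b by (auto simp: B_def Jb_def)
  have j0J: "j0 \<in> {1..<\<nu>}" "\<beta> j0 = b" using j0 by (auto simp: Jb_def)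
  \<comment> \<open>The common component at the pole enters the hub equation once for each index,
    hence with this factor.\<close>
  define r where "r = complex_of_real (real (pole_mult b))"
  have r0: "r \<noteq> 0" "cmod r \<ge> 1" using pole_mult_pos[OF b] by (auto simp: r_def)
  have eqJ: "h j = h j0" if "symk K h" "j \<in> Jb" for h :: "nat \<Rightarrow> (int ^ 'n) l2" and j
    using m
  proof
    assume "pole_mult b = 1"
    then obtain x where "Jb = {x}" unfolding pole_mult_def Jb_def using card_1_singletonE by metis
    then show ?thesis using that j0 by auto
  next
    assume "b \<in> K" then show ?thesis using that j0 unfolding symk_def Jb_def by auto
  qed
  have sumJb: "(\<Sum>j\<in>{1..<\<nu>}. h j) = scl r (h j0) + (\<Sum>j\<in>J'. h j)" if "symk K h" for h :: "nat \<Rightarrow> (int ^ 'n) l2"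
  proof -
    have "(\<Sum>j\<in>{1..<\<nu>}. h j) = (\<Sum>j\<in>Jb. h j) + (\<Sum>j\<in>J'. h j)" unfolding JJ(1) by (rule sum.union_disjoint) (use JJ in auto)
    also have "(\<Sum>j\<in>Jb. h j) = (\<Sum>j\<in>Jb. h j0)" using eqJ[OF that] by (intro sum.cong) auto
    also have "\<dots> = scl r (h j0)"
      by (rule l2_eqI) (simp add: ap_sum ap_simps r_def pole_mult_def Jb_def)
    finally show ?thesis .
  qed
  define e where "e j = complex_of_real (1 / (\<beta> j - b))" for j
  have e2: "scl (of_real (\<beta> j) - of_real b) (scl (e j) u) = u" "scl (e j) (scl (of_real (\<beta> j) - of_real b) u) = u"
    if "j \<in> J'" for j and u :: "(int ^ 'n) l2"
  proof -
    have "(of_real (\<beta> j) - of_real b) * e j = 1"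
      using that unfolding e_def by (simp add: J'_def Jb_def) 
    moreover from this have "e j * (of_real (\<beta> j) - of_real b) = 1" by (simp only: mult.commute)
    ultimately show "scl (of_real (\<beta> j) - of_real b) (scl (e j) u) = u" "scl (e j) (scl (of_real (\<beta> j) - of_real b) u) = u"
      by (simp_all only: scl_lin(3,7))
  qed
  define E where "E = 2 + (\<Sum>j\<in>J'. 2 * cmod (e j)) + \<bar>c - b\<bar> + symb_max"
  have E2: "2 \<le> E" by (simp add: E_def symb_max_def sum_nonneg)
  show ?thesis
  proof (rule not_spectrumI[where C = E])
    show "E \<ge> 0" using E2 by simp
  next
    fix h k assume h: "symk K h" and k: "k \<in> idx"
    let ?R = "Rz (of_real b) h"
    define S where "S = (\<Sum>j\<in>idx. norm (?R j))"
    have S0: "S \<ge> 0" by (simp add: S_def sum_nonneg)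
    have RS: "norm (?R k) \<le> S" if "k \<in> idx" for k unfolding S_def by (rule norm_Rz_le[OF that])
    have "?R j0 = - h \<nu>" unfolding Rz_J[OF j0J(1)] j0J(2) by (simp add: scl_0)
    then have hn: "norm (h \<nu>) \<le> S" using RS[OF J_idx[OF j0J(1)]] by (metis norm_minus_cancel)
    have hJ': "norm (h j) \<le> 2 * cmod (e j) * S" if "j \<in> J'" for j
    proof -
      have "h j = scl (e j) (?R j + h \<nu>)" unfolding Rz_J[OF J'J[OF that]] using e2[OF that] by simp
      then have "norm (h j) = cmod (e j) * norm (?R j + h \<nu>)" by (metis norm_scl)
      also have "\<dots> \<le> cmod (e j) * (S + S)"
        using norm_triangle_ineq[of "?R j" "h \<nu>"] RS[OF J_idx[OF J'J[OF that]]] hn by (intro mult_left_mono) auto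
      finally show ?thesis by simp
    qed
    have "scl r (h j0) = scl (of_real c - of_real b) (h \<nu>) + lap (h \<nu>) - (\<Sum>j\<in>J'. h j) - ?R \<nu>"
      unfolding Rz_nu sumJb[OF h] by simp
    then have "norm (scl r (h j0)) \<le> norm (scl (of_real c - of_real b) (h \<nu>)) + norm (lap (h \<nu>)) + norm (\<Sum>j\<in>J'. h j) + norm (?R \<nu>)"
      by (smt (verit) norm_triangle_ineq norm_triangle_ineq4)
    also have "\<dots> \<le> \<bar>c - b\<bar> * S + symb_max * S + (\<Sum>j\<in>J'. 2 * cmod (e j) * S) + S"
    proof (intro add_mono)
      show "norm (scl (of_real c - of_real b) (h \<nu>)) \<le> \<bar>c - b\<bar> * S"
        using hn by (simp add: norm_scl mult_left_mono of_real_diff[symmetric] del: of_real_diff)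
      show "norm (lap (h \<nu>)) \<le> symb_max * S" using norm_lap[of "h \<nu>"] hn
        by (simp add: symb_max_def) (meson mult_left_mono of_nat_0_le_iff order_trans zero_le_mult_iff zero_le_numeral)
      show "norm (\<Sum>j\<in>J'. h j) \<le> (\<Sum>j\<in>J'. 2 * cmod (e j) * S)"
        using hJ' by (rule sum_norm_le)
      show "norm (?R \<nu>) \<le> S" by (rule RS[OF nu_idx])
    qed
    also have "\<dots> = (E - 1) * S" by (simp add: E_def sum_distrib_right[symmetric] distrib_right)
    finally have h0: "cmod r * norm (h j0) \<le> (E - 1) * S" by (simp add: norm_scl)
    have "norm (h j0) \<le> cmod r * norm (h j0)" using mult_right_mono[OF r0(2), of "norm (h j0)"] by simp
    also note h0
    also have "(E - 1) * S \<le> E * S" using S0 by (simp add: mult_right_mono)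
    finally have h0': "norm (h j0) \<le> E * S" .
    from k show "norm (h k) \<le> E * S"
    proof (cases rule: idx_cases)
      case 1
      then show ?thesis using hn mult_right_mono[of 1 E S] E2 S0 by simp
    next
      case 2
      show ?thesis
      proof (cases "k \<in> Jb")
        case True
        then show ?thesis using eqJ[OF h True] h0' by simp
      next
        case False
        then have k': "k \<in> J'" using 2 by (simp add: J'_def)
        have "2 * cmod (e k) \<le> (\<Sum>j\<in>J'. 2 * cmod (e j))"
          using k' JJ(4) by (intro member_le_sum) auto
        then have "2 * cmod (e k) \<le> E" by (simp add: E_def symb_max_def)
        then show ?thesis using hJ'[OF k'] S0 by (meson mult_right_mono order_trans)
      qed
    qed
  next
    fix g assume g: "symk K g"
    define u where "u = - g j0"
    define v where "v = scl (of_real c - of_real b) u + lap u - (\<Sum>j\<in>J'. scl (e j) (g j + u)) - g \<nu>"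
    define h where "h k = (if k = \<nu> then u else if k \<in> Jb then scl (1 / r) v else scl (e k) (g k + u))" for k
    have hnu: "h \<nu> = u" by (simp add: h_def)
    have hj: "h j = scl (e j) (g j + u)" if "j \<in> J'" for j using that by (auto simp: h_def J'_def)
    have hb: "h j = scl (1 / r) v" if "j \<in> Jb" for j using that by (auto simp: h_def Jb_def)
    have sh: "symk K h" unfolding symk_def
    proof (intro ballI impI)
      fix i j assume ij: "i \<in> {1..<\<nu>}" "j \<in> {1..<\<nu>}" "\<beta> i = \<beta> j \<and> \<beta> i \<in> K"
      then have "g i = g j" using g unfolding symk_def by blast
      then show "h i = h j" using ij by (simp add: h_def e_def Jb_def)
    qed
    moreover have "\<forall>j\<in>idx. Rz (of_real b) h j = g j" unfolding idx_all
    proof (intro conjI ballI)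
      fix j assume j: "j \<in> {1..<\<nu>}"
      show "Rz (of_real b) h j = g j"
      proof (cases "j \<in> Jb")
        case True
        then have "Rz (of_real b) h j = - u" unfolding Rz_J[OF j] hnu by (simp add: Jb_def scl_0)
        then show ?thesis using eqJ[OF g True] by (simp add: u_def)
      next
        case False
        then have "j \<in> J'" using j by (simp add: J'_def)
        then show ?thesis unfolding Rz_J[OF j] hnu using e2 hj by simp
      qed
    next
      have "scl r (h j0) = v" unfolding hb[OF j0] using r0 by (simp add: scl_lin)
      then have "(\<Sum>j\<in>{1..<\<nu>}. h j) = v + (\<Sum>j\<in>J'. scl (e j) (g j + u))" unfolding sumJb[OF sh] by (simp add: hj)
      then show "Rz (of_real b) h \<nu> = g \<nu>" unfolding Rz_nu hnu by (simp add: v_def)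
    qed
    ultimately show "\<exists>h. symk K h \<and> (\<forall>j\<in>idx. Rz (of_real b) h j = g j)" by blast
  qed
qed

lemma Fz_real: "x \<notin> B \<Longrightarrow> Fz (of_real x) = of_real (F x)"
  by (simp add: Fz_def F_def)

text \<open>\<open>Im (Fz z)\<close> is \<open>Im z\<close> times a positive factor.\<close>

lemma Fz_Im: assumes "z \<notin> of_real ` B" "Im (Fz z) = 0" shows "Im z = 0"
proof -
  have "Im (1 / (of_real (\<beta> j) - z)) = Im z / (cmod (of_real (\<beta> j) - z))\<^sup>2" for j
    by (simp add: Im_divide cmod_power2)
  then have "Im (Fz z) = Im z * (1 + (\<Sum>j\<in>{1..<\<nu>}. 1 / (cmod (of_real (\<beta> j) - z))\<^sup>2))"
    by (simp add: Fz_def distrib_left sum_distrib_left)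
  moreover have "(1 + (\<Sum>j\<in>{1..<\<nu>}. 1 / (cmod (of_real (\<beta> j) - z))\<^sup>2)) > 0"
    by (intro add_pos_nonneg sum_nonneg) auto
  ultimately show ?thesis using assms(2) by simp
qed

text \<open>An approximate eigenfunction of \<open>lap\<close> at the hub is extended so that the
  pendant equations hold exactly. The extension depends on the pole only and thus lies in every
  \<open>Mset K\<close>.\<close>

lemma spectrum_band:
  assumes x: "x \<notin> B" "F x \<in> {0..symb_max}" shows "of_real x \<in> spectrum_on V (Mset K) H"
proof (rule ccontr)
  assume "\<not> ?thesis"
  then obtain C where C: "\<And>f. f \<in> Mset K \<Longrightarrow> ell2_norm V f \<le> C * ell2_norm V (\<lambda>v. H f v - of_real x * f v)"
    unfolding spectrum_on_def by blast
  \<comment> \<open>Small enough for \<open>\<bar>C\<bar> * \<epsilon> < 1\<close>, which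
    contradicts the bound \<open>C\<close> of the inverse.\<close>
  define \<epsilon> where "\<epsilon> = 1 / (2 * (\<bar>C\<bar> + 1))"
  have \<epsilon>: "\<epsilon> > 0" by (simp add: \<epsilon>_def)
  obtain u :: "(int ^ 'n) l2" where u: "u \<noteq> 0" "norm (lap u - scl (of_real (F x)) u) \<le> \<epsilon> * norm u"
    using lap_approx[of "F x" \<epsilon>] x(2) \<epsilon> by (auto simp: symb_max_def)
  define e where "e j = complex_of_real (1 / (\<beta> j - x))" for j
  define h where "h k = (if k = \<nu> then u else scl (e k) u)" for k
  have hs: "symk K h" by (auto simp: symk_def h_def e_def)
  have RJ: "Rz (of_real x) h j = 0" if "j \<in> {1..<\<nu>}" for j
  proof -
    have "(of_real (\<beta> j) - of_real x) * e j = 1" using ne_B(2)[OF x(1) that] by (simp add: e_def)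
    then show ?thesis unfolding Rz_J[OF that] using that by (simp add: h_def scl_lin)
  qed
  have "(\<Sum>j\<in>{1..<\<nu>}. h j) = scl (\<Sum>j\<in>{1..<\<nu>}. e j) u"
    by (rule l2_eqI) (simp add: h_def ap_sum ap_simps sum_distrib_right)
  also have "(\<Sum>j\<in>{1..<\<nu>}. e j) = of_real (F x - x + c)" by (simp add: F_def e_def)
  finally have Rn: "Rz (of_real x) h \<nu> = lap u - scl (of_real (F x)) u"
    unfolding Rz_nu by (simp add: h_def scl_lin)
  let ?f = "mk h"
  have c: "comp (\<lambda>v. H ?f v - of_real x * ?f v) j = Rz (of_real x) h j" if "j \<in> idx" for j
    unfolding comp_resolvent[OF mk_ell2 that] Rz_def using Hl_cong[of "comp ?f" h j] that by (simp add: comp_mk)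
  have "norm u \<le> ell2_norm V ?f" using norm_comp_le[OF mk_ell2 nu_idx, of h] by (simp add: comp_mk nu_idx h_def)
  also have "\<dots> \<le> C * ell2_norm V (\<lambda>v. H ?f v - of_real x * ?f v)" by (rule C[OF mk_Mset[OF hs]])
  also have "\<dots> \<le> \<bar>C\<bar> * (\<Sum>j\<in>idx. norm (Rz (of_real x) h j))"
  proof (rule mult_mono)
    show "ell2_norm V (\<lambda>v. H ?f v - of_real x * ?f v) \<le> (\<Sum>j\<in>idx. norm (Rz (of_real x) h j))"
      using ell2_norm_le[OF resolvent_ell2[OF mk_ell2[of h], of "of_real x"]] by (simp add: c)
  qed (auto simp: ell2_norm_eq[OF resolvent_ell2[OF mk_ell2]])
  also have "(\<Sum>j\<in>idx. norm (Rz (of_real x) h j)) = norm (lap u - scl (of_real (F x)) u)"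
    unfolding sum_idx Rn by (simp add: RJ)
  also have "\<bar>C\<bar> * \<dots> \<le> \<bar>C\<bar> * (\<epsilon> * norm u)" using u(2) by (rule mult_left_mono) simp
  also have "\<dots> = (\<bar>C\<bar> * \<epsilon>) * norm u" by simp
  also have "\<dots> < 1 * norm u"
    using u(1) by (intro mult_strict_right_mono) (auto simp: \<epsilon>_def field_simps)
  finally show False by simp
qed

definition dipole :: "nat \<Rightarrow> nat \<Rightarrow> int ^ 'n \<Rightarrow> 'v \<Rightarrow> complex" where
  "dipole i j m v = (if v = pt i m then 1 else if v = pt j m then -1 else 0)"

text \<open>The two values cancel in the sum at the common hub, and the hub value 0 leaves only the
  diagonal term at the pendant vertices.\<close>

lemma dipole: assumes ij: "i \<in> {1..<\<nu>}" "j \<in> {1..<\<nu>}" "i \<noteq> j" "\<beta> i = \<beta> j"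
  shows "dipole i j m \<in> ell2 V" "H (dipole i j m) v = of_real (\<beta> i) * dipole i j m v"
proof -
  have pV: "pt i m \<in> V" "pt j m \<in> V" by (rule pt_V[OF J_idx[OF ij(1)]], rule pt_V[OF J_idx[OF ij(2)]])
  have "(\<lambda>v. (cmod (dipole i j m v))\<^sup>2) summable_on {pt i m, pt j m}" by simp
  then have "(\<lambda>v. (cmod (dipole i j m v))\<^sup>2) summable_on UNIV"
    by (subst (asm) summable_on_cong_neutral[where T = UNIV and g = "\<lambda>v. (cmod (dipole i j m v))\<^sup>2"]) (auto simp: dipole_def)
  then show e: "dipole i j m \<in> ell2 V" unfolding ell2_iff sqs_def using pV by (auto simp: dipole_def)
  have nu0: "dipole i j m (pt \<nu> n) = 0" for n
    using ij pt_eq[OF nu_idx J_idx[OF ij(1)]] pt_eq[OF nu_idx J_idx[OF ij(2)]] by (simp add: dipole_def)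
  have v: "dipole i j m (pt k n) = (if n = m then (if k = i then 1 else if k = j then -1 else 0) else 0)" if "k \<in> {1..<\<nu>}" for k n
    using pt_eq[OF J_idx[OF that] J_idx[OF ij(1)]] pt_eq[OF J_idx[OF that] J_idx[OF ij(2)]] by (simp add: dipole_def)
  show "H (dipole i j m) v = of_real (\<beta> i) * dipole i j m v"
  proof (cases "v \<in> V")
    case True
    then obtain k n where kn: "k \<in> idx" "v = pt k n" using V_pt by blast
    from kn(1) show ?thesis
    proof (cases rule: idx_cases)
      case 1
      have "(\<Sum>k\<in>{1..<\<nu>}. dipole i j m (pt k n)) = (\<Sum>k\<in>{1..<\<nu>}. (if k = i then (if n = m then 1 else 0) else 0) - (if k = j then (if n = m then 1 else 0) else 0))"
        using ij(3) by (intro sum.cong refl) (auto simp: v)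
      also have "\<dots> = 0" using ij(1,2) by (simp add: sum_subtractf)
      finally show ?thesis unfolding kn(2) 1 H_hub nu0 by simp
    next
      case 2
      then show ?thesis unfolding kn(2) H_pend[OF 2(1)] nu0 v[OF 2(1)] using ij by simp
    qed
  next
    case False
    then show ?thesis using e H_out[OF False, of "dipole i j m"] by (simp add: ell2_iff)
  qed
qed

lemma mult2_pair: assumes "pole_mult b \<ge> 2"
  obtains i j where "i \<in> {1..<\<nu>}" "j \<in> {1..<\<nu>}" "i \<noteq> j" "\<beta> i = b" "\<beta> j = b"
proof -
  let ?S = "{j \<in> {1..<\<nu>}. \<beta> j = b}"
  have "\<not> card ?S \<le> 1" using assms by (simp add: pole_mult_def)
  then have "\<not> (\<forall>x\<in>?S. \<forall>y\<in>?S. x = y)" using card_le_Suc0_iff_eq[of ?S] by simp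
  then show thesis using that by blast
qed

text \<open>A dipole at \<open>b\<close> violates injectivity, and it belongs to
  \<open>Mset K\<close> because no symmetry is imposed at \<open>b\<close>.\<close>

lemma spectrum_flat:
  assumes b: "pole_mult b \<ge> 2" "b \<notin> K" shows "of_real b \<in> spectrum_on V (Mset K) H"
proof (rule ccontr)
  assume "\<not> ?thesis"
  then have inj: "inj_on (\<lambda>f v. H f v - of_real b * f v) (Mset K)"
    unfolding spectrum_on_def bij_betw_def by blast
  obtain i j where ij: "i \<in> {1..<\<nu>}" "j \<in> {1..<\<nu>}" "i \<noteq> j" "\<beta> i = b" "\<beta> j = b" using mult2_pair[OF b(1)] by blast
  let ?f = "dipole i j 0"
  have ij': "\<beta> i = \<beta> j" using ij by simp
  have fe: "?f \<in> ell2 V" by (rule dipole(1)[OF ij(1-3) ij'])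
  have z0: "(\<lambda>v. 0) \<in> ell2 V" by (simp add: ell2_iff sqs_0)
  have c0: "comp ?f k = 0" if k: "k \<in> {1..<\<nu>}" "\<beta> k \<in> K" for k
  proof (rule l2_eqI)
    fix n
    have "k \<noteq> i" "k \<noteq> j" using k ij b by auto
    then show "ap (comp ?f k) n = ap 0 n"
      using pt_eq[OF J_idx[OF k(1)] J_idx[OF ij(1)]] pt_eq[OF J_idx[OF k(1)] J_idx[OF ij(2)]]
      unfolding ap_comp[OF fe J_idx[OF k(1)]] by (simp add: dipole_def ap_simps)
  qed
  have "?f \<in> Mset K" unfolding Mset_def using fe c0 by auto
  moreover have "(\<lambda>v. 0) \<in> Mset K" unfolding Mset_def using z0 by (auto simp: comp_def)
  moreover have "(\<lambda>v. H ?f v - of_real b * ?f v) = (\<lambda>v. H (\<lambda>v. 0) v - of_real b * 0)"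
  proof -
    have "H (\<lambda>v. 0 * 0 + 0 * 0) = (\<lambda>v. 0 * H (\<lambda>v. 0) v + 0 * H (\<lambda>v. 0) v)" by (rule H_lin[OF z0 z0])
    then show ?thesis using dipole(2)[OF ij(1-3) ij'] ij(4) by (simp add: fun_eq_iff)
  qed
  ultimately have "?f = (\<lambda>v. 0)" using inj unfolding inj_on_def by blast
  then have "?f (pt i 0) = 0" by simp
  then show False by (simp add: dipole_def)
qed

theorem spectrum_Mset:
  "spectrum_on V (Mset K) H = of_real ` ({x. x \<notin> B \<and> F x \<in> {0..symb_max}} \<union> {b. pole_mult b \<ge> 2 \<and> b \<notin> K})"
proof (intro equalityI subsetI)
  fix z assume z: "z \<in> spectrum_on V (Mset K) H"
  show "z \<in> of_real ` ({x. x \<notin> B \<and> F x \<in> {0..symb_max}} \<union> {b. pole_mult b \<ge> 2 \<and> b \<notin> K})"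
  proof (cases "z \<in> of_real ` B")
    case True
    then obtain b where b: "b \<in> B" "z = of_real b" by blast
    then have "\<not> (pole_mult b = 1 \<or> b \<in> K)" using not_spectrum_pole z by blast
    then have "pole_mult b \<ge> 2" "b \<notin> K" using pole_mult_pos[OF b(1)] by auto
    then show ?thesis using b by blast
  next
    case False
    then have "Fz z \<in> of_real ` {0..symb_max}" using not_spectrum_regular z by blast
    then obtain t where t: "t \<in> {0..symb_max}" "Fz z = of_real t" by blast
    then have "Im z = 0" using Fz_Im[OF False] by simp
    then have zr: "z = of_real (Re z)" by (simp add: complex_eq_iff)
    then have xB: "Re z \<notin> B" using False by (metis imageI)
    have "F (Re z) = t" using Fz_real[OF xB] zr t(2) by (metis of_real_eq_iff)
    then show ?thesis using zr xB t by blast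
  qed
qed (use spectrum_band spectrum_flat in blast)

end

text \<open>The product of \<open>count_space I\<close> and \<open>M\<close> is a disjoint union of
  copies of \<open>M\<close>. The measure is the image under \<open>E\<close> of the density
  \<open>w\<close> on it; moments follow by change of variables, and null sets have null preimages
  by assumption.\<close>

lemma ac_measure_exists:
  fixes M :: "'a measure" and E w :: "nat \<Rightarrow> 'a \<Rightarrow> real"
  assumes M: "prob_space M" and I: "finite I"
    and w: "\<And>n. n \<in> I \<Longrightarrow> integrable M (w n)" "\<And>n x. n \<in> I \<Longrightarrow> w n x \<ge> 0"
    and Em: "\<And>n. n \<in> I \<Longrightarrow> E n \<in> borel_measurable M"
    and Eb: "\<And>n x. n \<in> I \<Longrightarrow> \<bar>E n x\<bar> \<le> R"
    and null: "\<And>n A. n \<in> I \<Longrightarrow> A \<in> null_sets lborel \<Longrightarrow> AE x in M. E n x \<notin> A"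
  shows "\<exists>\<mu>. sets \<mu> = sets borel \<and> finite_measure \<mu> \<and> (AE x in \<mu>. \<bar>x\<bar> \<le> R) \<and> absolutely_continuous lborel \<mu> \<and>
    (\<forall>k. (\<integral>x. x ^ k \<partial>\<mu>) = (\<Sum>n\<in>I. \<integral>x. E n x ^ k * w n x \<partial>M))"
proof -
  interpret M: prob_space M by fact
  define MM where "MM = count_space I \<Otimes>\<^sub>M M"
  interpret C: sigma_finite_measure "count_space I" using I by (rule sigma_finite_measure_count_space_finite)
  interpret P: pair_sigma_finite "count_space I" M ..
  define W where "W p = w (fst p) (snd p)" for p
  define EE where "EE p = E (fst p) (snd p)" for p
  have cI: "countable I" using I by (rule countable_finite)
  have Wm[measurable]: "W \<in> borel_measurable MM" unfolding MM_def W_def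
    by (rule measurable_pair_measure_countable1[OF cI]) (use borel_measurable_integrable[OF w(1)] in simp)
  have Em'[measurable]: "EE \<in> borel_measurable MM" unfolding MM_def EE_def
    by (rule measurable_pair_measure_countable1[OF cI]) (use Em in simp)
  have sp: "fst p \<in> I" if "p \<in> space MM" for p using that by (auto simp: MM_def space_pair_measure)
  have W0: "AE p in MM. 0 \<le> W p" by (rule AE_I2) (auto simp: W_def dest: sp intro: w(2))
  define D where "D = density MM (\<lambda>p. ennreal (W p))"
  define \<mu> where "\<mu> = distr D borel EE"
  have ED[measurable]: "EE \<in> borel_measurable D" unfolding D_def by simp
  have nn: "(\<integral>\<^sup>+p. f p \<partial>MM) = (\<Sum>n\<in>I. \<integral>\<^sup>+x. f (n, x) \<partial>M)" if "f \<in> borel_measurable MM" for f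
    using M.nn_integral_fst[of f "count_space I"] that I unfolding MM_def
    by (simp add: nn_integral_count_space_finite)
  have fin: "finite_measure \<mu>"
  proof (rule finite_measureI)
    have "emeasure \<mu> (space \<mu>) = (\<integral>\<^sup>+p. ennreal (W p) \<partial>MM)"
    proof -
      have "emeasure \<mu> (space \<mu>) = emeasure D (space D)" unfolding \<mu>_def by (simp add: emeasure_distr)
      also have "\<dots> = (\<integral>\<^sup>+p. ennreal (W p) * indicator (space MM) p \<partial>MM)"
        unfolding D_def by (simp add: emeasure_density)
      also have "\<dots> = (\<integral>\<^sup>+p. ennreal (W p) \<partial>MM)" by (rule nn_integral_cong) simp
      finally show ?thesis .
    qed
    also have "\<dots> = (\<Sum>n\<in>I. \<integral>\<^sup>+x. ennreal (W (n, x)) \<partial>M)" by (rule nn) simp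
    also have "\<dots> = (\<Sum>n\<in>I. ennreal (\<integral>x. w n x \<partial>M))"
      using w by (auto simp: W_def nn_integral_eq_integral intro!: sum.cong)
    also have "\<dots> = ennreal (\<Sum>n\<in>I. \<integral>x. w n x \<partial>M)"
      by (rule sum_ennreal) (simp add: Bochner_Integration.integral_nonneg w(2))
    also have "\<dots> < \<infinity>" by simp
    finally show "emeasure \<mu> (space \<mu>) \<noteq> \<infinity>" by simp
  qed
  have bd: "AE x in \<mu>. \<bar>x\<bar> \<le> R"
  proof -
    have "AE p in D. \<bar>EE p\<bar> \<le> R" by (rule AE_I2) (use sp Eb in \<open>auto simp: D_def EE_def\<close>)
    then show ?thesis unfolding \<mu>_def by (subst AE_distr_iff) auto
  qed
  have ac: "absolutely_continuous lborel \<mu>" unfolding absolutely_continuous_def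
  proof
    fix A :: "real set" assume A: "A \<in> null_sets lborel"
    have [measurable]: "A \<in> sets borel" using A by auto
    have "emeasure \<mu> A = emeasure D (EE -` A \<inter> space D)" unfolding \<mu>_def by (subst emeasure_distr) auto
    also have "\<dots> = (\<integral>\<^sup>+p. ennreal (W p) * indicator (EE -` A \<inter> space MM) p \<partial>MM)"
      unfolding D_def by (subst emeasure_density) auto
    also have "\<dots> = (\<Sum>n\<in>I. \<integral>\<^sup>+x. ennreal (W (n, x)) * indicator (EE -` A \<inter> space MM) (n, x) \<partial>M)"
      by (rule nn) simp
    also have "\<dots> = (\<Sum>n\<in>I. 0)"
    proof (intro sum.cong refl nn_integral_zero')
      fix n assume "n \<in> I"
      from null[OF this A] show "AE x in M. ennreal (W (n, x)) * indicator (EE -` A \<inter> space MM) (n, x) = 0"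
        by eventually_elim (auto simp: EE_def indicator_def)
    qed
    finally show "A \<in> null_sets \<mu>" by (auto simp: \<mu>_def null_sets_def)
  qed
  have mom: "(\<integral>x. x ^ k \<partial>\<mu>) = (\<Sum>n\<in>I. \<integral>x. E n x ^ k * w n x \<partial>M)" for k
  proof -
    have i: "integrable M (\<lambda>x. E n x ^ k * w n x)" if "n \<in> I" for n
    proof (rule Bochner_Integration.integrable_bound[OF integrable_mult_right[OF w(1)[OF that], of "\<bar>R\<bar> ^ k"]])
      have [measurable]: "E n \<in> borel_measurable M" "w n \<in> borel_measurable M" using Em w(1) that by auto
      show "(\<lambda>x. E n x ^ k * w n x) \<in> borel_measurable M" by measurable
      have "\<bar>E n x\<bar> ^ k \<le> \<bar>R\<bar> ^ k" for x using Eb[OF that, of x] by (intro power_mono) auto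
      then show "AE x in M. norm (E n x ^ k * w n x) \<le> norm (\<bar>R\<bar> ^ k * w n x)"
        using w(2)[OF that] by (intro AE_I2) (simp add: abs_mult power_abs mult_right_mono)
    qed
    have iP: "integrable (count_space I \<Otimes>\<^sub>M M) (\<lambda>p. W p * EE p ^ k)"
    proof (rule P.Fubini_integrable)
      show "(\<lambda>p. W p * EE p ^ k) \<in> borel_measurable (count_space I \<Otimes>\<^sub>M M)"
        using Wm Em' unfolding MM_def by measurable
      show "integrable (count_space I) (\<lambda>n. \<integral>x. norm (W (n, x) * EE (n, x) ^ k) \<partial>M)"
        using I by (rule integrable_count_space)
      show "AE n in count_space I. integrable M (\<lambda>x. W (n, x) * EE (n, x) ^ k)"
        using i by (intro AE_I2) (simp add: W_def EE_def mult.commute)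
    qed
    have "(\<integral>x. x ^ k \<partial>\<mu>) = (\<integral>p. EE p ^ k \<partial>D)" unfolding \<mu>_def by (rule integral_distr) simp_all
    also have "\<dots> = (\<integral>p. W p *\<^sub>R (EE p ^ k) \<partial>MM)" unfolding D_def by (rule integral_density) (use W0 in simp_all)
    also have "\<dots> = (\<integral>n. (\<integral>x. W (n, x) * EE (n, x) ^ k \<partial>M) \<partial>count_space I)"
      using P.integral_fst'[OF iP] by (simp add: MM_def)
    also have "\<dots> = (\<Sum>n\<in>I. \<integral>x. W (n, x) * EE (n, x) ^ k \<partial>M)"
      using I by (simp add: lebesgue_integral_count_space_finite)
    also have "\<dots> = (\<Sum>n\<in>I. \<integral>x. E n x ^ k * w n x \<partial>M)" by (simp add: W_def EE_def mult.commute)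
    finally show ?thesis .
  qed
  show ?thesis using fin bd ac mom by (intro exI[of _ \<mu>]) (simp add: \<mu>_def)
qed

lemma FT_sum: "finite S \<Longrightarrow> S \<noteq> {} \<Longrightarrow> (\<And>j. j \<in> S \<Longrightarrow> FT (f j) (F j)) \<Longrightarrow> FT (\<Sum>j\<in>S. f j) (\<lambda>\<omega>. \<Sum>j\<in>S. F j \<omega>)"
proof (induction S rule: finite_ne_induct)
  case (insert k S)
  then show ?case using FT_add[of "f k" "F k" "\<Sum>j\<in>S. f j" "\<lambda>\<omega>. \<Sum>j\<in>S. F j \<omega>"] by simp
qed simp

section \<open>The absolutely continuous subspace and spectrum\<close>

context secular
begin

text \<open>\<open>F\<close> recovers the symbol from the branch and, being differentiable on the
  gap, sends null sets to null sets. This reduces the claim to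
  \<open>symb_AE_not_in\<close>.\<close>

lemma ev_AE_not_in:
  assumes n: "n \<in> bands" and A: "A \<in> null_sets lborel"
  shows "AE \<omega> in (tor :: ('n::finite \<Rightarrow> real) measure). ev n (symb \<omega>) \<notin> A"
proof -
  have n': "n \<in> {1..\<nu>}" "lo n < hi n" using n by (auto simp: bands_def)
  have "negligible A" using A by (simp add: negligible_iff_null_sets null_sets_completionI)
  then have negl: "negligible (A \<inter> gap n)" by (rule negligible_subset) simp
  have "negligible (F ` (A \<inter> gap n))"
  proof (rule negligible_differentiable_image_negligible[OF _ negl])
    show "F differentiable_on A \<inter> gap n"
      by (rule differentiable_at_imp_differentiable_on)
        (use F_deriv gap_B[OF n'(1)] differentiable_def has_field_derivative_def in blast)
  qed simp
  \<comment> \<open>The image under \<open>F\<close> need not be a Borel set, so it is enlarged to a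
    Borel null set.\<close>
  then obtain A' where A': "A' \<in> null_sets lborel" "F ` (A \<inter> gap n) \<subseteq> A'"
    unfolding negligible_iff_null_sets null_sets_completion_iff2 by blast
  show ?thesis using symb_AE_not_in[OF A'(1)]
  proof eventually_elim
    case (elim \<omega>)
    then show ?case using ev_gap[OF n', of "symb \<omega>"] A'(2) by (metis IntI image_eqI subsetD)
  qed
qed

lemma measurable_ev: "n \<in> {1..\<nu>} \<Longrightarrow> ev n \<in> borel_measurable borel"
  by (rule borel_measurable_mono[OF ev_mono])

lemma Hm_Suc:
  "(Hm t ^^ Suc r) x \<nu> = of_real (c + t) * (Hm t ^^ r) x \<nu> - (\<Sum>j\<in>{1..<\<nu>}. (Hm t ^^ r) x j)"
  "k \<in> {1..<\<nu>} \<Longrightarrow> (Hm t ^^ Suc r) x k = of_real (\<beta> k) * (Hm t ^^ r) x k - (Hm t ^^ r) x \<nu>"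
  by (simp_all add: Hm_def[of t "(Hm t ^^ r) x"])

end

context pendant_model
begin

lemma comp_Hpow: "f \<in> ell2 V \<Longrightarrow> (H ^^ r) f \<in> ell2 V"
  by (induction r) (auto simp: H_ell2)

text \<open>The transform turns \<open>lap\<close> into multiplication by the symbol, so
  \<open>H\<close> acts in each fibre as \<open>Hm (symb \<omega>)\<close>.\<close>

lemma FT_Hpow:
  assumes f: "f \<in> ell2 V" and X: "\<And>k. k \<in> idx \<Longrightarrow> FT (comp f k) (\<lambda>\<omega>. X \<omega> k)"
  shows "k \<in> idx \<Longrightarrow> FT (comp ((H ^^ r) f) k) (\<lambda>\<omega>. (Hm (symb \<omega>) ^^ r) (X \<omega>) k)"
proof (induction r arbitrary: k)
  case 0
  then show ?case using X by simp
next
  case (Suc r)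
  let ?g = "comp ((H ^^ r) f)" and ?Y = "\<lambda>\<omega>. (Hm (symb \<omega>) ^^ r) (X \<omega>)"
  have c: "comp ((H ^^ Suc r) f) k = Hl ?g k" using comp_H[OF comp_Hpow[OF f] Suc.prems] by simp
  have neg: "FT (- u) (\<lambda>\<omega>. - U \<omega>)" if "FT u U" for u :: "(int ^ 'n) l2" and U
  proof -
    have "scl (-1) u = - u" by (rule l2_eqI) (simp add: ap_simps)
    then show ?thesis using FT_scl[OF that, of "-1"] by simp
  qed
  from Suc.prems show ?case
  proof (cases rule: idx_cases)
    case 1
    have J: "finite {1..<\<nu>}" "{1..<\<nu>} \<noteq> {}" using nu2 by auto
    have "FT (scl (of_real c) (?g \<nu>) + lap (?g \<nu>) + - (\<Sum>j\<in>{1..<\<nu>}. ?g j))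
      (\<lambda>\<omega>. of_real c * ?Y \<omega> \<nu> + of_real (symb \<omega>) * ?Y \<omega> \<nu> + - (\<Sum>j\<in>{1..<\<nu>}. ?Y \<omega> j))"
      by (intro FT_add neg FT_scl FT_lap FT_sum J Suc.IH nu_idx J_idx) 
    then show ?thesis unfolding c[unfolded 1] 1 Hm_Suc(1) by (simp add: Hl_def distrib_right)
  next
    case 2
    have "FT (scl (of_real (\<beta> k)) (?g k) + - ?g \<nu>) (\<lambda>\<omega>. of_real (\<beta> k) * ?Y \<omega> k + - ?Y \<omega> \<nu>)"
      by (intro FT_add neg FT_scl Suc.IH nu_idx Suc.prems)
    then show ?thesis unfolding c Hm_Suc(2)[OF 2(1)] using 2(2) by (simp add: Hl_def)
  qed
qed

text \<open>The moments of \<open>f\<close> are integrals over the torus of the fibre moments in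
  \<open>Hm_moments\<close>. The weights are dominated by the squared norms of the fibre vectors,
  hence integrable, and \<open>ac_measure_exists\<close> provides the measure.\<close>

lemma sym_ac:
  assumes f: "f \<in> Mset UNIV" shows "f \<in> ac_subspace V H"
proof -
  have fe: "f \<in> ell2 V" and fs: "symk UNIV (comp f)" using f by (auto simp: Mset_symk)
  \<comment> \<open>The chosen transform depends on the component alone, so equal components get the
    same representative. Hence the fibre vectors are symmetric at every point, and not just almost
    everywhere.\<close>
  define X where "X \<omega> k = (SOME G. FT (comp f k) G) \<omega>" for \<omega> :: "'n \<Rightarrow> real" and k
  have X: "FT (comp f k) (\<lambda>\<omega>. X \<omega> k)" for k
    using someI_ex[OF FT_ex[of "comp f k"]] by (simp add: X_def)
  have Xs: "sym_vec (X \<omega>)" for \<omega>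
    unfolding sym_vec_def
  proof (intro ballI impI)
    fix i j assume ij: "i \<in> {1..<\<nu>}" "j \<in> {1..<\<nu>}" "\<beta> i = \<beta> j"
    then have "comp f i = comp f j" using fs unfolding symk_def by blast
    then show "X \<omega> i = X \<omega> j" by (simp only: X_def)
  qed
  note Xm[measurable] = FT_measurable[OF X]
  define E where "E n \<omega> = ev n (symb \<omega>)" for n and \<omega> :: "'n \<Rightarrow> real"
  define w where "w n \<omega> = (cmod (Lf (E n \<omega>) (X \<omega>)))\<^sup>2 / F' (E n \<omega>)" for n and \<omega> :: "'n \<Rightarrow> real"
  have bn: "n \<in> {1..\<nu>}" if "n \<in> bands" for n using that by (simp add: bands_def)
  have Em: "E n \<in> borel_measurable tor" if "n \<in> bands" for n
    unfolding E_def by (rule measurable_compose[OF measurable_symb measurable_ev[OF bn[OF that]]])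
  have w0: "w n \<omega> \<ge> 0" for n \<omega> using F'_ge[of "E n \<omega>"] by (simp add: w_def)
  have wm: "w n \<in> borel_measurable tor" if "n \<in> bands" for n
  proof -
    note [measurable] = Em[OF that]
    have "(\<lambda>\<omega>. Lf (E n \<omega>) (X \<omega>)) \<in> borel_measurable tor" unfolding Lf_def by measurable
    moreover have "(\<lambda>\<omega>. F' (E n \<omega>)) \<in> borel_measurable tor" unfolding F'_def by measurable
    ultimately show ?thesis unfolding w_def by measurable
  qed
  have Hmw: "Re (\<Sum>k\<in>idx. cnj (X \<omega> k) * (Hm (symb \<omega>) ^^ r) (X \<omega>) k) = (\<Sum>n\<in>bands. E n \<omega> ^ r * w n \<omega>)" for \<omega> r
    unfolding Hm_moments[OF Xs] by (simp add: E_def w_def)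
  \<comment> \<open>The moment formula with exponent 0: the weights add up to the squared norm of
    the fibre vector.\<close>
  have wle: "w n \<omega> \<le> (\<Sum>k\<in>idx. (cmod (X \<omega> k))\<^sup>2)" if "n \<in> bands" for n \<omega>
  proof -
    have "w n \<omega> \<le> (\<Sum>n\<in>bands. w n \<omega>)" using that w0 finite_bands by (intro member_le_sum) auto
    also have "\<dots> = Re (\<Sum>k\<in>idx. cnj (X \<omega> k) * X \<omega> k)" using Hmw[of \<omega> 0] by simp
    also have "\<dots> = (\<Sum>k\<in>idx. (cmod (X \<omega> k))\<^sup>2)" by (simp add: cmod_power2) (simp add: power2_eq_square)
    finally show ?thesis .
  qed
  have wi: "integrable tor (w n)" if "n \<in> bands" for n
  proof (rule Bochner_Integration.integrable_bound)
    show "integrable tor (\<lambda>\<omega>. \<Sum>k\<in>idx. (cmod (X \<omega> k))\<^sup>2)"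
      by (intro Bochner_Integration.integrable_sum FT_integral(1)[OF X])
    show "AE \<omega> in tor. norm (w n \<omega>) \<le> norm (\<Sum>k\<in>idx. (cmod (X \<omega> k))\<^sup>2)"
      using wle[OF that] w0 by (intro AE_I2) (simp add: abs_of_nonneg sum_nonneg)
  qed (rule wm[OF that])
  define R where "R = (\<Sum>n\<in>bands. \<bar>ev n 0\<bar> + \<bar>ev n symb_max\<bar>)"
  have Eb: "\<bar>E n \<omega>\<bar> \<le> R" if "n \<in> bands" for n \<omega>
  proof -
    have "ev n 0 \<le> E n \<omega>" "E n \<omega> \<le> ev n symb_max"
      using ev_mono[OF bn[OF that]] symb_bounds[of \<omega>] unfolding E_def symb_max_def by (auto simp: mono_def)
    then have "\<bar>E n \<omega>\<bar> \<le> \<bar>ev n 0\<bar> + \<bar>ev n symb_max\<bar>" by linarith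
    also have "\<dots> \<le> R" unfolding R_def using that finite_bands by (intro member_le_sum) auto
    finally show ?thesis .
  qed
  obtain \<mu> where mu: "sets \<mu> = sets borel" "finite_measure \<mu>" "AE x in \<mu>. \<bar>x\<bar> \<le> R" "absolutely_continuous lborel \<mu>"
    "\<And>k. (\<integral>x. x ^ k \<partial>\<mu>) = (\<Sum>n\<in>bands. \<integral>\<omega>. E n \<omega> ^ k * w n \<omega> \<partial>tor)"
  proof -
    have "AE \<omega> in tor. E n \<omega> \<notin> A" if "n \<in> bands" "A \<in> null_sets lborel" for n A
      unfolding E_def by (rule ev_AE_not_in[OF that])
    from ac_measure_exists[where M = tor and I = bands and w = w and E = E and R = R,
      OF prob_space_tor finite_bands wi w0 Em Eb this]
    show thesis using that by auto
  qed
  have Ewi: "integrable tor (\<lambda>\<omega>. E n \<omega> ^ k * w n \<omega>)" if "n \<in> bands" for n k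
  proof (rule Bochner_Integration.integrable_bound[OF integrable_mult_right[OF wi[OF that], of "\<bar>R\<bar> ^ k"]])
    show "(\<lambda>\<omega>. E n \<omega> ^ k * w n \<omega>) \<in> borel_measurable tor" using Em[OF that] wm[OF that] by measurable
    have "\<bar>E n \<omega>\<bar> ^ k \<le> \<bar>R\<bar> ^ k" for \<omega> using Eb[OF that, of \<omega>] by (intro power_mono) auto
    then show "AE \<omega> in tor. norm (E n \<omega> ^ k * w n \<omega>) \<le> norm (\<bar>R\<bar> ^ k * w n \<omega>)"
      using w0 by (intro AE_I2) (simp add: abs_mult power_abs mult_right_mono)
  qed
  have Re: "Re (ell2_inner V f ((H ^^ r) f)) = (\<integral>x. x ^ r \<partial>\<mu>)" for r
  proof -
    have "Re (ell2_inner V f ((H ^^ r) f)) = (\<Sum>k\<in>idx. \<integral>\<omega>. Re (cnj (X \<omega> k) * (Hm (symb \<omega>) ^^ r) (X \<omega>) k) \<partial>tor)"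
      using FT_inner(2)[OF X FT_Hpow[OF fe X]] by (simp add: ell2_inner_comp fe comp_Hpow)
    also have "\<dots> = (\<integral>\<omega>. (\<Sum>k\<in>idx. Re (cnj (X \<omega> k) * (Hm (symb \<omega>) ^^ r) (X \<omega>) k)) \<partial>tor)"
      by (rule Bochner_Integration.integral_sum[symmetric]) (rule FT_inner(1)[OF X FT_Hpow[OF fe X]])
    also have "\<dots> = (\<integral>\<omega>. (\<Sum>n\<in>bands. E n \<omega> ^ r * w n \<omega>) \<partial>tor)"
      by (simp only: Hmw[symmetric] Re_sum)
    also have "\<dots> = (\<Sum>n\<in>bands. \<integral>\<omega>. E n \<omega> ^ r * w n \<omega> \<partial>tor)"
      by (rule Bochner_Integration.integral_sum) (rule Ewi)
    finally show ?thesis by (simp add: mu(5))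
  qed
  \<comment> \<open>Symmetry of the powers makes the moments real, so the identity for the real
    parts is enough.\<close>
  have Hs: "ell2_inner V ((H ^^ r) g) h = ell2_inner V g ((H ^^ r) h)" if "g \<in> ell2 V" "h \<in> ell2 V" for g h r
    using that
  proof (induction r arbitrary: h)
    case (Suc r)
    have "ell2_inner V ((H ^^ Suc r) g) h = ell2_inner V ((H ^^ r) g) (H h)"
      using Suc.prems by (simp add: H_sym comp_Hpow)
    also have "\<dots> = ell2_inner V g ((H ^^ r) (H h))" using Suc by (simp add: H_ell2)
    finally show ?case by (simp add: funpow_swap1)
  qed simp
  have "ell2_inner V f ((H ^^ r) f) = complex_of_real (\<integral>x. x ^ r \<partial>\<mu>)" for r
  proof -
    have "cnj (ell2_inner V f ((H ^^ r) f)) = ell2_inner V f ((H ^^ r) f)"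
      by (simp add: ell2_inner_cnj fe comp_Hpow Hs)
    then have "ell2_inner V f ((H ^^ r) f) = of_real (Re (ell2_inner V f ((H ^^ r) f)))"
      by (simp add: complex_eq_iff)
    then show ?thesis unfolding Re .
  qed
  then have "spectral_measure V H f \<mu>" unfolding spectral_measure_def using mu by blast
  then show ?thesis unfolding ac_subspace_def using fe mu(4) by blast
qed

text \<open>For the inclusion other than \<open>sym_ac\<close>: orthogonality to the dipole over
  \<open>m\<close> says that two components at the same pole agree at \<open>m\<close>.\<close>

theorem ac_subspace_eq: "ac_subspace V H = Mset UNIV"
proof (intro equalityI subsetI)
  fix f assume f: "f \<in> ac_subspace V H"
  have fe: "f \<in> ell2 V" using f by (simp add: ac_subspace_def)
  show "f \<in> Mset UNIV" unfolding Mset_def mem_Collect_eq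
  proof (intro conjI ballI impI)
    fix i j assume ij: "i \<in> {1..<\<nu>}" "j \<in> {1..<\<nu>}" "\<beta> i = \<beta> j \<and> \<beta> i \<in> UNIV"
    show "comp f i = comp f j"
    proof (cases "i = j")
      case False
      show ?thesis
      proof (rule l2_eqI)
        fix m
        note d = dipole[OF ij(1,2) False, of m, OF conjunct1[OF ij(3)]]
        have "ell2_inner V (dipole i j m) f = 0"
          by (rule ac_orthogonal_eigenvector[OF H_ell2 H_lin H_sym f d])
        moreover have "ell2_inner V (dipole i j m) f = (\<Sum>\<^sub>\<infinity>v\<in>{pt i m, pt j m}. cnj (dipole i j m v) * f v)"
          unfolding ell2_inner_def
          by (rule infsum_cong_neutral) (auto simp: dipole_def pt_V J_idx[OF ij(1)] J_idx[OF ij(2)])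
        moreover have "pt i m \<noteq> pt j m" using False pt_eq[OF J_idx[OF ij(1)] J_idx[OF ij(2)]] by simp
        ultimately have "f (pt i m) = f (pt j m)" by (simp add: dipole_def)
        then show "ap (comp f i) m = ap (comp f j) m" by (simp only: ap_comp fe J_idx ij)
      qed
    qed simp
  qed (rule fe)
qed (rule sym_ac)

theorem ac_spectrum_eq: "ac_spectrum V H = of_real ` {x. x \<notin> B \<and> F x \<in> {0..symb_max}}"
  unfolding ac_spectrum_def ac_subspace_eq spectrum_Mset by simp

theorem op_spectrum_eq: "op_spectrum V H = of_real ` ({x. x \<notin> B \<and> F x \<in> {0..symb_max}} \<union> {b. pole_mult b \<ge> 2})"
  unfolding op_spectrum_def Mset_empty[symmetric] spectrum_Mset by simp

text \<open>Outside the spectrum, \<open>H - z\<close> is injective. At a spectral point that is not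
  a pole, the pendant equations can be divided by \<open>\<beta> k - x\<close>, so an eigenvector is
  symmetric; it then lies in the absolutely continuous subspace and is orthogonal to every
  eigenvector, including itself.\<close>

lemma eigenspace_trivial:
  assumes z: "z \<notin> of_real ` {b. pole_mult b \<ge> 2}" and f: "f \<in> eigenspace V H z"
  shows "f = (\<lambda>v. 0)"
proof -
  have fe: "f \<in> ell2 V" and ev: "\<And>v. H f v = z * f v" using f by (auto simp: eigenspace_def)
  have z0: "(\<lambda>v. 0) \<in> ell2 V" by (simp add: ell2_iff sqs_0)
  show ?thesis
  proof (cases "z \<in> spectrum_on V (ell2 V) H")
    case False
    then have inj: "inj_on (\<lambda>f v. H f v - z * f v) (ell2 V)" unfolding spectrum_on_def bij_betw_def by blast
    have "H (\<lambda>v. 0 * 0 + 0 * 0) = (\<lambda>v. 0 * H (\<lambda>v. 0) v + 0 * H (\<lambda>v. 0) v)" by (rule H_lin[OF z0 z0])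
    then have "(\<lambda>v. H f v - z * f v) = (\<lambda>v. H (\<lambda>v. 0) v - z * 0)" using ev by (simp add: fun_eq_iff)
    then show ?thesis using inj fe z0 unfolding inj_on_def by blast
  next
    case True
    then obtain x where x: "x \<notin> B" "z = of_real x"
      using z unfolding Mset_empty[symmetric] spectrum_Mset by blast
    have "f \<in> Mset UNIV" unfolding Mset_def mem_Collect_eq
    proof (intro conjI ballI impI)
      fix i j assume ij: "i \<in> {1..<\<nu>}" "j \<in> {1..<\<nu>}" "\<beta> i = \<beta> j \<and> \<beta> i \<in> UNIV"
      show "comp f i = comp f j"
      proof (rule l2_eqI)
        fix m
        have e: "(of_real (\<beta> k) - of_real x) * f (pt k m) = f (pt \<nu> m)" if "k \<in> {1..<\<nu>}" for k
          using ev[of "pt k m"] H_pend[OF that, of f m] x(2) by (simp add: left_diff_distrib) (metis diff_add_cancel add_diff_cancel_left')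
        have "complex_of_real (\<beta> i) - of_real x \<noteq> 0" using ne_B(1)[OF x(1) ij(1)] by simp
        then have "f (pt i m) = f (pt j m)" using e[OF ij(1)] e[OF ij(2)] ij(3) by (metis mult_cancel_left)
        then show "ap (comp f i) m = ap (comp f j) m" by (simp only: ap_comp fe J_idx ij)
      qed
    qed (rule fe)
    then have "f \<in> ac_subspace V H" by (simp add: ac_subspace_eq)
    moreover have "H f v = of_real x * f v" for v by (simp only: ev x(2))
    ultimately have "ell2_inner V f f = 0" using ac_orthogonal_eigenvector[OF H_ell2 H_lin H_sym _ fe] by blast
    then have "norm (Abs_l2 f) = 0" by (simp add: ell2_inner_eq fe cin_eq_norm)
    then have "Abs_l2 f = 0" by simp
    then have "ap (Abs_l2 f) = (\<lambda>v. 0)" by (simp add: fun_eq_iff ap_simps)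
    then show ?thesis using fe by (simp add: ap_Abs ell2_iff)
  qed
qed

end

text \<open>Supplies span and independence over the complex scalars for the dimension count.\<close>

interpretation l2_vs: vector_space "scl :: complex \<Rightarrow> 'a l2 \<Rightarrow> 'a l2"
  by unfold_locales (simp_all add: scl_lin)

section \<open>Infinite multiplicity of the flat bands\<close>

context pendant_model
begin

text \<open>Dipoles over \<open>card S + 1\<close> lattice points are told apart by their values at
  the points \<open>pt i n\<close>, so they are independent and cannot lie in the span of
  \<open>S\<close>.\<close>

lemma flat_infinite:
  assumes b: "pole_mult b \<ge> 2" shows "\<not> finite_dimensional (eigenspace V H (of_real b))"
proof
  assume "finite_dimensional (eigenspace V H (of_real b))"
  then obtain S where S: "finite S" "\<And>f. f \<in> eigenspace V H (of_real b) \<Longrightarrow> \<exists>a. f = (\<lambda>v. \<Sum>s\<in>S. a s * s v)"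
    unfolding finite_dimensional_def by blast
  obtain i j where ij: "i \<in> {1..<\<nu>}" "j \<in> {1..<\<nu>}" "i \<noteq> j" "\<beta> i = b" "\<beta> j = b" using mult2_pair[OF b] by blast
  have ij': "\<beta> i = \<beta> j" using ij by simp
  have "infinite (UNIV :: (int ^ 'n) set)"
  proof
    assume "finite (UNIV :: (int ^ 'n) set)"
    then have "finite (range (\<lambda>k::int. (\<chi> i. k) :: int ^ 'n))" by (rule finite_subset[rotated]) simp
    moreover have "inj (\<lambda>k::int. (\<chi> i. k) :: int ^ 'n)" by (auto simp: inj_def Finite_Cartesian_Product.vec_eq_iff)
    ultimately show False using finite_imageD infinite_UNIV_int by blast
  qed
  then obtain A :: "(int ^ 'n) set" where A: "finite A" "card A = Suc (card S)"
    using infinite_arbitrarily_large by blast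
  \<comment> \<open>The functions in \<open>S\<close> need not be square summable. Restricted to the
    finite set \<open>W\<close> they are, and there the dipoles are still independent.\<close>
  define W where "W = pt i ` A"
  have finW: "finite W" using A by (simp add: W_def)
  have sq: "sqs (\<lambda>v. if v \<in> W then s v else 0)" for s :: "'v \<Rightarrow> complex"
  proof -
    have "(\<lambda>v. (cmod (if v \<in> W then s v else 0))\<^sup>2) summable_on W" using finW by simp
    then show ?thesis unfolding sqs_def
      by (subst (asm) summable_on_cong_neutral[where T = UNIV and g = "\<lambda>v. (cmod (if v \<in> W then s v else 0))\<^sup>2"]) auto
  qed
  define r where "r s = Abs_l2 (\<lambda>v. if v \<in> W then s v else 0)" for s :: "'v \<Rightarrow> complex"
  have apr: "ap (r s) v = (if v \<in> W then s v else 0)" for s v unfolding r_def by (simp add: ap_Abs sq)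
  have ptd: "dipole i j m (pt i n) = (if m = n then 1 else 0)" for m n
    using pt_eq[OF J_idx[OF ij(1)] J_idx[OF ij(1)]] pt_eq[OF J_idx[OF ij(1)] J_idx[OF ij(2)]] ij(3)
    by (auto simp: dipole_def)
  let ?e = "\<lambda>m. r (dipole i j m)"
  have ap_e: "ap (?e m) (pt i n) = (if m = n then 1 else 0)" if "n \<in> A" for m n
    using that by (simp add: apr W_def ptd)
  have inj: "inj_on ?e A"
  proof (rule inj_onI)
    fix m n assume mn: "m \<in> A" "n \<in> A" "?e m = ?e n"
    then have "ap (?e m) (pt i n) = ap (?e n) (pt i n)" by simp
    then show "m = n" using ap_e[OF mn(2)] by (metis zero_neq_one)
  qed
  have "?e ` A \<subseteq> l2_vs.span (r ` S)"
  proof (rule image_subsetI)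
    fix m assume "m \<in> A"
    have "dipole i j m \<in> eigenspace V H (of_real b)"
      using dipole[OF ij(1-3) ij', of m] ij(4) by (simp add: eigenspace_def)
    then obtain a where a: "dipole i j m = (\<lambda>v. \<Sum>s\<in>S. a s * s v)" using S(2) by blast
    have "?e m = (\<Sum>s\<in>S. scl (a s) (r s))"
      by (rule l2_eqI) (simp add: ap_sum ap_simps apr a)
    then show "?e m \<in> l2_vs.span (r ` S)"
      by (simp add: l2_vs.span_sum l2_vs.span_scale l2_vs.span_base)
  qed
  moreover have "l2_vs.independent (?e ` A)"
    unfolding l2_vs.independent_explicit_module
  proof (intro allI impI)
    fix t u v assume t: "finite t" "t \<subseteq> ?e ` A" "(\<Sum>x\<in>t. scl (u x) x) = 0" "v \<in> t"
    then obtain n where n: "n \<in> A" "v = ?e n" by blast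
    have "0 = ap (\<Sum>x\<in>t. scl (u x) x) (pt i n)" by (simp add: t(3) ap_simps)
    also have "\<dots> = (\<Sum>x\<in>t. u x * ap x (pt i n))" by (simp add: ap_sum ap_simps)
    also have "\<dots> = (\<Sum>x\<in>t. if x = v then u v else 0)"
    proof (rule sum.cong)
      fix x assume "x \<in> t"
      then obtain m where m: "m \<in> A" "x = ?e m" using t(2) by blast
      then show "u x * ap x (pt i n) = (if x = v then u v else 0)"
        using n ap_e[OF n(1), of m] inj_on_eq_iff[OF inj m(1) n(1)] by simp
    qed simp
    also have "\<dots> = u v" using t(1,4) by simp
    finally show "u v = 0" by simp
  qed
  ultimately have "card (?e ` A) \<le> card (r ` S)"
    using l2_vs.independent_span_bound[of "r ` S" "?e ` A"] S(1) by simp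
  also have "\<dots> \<le> card S" using S(1) by (rule card_image_le)
  finally show False using A(2) card_image[OF inj] by simp
qed

theorem flat_bands_eq: "flat_bands V H = of_real ` {b. pole_mult b \<ge> 2}"
proof (intro equalityI subsetI)
  fix z assume z: "z \<in> flat_bands V H"
  show "z \<in> of_real ` {b. pole_mult b \<ge> 2}"
  proof (rule ccontr)
    assume "\<not> ?thesis"
    then have "\<forall>f\<in>eigenspace V H z. f = (\<lambda>v. 0)" using eigenspace_trivial by blast
    then have "finite_dimensional (eigenspace V H z)"
      unfolding finite_dimensional_def by (intro exI[of _ "{}"]) auto
    then show False using z by (simp add: flat_bands_def)
  qed
qed (use flat_infinite in \<open>auto simp: flat_bands_def\<close>)

end

section \<open>Periodic graphs and their fundamental graphs\<close>

lemma lattice_vec_add: "lattice_vec a (m + n) = lattice_vec a m + lattice_vec a n"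
  by (simp add: lattice_vec_def scaleR_add_left sum.distrib)

lemma lattice_vec_0: "lattice_vec a 0 = 0"
  by (simp add: lattice_vec_def)

lemma lattice_vec_uminus: "lattice_vec a (- m) = - lattice_vec a m"
  using lattice_vec_add[of a m "- m"] by (simp add: lattice_vec_0 add_eq_0_iff)

lemma lattice_vec_diff: "lattice_vec a (m - n) = lattice_vec a m - lattice_vec a n"
  using lattice_vec_add[of a m "- n"] by (simp add: lattice_vec_uminus)

text \<open>Natural multiples of one period by induction, negative ones by reading the equivalence
  backwards, and then the sum over the periods.\<close>

lemma lattice_closed:
  assumes P: "\<And>t i. P (t + a i) \<longleftrightarrow> P t"
  shows "P (t + lattice_vec a m) \<longleftrightarrow> P t"
proof -
  have nat: "P (t + of_nat k *\<^sub>R a i) \<longleftrightarrow> P t" for t i k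
  proof (induction k)
    case (Suc k)
    have "t + of_nat (Suc k) *\<^sub>R a i = (t + of_nat k *\<^sub>R a i) + a i" by (simp add: scaleR_add_left)
    then show ?case using P Suc by (simp only:)
  qed simp
  have int: "P (t + of_int k *\<^sub>R a i) \<longleftrightarrow> P t" for t i k
  proof (cases "k \<ge> 0")
    case True
    then show ?thesis using nat[of t "nat k" i] by simp
  next
    case False
    then have "t + of_int k *\<^sub>R a i + of_nat (nat (- k)) *\<^sub>R a i = t" by simp
    then show ?thesis using nat[of "t + of_int k *\<^sub>R a i" "nat (- k)" i] by (simp only:)
  qed
  have "finite S \<Longrightarrow> P (t + (\<Sum>i\<in>S. of_int (m $ i) *\<^sub>R a i)) \<longleftrightarrow> P t" for S
  proof (induction S rule: finite_induct)
    case (insert i S)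
    have "t + (\<Sum>i\<in>insert i S. of_int (m $ i) *\<^sub>R a i) = (t + (\<Sum>i\<in>S. of_int (m $ i) *\<^sub>R a i)) + of_int (m $ i) *\<^sub>R a i"
      using insert.hyps by (simp add: add_ac)
    then show ?case using int insert.IH by (simp only:)
  qed simp
  then show ?thesis by (simp add: lattice_vec_def)
qed

lemma pathstart_translate: "pathstart (translate t g) = pathstart g + t"
  and pathfinish_translate: "pathfinish (translate t g) = pathfinish g + t"
  by (simp_all add: translate_def pathstart_def pathfinish_def)

lemma translate_translate: "translate s (translate t g) = translate (t + s) g"
  by (simp add: translate_def add.assoc)

lemma translate_0: "translate 0 g = g"
  by (simp add: translate_def)

lemma reversepath_translate: "reversepath (translate t g) = translate t (reversepath g)"
  by (simp add: translate_def reversepath_def)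

text \<open>Only the translation invariance of a periodic graph is needed, so that the lattice, too, is an
  instance without proving that it is embedded and connected.\<close>

locale periodic =
  fixes G :: "'n::finite pgraph" and a :: "'n \<Rightarrow> real ^ 'n" and p :: "real ^ 'n"
  assumes inj_a: "inj a" and indep: "independent (range a)" and span_a: "span (range a) = UNIV"
    and verts_a: "\<And>i. (\<lambda>v. v + a i) ` verts G = verts G"
    and arcs_a: "\<And>i. translate (a i) ` arcs G = arcs G"
    and arc_ends: "\<And>g. g \<in> arcs G \<Longrightarrow> pathstart g \<in> verts G \<and> pathfinish g \<in> verts G \<and> reversepath g \<in> arcs G"
begin

abbreviation "lat \<equiv> lattice_vec a"
abbreviation "FG \<equiv> fundamental_graph G a p"

lemma coords_add: "coords a p (v + lat m) $ i = coords a p v $ i + of_int (m $ i)"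
proof -
  have s: "x \<in> span (range a)" for x using span_a by simp
  have b: "representation (range a) (a j) (a i) = (if j = i then 1 else 0)" for j
    using representation_basis[OF indep, of "a j"] inj_a by (auto simp: inj_eq)
  have "representation (range a) (v + lat m - p) (a i) =
      representation (range a) (v - p) (a i) + representation (range a) (lat m) (a i)"
    using representation_add[OF indep s s, of "lat m" "v - p"] by (simp add: algebra_simps)
  also have "representation (range a) (lat m) (a i) = (\<Sum>j\<in>UNIV. of_int (m $ j) * representation (range a) (a j) (a i))"
    unfolding lattice_vec_def by (simp add: representation_sum[OF indep s] representation_scale[OF indep s])
  also have "\<dots> = of_int (m $ i)" by (simp add: b if_distrib cong: if_cong)
  finally show ?thesis by (simp add: coords_def)
qed

lemma int_part_add: "int_part a p (v + lat m) = int_part a p v + m"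
  by (simp add: int_part_def coords_add Finite_Cartesian_Product.vec_eq_iff)

lemma lat_inj: "lat m = lat n \<longleftrightarrow> m = n"
proof
  assume "lat m = lat n"
  then have "int_part a p (0 + lat m) = int_part a p (0 + lat n)" by simp
  then show "m = n" by (simp only: int_part_add add_left_cancel)
qed simp

lemma frac_part_add: "frac_part a p (v + lat m) = frac_part a p v"
  by (simp add: frac_part_def int_part_add lattice_vec_add)

lemma frac_decomp: "v = frac_part a p v + lat (int_part a p v)"
  by (simp add: frac_part_def)

lemma frac_cell: "frac_part a p v \<in> cell a p"
proof -
  have "coords a p (frac_part a p v) $ i = frac (coords a p v $ i)" for i
    using coords_add[of "frac_part a p v" "int_part a p v" i] frac_decomp[of v]
    by (simp add: int_part_def frac_def)
  then show ?thesis by (simp add: cell_def frac_lt_1)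
qed

lemma cell_parts: assumes "v \<in> cell a p" shows "int_part a p v = 0" "frac_part a p v = v"
proof -
  show i: "int_part a p v = 0" using assms
    by (auto simp: int_part_def cell_def Finite_Cartesian_Product.vec_eq_iff floor_eq_iff)
  show "frac_part a p v = v" by (simp add: frac_part_def i lattice_vec_0)
qed

lemma verts_lat: "v + lat m \<in> verts G \<longleftrightarrow> v \<in> verts G"
proof (rule lattice_closed[where P = "\<lambda>v. v \<in> verts G"])
  fix t i
  show "t + a i \<in> verts G \<longleftrightarrow> t \<in> verts G"
  proof
    assume "t + a i \<in> verts G"
    then have "t + a i \<in> (\<lambda>v. v + a i) ` verts G" by (simp only: verts_a)
    then show "t \<in> verts G" by auto
  next
    assume "t \<in> verts G"
    then have "t + a i \<in> (\<lambda>v. v + a i) ` verts G" by blast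
    then show "t + a i \<in> verts G" by (simp only: verts_a)
  qed
qed

lemma arcs_lat: "translate (lat m) g \<in> arcs G \<longleftrightarrow> g \<in> arcs G"
proof -
  have inj: "inj (translate s)" for s :: "real ^ 'n"
    by (auto simp: translate_def fun_eq_iff inj_def)
  have "translate (0 + lat m) g \<in> arcs G \<longleftrightarrow> translate 0 g \<in> arcs G"
  proof (rule lattice_closed[where P = "\<lambda>t. translate t g \<in> arcs G"])
    fix t i
    show "translate (t + a i) g \<in> arcs G \<longleftrightarrow> translate t g \<in> arcs G"
      unfolding translate_translate[symmetric]
      by (subst arcs_a[of i, symmetric]) (rule inj_image_mem_iff[OF inj])
  qed
  then show ?thesis by (simp add: translate_0)
qed

lemma frac_verts: "v \<in> verts G \<Longrightarrow> frac_part a p v \<in> verts G"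
  using verts_lat[of "frac_part a p v" "int_part a p v"] frac_decomp[of v] by simp

definition cls :: "(real \<Rightarrow> real ^ 'n) \<Rightarrow> (real \<Rightarrow> real ^ 'n) set" where
  "cls g = range (\<lambda>m. translate (lat m) g)"

lemma cls_self: "g \<in> cls g"
  unfolding cls_def using translate_0[of g] lattice_vec_0[of a] by (metis rangeI)

lemma cls_translate: "cls (translate (lat m) g) = cls g"
proof -
  have "cls (translate (lat m) g) = (\<lambda>k. translate (lat (m + k)) g) ` UNIV"
    by (simp add: cls_def translate_translate lattice_vec_add)
  also have "\<dots> = (\<lambda>k. translate (lat k) g) ` ((+) m ` UNIV)" by (simp only: image_image)
  finally show ?thesis by (simp only: cls_def surj_plus)
qed

lemma iarcs_cls: "iarcs FG = cls ` arcs G"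
proof -
  have "shift_rel G a `` {g} = cls g" if "g \<in> arcs G" for g
    using that arcs_lat by (auto simp: shift_rel_def cls_def)
  then show ?thesis by (force simp: fundamental_graph_def quotient_def)
qed

lemma iverts_FG: "iverts FG = verts G \<inter> cell a p"
  by (simp add: fundamental_graph_def)

lemma the_elem_const: "(\<And>x. x \<in> A \<Longrightarrow> f x = c) \<Longrightarrow> A \<noteq> {} \<Longrightarrow> the_elem (f ` A) = c"
  by (metis image_constant_conv image_cong the_elem_eq)

lemma cls_simps:
  "isrc FG (cls g) = frac_part a p (pathstart g)"
  "itgt FG (cls g) = frac_part a p (pathfinish g)"
  "iidx FG (cls g) = int_part a p (pathfinish g) - int_part a p (pathstart g)"
  "irev FG (cls g) = cls (reversepath g)"
proof -
  have ne: "cls g \<noteq> {}" using cls_self by blast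
  show "isrc FG (cls g) = frac_part a p (pathstart g)"
    unfolding fundamental_graph_def igraph.simps
    by (rule the_elem_const[OF _ ne]) (auto simp: cls_def pathstart_translate frac_part_add)
  show "itgt FG (cls g) = frac_part a p (pathfinish g)"
    unfolding fundamental_graph_def igraph.simps
    by (rule the_elem_const[OF _ ne]) (auto simp: cls_def pathfinish_translate frac_part_add)
  show "iidx FG (cls g) = int_part a p (pathfinish g) - int_part a p (pathstart g)"
    unfolding fundamental_graph_def igraph.simps
    by (rule the_elem_const[OF _ ne])
      (auto simp: cls_def edge_index_def pathfinish_translate pathstart_translate int_part_add)
  show "irev FG (cls g) = cls (reversepath g)"
    unfolding fundamental_graph_def igraph.simps cls_def image_image reversepath_translate ..
qed

lemma irev_simps: assumes "E \<in> iarcs FG"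
  shows "isrc FG (irev FG E) = itgt FG E" "itgt FG (irev FG E) = isrc FG E" "iidx FG (irev FG E) = - iidx FG E"
  using assms unfolding iarcs_cls by (auto simp: cls_simps)

text \<open>An orbit with source \<open>frac_part a p v\<close> has a member that starts at
  \<open>v\<close>, by translation through the difference of the integer parts, and only one, as a
  translation that keeps the starting point is trivial.\<close>

lemma star_bij: assumes v: "v \<in> verts G"
  shows "bij_betw cls (star G v) {E \<in> iarcs FG. isrc FG E = frac_part a p v}"
proof (rule bij_betw_imageI)
  show "inj_on cls (star G v)"
  proof (rule inj_onI)
    fix g h assume gh: "g \<in> star G v" "h \<in> star G v" "cls g = cls h"
    then obtain m where m: "h = translate (lat m) g" using cls_self[of h] by (auto simp: cls_def)
    then have "lat m = lat 0" using gh pathstart_translate[of "lat m" g] by (simp add: star_def lattice_vec_0)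
    then show "g = h" using m by (simp add: lat_inj lattice_vec_0 translate_0)
  qed
  show "cls ` star G v = {E \<in> iarcs FG. isrc FG E = frac_part a p v}"
  proof (intro equalityI subsetI)
    fix E assume "E \<in> cls ` star G v"
    then show "E \<in> {E \<in> iarcs FG. isrc FG E = frac_part a p v}" by (auto simp: iarcs_cls cls_simps star_def)
  next
    fix E assume "E \<in> {E \<in> iarcs FG. isrc FG E = frac_part a p v}"
    then obtain g where g: "g \<in> arcs G" "E = cls g" "frac_part a p (pathstart g) = frac_part a p v"
      by (auto simp: iarcs_cls cls_simps)
    define m where "m = int_part a p v - int_part a p (pathstart g)"
    have "pathstart g + lat m = v"
      using g(3) unfolding frac_part_def by (simp add: m_def lattice_vec_diff algebra_simps)
    then have "translate (lat m) g \<in> star G v" using g(1) by (simp add: star_def arcs_lat pathstart_translate)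
    then show "E \<in> cls ` star G v" using cls_translate[of m g] g(2) by blast
  qed
qed

text \<open>The far end of an edge at \<open>v\<close> is recovered from the target and index of its
  class and the integer part of \<open>v\<close>. Sums over edges at \<open>v\<close> thus depend on
  the fundamental graph alone.\<close>

lemma star_sum: assumes v: "v \<in> verts G"
  shows "(\<Sum>g\<in>star G v. h (pathfinish g)) =
    (\<Sum>E\<in>{E \<in> iarcs FG. isrc FG E = frac_part a p v}. h (itgt FG E + lat (int_part a p v + iidx FG E)))"
proof -
  have "(\<Sum>E\<in>{E \<in> iarcs FG. isrc FG E = frac_part a p v}. h (itgt FG E + lat (int_part a p v + iidx FG E)))
     = (\<Sum>g\<in>star G v. h (itgt FG (cls g) + lat (int_part a p v + iidx FG (cls g))))"
    by (rule sum.reindex_bij_betw[OF star_bij[OF v], symmetric])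
  also have "\<dots> = (\<Sum>g\<in>star G v. h (pathfinish g))"
  proof (rule sum.cong)
    fix g assume "g \<in> star G v"
    then have "pathstart g = v" by (simp add: star_def)
    then show "h (itgt FG (cls g) + lat (int_part a p v + iidx FG (cls g))) = h (pathfinish g)"
      using frac_decomp[of "pathfinish g"] by (simp add: cls_simps)
  qed simp
  finally show ?thesis ..
qed

end

section \<open>The lattice and its loops\<close>

lemma std_lattice_vec: "lattice_vec std_vec m $ i = of_int (m $ i)"
  by (simp add: lattice_vec_def std_vec_def axis_def if_distrib cong: if_cong)

lemma integer_points_eq: "integer_points = range (lattice_vec std_vec)"
proof (intro equalityI subsetI)
  fix x :: "real ^ 'n" assume x: "x \<in> integer_points"
  have "of_int \<lfloor>x $ i\<rfloor> = x $ i" for i using x by (auto simp: integer_points_def elim: Ints_cases)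
  then have "x = lattice_vec std_vec (\<chi> i. \<lfloor>x $ i\<rfloor>)"
    unfolding Finite_Cartesian_Product.vec_eq_iff std_lattice_vec vec_lambda_beta by metis
  then show "x \<in> range (lattice_vec std_vec)" by blast
qed (auto simp: integer_points_def std_lattice_vec)

lemma lattice_vec_ax: "lattice_vec a (ax i) = a i"
proof -
  have "(\<Sum>j\<in>UNIV. of_int (ax i $ j) *\<^sub>R a j) = (\<Sum>j\<in>UNIV. if j = i then a j else 0)"
    by (intro sum.cong) (auto simp: ax_nth)
  then show ?thesis by (simp add: lattice_vec_def)
qed

lemma linepath_translate: "translate t (linepath x y) = linepath (x + t) (y + t)"
  by (auto simp: translate_def linepath_def fun_eq_iff algebra_simps)

interpretation lattice: periodic "lattice_graph :: 'n::finite pgraph" std_vec 0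
proof
  show "inj (std_vec :: 'n \<Rightarrow> real ^ 'n)" by (auto simp: inj_def std_vec_def axis_eq_axis)
  have B: "range (std_vec :: 'n \<Rightarrow> real ^ 'n) = Basis" by (auto simp: std_vec_def Basis_vec_def)
  show "independent (range (std_vec :: 'n \<Rightarrow> real ^ 'n))" unfolding B by (rule independent_Basis)
  show "span (range (std_vec :: 'n \<Rightarrow> real ^ 'n)) = UNIV" unfolding B by (rule span_Basis)
  have s: "(\<lambda>v. v + std_vec i) ` integer_points = integer_points" for i :: 'n
  proof -
    have "(\<lambda>v. v + std_vec i) ` integer_points = (\<lambda>m. lattice_vec std_vec (m + ax i)) ` UNIV"
      by (simp add: integer_points_eq image_image lattice_vec_add lattice_vec_ax)
    also have "\<dots> = lattice_vec std_vec ` ((\<lambda>m. m + ax i) ` UNIV)" by (simp only: image_image)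
    also have "(\<lambda>m. m + ax i) ` UNIV = UNIV" using bij_plus_right[of "ax i"] by (simp only: bij_def)
    finally show ?thesis by (simp add: integer_points_eq)
  qed
  show "(\<lambda>v. v + std_vec i) ` verts lattice_graph = verts lattice_graph" for i :: 'n
    by (simp add: lattice_graph_def s)
  show "translate (std_vec i) ` arcs lattice_graph = arcs lattice_graph" for i :: 'n
  proof -
    let ?L = "\<lambda>m. \<Union>s. {linepath m (m + std_vec s), linepath (m + std_vec s) m} :: (real \<Rightarrow> real ^ 'n) set"
    have "translate (std_vec i) ` ?L m = ?L (m + std_vec i)" for m
      by (simp add: image_UN linepath_translate add_ac)
    then have "(\<Union>m\<in>integer_points. translate (std_vec i) ` ?L m) = (\<Union>m\<in>(\<lambda>v. v + std_vec i) ` integer_points. ?L m)"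
      by (simp only: image_image)
    then have "translate (std_vec i) ` (\<Union>m\<in>integer_points. ?L m) = (\<Union>m\<in>(\<lambda>v. v + std_vec i) ` integer_points. ?L m)"
      by (simp only: image_UN)
    then show ?thesis unfolding s by (simp add: lattice_graph_def)
  qed
  fix g :: "real \<Rightarrow> real ^ 'n" assume g: "g \<in> arcs lattice_graph"
  have "m + std_vec i \<in> integer_points" if "m \<in> integer_points" for m and i :: 'n using s[of i] that by blast
  then show "pathstart g \<in> verts lattice_graph \<and> pathfinish g \<in> verts lattice_graph \<and> reversepath g \<in> arcs lattice_graph"
    using g by (auto simp: lattice_graph_def) blast+
qed

lemma lattice_int_part:
  fixes m :: "int ^ 'n::finite"
  shows "int_part std_vec 0 (lattice_vec std_vec m) = m"
  "frac_part std_vec 0 (lattice_vec std_vec m) = 0"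
proof -
  have "coords std_vec 0 (0 :: real ^ 'n) $ i = 0" for i by (simp add: coords_def representation_zero)
  then have i0: "int_part std_vec 0 (0 :: real ^ 'n) = 0" by (simp add: int_part_def Finite_Cartesian_Product.vec_eq_iff)
  then have f0: "frac_part std_vec 0 (0 :: real ^ 'n) = 0" by (simp add: frac_part_def lattice_vec_0)
  show "int_part std_vec 0 (lattice_vec std_vec m) = m" using lattice.int_part_add[of 0 m] i0 by simp
  show "frac_part std_vec 0 (lattice_vec std_vec m) = 0" using lattice.frac_part_add[of 0 m] f0 by simp
qed

abbreviation LF :: "(real ^ 'n::finite, (real \<Rightarrow> real ^ 'n) set, 'n) igraph" where
  "LF \<equiv> fundamental_graph lattice_graph std_vec 0"

lemma lattice_iverts: "iverts (LF :: (real ^ 'n::finite, _, 'n) igraph) = {0}"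
proof -
  have "v = 0" if v: "v \<in> integer_points" "v \<in> cell std_vec 0" for v :: "real ^ 'n"
  proof -
    obtain m where "v = lattice_vec std_vec m" using v(1) unfolding integer_points_eq by blast
    then show ?thesis using lattice.cell_parts(2)[OF v(2)] lattice_int_part(2)[of m] by simp
  qed
  moreover have "(0 :: real ^ 'n) \<in> integer_points" by (simp add: integer_points_def)
  moreover have "(0 :: real ^ 'n) \<in> cell std_vec 0" 
    using lattice.frac_cell[of "0 :: real ^ 'n"] lattice_int_part(2)[of "0 :: int ^ 'n"] by (simp add: lattice_vec_0)
  ultimately show ?thesis unfolding lattice.iverts_FG by (auto simp: lattice_graph_def)
qed

text \<open>\<open>L s\<close> and \<open>L' s\<close> are the two orientations of the loop in
  direction \<open>s\<close>.\<close>

lemma lattice_loops: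
  obtains L :: "'n::finite \<Rightarrow> (real \<Rightarrow> real ^ 'n) set" and L' where
    "iarcs LF = range L \<union> range L'" "\<And>s. iidx LF (L s) = ax s" "\<And>s. iidx LF (L' s) = - ax s"
    "\<And>E :: (real \<Rightarrow> real ^ 'n) set. E \<in> iarcs LF \<Longrightarrow> isrc LF E = 0 \<and> itgt LF E = 0"
proof -
  define L :: "'n \<Rightarrow> (real \<Rightarrow> real ^ 'n) set" where "L s = lattice.cls (linepath 0 (std_vec s))" for s
  define L' :: "'n \<Rightarrow> (real \<Rightarrow> real ^ 'n) set" where "L' s = lattice.cls (linepath (std_vec s) 0)" for s
  have i0: "int_part std_vec 0 (0 :: real ^ 'n) = 0" "int_part std_vec 0 (std_vec s :: real ^ 'n) = ax s" for s
    using lattice_int_part(1)[of 0] lattice_int_part(1)[of "ax s"] by (simp_all add: lattice_vec_0 lattice_vec_ax)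
  have idx: "iidx LF (L s) = ax s" "iidx LF (L' s) = - ax s" for s
    by (simp_all add: L_def L'_def lattice.cls_simps i0)
  have arc: "g \<in> arcs lattice_graph \<longleftrightarrow> (\<exists>m s. g = translate (lattice_vec std_vec m) (linepath 0 (std_vec s)) \<or>
     g = translate (lattice_vec std_vec m) (linepath (std_vec s) 0))" for g :: "real \<Rightarrow> real ^ 'n"
    unfolding lattice_graph_def integer_points_eq by (auto simp: linepath_translate add.commute)
  have arcs: "iarcs LF = range L \<union> range L'"
    unfolding lattice.iarcs_cls L_def L'_def
  proof (intro equalityI subsetI)
    fix E assume "E \<in> lattice.cls ` (arcs lattice_graph :: (real \<Rightarrow> real ^ 'n) set)"
    then show "E \<in> range (\<lambda>s. lattice.cls (linepath 0 (std_vec s))) \<union> range (\<lambda>s. lattice.cls (linepath (std_vec s) 0))"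
      by (auto simp: arc lattice.cls_translate)
  next
    fix E assume "E \<in> range (\<lambda>s. lattice.cls (linepath 0 (std_vec s))) \<union> range (\<lambda>s. lattice.cls (linepath (std_vec s) 0 :: real \<Rightarrow> real ^ 'n))"
    moreover have "linepath 0 (std_vec s) \<in> arcs lattice_graph" "linepath (std_vec s) 0 \<in> arcs lattice_graph" for s :: 'n
      unfolding arc using translate_0 lattice_vec_0 by metis+
    ultimately show "E \<in> lattice.cls ` arcs lattice_graph" by blast
  qed
  have "isrc LF E = 0 \<and> itgt LF E = 0" if "E \<in> iarcs LF" for E :: "(real \<Rightarrow> real ^ 'n) set"
  proof -
  from that obtain g where g: "g \<in> arcs lattice_graph" "E = lattice.cls g" by (auto simp: lattice.iarcs_cls)
  have "pathstart g \<in> integer_points" "pathfinish g \<in> integer_points"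
    using lattice.arc_ends[OF g(1)] by (auto simp: lattice_graph_def)
  then show "isrc LF E = 0 \<and> itgt LF E = 0"
    unfolding g(2) lattice.cls_simps integer_points_eq by (auto simp: lattice_int_part)
  qed
  with arcs idx show thesis by (rule that)
qed

text \<open>The indices tell all the oriented loops apart, so that the sum over classes can be
  reindexed by directions and signs.\<close>

lemma lattice_sum:
  "(\<Sum>E\<in>iarcs (LF :: (real ^ 'n::finite, _, 'n) igraph). h (iidx LF E)) = (\<Sum>s\<in>UNIV. h (ax s) + h (- ax s))"
proof -
  obtain L L' where L: "iarcs (LF :: (real ^ 'n, _, 'n) igraph) = range L \<union> range L'"
    "\<And>s. iidx LF (L s) = ax s" "\<And>s. iidx LF (L' s) = - ax s" using lattice_loops by metis
  have ax_eq: "ax s = ax t \<longleftrightarrow> s = t" for s t :: 'n by (auto simp: ax_def axis_eq_axis)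
  have ne: "ax s \<noteq> - ax t" for s t :: 'n
  proof
    assume "ax s = - ax t"
    then have "ax s $ s = - ax t $ s" by simp
    then show False by (auto simp: ax_nth split: if_splits)
  qed
  have "inj L"
  proof (rule injI)
    fix s t assume "L s = L t"
    then have "iidx LF (L s) = iidx LF (L t)" by simp
    then show "s = t" by (simp only: L(2) ax_eq)
  qed
  moreover have "inj L'"
  proof (rule injI)
    fix s t assume "L' s = L' t"
    then have "iidx LF (L' s) = iidx LF (L' t)" by simp
    then show "s = t" by (simp only: L(3) neg_equal_iff_equal ax_eq)
  qed
  moreover have "L s \<noteq> L' t" for s t
  proof
    assume "L s = L' t"
    then have "iidx LF (L s) = iidx LF (L' t)" by simp
    then show False by (simp only: L(2,3) ne)
  qed
  then have "range L \<inter> range L' = {}" by blast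
  ultimately show ?thesis unfolding L(1)
    by (subst sum.union_disjoint) (auto simp: sum.reindex L(2,3) sum.distrib)
qed

lemma periodic_graph_periodic: "periodic_graph G a \<Longrightarrow> periodic G a"
  unfolding periodic_graph_def embedded_graph_def by unfold_locales auto

section \<open>The periodic graph in orbit coordinates\<close>

locale pendant_graph = periodic G a p
  for G :: "'n::finite pgraph" and a :: "'n \<Rightarrow> real ^ 'n" and p :: "real ^ 'n" +
  fixes \<nu> :: nat and vs :: "nat \<Rightarrow> real ^ 'n"
  assumes nu2: "\<nu> \<ge> 2" and pendants: "adds_pendants LF FG \<nu> vs" and fin_star: "\<And>v. v \<in> verts G \<Longrightarrow> finite (star G v)"
begin

definition pt :: "nat \<Rightarrow> int ^ 'n \<Rightarrow> real ^ 'n" where "pt j m = vs j + lat m"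

text \<open>\<open>adds_pendants\<close> specialised to the lattice: its fundamental graph has the
  single vertex 0, so the image of 0 must be the hub \<open>vs \<nu>\<close>.\<close>

lemma arc_structure:
  obtains \<psi> e where
    "inj_on \<psi> (iarcs LF)" "iarcs FG = \<psi> ` iarcs LF \<union> (\<Union>j\<in>{1..<\<nu>}. {e j, irev FG (e j)})"
    "\<And>x. x \<in> iarcs LF \<Longrightarrow> isrc FG (\<psi> x) = vs \<nu> \<and> itgt FG (\<psi> x) = vs \<nu> \<and> iidx FG (\<psi> x) = iidx LF x"
    "\<And>j. j \<in> {1..<\<nu>} \<Longrightarrow> isrc FG (e j) = vs j \<and> itgt FG (e j) = vs \<nu> \<and> iidx FG (e j) = 0"
    "inj_on vs {1..\<nu>}" "verts G \<inter> cell a p = vs ` {1..\<nu>}"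
proof -
  obtain \<phi> \<psi> e where A0: "inj_on \<phi> {0}" and A:
    "inj_on vs {1..<\<nu>}" "\<phi> ` {0} \<inter> vs ` {1..<\<nu>} = {}" "iverts FG = \<phi> ` {0} \<union> vs ` {1..<\<nu>}" "vs \<nu> \<in> \<phi> ` {0}"
    "inj_on \<psi> (iarcs LF)" "iarcs FG = \<psi> ` iarcs LF \<union> (\<Union>j\<in>{1..<\<nu>}. {e j, irev FG (e j)})"
    "\<forall>x\<in>iarcs LF. isrc FG (\<psi> x) = \<phi> (isrc LF x) \<and> itgt FG (\<psi> x) = \<phi> (itgt LF x) \<and>
       irev FG (\<psi> x) = \<psi> (irev LF x) \<and> iidx FG (\<psi> x) = iidx LF x"
    "\<forall>j\<in>{1..<\<nu>}. isrc FG (e j) = vs j \<and> itgt FG (e j) = vs \<nu> \<and> iidx FG (e j) = 0"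
    using pendants[unfolded adds_pendants_def lattice_iverts] by (elim exE conjE) (rule that)
  have ph: "\<phi> 0 = vs \<nu>" using A(4) by simp
  have ins: "{1..\<nu>} = insert \<nu> {1..<\<nu>}" using nu2 by auto
  have i: "inj_on vs {1..\<nu>}" unfolding ins using A(1,2) ph by auto
  have v: "verts G \<inter> cell a p = vs ` {1..\<nu>}" using A(3) ph unfolding ins iverts_FG by simp
  obtain L L' where L: "\<And>E :: (real \<Rightarrow> real ^ 'n) set. E \<in> iarcs LF \<Longrightarrow> isrc LF E = 0 \<and> itgt LF E = 0"
    using lattice_loops by metis
  have "isrc FG (\<psi> x) = vs \<nu> \<and> itgt FG (\<psi> x) = vs \<nu> \<and> iidx FG (\<psi> x) = iidx LF x" if "x \<in> iarcs LF" for x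
    using A(7)[rule_format, OF that] L[OF that] ph by simp
  from that[OF A(5,6) this _ i v] A(8) show thesis by blast
qed

lemma vs_cell: "j \<in> {1..\<nu>} \<Longrightarrow> vs j \<in> verts G" "j \<in> {1..\<nu>} \<Longrightarrow> vs j \<in> cell a p"
proof -
  have "verts G \<inter> cell a p = vs ` {1..\<nu>}" using arc_structure by metis
  then show "j \<in> {1..\<nu>} \<Longrightarrow> vs j \<in> verts G" "j \<in> {1..\<nu>} \<Longrightarrow> vs j \<in> cell a p" by blast+
qed

lemma inj_vs: "i \<in> {1..\<nu>} \<Longrightarrow> j \<in> {1..\<nu>} \<Longrightarrow> vs i = vs j \<longleftrightarrow> i = j"
proof -
  have "inj_on vs {1..\<nu>}" using arc_structure by metis
  then show "i \<in> {1..\<nu>} \<Longrightarrow> j \<in> {1..\<nu>} \<Longrightarrow> vs i = vs j \<longleftrightarrow> i = j" by (rule inj_on_eq_iff)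
qed

lemma pt_parts: assumes "j \<in> {1..\<nu>}" shows "pt j m \<in> verts G" "int_part a p (pt j m) = m" "frac_part a p (pt j m) = vs j"
  using vs_cell[OF assms] cell_parts[of "vs j"] by (simp_all add: pt_def verts_lat int_part_add frac_part_add)

lemma pt_bij: "bij_betw (\<lambda>(j, m). pt j m) ({1..\<nu>} \<times> UNIV) (verts G)"
proof (rule bij_betw_imageI)
  show "inj_on (\<lambda>(j, m). pt j m) ({1..\<nu>} \<times> UNIV)"
  proof (rule inj_onI, clarify)
    fix i m j n assume ij: "i \<in> {1..\<nu>}" "j \<in> {1..\<nu>}" and e: "pt i m = pt j n"
    have "m = n" using pt_parts(2)[OF ij(1), of m] pt_parts(2)[OF ij(2), of n] e by simp
    moreover have "vs i = vs j" using pt_parts(3)[OF ij(1), of m] pt_parts(3)[OF ij(2), of n] e by simp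
    ultimately show "i = j \<and> m = n" using inj_vs[OF ij] by simp
  qed
  show "(\<lambda>(j, m). pt j m) ` ({1..\<nu>} \<times> UNIV) = verts G"
  proof (intro equalityI subsetI)
    fix v assume v: "v \<in> verts G"
    have "frac_part a p v \<in> vs ` {1..\<nu>}" using frac_verts[OF v] frac_cell[of v] arc_structure by (metis IntI)
    then obtain j where j: "j \<in> {1..\<nu>}" "frac_part a p v = vs j" by blast
    have "v = pt j (int_part a p v)" using frac_decomp[of v] j(2) by (simp add: pt_def)
    then show "v \<in> (\<lambda>(j, m). pt j m) ` ({1..\<nu>} \<times> UNIV)" using j(1) by force
  qed (use pt_parts(1) in auto)
qed

text \<open>One evaluation for arbitrary \<open>h\<close> serves the Laplacian, the degrees and the
  entries of the Floquet matrix.\<close>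

lemma arc_sums:
  fixes h :: "real ^ 'n \<Rightarrow> int ^ 'n \<Rightarrow> 'b :: comm_monoid_add"
  shows "j \<in> {1..<\<nu>} \<Longrightarrow> (\<Sum>E\<in>{E \<in> iarcs FG. isrc FG E = vs j}. h (itgt FG E) (iidx FG E)) = h (vs \<nu>) 0"
    and "(\<Sum>E\<in>{E \<in> iarcs FG. isrc FG E = vs \<nu>}. h (itgt FG E) (iidx FG E)) =
       (\<Sum>s\<in>UNIV. h (vs \<nu>) (ax s) + h (vs \<nu>) (- ax s)) + (\<Sum>j\<in>{1..<\<nu>}. h (vs j) 0)"
proof -
  obtain \<psi> e where S:
    "inj_on \<psi> (iarcs LF)" "iarcs FG = \<psi> ` iarcs LF \<union> (\<Union>j\<in>{1..<\<nu>}. {e j, irev FG (e j)})"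
    "\<And>x. x \<in> iarcs LF \<Longrightarrow> isrc FG (\<psi> x) = vs \<nu> \<and> itgt FG (\<psi> x) = vs \<nu> \<and> iidx FG (\<psi> x) = iidx LF x"
    "\<And>j. j \<in> {1..<\<nu>} \<Longrightarrow> isrc FG (e j) = vs j \<and> itgt FG (e j) = vs \<nu> \<and> iidx FG (e j) = 0"
    "inj_on vs {1..\<nu>}" "verts G \<inter> cell a p = vs ` {1..\<nu>}"
    by (rule arc_structure) (rule that)
  have eF: "e j \<in> iarcs FG" if "j \<in> {1..<\<nu>}" for j using that unfolding S(2) by blast
  have r: "isrc FG (irev FG (e j)) = vs \<nu>" "itgt FG (irev FG (e j)) = vs j" "iidx FG (irev FG (e j)) = 0"
    if "j \<in> {1..<\<nu>}" for j using irev_simps[OF eF[OF that]] S(4)[OF that] by auto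
  have J: "j \<in> {1..\<nu>}" "vs j \<noteq> vs \<nu>" if "j \<in> {1..<\<nu>}" for j using that inj_vs[of j \<nu>] nu2 by auto
  {
    assume j: "j \<in> {1..<\<nu>}"
    have "{E \<in> iarcs FG. isrc FG E = vs j} = {e j}"
    proof (intro equalityI subsetI)
      fix E assume E: "E \<in> {E \<in> iarcs FG. isrc FG E = vs j}"
      then consider x where "x \<in> iarcs LF" "E = \<psi> x" | i where "i \<in> {1..<\<nu>}" "E = e i" | i where "i \<in> {1..<\<nu>}" "E = irev FG (e i)"
        unfolding S(2) by blast
      then show "E \<in> {e j}"
      proof cases
        case 1
        then show ?thesis using S(3)[OF 1(1)] E J(2)[OF j] by auto
      next
        case 2
        then have "vs i = vs j" using S(4)[OF 2(1)] E by auto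
        then have "i = j" using inj_vs[OF J(1)[OF 2(1)] J(1)[OF j]] by simp
        then show ?thesis using 2(2) by simp
      next
        case 3
        then show ?thesis using r(1)[OF 3(1)] E J(2)[OF j] by auto
      qed
    qed (use eF[OF j] S(4)[OF j] in auto)
    then show "(\<Sum>E\<in>{E \<in> iarcs FG. isrc FG E = vs j}. h (itgt FG E) (iidx FG E)) = h (vs \<nu>) 0"
      using S(4)[OF j] by simp
  }
  have fin: "finite (iarcs (LF :: (real ^ 'n, _, 'n) igraph))"
  proof (rule lattice_loops)
    fix L L' :: "'n \<Rightarrow> (real \<Rightarrow> real ^ 'n) set"
    assume "iarcs LF = range L \<union> range L'"
    then show ?thesis by simp
  qed
  have injr: "inj_on (\<lambda>j. irev FG (e j)) {1..<\<nu>}"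
  proof (rule inj_onI)
    fix i j assume ij: "i \<in> {1..<\<nu>}" "j \<in> {1..<\<nu>}" "irev FG (e i) = irev FG (e j)"
    then have "vs i = vs j" using r(2)[OF ij(1)] r(2)[OF ij(2)] by simp
    then show "i = j" using inj_vs[OF J(1)[OF ij(1)] J(1)[OF ij(2)]] by simp
  qed
  have set: "{E \<in> iarcs FG. isrc FG E = vs \<nu>} = \<psi> ` iarcs LF \<union> (\<lambda>j. irev FG (e j)) ` {1..<\<nu>}"
  proof (intro equalityI subsetI)
    fix E assume E: "E \<in> {E \<in> iarcs FG. isrc FG E = vs \<nu>}"
    then consider "E \<in> \<psi> ` iarcs LF" | i where "i \<in> {1..<\<nu>}" "E = e i" | "E \<in> (\<lambda>j. irev FG (e j)) ` {1..<\<nu>}"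
      unfolding S(2) by blast
    then show "E \<in> \<psi> ` iarcs LF \<union> (\<lambda>j. irev FG (e j)) ` {1..<\<nu>}"
    proof cases
      case 2
      then show ?thesis using S(4)[OF 2(1)] E J(2)[OF 2(1)] by auto
    qed auto
  next
    fix E assume "E \<in> \<psi> ` iarcs LF \<union> (\<lambda>j. irev FG (e j)) ` {1..<\<nu>}"
    then consider x where "x \<in> iarcs LF" "E = \<psi> x" | j where "j \<in> {1..<\<nu>}" "E = irev FG (e j)" by blast
    then show "E \<in> {E \<in> iarcs FG. isrc FG E = vs \<nu>}"
    proof cases
      case 1
      then show ?thesis using S(3)[OF 1(1)] unfolding S(2) by blast
    next
      case 2
      then show ?thesis using r(1)[OF 2(1)] unfolding S(2) by blast
    qed
  qed
  have disj: "\<psi> ` iarcs LF \<inter> (\<lambda>j. irev FG (e j)) ` {1..<\<nu>} = {}"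
  proof (rule ccontr)
    assume "\<not> ?thesis"
    then obtain x j where xj: "x \<in> iarcs LF" "j \<in> {1..<\<nu>}" "\<psi> x = irev FG (e j)" by blast
    then show False using S(3)[OF xj(1)] r(2)[OF xj(2)] J(2)[OF xj(2)] by simp
  qed
  have "(\<Sum>E\<in>{E \<in> iarcs FG. isrc FG E = vs \<nu>}. h (itgt FG E) (iidx FG E)) =
     (\<Sum>E\<in>\<psi> ` iarcs LF. h (itgt FG E) (iidx FG E)) + (\<Sum>E\<in>(\<lambda>j. irev FG (e j)) ` {1..<\<nu>}. h (itgt FG E) (iidx FG E))"
    unfolding set by (rule sum.union_disjoint[OF _ _ disj]) (use fin in auto)
  also have "(\<Sum>E\<in>\<psi> ` iarcs LF. h (itgt FG E) (iidx FG E)) = (\<Sum>x\<in>iarcs LF. h (vs \<nu>) (iidx LF x))"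
    unfolding sum.reindex[OF S(1)] o_def by (rule sum.cong) (use S(3) in auto)
  also have "\<dots> = (\<Sum>s\<in>UNIV. h (vs \<nu>) (ax s) + h (vs \<nu>) (- ax s))" by (rule lattice_sum)
  also have "(\<Sum>E\<in>(\<lambda>j. irev FG (e j)) ` {1..<\<nu>}. h (itgt FG E) (iidx FG E)) = (\<Sum>j\<in>{1..<\<nu>}. h (vs j) 0)"
    unfolding sum.reindex[OF injr] o_def by (rule sum.cong) (use r in auto)
  finally show "(\<Sum>E\<in>{E \<in> iarcs FG. isrc FG E = vs \<nu>}. h (itgt FG E) (iidx FG E)) =
       (\<Sum>s\<in>UNIV. h (vs \<nu>) (ax s) + h (vs \<nu>) (- ax s)) + (\<Sum>j\<in>{1..<\<nu>}. h (vs j) 0)" .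
qed

lemma laplacian_sum: assumes "j \<in> {1..\<nu>}"
  shows "laplacian G f (pt j m) =
    (\<Sum>E\<in>{E \<in> iarcs FG. isrc FG E = vs j}. f (pt j m) - f (itgt FG E + lat (m + iidx FG E)))"
  using star_sum[OF pt_parts(1)[OF assms], of "\<lambda>w. f (pt j m) - f w"] pt_parts[OF assms]
  by (simp add: laplacian_def)

lemma laplacian_pend: assumes j: "j \<in> {1..<\<nu>}"
  shows "laplacian G f (pt j m) = f (pt j m) - f (pt \<nu> m)"
proof -
  have "j \<in> {1..\<nu>}" using j by auto
  then show ?thesis unfolding laplacian_sum[OF \<open>j \<in> {1..\<nu>}\<close>]
    using arc_sums(1)[OF j, of "\<lambda>w t. f (pt j m) - f (w + lat (m + t))"] by (simp add: pt_def)
qed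

lemma laplacian_hub:
  "laplacian G f (pt \<nu> m) = of_nat (2 * CARD('n)) * f (pt \<nu> m) - (\<Sum>s\<in>UNIV. f (pt \<nu> (m + ax s)) + f (pt \<nu> (m - ax s)))
     + of_nat (\<nu> - 1) * f (pt \<nu> m) - (\<Sum>j\<in>{1..<\<nu>}. f (pt j m))"
proof -
  have n: "\<nu> \<in> {1..\<nu>}" using nu2 by auto
  show ?thesis unfolding laplacian_sum[OF n]
    using arc_sums(2)[of "\<lambda>w t. f (pt \<nu> m) - f (w + lat (m + t))"]
    by (simp add: pt_def sum.distrib sum_subtractf sum_negf)
qed

lemma vdegree_vs: "j \<in> {1..<\<nu>} \<Longrightarrow> vdegree G (vs j) = 1" "vdegree G (vs \<nu>) = 2 * CARD('n) + (\<nu> - 1)"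
proof -
  have deg: "vdegree G (vs j) = (\<Sum>E\<in>{E \<in> iarcs FG. isrc FG E = vs j}. 1)" if "j \<in> {1..\<nu>}" for j
    using bij_betw_same_card[OF star_bij[OF vs_cell(1)[OF that]]] cell_parts(2)[OF vs_cell(2)[OF that]]
    by (simp add: vdegree_def)
  {
    assume j: "j \<in> {1..<\<nu>}"
    then have "j \<in> {1..\<nu>}" by auto
    from deg[OF this] show "vdegree G (vs j) = 1" using arc_sums(1)[OF j, of "\<lambda>_ _. 1 :: nat"] by simp
  }
  have "\<nu> \<in> {1..\<nu>}" using nu2 by auto
  from deg[OF this] show "vdegree G (vs \<nu>) = 2 * CARD('n) + (\<nu> - 1)"
    using arc_sums(2)[of "\<lambda>_ _. 1 :: nat"] by simp
qed

text \<open>Periodicity is given at vertices only, so the property carried along the lattice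
  includes being a vertex.\<close>

lemma potential_pt: assumes "periodic_potential G a Q" "j \<in> {1..\<nu>}" shows "Q (pt j m) = Q (vs j)"
proof -
  have "(vs j + lat m \<in> verts G \<and> Q (vs j + lat m) = Q (vs j)) \<longleftrightarrow> (vs j \<in> verts G \<and> Q (vs j) = Q (vs j))"
  proof (rule lattice_closed[where P = "\<lambda>v. v \<in> verts G \<and> Q v = Q (vs j)"])
    fix t i
    have "t + a i \<in> verts G \<longleftrightarrow> t \<in> verts G" using verts_lat[of t "ax i"] by (simp add: lattice_vec_ax)
    then show "t + a i \<in> verts G \<and> Q (t + a i) = Q (vs j) \<longleftrightarrow> t \<in> verts G \<and> Q t = Q (vs j)"
      using assms(1) by (auto simp: periodic_potential_def)
  qed
  then show ?thesis using vs_cell(1)[OF assms(2)] by (simp add: pt_def)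
qed

lemma bridges_loops: assumes "E \<in> bridges FG"
  obtains s where "isrc FG E = itgt FG E" "iidx FG E = ax s \<or> iidx FG E = - ax s"
proof -
  obtain \<psi> e where S:
    "inj_on \<psi> (iarcs LF)" "iarcs FG = \<psi> ` iarcs LF \<union> (\<Union>j\<in>{1..<\<nu>}. {e j, irev FG (e j)})"
    "\<And>x. x \<in> iarcs LF \<Longrightarrow> isrc FG (\<psi> x) = vs \<nu> \<and> itgt FG (\<psi> x) = vs \<nu> \<and> iidx FG (\<psi> x) = iidx LF x"
    "\<And>j. j \<in> {1..<\<nu>} \<Longrightarrow> isrc FG (e j) = vs j \<and> itgt FG (e j) = vs \<nu> \<and> iidx FG (e j) = 0"
    "inj_on vs {1..\<nu>}" "verts G \<inter> cell a p = vs ` {1..\<nu>}"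
    by (rule arc_structure) (rule that)
  obtain L L' where L: "iarcs (LF :: (real ^ 'n, _, 'n) igraph) = range L \<union> range L'"
    "\<And>s. iidx LF (L s) = ax s" "\<And>s. iidx LF (L' s) = - ax s" using lattice_loops by metis
  have E: "E \<in> iarcs FG" "iidx FG E \<noteq> 0" using assms by (auto simp: bridges_def)
  have eF: "e j \<in> iarcs FG" if "j \<in> {1..<\<nu>}" for j using that unfolding S(2) by blast
  have "E \<in> \<psi> ` iarcs LF"
  proof (rule ccontr)
    assume "E \<notin> \<psi> ` iarcs LF"
    then obtain j where j: "j \<in> {1..<\<nu>}" "E = e j \<or> E = irev FG (e j)" using E(1) unfolding S(2) by blast
    then have "iidx FG E = 0" using S(4)[OF j(1)] irev_simps(3)[OF eF[OF j(1)]] by auto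
    then show False using E(2) by simp
  qed
  then obtain x where x: "x \<in> iarcs LF" "E = \<psi> x" by blast
  have "\<exists>s. iidx LF x = ax s \<or> iidx LF x = - ax s" using x(1) L by auto
  then show thesis using that S(3)[OF x(1)] x(2) by auto
qed

end

section \<open>Floquet matrices\<close>

context secular
begin

text \<open>The Floquet matrix at symbol value \<open>t\<close>, an arrowhead matrix with the hub in
  the last row and column. Rows count from 0, so row \<open>j\<close> belongs to vertex number
  \<open>Suc j\<close>.\<close>

definition arrow :: "real \<Rightarrow> complex mat" where
  "arrow t = Matrix.mat \<nu> \<nu> (\<lambda>(j, k). if j = k then (if Suc j = \<nu> then of_real (c + t) else of_real (\<beta> (Suc j)))
     else if Suc j = \<nu> \<or> Suc k = \<nu> then - 1 else 0)"

lemma arrow_carrier: "arrow t \<in> carrier_mat \<nu> \<nu>"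
  by (simp add: arrow_def)

lemma arrow_nth:
  assumes "j < \<nu>" "k < \<nu>"
  shows "arrow t $$ (j, k) = (if j = k then (if Suc j = \<nu> then of_real (c + t) else of_real (\<beta> (Suc j)))
     else if Suc j = \<nu> \<or> Suc k = \<nu> then - 1 else 0)"
  using assms by (simp add: arrow_def)

text \<open>Off the poles, \<open>x - arrow t\<close> is a lower times an upper triangular matrix.
  The last pivot \<open>s\<close> is the Schur complement of the diagonal pendant block and equals
  \<open>F x - t\<close>.\<close>

lemma det_arrow:
  assumes x: "x \<notin> B"
  shows "poly (char_poly (arrow t)) (of_real x) = of_real (poly (chi t) x)"
proof -
  obtain l where l: "\<nu> = Suc l" using nu2 by (cases \<nu>) auto
  define e where "e i = complex_of_real (x - \<beta> (Suc i))" for i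
  have e0: "e i \<noteq> 0" if "i < l" for i
  proof -
    have "\<beta> (Suc i) \<in> B" unfolding B_def using that l by (intro imageI) simp
    then show ?thesis using x by (auto simp: e_def)
  qed
  define s where "s = complex_of_real (x - c - t) - (\<Sum>i\<in>{0..<l}. 1 / e i)"
  define L where "L = Matrix.mat \<nu> \<nu> (\<lambda>(i, j). if i = j then (if i = l then 1 else e i) else if i = l then 1 else 0)"
  define U where "U = Matrix.mat \<nu> \<nu> (\<lambda>(i, j). if i = j then (if i = l then s else 1) else if j = l then 1 / e i else 0)"
  define M where "M = - (char_matrix (arrow t) (of_real x))"
  have LU: "L \<in> carrier_mat \<nu> \<nu>" "U \<in> carrier_mat \<nu> \<nu>" by (simp_all add: L_def U_def)
  have "M = L * U"
  proof (rule eq_matI)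
    show "dim_row M = dim_row (L * U)" "dim_col M = dim_col (L * U)"
      using arrow_carrier[of t] LU by (auto simp: M_def char_matrix_def)
    fix i j assume "i < dim_row (L * U)" "j < dim_col (L * U)"
    then have ij: "i < \<nu>" "j < \<nu>" using LU by auto
    have Mij: "M $$ (i, j) = (if i = j then (if i = l then of_real (x - c - t) else e i) else if i = l \<or> j = l then 1 else 0)"
    proof -
      have "M $$ (i, j) = (if i = j then of_real x else 0) - arrow t $$ (i, j)"
        using ij carrier_matD[OF arrow_carrier[of t]] by (simp add: M_def char_matrix_def)
      moreover have "Suc i = \<nu> \<longleftrightarrow> i = l" "Suc j = \<nu> \<longleftrightarrow> j = l" by (simp_all add: l)
      ultimately show ?thesis by (simp add: arrow_nth[OF ij] e_def)
    qed
    have "(L * U) $$ (i, j) = (\<Sum>k\<in>{0..<\<nu>}. L $$ (i, k) * U $$ (k, j))"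
      using ij LU by (simp add: times_mat_def scalar_prod_def)
    also have "\<dots> = (\<Sum>k\<in>{0..<l}. L $$ (i, k) * U $$ (k, j)) + L $$ (i, l) * U $$ (l, j)"
      by (simp add: l)
    also have "\<dots> = M $$ (i, j)"
    proof (cases "i = l")
      case True
      show ?thesis
      proof (cases "j = l")
        case jl: True
        have "(\<Sum>k\<in>{0..<l}. L $$ (i, k) * U $$ (k, j)) = (\<Sum>k\<in>{0..<l}. 1 / e k)"
          using True jl l by (intro sum.cong) (auto simp: L_def U_def)
        then show ?thesis unfolding Mij using True jl l by (simp add: L_def U_def s_def)
      next
        case jl: False
        have "(\<Sum>k\<in>{0..<l}. L $$ (i, k) * U $$ (k, j)) = (\<Sum>k\<in>{0..<l}. if k = j then 1 else 0)"
          using True jl l ij by (intro sum.cong) (auto simp: L_def U_def)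
        then show ?thesis unfolding Mij using True jl l ij by (simp add: L_def U_def)
      qed
    next
      case False
      then have il: "i < l" using ij l by simp
      have "(\<Sum>k\<in>{0..<l}. L $$ (i, k) * U $$ (k, j)) = (\<Sum>k\<in>{0..<l}. if k = i then e i * U $$ (i, j) else 0)"
        using il l by (intro sum.cong) (auto simp: L_def)
      also have "\<dots> = e i * U $$ (i, j)" using il by simp
      finally show ?thesis unfolding Mij using il l ij e0[OF il] by (auto simp: L_def U_def)
    qed
    finally show "M $$ (i, j) = (L * U) $$ (i, j)" by simp
  qed
  then have "det M = det L * det U" using det_mult[OF LU] by simp
  also have "det L = (\<Prod>i\<in>{0..<\<nu>}. L $$ (i, i))"
    by (subst det_lower_triangular[OF _ LU(1)]) (auto simp: L_def l prod_list_diag_prod)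
  also have "\<dots> = (\<Prod>i\<in>{0..<l}. e i)" by (simp add: l L_def)
  also have "det U = (\<Prod>i\<in>{0..<\<nu>}. U $$ (i, i))"
    by (subst det_upper_triangular[OF _ LU(2)]) (auto simp: U_def l prod_list_diag_prod)
  also have "\<dots> = s" by (simp add: l U_def)
  also have "s = of_real (F x - t)"
  proof -
    have "(\<Sum>j\<in>{1..<\<nu>}. 1 / (\<beta> j - x)) = (\<Sum>i\<in>{0..<l}. 1 / (\<beta> (Suc i) - x))"
      using sum.shift_bounds_Suc_ivl[of "\<lambda>j. 1 / (\<beta> j - x)" 0 l] by (simp add: l)
    also have "\<dots> = - (\<Sum>i\<in>{0..<l}. 1 / (x - \<beta> (Suc i)))"
      unfolding sum_negf[symmetric] by (intro sum.cong) (auto simp: minus_divide_right)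
    finally show ?thesis by (simp add: s_def F_def e_def)
  qed
  also have "(\<Prod>i\<in>{0..<l}. e i) = of_real (poly pend x)"
  proof -
    have "poly pend x = (\<Prod>j\<in>{Suc 0..<Suc l}. x - \<beta> j)" by (simp add: pend_def poly_prod flip: l)
    then show ?thesis by (simp only: prod.shift_bounds_Suc_ivl e_def of_real_prod)
  qed
  finally show ?thesis
    using char_poly_matrix[OF arrow_carrier[of t], of "of_real x"] poly_chi[OF x, of t] by (simp add: M_def)
qed

text \<open>Both polynomials agree at all real points outside the finite set of poles, hence
  identically.\<close>

lemma char_poly_arrow: "char_poly (arrow t) = (\<Prod>n\<in>{1..\<nu>}. [:- complex_of_real (ev n t), 1:])"
proof -
  let ?P = "\<Prod>n\<in>{1..\<nu>}. [:- complex_of_real (ev n t), 1:]"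
  have "poly ?P (of_real x) = of_real (poly (linprod t) x)" for x
    by (simp add: linprod_def poly_prod)
  then have "complex_of_real ` (- B) \<subseteq> {z. poly (char_poly (arrow t) - ?P) z = 0}"
    using det_arrow by (auto simp: chi_eq)
  moreover have "infinite (complex_of_real ` (- B))"
    using finite_B infinite_UNIV_char_0[where 'a = real]
    by (subst finite_image_iff) (auto simp: inj_on_def Compl_eq_Diff_UNIV)
  ultimately have "infinite {z. poly (char_poly (arrow t) - ?P) z = 0}" using finite_subset by blast
  then have "char_poly (arrow t) - ?P = 0" using poly_roots_finite by blast
  then show ?thesis by simp
qed

lemma proots_arrow: "proots (char_poly (arrow t)) = image_mset (\<lambda>n. complex_of_real (ev n t)) (mset_set {1..\<nu>})"
proof -
  have "proots (char_poly (arrow t)) = (\<Sum>n\<in>{1..\<nu>}. {#complex_of_real (ev n t)#})"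
    unfolding char_poly_arrow by (subst proots_prod) auto
  then show ?thesis by (simp add: sum_unfold_sum_mset)
qed

text \<open>By \<open>ev_le_ev\<close> the branch values are already sorted; branch numbers start at
  1 and list positions at 0.\<close>

lemma arrow_eigenvalue:
  assumes n: "n \<in> {1..\<nu>}"
  shows "sorted_list_of_multiset (image_mset Re (proots (char_poly (arrow t)))) ! (n - 1) = ev n t"
proof -
  let ?xs = "map (\<lambda>n. ev n t) [1..<Suc \<nu>]"
  have "image_mset Re (proots (char_poly (arrow t))) = mset ?xs"
    by (simp add: proots_arrow image_mset.compositionality o_def mset_upt atLeastLessThanSuc_atLeastAtMost del: upt_Suc)
  moreover have "sorted ?xs"
    unfolding sorted_iff_nth_mono_less using ev_le_ev by (auto simp del: upt_Suc)
  ultimately have "sorted_list_of_multiset (image_mset Re (proots (char_poly (arrow t)))) = ?xs"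
    by (simp only: sorted_list_of_multiset_mset sorted_sort_id)
  moreover have "?xs ! (n - 1) = ev n t"
    using n by (subst nth_map) (auto simp del: upt_Suc)
  ultimately show ?thesis by simp
qed

lemma order_arrow:
  assumes "b \<in> B" shows "Polynomial.order (of_real b) (char_poly (arrow t)) = pole_mult b - 1"
proof -
  have "char_poly (arrow t) \<noteq> 0" unfolding char_poly_arrow by simp
  then have "Polynomial.order (of_real b) (char_poly (arrow t)) = count (proots (char_poly (arrow t))) (of_real b)" by simp
  also have "\<dots> = card {n\<in>{1..\<nu>}. ev n t = b}"
    by (simp add: proots_arrow count_image_mset' sum.If_cases) (auto intro!: arg_cong[where f = card])
  also have "\<dots> = pole_mult b - 1" by (rule card_ev[OF assms])
  finally show ?thesis .
qed

text \<open>Compared with \<open>bands_union\<close>, only nondegenerate branches occur. This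
  removes the repeated poles, since no gap contains a pole.\<close>

lemma bands_spectrum:
  assumes "0 \<le> s" shows "{x. x \<notin> B \<and> F x \<in> {0..s}} = (\<Union>n\<in>bands. {ev n 0..ev n s})"
proof (intro equalityI subsetI)
  fix x assume x: "x \<in> {x. x \<notin> B \<and> F x \<in> {0..s}}"
  then obtain n where n: "n \<in> {1..\<nu>}" "x \<in> gap n" using in_gap by blast
  have "x \<in> ev n ` {0..s}" using ev_eq[OF n] x by (metis (mono_tags, lifting) imageI mem_Collect_eq)
  moreover have "n \<in> bands" using n by (auto simp: bands_def gap_def)
  ultimately show "x \<in> (\<Union>n\<in>bands. {ev n 0..ev n s})" using ev_image[OF n(1) assms] by blast
next
  fix x assume "x \<in> (\<Union>n\<in>bands. {ev n 0..ev n s})"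
  then obtain n where n: "n \<in> bands" "x \<in> {ev n 0..ev n s}" by blast
  then have n': "n \<in> {1..\<nu>}" "lo n < hi n" by (auto simp: bands_def)
  obtain t where t: "t \<in> {0..s}" "x = ev n t" using n(2) ev_image[OF n'(1) assms] by blast
  show "x \<in> {x. x \<notin> B \<and> F x \<in> {0..s}}" using ev_gap[OF n', of t] gap_B[OF n'(1)] t by auto
qed

lemma ev_strict: assumes "n \<in> bands" "s < t" shows "ev n s < ev n t"
proof -
  have n: "n \<in> {1..\<nu>}" "lo n < hi n" using assms by (auto simp: bands_def)
  have "ev n s \<le> ev n t" using ev_mono[OF n(1)] assms(2) by (auto simp: mono_def)
  moreover have "ev n s \<noteq> ev n t" using ev_gap(2)[OF n, of s] ev_gap(2)[OF n, of t] assms(2) by auto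
  ultimately show ?thesis by simp
qed

end

section \<open>Floquet matrices of the graph and the resulting spectra\<close>

lemma symb_const: "symb (\<lambda>i :: 'n::finite. x) = 2 * real CARD('n) * (1 - cos x)"
  by (simp add: symb_def algebra_simps)

text \<open>Constant quasimomenta already attain every value.\<close>

lemma symb_torus: "(\<lambda>\<theta>. symb (\<lambda>i. \<theta> $ i)) ` (torus :: (real ^ 'n::finite) set) = {0..4 * real CARD('n)}"
proof (intro equalityI subsetI)
  fix t assume t: "t \<in> {0..4 * real CARD('n)}"
  define x where "x = arccos (1 - t / (2 * real CARD('n)))"
  have b: "-1 \<le> 1 - t / (2 * real CARD('n))" "1 - t / (2 * real CARD('n)) \<le> 1" using t by (auto simp: field_simps)
  have "0 \<le> x" "x \<le> pi" using arccos_bounded[OF b] by (auto simp: x_def)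
  then have "(\<chi> i. x) \<in> (torus :: (real ^ 'n) set)" by (simp add: torus_def) (use pi_gt_zero in linarith)
  moreover have "symb (\<lambda>i. ((\<chi> i. x) :: real ^ 'n) $ i) = t"
    using cos_arccos[OF b] by (simp add: symb_const x_def)
  ultimately show "t \<in> (\<lambda>\<theta>. symb (\<lambda>i. \<theta> $ i)) ` (torus :: (real ^ 'n) set)" by (metis (no_types, lifting) imageI)
qed (use symb_bounds in auto)

lemma phase_ax: "phase (ax s) \<theta> = \<theta> $ s" "phase (- ax s) \<theta> = - \<theta> $ s"
proof -
  have "(\<Sum>i\<in>UNIV. of_int (ax s $ i) * \<theta> $ i) = (\<Sum>i\<in>UNIV. if i = s then \<theta> $ i else 0)"
    by (intro sum.cong) (auto simp: ax_nth)
  then show "phase (ax s) \<theta> = \<theta> $ s" by (simp add: phase_def)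
  then show "phase (- ax s) \<theta> = - \<theta> $ s" by (simp add: phase_def sum_negf)
qed

context pendant_graph
begin

lemma precise: assumes "periodic_graph G a" shows "precise_loop_graph G a p (\<chi> i. pi)"
proof -
  have "isrc FG E = itgt FG E \<and> cos (phase (iidx FG E) (\<chi> i. pi)) = - 1" if E: "E \<in> bridges FG" for E
  proof (rule bridges_loops[OF E])
    fix s assume "isrc FG E = itgt FG E" "iidx FG E = ax s \<or> iidx FG E = - ax s"
    then show ?thesis by (auto simp: phase_ax)
  qed
  then show ?thesis using assms by (simp add: precise_loop_graph_def loop_graph_def Let_def)
qed

lemma model:
  assumes Q: "periodic_potential G a Q"
  shows "pendant_model \<nu> (\<lambda>j. 1 + Q (vs j)) (Q (vs \<nu>) + real (\<nu> - 1)) (verts G) pt (schroedinger G Q)"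
proof
  show "\<nu> \<ge> 2" by (rule nu2)
  show "bij_betw (\<lambda>(j, m). pt j m) ({1..\<nu>} \<times> UNIV) (verts G)" by (rule pt_bij)
  show "schroedinger G Q f v = 0" if "v \<notin> verts G" "f v = 0" for f v
    using that by (simp add: schroedinger_def laplacian_def)
  show "schroedinger G Q f (pt j m) = of_real (1 + Q (vs j)) * f (pt j m) - f (pt \<nu> m)" if "j \<in> {1..<\<nu>}" for f j m
    using that potential_pt[OF Q, of j m] by (simp add: schroedinger_def laplacian_pend algebra_simps)
  show "schroedinger G Q f (pt \<nu> m) = of_real (Q (vs \<nu>) + real (\<nu> - 1)) * f (pt \<nu> m) + (of_nat (2 * CARD('n)) * f (pt \<nu> m)
        - (\<Sum>i\<in>UNIV. f (pt \<nu> (m + ax i)) + f (pt \<nu> (m - ax i)))) - (\<Sum>j\<in>{1..<\<nu>}. f (pt j m))" for f m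
    using potential_pt[OF Q, of \<nu> m] nu2
    unfolding schroedinger_def laplacian_hub by (simp add: algebra_simps)
qed

text \<open>The loops contribute twice the sum of the cosines to the hub entry, and the hub has
  degree \<open>2 d + \<nu> - 1\<close>; together they give \<open>c\<close> plus the symbol.
  Pendant edges have index 0 and so phase factor 1.\<close>

lemma floquet_arrow:
  "floquet G a p vs Q \<theta> = secular.arrow \<nu> (\<lambda>j. 1 + Q (vs j)) (Q (vs \<nu>) + real (\<nu> - 1)) (symb (\<lambda>i. \<theta> $ i))"
proof -
  define c where "c = Q (vs \<nu>) + real (\<nu> - 1)"
  interpret secular \<nu> "\<lambda>j. 1 + Q (vs j)" c by unfold_locales (rule nu2)
  have iv: "iverts FG = vs ` {1..\<nu>}" using arc_structure unfolding iverts_FG by metis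
  have inj: "inj_on vs {1..\<nu>}" using inj_vs by (simp add: inj_on_def)
  have card: "card (iverts FG) = \<nu>" unfolding iv card_image[OF inj] by simp
  define S where "S j k = (\<Sum>E\<in>{E \<in> iarcs FG. isrc FG E = vs j \<and> itgt FG E = vs k}. cis (phase (iidx FG E) \<theta>))" for j k
  \<comment> \<open>As a sum over all edges from \<open>vs j\<close>, with the target tested inside,
    the entry becomes an instance of \<open>arc_sums\<close>.\<close>
  have S: "S j k = (\<Sum>E\<in>{E \<in> iarcs FG. isrc FG E = vs j}. if itgt FG E = vs k then cis (phase (iidx FG E) \<theta>) else 0)"
    if j: "j \<in> {1..\<nu>}" for j k
  proof -
    have "finite {E \<in> iarcs FG. isrc FG E = frac_part a p (vs j)}"
      using bij_betw_finite[OF star_bij[OF vs_cell(1)[OF j]]] fin_star[OF vs_cell(1)[OF j]] by simp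
    then have fin: "finite {E \<in> iarcs FG. isrc FG E = vs j}" using cell_parts(2)[OF vs_cell(2)[OF j]] by simp
    have "{E \<in> iarcs FG. isrc FG E = vs j \<and> itgt FG E = vs k} = {E \<in> {E \<in> iarcs FG. isrc FG E = vs j}. itgt FG E = vs k}" by auto
    then show ?thesis unfolding S_def using sum.inter_filter[OF fin] by simp
  qed
  have n: "\<nu> \<in> {1..\<nu>}" using nu2 by auto
  have vse: "vs i = vs k \<longleftrightarrow> i = k" if "i \<in> {1..\<nu>}" "k \<in> {1..\<nu>}" for i k using inj_vs[OF that] .
  have S1: "S j k = (if k = \<nu> then 1 else 0)" if j: "j \<in> {1..<\<nu>}" and k: "k \<in> {1..\<nu>}" for j k
  proof -
    have j': "j \<in> {1..\<nu>}" using j by auto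
    show ?thesis unfolding S[OF j'] using arc_sums(1)[OF j, of "\<lambda>w \<tau>. if w = vs k then cis (phase \<tau> \<theta>) else 0"]
      vse[OF n k] by (auto simp: phase_def)
  qed
  have S2: "S \<nu> k = (if k = \<nu> then of_real (2 * (\<Sum>s\<in>UNIV. cos (\<theta> $ s))) else 1)" if k: "k \<in> {1..\<nu>}" for k
  proof -
    have s0: "(\<Sum>j\<in>{1..<\<nu>}. if vs j = vs k then cis (phase 0 \<theta>) else 0) = (if k = \<nu> then 0 else 1)"
    proof -
      have "(\<Sum>j\<in>{1..<\<nu>}. if vs j = vs k then cis (phase 0 \<theta>) else 0) = (\<Sum>j\<in>{1..<\<nu>}. if j = k then 1 else 0)"
        using vse[OF _ k] by (intro sum.cong) (auto simp: phase_def)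
      also have "\<dots> = (if k = \<nu> then 0 else 1)" using k by auto
      finally show ?thesis .
    qed
    have "cis x + cis (- x) = of_real (2 * cos x)" for x by (simp add: complex_eq_iff)
    then have c: "(\<Sum>s\<in>UNIV. cis (\<theta> $ s) + cis (- \<theta> $ s)) = of_real (2 * (\<Sum>s\<in>UNIV. cos (\<theta> $ s)))"
      by (simp only: of_real_sum sum_distrib_left)
    show ?thesis unfolding S[OF n] using arc_sums(2)[of "\<lambda>w \<tau>. if w = vs k then cis (phase \<tau> \<theta>) else 0"]
      vse[OF n k] s0 c by (auto simp: phase_ax)
  qed
  show ?thesis unfolding c_def[symmetric]
  proof (rule eq_matI)
    show "dim_row (floquet G a p vs Q \<theta>) = dim_row (arrow (symb (\<lambda>i. \<theta> $ i)))"
      "dim_col (floquet G a p vs Q \<theta>) = dim_col (arrow (symb (\<lambda>i. \<theta> $ i)))"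
      by (simp_all add: floquet_def Let_def card arrow_def)
    fix j k assume "j < dim_row (arrow (symb (\<lambda>i. \<theta> $ i)))" "k < dim_col (arrow (symb (\<lambda>i. \<theta> $ i)))"
    then have jk: "j < \<nu>" "k < \<nu>" by (simp_all add: arrow_def)
    have K: "Suc k \<in> {1..\<nu>}" using jk by auto
    have "floquet G a p vs Q \<theta> $$ (j, k) =
       (if j = k then of_nat (vdegree G (vs (Suc j))) + complex_of_real (Q (vs (Suc j))) else 0) - S (Suc j) (Suc k)"
      unfolding S_def using jk by (simp add: floquet_def Let_def card)
    also have "\<dots> = arrow (symb (\<lambda>i. \<theta> $ i)) $$ (j, k)"
    proof (cases "Suc j = \<nu>")
      case True
      have v: "of_nat (vdegree G (vs (Suc j))) = complex_of_real (2 * real CARD('n) + real (\<nu> - 1))"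
        unfolding True vdegree_vs by simp
      have "j = k \<longleftrightarrow> Suc k = \<nu>" using True by auto
      then show ?thesis unfolding v unfolding True S2[OF K] arrow_nth[OF jk]
        by (simp add: True symb_def c_def)
    next
      case False
      then have J: "Suc j \<in> {1..<\<nu>}" using jk by auto
      show ?thesis unfolding S1[OF J K] vdegree_vs(1)[OF J] arrow_nth[OF jk] using False by simp
    qed
    finally show "floquet G a p vs Q \<theta> $$ (j, k) = arrow (symb (\<lambda>i. \<theta> $ i)) $$ (j, k)" .
  qed
qed

lemma band_function_ev:
  assumes "n \<in> {1..\<nu>}"
  shows "band_function G a p vs Q n \<theta> =
    secular.ev \<nu> (\<lambda>j. 1 + Q (vs j)) (Q (vs \<nu>) + real (\<nu> - 1)) n (symb (\<lambda>i. \<theta> $ i))"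
proof -
  define c where "c = Q (vs \<nu>) + real (\<nu> - 1)"
  interpret secular \<nu> "\<lambda>j. 1 + Q (vs j)" c by unfold_locales (rule nu2)
  show ?thesis unfolding band_function_def floquet_arrow c_def[symmetric] by (rule arrow_eigenvalue[OF assms])
qed

lemma schroedinger_spectrum:
  assumes Q: "periodic_potential G a Q"
  defines "d \<equiv> real CARD('n)"
  defines "lam \<equiv> band_function G a p vs Q"
  shows "op_spectrum (verts G) (schroedinger G Q) = complex_of_real ` (\<Union>n\<in>{1..\<nu>}. {lam n 0 .. lam n (\<chi> i. pi)})"
    "inj_on (\<lambda>j. Q (vs j)) {1..<\<nu>} \<Longrightarrow> op_spectrum (verts G) (schroedinger G Q) = ac_spectrum (verts G) (schroedinger G Q) \<and>
         flat_bands (verts G) (schroedinger G Q) = {}"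
    "m \<ge> 1 \<Longrightarrow> card {j \<in> {1..<\<nu>}. Q (vs j) = q} = m \<Longrightarrow> has_flat_band G a p vs Q (q + 1) (m - 1)"
    "emeasure lborel {t. complex_of_real t \<in> op_spectrum (verts G) (schroedinger G Q)} = ennreal (4 * d)"
proof -
  define c where "c = Q (vs \<nu>) + real (\<nu> - 1)"
  interpret M: pendant_model \<nu> "\<lambda>j. 1 + Q (vs j)" c "verts G" pt "schroedinger G Q"
    unfolding c_def by (rule model[OF Q])
  have symb_max: "M.symb_max = 4 * d" "0 \<le> 4 * d" by (simp_all add: M.symb_max_def d_def)
  have lam: "lam n 0 = M.ev n 0" "lam n (\<chi> i. pi) = M.ev n (4 * d)" if "n \<in> {1..\<nu>}" for n
    using that by (simp_all add: lam_def band_function_ev c_def symb_const d_def)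
  have op: "op_spectrum (verts G) (schroedinger G Q) = of_real ` (\<Union>n\<in>{1..\<nu>}. {M.ev n 0..M.ev n (4 * d)})"
    unfolding M.op_spectrum_eq M.bands_union[OF symb_max(2)] symb_max(1) ..
  also have "(\<Union>n\<in>{1..\<nu>}. {M.ev n 0..M.ev n (4 * d)}) = (\<Union>n\<in>{1..\<nu>}. {lam n 0 .. lam n (\<chi> i. pi)})"
    by (rule SUP_cong) (simp_all only: lam)
  finally show "op_spectrum (verts G) (schroedinger G Q) = complex_of_real ` (\<Union>n\<in>{1..\<nu>}. {lam n 0 .. lam n (\<chi> i. pi)})" .
  have "{t. complex_of_real t \<in> op_spectrum (verts G) (schroedinger G Q)} = (\<Union>n\<in>{1..\<nu>}. {M.ev n 0..M.ev n (4 * d)})"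
    unfolding op by auto
  then show "emeasure lborel {t. complex_of_real t \<in> op_spectrum (verts G) (schroedinger G Q)} = ennreal (4 * d)"
    using M.emeasure_bands[OF symb_max(2)] by (simp only:)
  {
    assume inj: "inj_on (\<lambda>j. Q (vs j)) {1..<\<nu>}"
    have "\<not> M.pole_mult b \<ge> 2" for b
    proof
      assume "M.pole_mult b \<ge> 2"
      then obtain i j where "i \<in> {1..<\<nu>}" "j \<in> {1..<\<nu>}" "i \<noteq> j" "1 + Q (vs i) = b" "1 + Q (vs j) = b"
        by (rule M.mult2_pair)
      then show False using inj by (auto simp: inj_on_def)
    qed
    then show "op_spectrum (verts G) (schroedinger G Q) = ac_spectrum (verts G) (schroedinger G Q) \<and>
         flat_bands (verts G) (schroedinger G Q) = {}"
      unfolding M.op_spectrum_eq M.ac_spectrum_eq M.flat_bands_eq by simp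
  }
  {
    assume m: "m \<ge> 1" "card {j \<in> {1..<\<nu>}. Q (vs j) = q} = m"
    have "{j \<in> {1..<\<nu>}. 1 + Q (vs j) = q + 1} = {j \<in> {1..<\<nu>}. Q (vs j) = q}" by auto
    then have pole_mult: "M.pole_mult (q + 1) = m" unfolding M.pole_mult_def using m(2) by simp
    have "{j \<in> {1..<\<nu>}. Q (vs j) = q} \<noteq> {}" using m by (metis card.empty not_one_le_zero)
    then have qB: "q + 1 \<in> M.B" by (auto simp: M.B_def)
    have flat: "complex_of_real (q + 1) \<in> flat_bands (verts G) (schroedinger G Q) \<longleftrightarrow> m \<ge> 2"
      unfolding M.flat_bands_eq using pole_mult by (auto simp del: of_real_add)
    have ord: "Polynomial.order (complex_of_real (q + 1)) (char_poly (floquet G a p vs Q \<theta>)) = m - 1" for \<theta>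
      unfolding floquet_arrow c_def[symmetric] using M.order_arrow[OF qB] pole_mult by simp
    show "has_flat_band G a p vs Q (q + 1) (m - 1)"
      unfolding has_flat_band_def ord using flat m(1) by auto
  }
qed

text \<open>Without a potential, the secular equation is \<open>x\<^sup>2 - (\<nu> + t) x + t = 0\<close>.\<close>

lemma laplacian_spectrum:
  defines "d \<equiv> real CARD('n)"
  defines "x \<equiv> (real \<nu> + 4 * d) / 2"
  defines "S\<^sub>1 \<equiv> {0 .. x - sqrt (x\<^sup>2 - 4 * d)}" and "S\<^sub>2 \<equiv> {real \<nu> .. x + sqrt (x\<^sup>2 - 4 * d)}"
  shows "op_spectrum (verts G) (laplacian G) = ac_spectrum (verts G) (laplacian G) \<union> flat_bands (verts G) (laplacian G)"
    "flat_bands (verts G) (laplacian G) = (if \<nu> = 2 then {} else {1})"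
    "has_flat_band G a p vs (\<lambda>_. 0) 1 (\<nu> - 2)"
    "ac_spectrum (verts G) (laplacian G) = complex_of_real ` (S\<^sub>1 \<union> S\<^sub>2)"
    "{B. \<exists>n\<in>{1..\<nu>}. B = spectral_band G a p vs (\<lambda>_. 0) n \<and> \<not> is_singleton B} = {S\<^sub>1, S\<^sub>2}"
proof -
  have lap: "schroedinger G (\<lambda>_. 0) = laplacian G" by (intro ext) (simp add: schroedinger_def)
  have Q0: "periodic_potential G a (\<lambda>_. 0)" by (simp add: periodic_potential_def)
  interpret M: pendant_model \<nu> "\<lambda>j. 1" "real (\<nu> - 1)" "verts G" pt "laplacian G"
    using model[OF Q0] by (simp add: lap)
  have d0: "d > 0" by (simp add: d_def)
  have symb_max: "M.symb_max = 4 * d" "0 \<le> 4 * d" using d0 by (simp_all add: M.symb_max_def d_def)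
  have "{1..<\<nu>} \<noteq> {}" using nu2 by simp
  then have MB: "M.B = {1}" unfolding M.B_def by blast
  have pole_mult: "M.pole_mult b = (if b = 1 then \<nu> - 1 else 0)" for b
  proof -
    have "{j \<in> {1..<\<nu>}. 1 = b} = (if b = 1 then {1..<\<nu>} else {})" by auto
    then show ?thesis unfolding M.pole_mult_def by simp
  qed
  have flat: "{b. M.pole_mult b \<ge> 2} = (if \<nu> = 2 then {} else {1})" using nu2 by (auto simp: pole_mult)
  show "op_spectrum (verts G) (laplacian G) = ac_spectrum (verts G) (laplacian G) \<union> flat_bands (verts G) (laplacian G)"
    unfolding M.op_spectrum_eq M.ac_spectrum_eq M.flat_bands_eq by (rule image_Un)
  show "flat_bands (verts G) (laplacian G) = (if \<nu> = 2 then {} else {1})"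
    unfolding M.flat_bands_eq flat by simp
  have "{j \<in> {1..<\<nu>}. (0::real) = 0} = {1..<\<nu>}" by auto
  then have "card {j \<in> {1..<\<nu>}. (0::real) = 0} = \<nu> - 1" by (simp only: card_atLeastLessThan)
  then have "has_flat_band G a p vs (\<lambda>_. 0) (0 + 1) (\<nu> - 1 - 1)"
    using schroedinger_spectrum(3)[OF Q0, of "\<nu> - 1" 0] nu2 by simp
  then show "has_flat_band G a p vs (\<lambda>_. 0) 1 (\<nu> - 2)" by (simp add: numeral_2_eq_2)
  have bs1: "M.bs ! i = 1" if "i < \<nu> - 1" for i
    using nth_mem[of i M.bs] that MB by (simp add: M.set_bs M.length_bs)
  have lo: "M.lo n = (if n \<le> 1 then -\<infinity> else 1)" if "n \<le> \<nu>" for n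
    using bs1[of "n - 2"] that by (auto simp: M.lo_def one_ereal_def)
  have hi: "M.hi n = (if n \<ge> \<nu> then \<infinity> else 1)" if "n \<ge> 1" for n
    using bs1[of "n - 1"] that by (auto simp: M.hi_def one_ereal_def)
  \<comment> \<open>All poles coincide with 1, so every gap except the two outer ones is
    empty.\<close>
  have bands: "M.bands = {1, \<nu>}" unfolding M.bands_def using nu2 by (auto simp: lo hi one_ereal_def split: if_splits)
  have n: "1 \<in> {1..\<nu>}" "\<nu> \<in> {1..\<nu>}" using nu2 by auto
  have gap1: "M.gap 1 = {..<1}" and gapnu: "M.gap \<nu> = {1<..}"
    unfolding M.gap_def using nu2 by (auto simp: lo hi one_ereal_def)
  have F: "M.F y = t" if "y \<noteq> 1" "y\<^sup>2 - (real \<nu> + t) * y + t = 0" for y t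
  proof -
    have "M.F y = y - (real \<nu> - 1) + (real \<nu> - 1) / (1 - y)" unfolding M.F_def using nu2 by (simp add: of_nat_diff)
    also have "\<dots> = (y * (real \<nu> - y)) / (1 - y)" using that(1) by (simp add: field_simps)
    also have "y * (real \<nu> - y) = t * (1 - y)" using that(2) by (simp add: power2_eq_square algebra_simps)
    finally show ?thesis using that(1) by simp
  qed
  define s where "s = sqrt (x\<^sup>2 - 4 * d)"
  have nu2r: "real \<nu> \<ge> 2" using nu2 by simp
  \<comment> \<open>The two sides differ by \<open>\<nu> - 1\<close>. Hence the pole 1 lies strictly
    between the roots \<open>x - s\<close> and \<open>x + s\<close>, and each root belongs to its
    own outer gap.\<close>
  have x2: "(x - 1)\<^sup>2 < x\<^sup>2 - 4 * d" using nu2r by (simp add: x_def power2_eq_square field_simps)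
  then have s2: "s\<^sup>2 = x\<^sup>2 - 4 * d" unfolding s_def by (smt (verit) real_sqrt_pow2 zero_le_power2)
  have s0: "s \<ge> 0" unfolding s_def using x2 by (smt (verit) real_sqrt_ge_zero zero_le_power2)
  have s1: "\<bar>x - 1\<bar> < s" using x2 s2 s0 by (metis abs_le_square_iff abs_of_nonneg linorder_not_less)
  have quad: "y\<^sup>2 - (real \<nu> + 4 * d) * y + 4 * d = 0" if "y = x - s \<or> y = x + s" for y
  proof -
    have "real \<nu> + 4 * d = 2 * x" by (simp add: x_def)
    moreover have "(y - x)\<^sup>2 = s\<^sup>2" using that by auto
    ultimately show ?thesis using s2 by (simp add: power2_eq_square algebra_simps)
  qed
  have ev: "M.ev 1 0 = 0" "M.ev \<nu> 0 = real \<nu>" "M.ev 1 (4 * d) = x - s" "M.ev \<nu> (4 * d) = x + s"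
  proof -
    have l: "x - s < 1" "1 < x + s" using s1 by auto
    have g: "0 \<in> M.gap 1" "real \<nu> \<in> M.gap \<nu>" "x - s \<in> M.gap 1" "x + s \<in> M.gap \<nu>"
      using l nu2r by (simp_all only: gap1 gapnu lessThan_iff greaterThan_iff)
    show "M.ev 1 0 = 0" using M.ev_eq[OF n(1) g(1)] F[of 0 0] by simp
    show "M.ev \<nu> 0 = real \<nu>" using M.ev_eq[OF n(2) g(2)] F[of "real \<nu>" 0] nu2r by (simp add: power2_eq_square)
    show "M.ev 1 (4 * d) = x - s" using M.ev_eq[OF n(1) g(3)] F[of "x - s" "4 * d"] quad[of "x - s"] l by simp
    show "M.ev \<nu> (4 * d) = x + s" using M.ev_eq[OF n(2) g(4)] F[of "x + s" "4 * d"] quad[of "x + s"] l by simp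
  qed
  have S: "S\<^sub>1 = {M.ev 1 0..M.ev 1 (4 * d)}" "S\<^sub>2 = {M.ev \<nu> 0..M.ev \<nu> (4 * d)}"
    unfolding S\<^sub>1_def S\<^sub>2_def ev s_def by simp_all
  show "ac_spectrum (verts G) (laplacian G) = complex_of_real ` (S\<^sub>1 \<union> S\<^sub>2)"
    unfolding M.ac_spectrum_eq symb_max(1) M.bands_spectrum[OF symb_max(2)] bands S by simp
  have band: "spectral_band G a p vs (\<lambda>_. 0) k = {M.ev k 0..M.ev k (4 * d)}" if "k \<in> {1..\<nu>}" for k
  proof -
    have "spectral_band G a p vs (\<lambda>_. 0) k = M.ev k ` ((\<lambda>\<theta>. symb (\<lambda>i. \<theta> $ i)) ` (torus :: (real ^ 'n) set))"
      unfolding spectral_band_def image_image by (rule image_cong) (simp_all add: band_function_ev[OF that])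
    then show ?thesis unfolding symb_torus using M.ev_image[OF that symb_max(2)] by (simp add: d_def)
  qed
  have sing: "is_singleton {M.ev k 0..M.ev k (4 * d)} \<longleftrightarrow> k \<notin> M.bands" if k: "k \<in> {1..\<nu>}" for k
  proof (cases "k \<in> M.bands")
    case True
    have lt: "M.ev k 0 < M.ev k (4 * d)" using M.ev_strict[OF True] d0 by simp
    have "\<not> is_singleton {M.ev k 0..M.ev k (4 * d)}"
    proof
      assume "is_singleton {M.ev k 0..M.ev k (4 * d)}"
      then obtain y where "{M.ev k 0..M.ev k (4 * d)} = {y}" by (rule is_singletonE)
      then have "M.ev k 0 \<in> {y}" "M.ev k (4 * d) \<in> {y}" using lt by auto
      then show False using lt by simp
    qed
    then show ?thesis using True by simp
  next
    case False
    then have nf: "\<not> M.lo k < M.hi k" using k by (simp add: M.bands_def)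
    show ?thesis using False M.flat_cases(4)[OF k nf] by (simp add: is_singleton_def)
  qed
  show "{B. \<exists>n\<in>{1..\<nu>}. B = spectral_band G a p vs (\<lambda>_. 0) n \<and> \<not> is_singleton B} = {S\<^sub>1, S\<^sub>2}"
  proof (intro equalityI subsetI)
    fix B assume "B \<in> {B. \<exists>n\<in>{1..\<nu>}. B = spectral_band G a p vs (\<lambda>_. 0) n \<and> \<not> is_singleton B}"
    then obtain k where k: "k \<in> {1..\<nu>}" "B = {M.ev k 0..M.ev k (4 * d)}" "k \<in> M.bands" using band sing by auto
    then show "B \<in> {S\<^sub>1, S\<^sub>2}" unfolding bands S by auto
  next
    fix B assume "B \<in> {S\<^sub>1, S\<^sub>2}"
    then obtain k where k: "k \<in> M.bands" "k \<in> {1..\<nu>}" "B = {M.ev k 0..M.ev k (4 * d)}" unfolding bands S using n by auto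
    then show "B \<in> {B. \<exists>n\<in>{1..\<nu>}. B = spectral_band G a p vs (\<lambda>_. 0) n \<and> \<not> is_singleton B}"
      using band[OF k(2)] sing[OF k(2)] by auto
  qed
qed

end

theorem proposition7p2:
  fixes G :: "'n::finite pgraph" and a :: "'n \<Rightarrow> real ^ 'n" and p :: "real ^ 'n"
    and \<nu> :: nat and vs :: "nat \<Rightarrow> real ^ 'n"
    and d x :: real and \<theta>\<^sub>\<pi> :: "real ^ 'n" and S\<^sub>1 S\<^sub>2 :: "real set"
  assumes "CARD('n) \<ge> 2" and "\<nu> \<ge> 2"
    and "periodic_graph G a"
    and "adds_pendants (fundamental_graph lattice_graph std_vec 0) (fundamental_graph G a p) \<nu> vs"
  defines "d \<equiv> real CARD('n)"
    and "x \<equiv> (real \<nu> + 4 * d) / 2"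
    and "\<theta>\<^sub>\<pi> \<equiv> (\<chi> i. pi)"
    and "S\<^sub>1 \<equiv> {0 .. x - sqrt (x\<^sup>2 - 4 * d)}"
    and "S\<^sub>2 \<equiv> {real \<nu> .. x + sqrt (x\<^sup>2 - 4 * d)}"
  shows "precise_loop_graph G a p \<theta>\<^sub>\<pi> \<and>
    \<comment> \<open>(i)\<close>
    (op_spectrum (verts G) (laplacian G) =
       ac_spectrum (verts G) (laplacian G) \<union> flat_bands (verts G) (laplacian G) \<and>
     flat_bands (verts G) (laplacian G) = (if \<nu> = 2 then {} else {1}) \<and>
     has_flat_band G a p vs (\<lambda>_. 0) 1 (\<nu> - 2) \<and>
     ac_spectrum (verts G) (laplacian G) = complex_of_real ` (S\<^sub>1 \<union> S\<^sub>2) \<and>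
     {B. \<exists>n\<in>{1..\<nu>}. B = spectral_band G a p vs (\<lambda>_. 0) n \<and> \<not> is_singleton B} = {S\<^sub>1, S\<^sub>2}) \<and>
    (\<forall>Q. periodic_potential G a Q \<longrightarrow>
       \<comment> \<open>(ii)\<close>
       op_spectrum (verts G) (schroedinger G Q) =
         complex_of_real ` (\<Union>n\<in>{1..\<nu>}. {band_function G a p vs Q n 0 .. band_function G a p vs Q n \<theta>\<^sub>\<pi>}) \<and>
       \<comment> \<open>(iii)\<close>
       (Q (vs \<nu>) = 0 \<and> inj_on (\<lambda>j. Q (vs j)) {1..<\<nu>} \<longrightarrow>
         op_spectrum (verts G) (schroedinger G Q) = ac_spectrum (verts G) (schroedinger G Q) \<and>
         flat_bands (verts G) (schroedinger G Q) = {}) \<and>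
       \<comment> \<open>(iv)\<close>
       (\<forall>q m. m \<ge> 1 \<and> card {j \<in> {1..<\<nu>}. Q (vs j) = q} = m \<longrightarrow>
         has_flat_band G a p vs Q (q + 1) (m - 1)) \<and>
       \<comment> \<open>(v)\<close>
       emeasure lborel {t. complex_of_real t \<in> op_spectrum (verts G) (schroedinger G Q)} = ennreal (4 * d))"
proof -
  interpret pendant_graph G a p \<nu> vs
    using periodic_graph_periodic[OF assms(3)] assms(2,4) assms(3)[unfolded periodic_graph_def]
    by (intro pendant_graph.intro pendant_graph_axioms.intro) auto
  have Q: "op_spectrum (verts G) (schroedinger G Q) =
         complex_of_real ` (\<Union>n\<in>{1..\<nu>}. {band_function G a p vs Q n 0 .. band_function G a p vs Q n \<theta>\<^sub>\<pi>}) \<and>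
       (Q (vs \<nu>) = 0 \<and> inj_on (\<lambda>j. Q (vs j)) {1..<\<nu>} \<longrightarrow>
         op_spectrum (verts G) (schroedinger G Q) = ac_spectrum (verts G) (schroedinger G Q) \<and>
         flat_bands (verts G) (schroedinger G Q) = {}) \<and>
       (\<forall>q m. m \<ge> 1 \<and> card {j \<in> {1..<\<nu>}. Q (vs j) = q} = m \<longrightarrow>
         has_flat_band G a p vs Q (q + 1) (m - 1)) \<and>
       emeasure lborel {t. complex_of_real t \<in> op_spectrum (verts G) (schroedinger G Q)} = ennreal (4 * d)"
    if "periodic_potential G a Q" for Q
    unfolding \<theta>\<^sub>\<pi>_def d_def
    using schroedinger_spectrum(1,2,4)[OF that] schroedinger_spectrum(3)[OF that] by blast
  note L = laplacian_spectrum[folded d_def, folded x_def, folded S\<^sub>1_def S\<^sub>2_def]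
  have P: "precise_loop_graph G a p \<theta>\<^sub>\<pi>" unfolding \<theta>\<^sub>\<pi>_def by (rule precise[OF assms(3)])
  show ?thesis
    using P L Q by blast
qed

end
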